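(* Let $\mathcal C$ be a $BTC^*$ whose subcategory $\mathcal D=\mathcal D(\mathcal C)$ of degenerate objects is even. The modular closure $\overline{\overline{\mathcal C}}=\mathcal C\rtimes\mathcal D$ is non-trivial if and only if $\mathcal C$ contains at least one non-degenerate object.
   Context: Tensor categories. All are small and strict; $\rho\sigma$ is the tensor product of objects, $\times$ that of arrows, $\circ$ is composition, $\iota$ the unit. A tensor $*$-category has complex vector spaces as Hom-sets, bilinear $\circ,\times$, and a positive $*$-operation (antilinear, involutive, contravariant, monoidal, and $X^*\circ X=0\Rightarrow X=0$). $\rho$ is irreducible if $\mathrm{Hom}(\rho,\rho)=\mathbb C\,\mathrm{id}_\rho$. Subobjects (for every projection $E=E^*=E^2\in\mathrm{Hom}(\rho,\rho)$ an isometry $V$ with $VV^*=E$), direct sums (isometries $V_i\in\mathrm{Hom}(\rho_i,\tau)$ with $V_1V_1^*+V_2V_2^*=\mathrm{id}_\tau$) and conjugates ($R\in\mathrm{Hom}(\iota,\bar\rho\rho)$, $\bar R\in\mathrm{Hom}(\iota,\rho\bar\rho)$ with $(\bar R^*\times\mathrm{id}_\rho)\circ(\mathrm{id}_\rho\times R)=\mathrm{id}_\rho$, $(R^*\times\mathrm{id}_{\bar\rho})\circ(\mathrm{id}_{\bar\rho}\times\bar R)=\mathrm{id}_{\bar\rho}$, normalized by $R^*R=\bar R^*\bar R=d(\rho)\mathrm{id}_\iota$ for $\rho$ irreducible) are meant in the $*$-sense. For reducible $\rho$ only standard solutions $R_\rho=\sum_i(\bar W_i\times W_i)\circ R_i$,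 built from a decomposition into irreducibles, are used. A $TC^*$ is a tensor $*$-category with conjugates, direct sums, subobjects, finite dimensional Hom-spaces and irreducible unit; a $BTC^*$ is a $TC^*$ with unitary braiding $\varepsilon$. $\rho\in\mathcal C$ is degenerate if $\varepsilon(\eta,\rho)\circ\varepsilon(\rho,\eta)=\mathrm{id}_{\rho\eta}$ for all $\eta\in\mathcal C$, and non-degenerate otherwise; $\mathcal D(\mathcal C)$ is the full subcategory of degenerate objects (replete, symmetric, closed under tensor products, conjugates, direct sums, subobjects). The twist is $\kappa(\rho)=(R_\rho^*\times\mathrm{id}_\rho)\circ(\mathrm{id}_{\bar\rho}\times\varepsilon(\rho,\rho))\circ(R_\rho\times\mathrm{id}_\rho)$; $\mathcal D$ is even if $\kappa(\rho)=\mathrm{id}_\rho$ for all $\rho\in\mathcal D$. A category is trivial if all its irreducible objects are equivalent to $\iota$, non-trivial otherwise. Crossed product (here with $\mathcal S=\mathcal D$). By Doplicher–Roberts there are a compact group $G$, unique up to isomorphism, and an isomorphism $F:\mathcal S\to U(G)$ of symmetric tensor $*$-categories onto a category of finite dimensional continuous unitary representations of $G$ closed under direct sums and subrepresentations and containing members of all classes of irreducibles. Tensor product in $U(G)$ is $\boxtimes$; $F(\iota)=\mathbb C$ contains a unit vector $\Omega$ with $\Omega\boxtimes\psi=\psi\boxtimes\Omega=\psi$. Let $\hat G$ be the set of isomorphism classes of irreducible objects of $\mathcal S$, $\gamma_k$ ($k\in\hat G$) representatives with $\gamma_0=\iota$, $\mathcal H_k=F(\gamma_k)$; choose orthonormal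 bases $\{V_{k,l}^{m,\alpha}\}_{\alpha=1}^{N_{k,l}^m}$ of $\mathrm{Hom}(\gamma_m,\gamma_k\gamma_l)$ ($V^*\circ W=\langle V,W\rangle\mathrm{id}$), and normalized solutions $R_k\in\mathrm{Hom}(\iota,\gamma_{\bar k}\gamma_k)$, $\bar R_k\in\mathrm{Hom}(\iota,\gamma_k\gamma_{\bar k})$ of the conjugate equations with $R_{\bar k}=\bar R_k$, $\bar R_{\bar k}=R_k$ if $\bar k\neq k$ and $\bar R_k=\pm R_k$ if $\bar k=k$. $\mathcal C\rtimes_0\mathcal S$ has the objects and tensor product of objects of $\mathcal C$, and $\mathrm{Hom}_{\mathcal C\rtimes_0\mathcal S}(\rho,\sigma)=\bigoplus_{k\in\hat G}\mathrm{Hom}_{\mathcal C}(\gamma_k\rho,\sigma)\otimes\mathcal H_k$. For $S\in\mathrm{Hom}(\gamma_k\sigma,\delta)$, $T\in\mathrm{Hom}(\gamma_l\rho,\sigma)$, $\psi_k\in\mathcal H_k,\psi_l\in\mathcal H_l$, $$(S\otimes\psi_k)\circ(T\otimes\psi_l)=\bigoplus_{m}\sum_\alpha\big[S\circ(\mathrm{id}_{\gamma_k}\times T)\circ(V_{k,l}^{m,\alpha}\times\mathrm{id}_\rho)\big]\otimes F(V_{k,l}^{m,\alpha})^*(\psi_k\boxtimes\psi_l);$$ for $S\in\mathrm{Hom}(\gamma_k\rho_1,\sigma_1)$, $T\in\mathrm{Hom}(\gamma_l\rho_2,\sigma_2)$, $$(S\otimes\psi_k)\times(T\otimes\psi_l)=\bigoplus_{m}\sum_\alpha\big[(S\times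 T)\circ(\mathrm{id}_{\gamma_k}\times\varepsilon(\gamma_l,\rho_1)\times\mathrm{id}_{\rho_2})\circ(V_{k,l}^{m,\alpha}\times\mathrm{id}_{\rho_1\rho_2})\big]\otimes F(V_{k,l}^{m,\alpha})^*(\psi_k\boxtimes\psi_l);$$ for $S\in\mathrm{Hom}(\gamma_k\rho,\sigma)$, $(S\otimes\psi_k)^*=\big[(R_k^*\times\mathrm{id}_\rho)\circ(\mathrm{id}_{\gamma_{\bar k}}\times S^* )\big]\otimes\bar\psi$, where $\bar\psi\in\mathcal H_{\bar k}$ is defined by $\langle a,\bar\psi\rangle=\langle\psi_k\boxtimes a,F(\bar R_k)\Omega\rangle$ for all $a\in\mathcal H_{\bar k}$ (inner products antilinear in the first variable). $\mathcal C\rtimes\mathcal S$ is the closure of $\mathcal C\rtimes_0\mathcal S$ under subobjects: objects are pairs $(\rho,E)$ with $E=E^2=E^*\in\mathrm{Hom}_{\mathcal C\rtimes_0\mathcal S}(\rho,\rho)$, $\mathrm{Hom}((\rho,E),(\sigma,E'))=E'\circ\mathrm{Hom}_{\mathcal C\rtimes_0\mathcal S}(\rho,\sigma)\circ E$, $\mathrm{id}_{(\rho,E)}=E$, $(\rho,E)(\sigma,E')=(\rho\sigma,E\times E')$, arrows as in $\mathcal C\rtimes_0\mathcal S$. *)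

theory Defs
  imports "HOL-Analysis.Analysis" "HOL-Algebra.Group" "HOL-Library.Function_Algebras"
begin

section \<open>Complex vector spaces\<close>

text \<open>
  Every complex vector space below (Hom-space or Hilbert space) is a linear subspace of an
  ambient type of the following class; this only fixes where the vectors live.
\<close>

class complex_vector = ab_group_add +
  fixes scaleC :: "complex \<Rightarrow> 'a \<Rightarrow> 'a" (infixr "*\<^sub>C" 75)
  assumes scaleC_add_right: "c *\<^sub>C (x + y) = c *\<^sub>C x + c *\<^sub>C y"
    and scaleC_add_left: "(c + d) *\<^sub>C x = c *\<^sub>C x + d *\<^sub>C x"
    and scaleC_scaleC: "c *\<^sub>C (d *\<^sub>C x) = (c * d) *\<^sub>C x"
    and scaleC_one: "1 *\<^sub>C x = x"

global_interpretation cvec: vector_space "scaleC :: complex \<Rightarrow> 'a \<Rightarrow> 'a::complex_vector"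
  by standard (simp_all add: scaleC_add_right scaleC_add_left scaleC_scaleC scaleC_one)

instantiation "fun" :: (type, complex_vector) complex_vector
begin

definition scaleC_fun :: "complex \<Rightarrow> ('a \<Rightarrow> 'b) \<Rightarrow> 'a \<Rightarrow> 'b"
  where "scaleC_fun c f = (\<lambda>x. c *\<^sub>C f x)"

instance
  by standard
    (simp_all add: scaleC_fun_def fun_eq_iff scaleC_add_right scaleC_add_left scaleC_scaleC scaleC_one)

end

definition finite_dim :: "'a::complex_vector set \<Rightarrow> bool"
  where "finite_dim W \<longleftrightarrow> (\<exists>B. finite B \<and> cvec.span B = W)"


section \<open>Strict tensor *-categories\<close>

text \<open>
  The operations on arrows take the objects involved as explicit arguments, so that
  Hom-spaces need not be disjoint:
  \<^item> \<open>cmp C \<rho> \<sigma> \<tau> S T\<close> is \<open>S \<circ> T\<close> for \<open>T \<in> Hom(\<rho>,\<sigma>)\<close> and \<open>S \<in> Hom(\<sigma>,\<tau>)\<close>;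
  \<^item> \<open>ten C \<rho>\<^sub>1 \<sigma>\<^sub>1 \<rho>\<^sub>2 \<sigma>\<^sub>2 S T\<close> is \<open>S \<times> T\<close> for \<open>S \<in> Hom(\<rho>\<^sub>1,\<sigma>\<^sub>1)\<close> and \<open>T \<in> Hom(\<rho>\<^sub>2,\<sigma>\<^sub>2)\<close>;
  \<^item> \<open>str C \<rho> \<sigma> S \<in> Hom(\<sigma>,\<rho>)\<close> is \<open>S\<^sup>*\<close> for \<open>S \<in> Hom(\<rho>,\<sigma>)\<close>.
  Values of the operations on other arguments are irrelevant.
\<close>

record ('o, 'a) tcat =
  obj :: "'o set"
  Hom :: "'o \<Rightarrow> 'o \<Rightarrow> 'a set"
  ide :: "'o \<Rightarrow> 'a"
  cmp :: "'o \<Rightarrow> 'o \<Rightarrow> 'o \<Rightarrow> 'a \<Rightarrow> 'a \<Rightarrow> 'a"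
  unt :: "'o"  (\<open>\<iota>\<index>\<close>)
  otn :: "'o \<Rightarrow> 'o \<Rightarrow> 'o"  (infixr \<open>\<odot>\<index>\<close> 72)
  ten :: "'o \<Rightarrow> 'o \<Rightarrow> 'o \<Rightarrow> 'o \<Rightarrow> 'a \<Rightarrow> 'a \<Rightarrow> 'a"
  str :: "'o \<Rightarrow> 'o \<Rightarrow> 'a \<Rightarrow> 'a"

record ('o, 'a) btcat = "('o, 'a) tcat" +
  braid :: "'o \<Rightarrow> 'o \<Rightarrow> 'a"  (\<open>\<epsilon>\<index>\<close>)

locale tensor_star_category =
  fixes C :: "('o, 'a::complex_vector, 'm) tcat_scheme" (structure)
  assumes Hom_subspace: "\<lbrakk>\<rho> \<in> obj C; \<sigma> \<in> obj C\<rbrakk> \<Longrightarrow> cvec.subspace (Hom C \<rho> \<sigma>)"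
    and ide_in: "\<rho> \<in> obj C \<Longrightarrow> ide C \<rho> \<in> Hom C \<rho> \<rho>"
    and cmp_in: "\<lbrakk>\<rho> \<in> obj C; \<sigma> \<in> obj C; \<tau> \<in> obj C; S \<in> Hom C \<sigma> \<tau>; T \<in> Hom C \<rho> \<sigma>\<rbrakk>
      \<Longrightarrow> cmp C \<rho> \<sigma> \<tau> S T \<in> Hom C \<rho> \<tau>"
    and ide_cmp: "\<lbrakk>\<rho> \<in> obj C; \<sigma> \<in> obj C; T \<in> Hom C \<rho> \<sigma>\<rbrakk> \<Longrightarrow> cmp C \<rho> \<sigma> \<sigma> (ide C \<sigma>) T = T"
    and cmp_ide: "\<lbrakk>\<rho> \<in> obj C; \<sigma> \<in> obj C; T \<in> Hom C \<rho> \<sigma>\<rbrakk> \<Longrightarrow> cmp C \<rho> \<rho> \<sigma> T (ide C \<rho>) = T"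
    and cmp_assoc: "\<lbrakk>\<rho> \<in> obj C; \<sigma> \<in> obj C; \<tau> \<in> obj C; \<upsilon> \<in> obj C;
        S \<in> Hom C \<tau> \<upsilon>; T \<in> Hom C \<sigma> \<tau>; X \<in> Hom C \<rho> \<sigma>\<rbrakk>
      \<Longrightarrow> cmp C \<rho> \<sigma> \<upsilon> (cmp C \<sigma> \<tau> \<upsilon> S T) X = cmp C \<rho> \<tau> \<upsilon> S (cmp C \<rho> \<sigma> \<tau> T X)"
    and cmp_add_left: "\<lbrakk>\<rho> \<in> obj C; \<sigma> \<in> obj C; \<tau> \<in> obj C; S \<in> Hom C \<sigma> \<tau>; S' \<in> Hom C \<sigma> \<tau>; T \<in> Hom C \<rho> \<sigma>\<rbrakk>
      \<Longrightarrow> cmp C \<rho> \<sigma> \<tau> (S + S') T = cmp C \<rho> \<sigma> \<tau> S T + cmp C \<rho> \<sigma> \<tau> S' T"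
    and cmp_add_right: "\<lbrakk>\<rho> \<in> obj C; \<sigma> \<in> obj C; \<tau> \<in> obj C; S \<in> Hom C \<sigma> \<tau>; T \<in> Hom C \<rho> \<sigma>; T' \<in> Hom C \<rho> \<sigma>\<rbrakk>
      \<Longrightarrow> cmp C \<rho> \<sigma> \<tau> S (T + T') = cmp C \<rho> \<sigma> \<tau> S T + cmp C \<rho> \<sigma> \<tau> S T'"
    and cmp_scale_left: "\<lbrakk>\<rho> \<in> obj C; \<sigma> \<in> obj C; \<tau> \<in> obj C; S \<in> Hom C \<sigma> \<tau>; T \<in> Hom C \<rho> \<sigma>\<rbrakk>
      \<Longrightarrow> cmp C \<rho> \<sigma> \<tau> (c *\<^sub>C S) T = c *\<^sub>C cmp C \<rho> \<sigma> \<tau> S T"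
    and cmp_scale_right: "\<lbrakk>\<rho> \<in> obj C; \<sigma> \<in> obj C; \<tau> \<in> obj C; S \<in> Hom C \<sigma> \<tau>; T \<in> Hom C \<rho> \<sigma>\<rbrakk>
      \<Longrightarrow> cmp C \<rho> \<sigma> \<tau> S (c *\<^sub>C T) = c *\<^sub>C cmp C \<rho> \<sigma> \<tau> S T"
    and unt_obj: "\<iota> \<in> obj C"
    and otn_obj: "\<lbrakk>\<rho> \<in> obj C; \<sigma> \<in> obj C\<rbrakk> \<Longrightarrow> \<rho> \<odot> \<sigma> \<in> obj C"
    and otn_assoc: "\<lbrakk>\<rho> \<in> obj C; \<sigma> \<in> obj C; \<tau> \<in> obj C\<rbrakk> \<Longrightarrow> (\<rho> \<odot> \<sigma>) \<odot> \<tau> = \<rho> \<odot> (\<sigma> \<odot> \<tau>)"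
    and unt_otn: "\<rho> \<in> obj C \<Longrightarrow> \<iota> \<odot> \<rho> = \<rho>"
    and otn_unt: "\<rho> \<in> obj C \<Longrightarrow> \<rho> \<odot> \<iota> = \<rho>"
    and ten_in: "\<lbrakk>\<rho>1 \<in> obj C; \<sigma>1 \<in> obj C; \<rho>2 \<in> obj C; \<sigma>2 \<in> obj C; S \<in> Hom C \<rho>1 \<sigma>1; T \<in> Hom C \<rho>2 \<sigma>2\<rbrakk>
      \<Longrightarrow> ten C \<rho>1 \<sigma>1 \<rho>2 \<sigma>2 S T \<in> Hom C (\<rho>1 \<odot> \<rho>2) (\<sigma>1 \<odot> \<sigma>2)"
    and ten_add_left: "\<lbrakk>\<rho>1 \<in> obj C; \<sigma>1 \<in> obj C; \<rho>2 \<in> obj C; \<sigma>2 \<in> obj C;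
        S \<in> Hom C \<rho>1 \<sigma>1; S' \<in> Hom C \<rho>1 \<sigma>1; T \<in> Hom C \<rho>2 \<sigma>2\<rbrakk>
      \<Longrightarrow> ten C \<rho>1 \<sigma>1 \<rho>2 \<sigma>2 (S + S') T = ten C \<rho>1 \<sigma>1 \<rho>2 \<sigma>2 S T + ten C \<rho>1 \<sigma>1 \<rho>2 \<sigma>2 S' T"
    and ten_add_right: "\<lbrakk>\<rho>1 \<in> obj C; \<sigma>1 \<in> obj C; \<rho>2 \<in> obj C; \<sigma>2 \<in> obj C;
        S \<in> Hom C \<rho>1 \<sigma>1; T \<in> Hom C \<rho>2 \<sigma>2; T' \<in> Hom C \<rho>2 \<sigma>2\<rbrakk>
      \<Longrightarrow> ten C \<rho>1 \<sigma>1 \<rho>2 \<sigma>2 S (T + T') = ten C \<rho>1 \<sigma>1 \<rho>2 \<sigma>2 S T + ten C \<rho>1 \<sigma>1 \<rho>2 \<sigma>2 S T'"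
    and ten_scale_left: "\<lbrakk>\<rho>1 \<in> obj C; \<sigma>1 \<in> obj C; \<rho>2 \<in> obj C; \<sigma>2 \<in> obj C; S \<in> Hom C \<rho>1 \<sigma>1; T \<in> Hom C \<rho>2 \<sigma>2\<rbrakk>
      \<Longrightarrow> ten C \<rho>1 \<sigma>1 \<rho>2 \<sigma>2 (c *\<^sub>C S) T = c *\<^sub>C ten C \<rho>1 \<sigma>1 \<rho>2 \<sigma>2 S T"
    and ten_scale_right: "\<lbrakk>\<rho>1 \<in> obj C; \<sigma>1 \<in> obj C; \<rho>2 \<in> obj C; \<sigma>2 \<in> obj C; S \<in> Hom C \<rho>1 \<sigma>1; T \<in> Hom C \<rho>2 \<sigma>2\<rbrakk>
      \<Longrightarrow> ten C \<rho>1 \<sigma>1 \<rho>2 \<sigma>2 S (c *\<^sub>C T) = c *\<^sub>C ten C \<rho>1 \<sigma>1 \<rho>2 \<sigma>2 S T"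
    and ten_ide: "\<lbrakk>\<rho> \<in> obj C; \<sigma> \<in> obj C\<rbrakk> \<Longrightarrow> ten C \<rho> \<rho> \<sigma> \<sigma> (ide C \<rho>) (ide C \<sigma>) = ide C (\<rho> \<odot> \<sigma>)"
    and interchange: "\<lbrakk>\<rho>1 \<in> obj C; \<sigma>1 \<in> obj C; \<tau>1 \<in> obj C; \<rho>2 \<in> obj C; \<sigma>2 \<in> obj C; \<tau>2 \<in> obj C;
        S1 \<in> Hom C \<sigma>1 \<tau>1; T1 \<in> Hom C \<rho>1 \<sigma>1; S2 \<in> Hom C \<sigma>2 \<tau>2; T2 \<in> Hom C \<rho>2 \<sigma>2\<rbrakk>
      \<Longrightarrow> cmp C (\<rho>1 \<odot> \<rho>2) (\<sigma>1 \<odot> \<sigma>2) (\<tau>1 \<odot> \<tau>2) (ten C \<sigma>1 \<tau>1 \<sigma>2 \<tau>2 S1 S2) (ten C \<rho>1 \<sigma>1 \<rho>2 \<sigma>2 T1 T2)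
        = ten C \<rho>1 \<tau>1 \<rho>2 \<tau>2 (cmp C \<rho>1 \<sigma>1 \<tau>1 S1 T1) (cmp C \<rho>2 \<sigma>2 \<tau>2 S2 T2)"
    and ten_assoc: "\<lbrakk>\<rho>1 \<in> obj C; \<sigma>1 \<in> obj C; \<rho>2 \<in> obj C; \<sigma>2 \<in> obj C; \<rho>3 \<in> obj C; \<sigma>3 \<in> obj C;
        S \<in> Hom C \<rho>1 \<sigma>1; T \<in> Hom C \<rho>2 \<sigma>2; X \<in> Hom C \<rho>3 \<sigma>3\<rbrakk>
      \<Longrightarrow> ten C (\<rho>1 \<odot> \<rho>2) (\<sigma>1 \<odot> \<sigma>2) \<rho>3 \<sigma>3 (ten C \<rho>1 \<sigma>1 \<rho>2 \<sigma>2 S T) X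
        = ten C \<rho>1 \<sigma>1 (\<rho>2 \<odot> \<rho>3) (\<sigma>2 \<odot> \<sigma>3) S (ten C \<rho>2 \<sigma>2 \<rho>3 \<sigma>3 T X)"
    and unt_ten: "\<lbrakk>\<rho> \<in> obj C; \<sigma> \<in> obj C; T \<in> Hom C \<rho> \<sigma>\<rbrakk> \<Longrightarrow> ten C \<iota> \<iota> \<rho> \<sigma> (ide C \<iota>) T = T"
    and ten_unt: "\<lbrakk>\<rho> \<in> obj C; \<sigma> \<in> obj C; T \<in> Hom C \<rho> \<sigma>\<rbrakk> \<Longrightarrow> ten C \<rho> \<sigma> \<iota> \<iota> T (ide C \<iota>) = T"
    and str_in: "\<lbrakk>\<rho> \<in> obj C; \<sigma> \<in> obj C; T \<in> Hom C \<rho> \<sigma>\<rbrakk> \<Longrightarrow> str C \<rho> \<sigma> T \<in> Hom C \<sigma> \<rho>"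
    and str_add: "\<lbrakk>\<rho> \<in> obj C; \<sigma> \<in> obj C; S \<in> Hom C \<rho> \<sigma>; T \<in> Hom C \<rho> \<sigma>\<rbrakk>
      \<Longrightarrow> str C \<rho> \<sigma> (S + T) = str C \<rho> \<sigma> S + str C \<rho> \<sigma> T"
    and str_scale: "\<lbrakk>\<rho> \<in> obj C; \<sigma> \<in> obj C; T \<in> Hom C \<rho> \<sigma>\<rbrakk>
      \<Longrightarrow> str C \<rho> \<sigma> (c *\<^sub>C T) = cnj c *\<^sub>C str C \<rho> \<sigma> T"
    and str_str: "\<lbrakk>\<rho> \<in> obj C; \<sigma> \<in> obj C; T \<in> Hom C \<rho> \<sigma>\<rbrakk> \<Longrightarrow> str C \<sigma> \<rho> (str C \<rho> \<sigma> T) = T"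
    and str_cmp: "\<lbrakk>\<rho> \<in> obj C; \<sigma> \<in> obj C; \<tau> \<in> obj C; S \<in> Hom C \<sigma> \<tau>; T \<in> Hom C \<rho> \<sigma>\<rbrakk>
      \<Longrightarrow> str C \<rho> \<tau> (cmp C \<rho> \<sigma> \<tau> S T) = cmp C \<tau> \<sigma> \<rho> (str C \<rho> \<sigma> T) (str C \<sigma> \<tau> S)"
    and str_ten: "\<lbrakk>\<rho>1 \<in> obj C; \<sigma>1 \<in> obj C; \<rho>2 \<in> obj C; \<sigma>2 \<in> obj C; S \<in> Hom C \<rho>1 \<sigma>1; T \<in> Hom C \<rho>2 \<sigma>2\<rbrakk>
      \<Longrightarrow> str C (\<rho>1 \<odot> \<rho>2) (\<sigma>1 \<odot> \<sigma>2) (ten C \<rho>1 \<sigma>1 \<rho>2 \<sigma>2 S T)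
        = ten C \<sigma>1 \<rho>1 \<sigma>2 \<rho>2 (str C \<rho>1 \<sigma>1 S) (str C \<rho>2 \<sigma>2 T)"
    and str_pos: "\<lbrakk>\<rho> \<in> obj C; \<sigma> \<in> obj C; T \<in> Hom C \<rho> \<sigma>; cmp C \<rho> \<sigma> \<rho> (str C \<rho> \<sigma> T) T = 0\<rbrakk> \<Longrightarrow> T = 0"

text \<open>
  Zero objects exist as soon as the zero projection has a subobject. They are not irreducible:
  \<open>Hom(\<rho>,\<rho>) = \<complex> id\<^sub>\<rho>\<close> is read as a one-dimensional space.
\<close>

definition irreducible_obj :: "('o, 'a::complex_vector, 'm) tcat_scheme \<Rightarrow> 'o \<Rightarrow> bool"
  where "irreducible_obj C \<rho> \<longleftrightarrow>
    \<rho> \<in> obj C \<and> ide C \<rho> \<noteq> 0 \<and> Hom C \<rho> \<rho> = range (\<lambda>c. c *\<^sub>C ide C \<rho>)"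

definition isometry :: "('o, 'a, 'm) tcat_scheme \<Rightarrow> 'o \<Rightarrow> 'o \<Rightarrow> 'a \<Rightarrow> bool"
  where "isometry C \<rho> \<sigma> V \<longleftrightarrow> V \<in> Hom C \<rho> \<sigma> \<and> cmp C \<rho> \<sigma> \<rho> (str C \<rho> \<sigma> V) V = ide C \<rho>"

definition range_proj :: "('o, 'a, 'm) tcat_scheme \<Rightarrow> 'o \<Rightarrow> 'o \<Rightarrow> 'a \<Rightarrow> 'a"
  where "range_proj C \<rho> \<sigma> V = cmp C \<sigma> \<rho> \<sigma> V (str C \<rho> \<sigma> V)"  \<comment> \<open>\<open>V \<circ> V\<^sup>*\<close>\<close>

definition equivalent_obj :: "('o, 'a, 'm) tcat_scheme \<Rightarrow> 'o \<Rightarrow> 'o \<Rightarrow> bool"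
  where "equivalent_obj C \<rho> \<sigma> \<longleftrightarrow> (\<exists>V. isometry C \<rho> \<sigma> V \<and> range_proj C \<rho> \<sigma> V = ide C \<sigma>)"

definition trivial_category :: "('o, 'a::complex_vector, 'm) tcat_scheme \<Rightarrow> bool"
  where "trivial_category C \<longleftrightarrow> (\<forall>\<rho>. irreducible_obj C \<rho> \<longrightarrow> equivalent_obj C \<rho> \<iota>\<^bsub>C\<^esub>)"

definition conjugate_solution ::
    "('o, 'a, 'm) tcat_scheme \<Rightarrow> 'o \<Rightarrow> 'o \<Rightarrow> 'a \<Rightarrow> 'a \<Rightarrow> bool"
  where "conjugate_solution C \<rho> \<rho>' R R' \<longleftrightarrow>
    R \<in> Hom C \<iota>\<^bsub>C\<^esub> (\<rho>' \<odot>\<^bsub>C\<^esub> \<rho>) \<and> R' \<in> Hom C \<iota>\<^bsub>C\<^esub> (\<rho> \<odot>\<^bsub>C\<^esub> \<rho>') \<and>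
    cmp C \<rho> (\<rho> \<odot>\<^bsub>C\<^esub> \<rho>' \<odot>\<^bsub>C\<^esub> \<rho>) \<rho>
      (ten C (\<rho> \<odot>\<^bsub>C\<^esub> \<rho>') \<iota>\<^bsub>C\<^esub> \<rho> \<rho> (str C \<iota>\<^bsub>C\<^esub> (\<rho> \<odot>\<^bsub>C\<^esub> \<rho>') R') (ide C \<rho>))
      (ten C \<rho> \<rho> \<iota>\<^bsub>C\<^esub> (\<rho>' \<odot>\<^bsub>C\<^esub> \<rho>) (ide C \<rho>) R) = ide C \<rho> \<and>
    cmp C \<rho>' (\<rho>' \<odot>\<^bsub>C\<^esub> \<rho> \<odot>\<^bsub>C\<^esub> \<rho>') \<rho>'
      (ten C (\<rho>' \<odot>\<^bsub>C\<^esub> \<rho>) \<iota>\<^bsub>C\<^esub> \<rho>' \<rho>' (str C \<iota>\<^bsub>C\<^esub> (\<rho>' \<odot>\<^bsub>C\<^esub> \<rho>) R) (ide C \<rho>'))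
      (ten C \<rho>' \<rho>' \<iota>\<^bsub>C\<^esub> (\<rho> \<odot>\<^bsub>C\<^esub> \<rho>') (ide C \<rho>') R') = ide C \<rho>'"

text \<open>The common scalar \<open>d\<close> is the dimension \<open>d(\<rho>)\<close>.\<close>

definition normalized_solution ::
    "('o, 'a::complex_vector, 'm) tcat_scheme \<Rightarrow> 'o \<Rightarrow> 'o \<Rightarrow> 'a \<Rightarrow> 'a \<Rightarrow> bool"
  where "normalized_solution C \<rho> \<rho>' R R' \<longleftrightarrow> conjugate_solution C \<rho> \<rho>' R R' \<and>
    (\<exists>d. cmp C \<iota>\<^bsub>C\<^esub> (\<rho>' \<odot>\<^bsub>C\<^esub> \<rho>) \<iota>\<^bsub>C\<^esub> (str C \<iota>\<^bsub>C\<^esub> (\<rho>' \<odot>\<^bsub>C\<^esub> \<rho>) R) R = d *\<^sub>C ide C \<iota>\<^bsub>C\<^esub> \<and>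
         cmp C \<iota>\<^bsub>C\<^esub> (\<rho> \<odot>\<^bsub>C\<^esub> \<rho>') \<iota>\<^bsub>C\<^esub> (str C \<iota>\<^bsub>C\<^esub> (\<rho> \<odot>\<^bsub>C\<^esub> \<rho>') R') R' = d *\<^sub>C ide C \<iota>\<^bsub>C\<^esub>)"

text \<open>
  \<open>R = \<Sum>\<^sub>i (W'\<^sub>i \<times> W\<^sub>i) \<circ> R\<^sub>i\<close> and \<open>R' = \<Sum>\<^sub>i (W\<^sub>i \<times> W'\<^sub>i) \<circ> R'\<^sub>i\<close>, where the \<open>W\<^sub>i\<close> decompose \<open>\<rho>\<close> into
  irreducibles \<open>r i\<close>, the \<open>W'\<^sub>i\<close> decompose \<open>\<rho>'\<close> into conjugates \<open>r' i\<close> of the \<open>r i\<close>, and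
  \<open>(R\<^sub>i, R'\<^sub>i)\<close> is a normalized solution for \<open>r i\<close>.
\<close>

definition standard_solution ::
    "('o, 'a::complex_vector, 'm) tcat_scheme \<Rightarrow> 'o \<Rightarrow> 'o \<Rightarrow> 'a \<Rightarrow> 'a \<Rightarrow> bool"
  where "standard_solution C \<rho> \<rho>' R R' \<longleftrightarrow> \<rho> \<in> obj C \<and> \<rho>' \<in> obj C \<and>
    (\<exists>(n::nat) r r' W W' Ri Ri'.
      (\<forall>i<n. irreducible_obj C (r i) \<and> r' i \<in> obj C \<and>
        isometry C (r i) \<rho> (W i) \<and> isometry C (r' i) \<rho>' (W' i) \<and>
        normalized_solution C (r i) (r' i) (Ri i) (Ri' i)) \<and>
      (\<Sum>i<n. range_proj C (r i) \<rho> (W i)) = ide C \<rho> \<and>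
      (\<Sum>i<n. range_proj C (r' i) \<rho>' (W' i)) = ide C \<rho>' \<and>
      R = (\<Sum>i<n. cmp C \<iota>\<^bsub>C\<^esub> (r' i \<odot>\<^bsub>C\<^esub> r i) (\<rho>' \<odot>\<^bsub>C\<^esub> \<rho>)
        (ten C (r' i) \<rho>' (r i) \<rho> (W' i) (W i)) (Ri i)) \<and>
      R' = (\<Sum>i<n. cmp C \<iota>\<^bsub>C\<^esub> (r i \<odot>\<^bsub>C\<^esub> r' i) (\<rho> \<odot>\<^bsub>C\<^esub> \<rho>')
        (ten C (r i) \<rho> (r' i) \<rho>' (W i) (W' i)) (Ri' i)))"

locale TC_star = tensor_star_category C
  for C :: "('o, 'a::complex_vector, 'm) tcat_scheme" (structure) +
  assumes conjugates: "\<rho> \<in> obj C \<Longrightarrow> \<exists>\<rho>'\<in>obj C. \<exists>R R'. conjugate_solution C \<rho> \<rho>' R R' \<and>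
      (irreducible_obj C \<rho> \<longrightarrow> normalized_solution C \<rho> \<rho>' R R')"
    and direct_sums: "\<lbrakk>\<rho> \<in> obj C; \<sigma> \<in> obj C\<rbrakk> \<Longrightarrow> \<exists>\<tau>\<in>obj C. \<exists>V W. isometry C \<rho> \<tau> V \<and> isometry C \<sigma> \<tau> W \<and>
      range_proj C \<rho> \<tau> V + range_proj C \<sigma> \<tau> W = ide C \<tau>"
    and subobjects: "\<lbrakk>\<rho> \<in> obj C; E \<in> Hom C \<rho> \<rho>; str C \<rho> \<rho> E = E; cmp C \<rho> \<rho> \<rho> E E = E\<rbrakk>
      \<Longrightarrow> \<exists>\<sigma>\<in>obj C. \<exists>V. isometry C \<sigma> \<rho> V \<and> range_proj C \<sigma> \<rho> V = E"
    and finite_dim_Hom: "\<lbrakk>\<rho> \<in> obj C; \<sigma> \<in> obj C\<rbrakk> \<Longrightarrow> finite_dim (Hom C \<rho> \<sigma>)"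
    and unt_irreducible: "irreducible_obj C \<iota>"

locale BTC_star = TC_star C
  for C :: "('o, 'a::complex_vector, 'm) btcat_scheme" (structure) +
  assumes braid_in: "\<lbrakk>\<rho> \<in> obj C; \<sigma> \<in> obj C\<rbrakk> \<Longrightarrow> \<epsilon> \<rho> \<sigma> \<in> Hom C (\<rho> \<odot> \<sigma>) (\<sigma> \<odot> \<rho>)"
    and braid_unitary1: "\<lbrakk>\<rho> \<in> obj C; \<sigma> \<in> obj C\<rbrakk>
      \<Longrightarrow> cmp C (\<rho> \<odot> \<sigma>) (\<sigma> \<odot> \<rho>) (\<rho> \<odot> \<sigma>) (str C (\<rho> \<odot> \<sigma>) (\<sigma> \<odot> \<rho>) (\<epsilon> \<rho> \<sigma>)) (\<epsilon> \<rho> \<sigma>) = ide C (\<rho> \<odot> \<sigma>)"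
    and braid_unitary2: "\<lbrakk>\<rho> \<in> obj C; \<sigma> \<in> obj C\<rbrakk>
      \<Longrightarrow> cmp C (\<sigma> \<odot> \<rho>) (\<rho> \<odot> \<sigma>) (\<sigma> \<odot> \<rho>) (\<epsilon> \<rho> \<sigma>) (str C (\<rho> \<odot> \<sigma>) (\<sigma> \<odot> \<rho>) (\<epsilon> \<rho> \<sigma>)) = ide C (\<sigma> \<odot> \<rho>)"
    and braid_natural: "\<lbrakk>\<rho>1 \<in> obj C; \<sigma>1 \<in> obj C; \<rho>2 \<in> obj C; \<sigma>2 \<in> obj C; S \<in> Hom C \<rho>1 \<sigma>1; T \<in> Hom C \<rho>2 \<sigma>2\<rbrakk>
      \<Longrightarrow> cmp C (\<rho>1 \<odot> \<rho>2) (\<sigma>1 \<odot> \<sigma>2) (\<sigma>2 \<odot> \<sigma>1) (\<epsilon> \<sigma>1 \<sigma>2) (ten C \<rho>1 \<sigma>1 \<rho>2 \<sigma>2 S T)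
        = cmp C (\<rho>1 \<odot> \<rho>2) (\<rho>2 \<odot> \<rho>1) (\<sigma>2 \<odot> \<sigma>1) (ten C \<rho>2 \<sigma>2 \<rho>1 \<sigma>1 T S) (\<epsilon> \<rho>1 \<rho>2)"
    and hexagon1: "\<lbrakk>\<rho> \<in> obj C; \<sigma> \<in> obj C; \<tau> \<in> obj C\<rbrakk>
      \<Longrightarrow> \<epsilon> (\<rho> \<odot> \<sigma>) \<tau> = cmp C (\<rho> \<odot> \<sigma> \<odot> \<tau>) (\<rho> \<odot> \<tau> \<odot> \<sigma>) (\<tau> \<odot> \<rho> \<odot> \<sigma>)
        (ten C (\<rho> \<odot> \<tau>) (\<tau> \<odot> \<rho>) \<sigma> \<sigma> (\<epsilon> \<rho> \<tau>) (ide C \<sigma>)) (ten C \<rho> \<rho> (\<sigma> \<odot> \<tau>) (\<tau> \<odot> \<sigma>) (ide C \<rho>) (\<epsilon> \<sigma> \<tau>))"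
    and hexagon2: "\<lbrakk>\<rho> \<in> obj C; \<sigma> \<in> obj C; \<tau> \<in> obj C\<rbrakk>
      \<Longrightarrow> \<epsilon> \<rho> (\<sigma> \<odot> \<tau>) = cmp C (\<rho> \<odot> \<sigma> \<odot> \<tau>) (\<sigma> \<odot> \<rho> \<odot> \<tau>) (\<sigma> \<odot> \<tau> \<odot> \<rho>)
        (ten C \<sigma> \<sigma> (\<rho> \<odot> \<tau>) (\<tau> \<odot> \<rho>) (ide C \<sigma>) (\<epsilon> \<rho> \<tau>)) (ten C (\<rho> \<odot> \<sigma>) (\<sigma> \<odot> \<rho>) \<tau> \<tau> (\<epsilon> \<rho> \<sigma>) (ide C \<tau>))"

definition degenerate :: "('o, 'a, 'm) btcat_scheme \<Rightarrow> 'o \<Rightarrow> bool"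
  where "degenerate C \<rho> \<longleftrightarrow> (\<forall>\<eta>\<in>obj C.
    cmp C (\<rho> \<odot>\<^bsub>C\<^esub> \<eta>) (\<eta> \<odot>\<^bsub>C\<^esub> \<rho>) (\<rho> \<odot>\<^bsub>C\<^esub> \<eta>) (\<epsilon>\<^bsub>C\<^esub> \<eta> \<rho>) (\<epsilon>\<^bsub>C\<^esub> \<rho> \<eta>) = ide C (\<rho> \<odot>\<^bsub>C\<^esub> \<eta>))"

definition degenerate_part :: "('o, 'a, 'm) btcat_scheme \<Rightarrow> ('o, 'a, 'm) btcat_scheme"  (\<open>\<D>\<close>)
  where "\<D> C = C\<lparr>obj := {\<rho> \<in> obj C. degenerate C \<rho>}\<rparr>"

definition twist :: "('o, 'a, 'm) btcat_scheme \<Rightarrow> 'o \<Rightarrow> 'o \<Rightarrow> 'a \<Rightarrow> 'a"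
  where "twist C \<rho> \<rho>' R =
    cmp C \<rho> (\<rho>' \<odot>\<^bsub>C\<^esub> \<rho> \<odot>\<^bsub>C\<^esub> \<rho>) \<rho>
      (ten C (\<rho>' \<odot>\<^bsub>C\<^esub> \<rho>) \<iota>\<^bsub>C\<^esub> \<rho> \<rho> (str C \<iota>\<^bsub>C\<^esub> (\<rho>' \<odot>\<^bsub>C\<^esub> \<rho>) R) (ide C \<rho>))
      (cmp C \<rho> (\<rho>' \<odot>\<^bsub>C\<^esub> \<rho> \<odot>\<^bsub>C\<^esub> \<rho>) (\<rho>' \<odot>\<^bsub>C\<^esub> \<rho> \<odot>\<^bsub>C\<^esub> \<rho>)
        (ten C \<rho>' \<rho>' (\<rho> \<odot>\<^bsub>C\<^esub> \<rho>) (\<rho> \<odot>\<^bsub>C\<^esub> \<rho>) (ide C \<rho>') (\<epsilon>\<^bsub>C\<^esub> \<rho> \<rho>))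
        (ten C \<iota>\<^bsub>C\<^esub> (\<rho>' \<odot>\<^bsub>C\<^esub> \<rho>) \<rho> \<rho> R (ide C \<rho>)))"

text \<open>The twist does not depend on the standard solution used to compute it.\<close>

definition even_category :: "('o, 'a::complex_vector, 'm) btcat_scheme \<Rightarrow> bool"
  where "even_category C \<longleftrightarrow>
    (\<forall>\<rho>\<in>obj C. \<forall>\<rho>' R R'. standard_solution C \<rho> \<rho>' R R' \<longrightarrow> twist C \<rho> \<rho>' R = ide C \<rho>)"


section \<open>Representation categories of compact groups\<close>

locale compact_group = group G
  for G :: "('g, 'm) monoid_scheme" (structure) and \<T> :: "'g topology" +
  assumes topspace_eq: "topspace \<T> = carrier G"
    and compact: "compact_space \<T>"
    and Hausdorff: "Hausdorff_space \<T>"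
    and continuous_mult: "continuous_map (prod_topology \<T> \<T>) \<T> (\<lambda>(x, y). x \<otimes> y)"
    and continuous_inv: "continuous_map \<T> \<T> (\<lambda>x. inv x)"

text \<open>
  A finite-dimensional Hilbert space \<open>carr\<close> with inner product \<open>ip\<close> (antilinear in the first
  variable) and an action of the group.
\<close>

record ('g, 'v) urep =
  carr :: "'v set"
  ip :: "'v \<Rightarrow> 'v \<Rightarrow> complex"
  act :: "'g \<Rightarrow> 'v \<Rightarrow> 'v"

definition linear_between :: "'v::complex_vector set \<Rightarrow> 'w::complex_vector set \<Rightarrow> ('v \<Rightarrow> 'w) \<Rightarrow> bool"
  where "linear_between H K f \<longleftrightarrow> (\<forall>x\<in>H. f x \<in> K) \<and>
    (\<forall>x\<in>H. \<forall>y\<in>H. f (x + y) = f x + f y) \<and> (\<forall>c. \<forall>x\<in>H. f (c *\<^sub>C x) = c *\<^sub>C f x)"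

locale unitary_rep =
  fixes G :: "('g, 'm) monoid_scheme" (structure) and \<T> :: "'g topology"
    and H :: "('g, 'v::complex_vector) urep"
  assumes carr_subspace: "cvec.subspace (carr H)"
    and carr_finite_dim: "finite_dim (carr H)"
    and ip_add: "\<lbrakk>x \<in> carr H; y \<in> carr H; z \<in> carr H\<rbrakk> \<Longrightarrow> ip H x (y + z) = ip H x y + ip H x z"
    and ip_scale: "\<lbrakk>x \<in> carr H; y \<in> carr H\<rbrakk> \<Longrightarrow> ip H x (c *\<^sub>C y) = c * ip H x y"
    and ip_cnj: "\<lbrakk>x \<in> carr H; y \<in> carr H\<rbrakk> \<Longrightarrow> ip H y x = cnj (ip H x y)"
    and ip_pos: "\<lbrakk>x \<in> carr H; x \<noteq> 0\<rbrakk> \<Longrightarrow> Re (ip H x x) > 0"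
    and act_linear: "g \<in> carrier G \<Longrightarrow> linear_between (carr H) (carr H) (act H g)"
    and act_one: "x \<in> carr H \<Longrightarrow> act H \<one> x = x"
    and act_mult: "\<lbrakk>g \<in> carrier G; h \<in> carrier G; x \<in> carr H\<rbrakk> \<Longrightarrow> act H (g \<otimes> h) x = act H g (act H h x)"
    and act_unitary: "\<lbrakk>g \<in> carrier G; x \<in> carr H; y \<in> carr H\<rbrakk> \<Longrightarrow> ip H (act H g x) (act H g y) = ip H x y"
    and act_continuous: "\<lbrakk>x \<in> carr H; y \<in> carr H\<rbrakk> \<Longrightarrow> continuous_map \<T> euclidean (\<lambda>g. ip H x (act H g y))"

text \<open>Intertwiners are normalized to vanish off the carrier, so that they are determined by their action on it.\<close>

definition intertwiners ::
    "('g, 'm) monoid_scheme \<Rightarrow> ('g, 'v::complex_vector) urep \<Rightarrow> ('g, 'v) urep \<Rightarrow> ('v \<Rightarrow> 'v) set"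
  where "intertwiners G H K = {f. linear_between (carr H) (carr K) f \<and> (\<forall>x. x \<notin> carr H \<longrightarrow> f x = 0) \<and>
    (\<forall>g\<in>carrier G. \<forall>x\<in>carr H. f (act H g x) = act K g (f x))}"

definition isometric_intertwiners ::
    "('g, 'm) monoid_scheme \<Rightarrow> ('g, 'v::complex_vector) urep \<Rightarrow> ('g, 'v) urep \<Rightarrow> ('v \<Rightarrow> 'v) set"
  where "isometric_intertwiners G H K =
    {f \<in> intertwiners G H K. \<forall>x\<in>carr H. \<forall>y\<in>carr H. ip K (f x) (f y) = ip H x y}"

definition invariant_subspace ::
    "('g, 'm) monoid_scheme \<Rightarrow> ('g, 'v::complex_vector) urep \<Rightarrow> 'v set \<Rightarrow> bool"
  where "invariant_subspace G H W \<longleftrightarrow>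
    cvec.subspace W \<and> W \<subseteq> carr H \<and> (\<forall>g\<in>carrier G. \<forall>x\<in>W. act H g x \<in> W)"

definition irreducible_rep :: "('g, 'm) monoid_scheme \<Rightarrow> ('g, 'v::complex_vector) urep \<Rightarrow> bool"
  where "irreducible_rep G H \<longleftrightarrow> carr H \<noteq> {0} \<and>
    (\<forall>W. invariant_subspace G H W \<longrightarrow> W = {0} \<or> W = carr H)"

text \<open>
  A set \<open>robj\<close> of representations with a strict tensor product: \<open>rten H K\<close> is \<open>H \<boxtimes> K\<close>,
  \<open>vten H K x y\<close> is \<open>x \<boxtimes> y\<close> for \<open>x \<in> H\<close> and \<open>y \<in> K\<close>, and \<open>vac\<close> is the unit vector \<open>\<Omega>\<close> of the
  tensor unit \<open>runit = \<complex> \<Omega>\<close>.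
\<close>

record ('g, 'v) repcat =
  robj :: "('g, 'v) urep set"
  runit :: "('g, 'v) urep"
  vac :: "'v"
  rten :: "('g, 'v) urep \<Rightarrow> ('g, 'v) urep \<Rightarrow> ('g, 'v) urep"
  vten :: "('g, 'v) urep \<Rightarrow> ('g, 'v) urep \<Rightarrow> 'v \<Rightarrow> 'v \<Rightarrow> 'v"

text \<open>
  Closure under direct sums and subrepresentations is meant up to unitary equivalence. In
  \<open>all_irreps\<close> it is no restriction that \<open>H\<close> lives in \<open>'v\<close>: \<open>robj\<close> contains all finite multiples
  of \<open>runit\<close>, so \<open>'v\<close> is infinite-dimensional and every finite-dimensional representation of \<open>G\<close>
  is equivalent to one carried by a subspace of \<open>'v\<close>.
\<close>

locale rep_category = compact_group G \<T>
  for G :: "('g, 'm) monoid_scheme" (structure) and \<T> :: "'g topology" +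
  fixes U :: "('g, 'v::complex_vector) repcat"
  assumes robj_rep: "H \<in> robj U \<Longrightarrow> unitary_rep G \<T> H"
    and rten_obj: "\<lbrakk>H \<in> robj U; K \<in> robj U\<rbrakk> \<Longrightarrow> rten U H K \<in> robj U"
    and vten_linear_left: "\<lbrakk>H \<in> robj U; K \<in> robj U; y \<in> carr K\<rbrakk>
      \<Longrightarrow> linear_between (carr H) (carr (rten U H K)) (\<lambda>x. vten U H K x y)"
    and vten_linear_right: "\<lbrakk>H \<in> robj U; K \<in> robj U; x \<in> carr H\<rbrakk>
      \<Longrightarrow> linear_between (carr K) (carr (rten U H K)) (vten U H K x)"
    and vten_ip: "\<lbrakk>H \<in> robj U; K \<in> robj U; x \<in> carr H; x' \<in> carr H; y \<in> carr K; y' \<in> carr K\<rbrakk>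
      \<Longrightarrow> ip (rten U H K) (vten U H K x y) (vten U H K x' y') = ip H x x' * ip K y y'"
    and vten_span: "\<lbrakk>H \<in> robj U; K \<in> robj U\<rbrakk>
      \<Longrightarrow> carr (rten U H K) = cvec.span {vten U H K x y |x y. x \<in> carr H \<and> y \<in> carr K}"
    and vten_act: "\<lbrakk>H \<in> robj U; K \<in> robj U; g \<in> carrier G; x \<in> carr H; y \<in> carr K\<rbrakk>
      \<Longrightarrow> act (rten U H K) g (vten U H K x y) = vten U H K (act H g x) (act K g y)"
    and rten_assoc: "\<lbrakk>H \<in> robj U; K \<in> robj U; L \<in> robj U\<rbrakk>
      \<Longrightarrow> rten U (rten U H K) L = rten U H (rten U K L)"
    and vten_assoc: "\<lbrakk>H \<in> robj U; K \<in> robj U; L \<in> robj U; x \<in> carr H; y \<in> carr K; z \<in> carr L\<rbrakk>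
      \<Longrightarrow> vten U (rten U H K) L (vten U H K x y) z = vten U H (rten U K L) x (vten U K L y z)"
    and runit_obj: "runit U \<in> robj U"
    and runit_carr: "carr (runit U) = range (\<lambda>c. c *\<^sub>C vac U)"
    and runit_ip: "ip (runit U) (vac U) (vac U) = 1"
    and runit_act: "g \<in> carrier G \<Longrightarrow> act (runit U) g (vac U) = vac U"
    and runit_rten: "H \<in> robj U \<Longrightarrow> rten U (runit U) H = H"
    and rten_runit: "H \<in> robj U \<Longrightarrow> rten U H (runit U) = H"
    and vac_vten: "\<lbrakk>H \<in> robj U; x \<in> carr H\<rbrakk> \<Longrightarrow> vten U (runit U) H (vac U) x = x"
    and vten_vac: "\<lbrakk>H \<in> robj U; x \<in> carr H\<rbrakk> \<Longrightarrow> vten U H (runit U) x (vac U) = x"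
    and rep_direct_sums: "\<lbrakk>H \<in> robj U; K \<in> robj U\<rbrakk>
      \<Longrightarrow> \<exists>L\<in>robj U. \<exists>V\<in>isometric_intertwiners G H L. \<exists>W\<in>isometric_intertwiners G K L.
        (\<forall>x\<in>carr H. \<forall>y\<in>carr K. ip L (V x) (W y) = 0) \<and>
        carr L = {V x + W y |x y. x \<in> carr H \<and> y \<in> carr K}"
    and rep_subreps: "\<lbrakk>H \<in> robj U; invariant_subspace G H W\<rbrakk>
      \<Longrightarrow> \<exists>L\<in>robj U. \<exists>V\<in>isometric_intertwiners G L H. V ` carr L = W"
    and all_irreps: "\<lbrakk>unitary_rep G \<T> (H :: ('g, 'v) urep); irreducible_rep G H\<rbrakk>
      \<Longrightarrow> \<exists>L\<in>robj U. \<exists>V\<in>isometric_intertwiners G L H. V ` carr L = carr H"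

record ('o, 'a, 'g, 'v) rep_functor =
  fobj :: "'o \<Rightarrow> ('g, 'v) urep"
  farr :: "'o \<Rightarrow> 'o \<Rightarrow> 'a \<Rightarrow> 'v \<Rightarrow> 'v"

locale symmetric_tensor_iso =
  fixes S :: "('o, 'a::complex_vector, 'm) btcat_scheme" (structure)
    and G :: "('g, 'n) monoid_scheme"
    and U :: "('g, 'v::complex_vector) repcat"
    and F :: "('o, 'a, 'g, 'v) rep_functor"
  assumes fobj_bij: "bij_betw (fobj F) (obj S) (robj U)"
    and farr_bij: "\<lbrakk>\<rho> \<in> obj S; \<sigma> \<in> obj S\<rbrakk>
      \<Longrightarrow> bij_betw (farr F \<rho> \<sigma>) (Hom S \<rho> \<sigma>) (intertwiners G (fobj F \<rho>) (fobj F \<sigma>))"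
    and farr_linear: "\<lbrakk>\<rho> \<in> obj S; \<sigma> \<in> obj S\<rbrakk>
      \<Longrightarrow> linear_between (Hom S \<rho> \<sigma>) (intertwiners G (fobj F \<rho>) (fobj F \<sigma>)) (farr F \<rho> \<sigma>)"
    and farr_ide: "\<lbrakk>\<rho> \<in> obj S; x \<in> carr (fobj F \<rho>)\<rbrakk> \<Longrightarrow> farr F \<rho> \<rho> (ide S \<rho>) x = x"
    and farr_cmp: "\<lbrakk>\<rho> \<in> obj S; \<sigma> \<in> obj S; \<tau> \<in> obj S; X \<in> Hom S \<sigma> \<tau>; Y \<in> Hom S \<rho> \<sigma>; x \<in> carr (fobj F \<rho>)\<rbrakk>
      \<Longrightarrow> farr F \<rho> \<tau> (cmp S \<rho> \<sigma> \<tau> X Y) x = farr F \<sigma> \<tau> X (farr F \<rho> \<sigma> Y x)"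
    and farr_str: "\<lbrakk>\<rho> \<in> obj S; \<sigma> \<in> obj S; X \<in> Hom S \<rho> \<sigma>; x \<in> carr (fobj F \<rho>); y \<in> carr (fobj F \<sigma>)\<rbrakk>
      \<Longrightarrow> ip (fobj F \<rho>) (farr F \<sigma> \<rho> (str S \<rho> \<sigma> X) y) x = ip (fobj F \<sigma>) y (farr F \<rho> \<sigma> X x)"
    and fobj_unt: "fobj F \<iota> = runit U"
    and fobj_otn: "\<lbrakk>\<rho> \<in> obj S; \<sigma> \<in> obj S\<rbrakk> \<Longrightarrow> fobj F (\<rho> \<odot> \<sigma>) = rten U (fobj F \<rho>) (fobj F \<sigma>)"
    and farr_ten: "\<lbrakk>\<rho>1 \<in> obj S; \<sigma>1 \<in> obj S; \<rho>2 \<in> obj S; \<sigma>2 \<in> obj S; X \<in> Hom S \<rho>1 \<sigma>1; Y \<in> Hom S \<rho>2 \<sigma>2;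
        x \<in> carr (fobj F \<rho>1); y \<in> carr (fobj F \<rho>2)\<rbrakk>
      \<Longrightarrow> farr F (\<rho>1 \<odot> \<rho>2) (\<sigma>1 \<odot> \<sigma>2) (ten S \<rho>1 \<sigma>1 \<rho>2 \<sigma>2 X Y) (vten U (fobj F \<rho>1) (fobj F \<rho>2) x y)
        = vten U (fobj F \<sigma>1) (fobj F \<sigma>2) (farr F \<rho>1 \<sigma>1 X x) (farr F \<rho>2 \<sigma>2 Y y)"
    \<comment> \<open>the symmetry of the representation category is the flip\<close>
    and farr_braid: "\<lbrakk>\<rho> \<in> obj S; \<sigma> \<in> obj S; x \<in> carr (fobj F \<rho>); y \<in> carr (fobj F \<sigma>)\<rbrakk>
      \<Longrightarrow> farr F (\<rho> \<odot> \<sigma>) (\<sigma> \<odot> \<rho>) (\<epsilon> \<rho> \<sigma>) (vten U (fobj F \<rho>) (fobj F \<sigma>) x y)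
        = vten U (fobj F \<sigma>) (fobj F \<rho>) y x"


section \<open>The crossed product\<close>

definition irr_class :: "('o, 'a::complex_vector, 'm) tcat_scheme \<Rightarrow> 'o \<Rightarrow> 'o set"
  where "irr_class S \<rho> = {\<sigma>. irreducible_obj S \<sigma> \<and> equivalent_obj S \<rho> \<sigma>}"

definition irr_classes :: "('o, 'a::complex_vector, 'm) tcat_scheme \<Rightarrow> 'o set set"
  where "irr_classes S = irr_class S ` {\<rho>. irreducible_obj S \<rho>}"

text \<open>
  The choices entering the construction, indexed by \<open>irr_classes S\<close>: representatives
  \<open>\<gamma> k\<close>, multiplicities \<open>N k l m\<close>, bases \<open>V k l m \<alpha>\<close> (\<open>\<alpha> < N k l m\<close>) of
  \<open>Hom(\<gamma>\<^sub>m, \<gamma>\<^sub>k \<gamma>\<^sub>l)\<close>, conjugate classes, and solutions of the conjugate equations.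
\<close>

record ('o, 'a) cp_data =
  gam :: "'o set \<Rightarrow> 'o"
  mult :: "'o set \<Rightarrow> 'o set \<Rightarrow> 'o set \<Rightarrow> nat"
  bas :: "'o set \<Rightarrow> 'o set \<Rightarrow> 'o set \<Rightarrow> nat \<Rightarrow> 'a"
  cbar :: "'o set \<Rightarrow> 'o set"
  Rsol :: "'o set \<Rightarrow> 'a"
  Rbar :: "'o set \<Rightarrow> 'a"

locale crossed_product_data =
  fixes S :: "('o, 'a::complex_vector, 'm) tcat_scheme" (structure)
    and P :: "('o, 'a) cp_data"
  assumes gam_class: "k \<in> irr_classes S \<Longrightarrow> gam P k \<in> k"
    and gam_zero: "gam P (irr_class S \<iota>) = \<iota>"
    and bas_orthonormal: "\<lbrakk>k \<in> irr_classes S; l \<in> irr_classes S; m \<in> irr_classes S; \<alpha> < mult P k l m; \<beta> < mult P k l m\<rbrakk>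
      \<Longrightarrow> cmp S (gam P m) (gam P k \<odot> gam P l) (gam P m)
            (str S (gam P m) (gam P k \<odot> gam P l) (bas P k l m \<alpha>)) (bas P k l m \<beta>)
          = (if \<alpha> = \<beta> then ide S (gam P m) else 0)"
    and bas_span: "\<lbrakk>k \<in> irr_classes S; l \<in> irr_classes S; m \<in> irr_classes S\<rbrakk>
      \<Longrightarrow> cvec.span (bas P k l m ` {..<mult P k l m}) = Hom S (gam P m) (gam P k \<odot> gam P l)"
    and cbar_class: "k \<in> irr_classes S \<Longrightarrow> cbar P k \<in> irr_classes S"
    and R_solution: "k \<in> irr_classes S
      \<Longrightarrow> normalized_solution S (gam P k) (gam P (cbar P k)) (Rsol P k) (Rbar P k)"
    and R_nonselfconj: "\<lbrakk>k \<in> irr_classes S; cbar P k \<noteq> k\<rbrakk>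
      \<Longrightarrow> Rsol P (cbar P k) = Rbar P k \<and> Rbar P (cbar P k) = Rsol P k"
    and R_selfconj: "\<lbrakk>k \<in> irr_classes S; cbar P k = k\<rbrakk> \<Longrightarrow> Rbar P k = Rsol P k \<or> Rbar P k = - Rsol P k"

definition orthonormal_basis :: "('g, 'v::complex_vector) urep \<Rightarrow> 'v set \<Rightarrow> bool"
  where "orthonormal_basis H B \<longleftrightarrow> finite B \<and> B \<subseteq> carr H \<and> cvec.span B = carr H \<and>
    (\<forall>x\<in>B. \<forall>y\<in>B. ip H x y = (if x = y then 1 else 0))"

locale crossed_product =
  fixes C :: "('o, 'a::complex_vector, 'm) btcat_scheme" (structure)
    and S :: "('o, 'a, 'm) btcat_scheme"
    and U :: "('g, 'v::complex_vector) repcat"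
    and F :: "('o, 'a, 'g, 'v) rep_functor"
    and P :: "('o, 'a) cp_data"
begin

abbreviation \<gamma> :: "'o set \<Rightarrow> 'o"
  where "\<gamma> \<equiv> gam P"

abbreviation fib :: "'o set \<Rightarrow> ('g, 'v) urep"
  where "fib k \<equiv> fobj F (\<gamma> k)"

text \<open>
  \<open>\<Oplus>\<^sub>k Hom(\<gamma>\<^sub>k \<rho>, \<sigma>) \<otimes> H\<^sub>k\<close>: since \<open>H\<^sub>k\<close> is a finite-dimensional Hilbert space, \<open>A \<otimes> H\<^sub>k\<close> is
  realized as the space of antilinear maps \<open>H\<^sub>k \<rightarrow> A\<close>, with \<open>T \<otimes> \<psi>\<close> the map
  \<open>x \<mapsto> \<langle>x,\<psi>\<rangle> T\<close>. An element of the direct sum is a finitely supported family of such maps,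
  extended by zero.
\<close>

definition etens :: "'o set \<Rightarrow> 'a \<Rightarrow> 'v \<Rightarrow> 'o set \<Rightarrow> 'v \<Rightarrow> 'a"
  where "etens k T \<psi> = (\<lambda>l x. if l = k \<and> x \<in> carr (fib k) then ip (fib k) x \<psi> *\<^sub>C T else 0)"

definition hom0 :: "'o \<Rightarrow> 'o \<Rightarrow> ('o set \<Rightarrow> 'v \<Rightarrow> 'a) set"
  where "hom0 \<rho> \<sigma> = {X.
    finite {k. X k \<noteq> 0} \<and> {k. X k \<noteq> 0} \<subseteq> irr_classes S \<and>
    (\<forall>k\<in>irr_classes S.
      (\<forall>x. x \<notin> carr (fib k) \<longrightarrow> X k x = 0) \<and>
      (\<forall>x\<in>carr (fib k). X k x \<in> Hom C (\<gamma> k \<odot> \<rho>) \<sigma>) \<and>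
      (\<forall>x\<in>carr (fib k). \<forall>x'\<in>carr (fib k). X k (x + x') = X k x + X k x') \<and>
      (\<forall>c. \<forall>x\<in>carr (fib k). X k (c *\<^sub>C x) = cnj c *\<^sub>C X k x))}"

text \<open>
  Every \<open>X \<in> hom0 \<rho> \<sigma>\<close> is the sum of the \<open>X k e \<otimes> e\<close>, where \<open>k\<close> runs over the support of \<open>X\<close>
  and \<open>e\<close> over an orthonormal basis \<open>onb k\<close> of \<open>H\<^sub>k\<close>. The operations are given on
  elementary tensors and extended along this expansion; by (anti)linearity the result does not
  depend on the basis.
\<close>

definition onb :: "'o set \<Rightarrow> 'v set"
  where "onb k = (SOME B. orthonormal_basis (fib k) B)"

text \<open>\<open>F(V)\<^sup>* (\<psi> \<boxtimes> \<phi>)\<close> for \<open>V = V\<^sub>k\<^sub>l\<^sup>m\<^sup>\<alpha>\<close>; here \<open>F(V)\<^sup>* = F(V\<^sup>*)\<close>.\<close>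

definition coef :: "'o set \<Rightarrow> 'o set \<Rightarrow> 'o set \<Rightarrow> nat \<Rightarrow> 'v \<Rightarrow> 'v \<Rightarrow> 'v"
  where "coef k l m \<alpha> \<psi> \<phi> =
    farr F (\<gamma> k \<odot> \<gamma> l) (\<gamma> m) (str C (\<gamma> m) (\<gamma> k \<odot> \<gamma> l) (bas P k l m \<alpha>)) (vten U (fib k) (fib l) \<psi> \<phi>)"

text \<open>\<open>(A \<otimes> \<psi>) \<circ> (T \<otimes> \<phi>)\<close> for \<open>A \<in> Hom(\<gamma>\<^sub>k \<sigma>, \<delta>)\<close> and \<open>T \<in> Hom(\<gamma>\<^sub>l \<rho>, \<sigma>)\<close>.\<close>

definition cmp_et :: "'o \<Rightarrow> 'o \<Rightarrow> 'o \<Rightarrow> 'o set \<Rightarrow> 'a \<Rightarrow> 'v \<Rightarrow> 'o set \<Rightarrow> 'a \<Rightarrow> 'v \<Rightarrow> 'o set \<Rightarrow> 'v \<Rightarrow> 'a"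
  where "cmp_et \<rho> \<sigma> \<delta> k A \<psi> l T \<phi> =
    (\<Sum>m \<in> {m \<in> irr_classes S. 0 < mult P k l m}. \<Sum>\<alpha> < mult P k l m.
      etens m
        (cmp C (\<gamma> m \<odot> \<rho>) (\<gamma> k \<odot> \<sigma>) \<delta> A
          (cmp C (\<gamma> m \<odot> \<rho>) (\<gamma> k \<odot> \<gamma> l \<odot> \<rho>) (\<gamma> k \<odot> \<sigma>)
            (ten C (\<gamma> k) (\<gamma> k) (\<gamma> l \<odot> \<rho>) \<sigma> (ide C (\<gamma> k)) T)
            (ten C (\<gamma> m) (\<gamma> k \<odot> \<gamma> l) \<rho> \<rho> (bas P k l m \<alpha>) (ide C \<rho>))))
        (coef k l m \<alpha> \<psi> \<phi>))"

definition cmp0 :: "'o \<Rightarrow> 'o \<Rightarrow> 'o \<Rightarrow> ('o set \<Rightarrow> 'v \<Rightarrow> 'a) \<Rightarrow> ('o set \<Rightarrow> 'v \<Rightarrow> 'a) \<Rightarrow> 'o set \<Rightarrow> 'v \<Rightarrow> 'a"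
  where "cmp0 \<rho> \<sigma> \<delta> X Y =
    (\<Sum>k \<in> {k. X k \<noteq> 0}. \<Sum>e \<in> onb k. \<Sum>l \<in> {l. Y l \<noteq> 0}. \<Sum>f \<in> onb l.
      cmp_et \<rho> \<sigma> \<delta> k (X k e) e l (Y l f) f)"

text \<open>\<open>(A \<otimes> \<psi>) \<times> (T \<otimes> \<phi>)\<close> for \<open>A \<in> Hom(\<gamma>\<^sub>k \<rho>\<^sub>1, \<sigma>\<^sub>1)\<close> and \<open>T \<in> Hom(\<gamma>\<^sub>l \<rho>\<^sub>2, \<sigma>\<^sub>2)\<close>.\<close>

definition ten_et ::
    "'o \<Rightarrow> 'o \<Rightarrow> 'o \<Rightarrow> 'o \<Rightarrow> 'o set \<Rightarrow> 'a \<Rightarrow> 'v \<Rightarrow> 'o set \<Rightarrow> 'a \<Rightarrow> 'v \<Rightarrow> 'o set \<Rightarrow> 'v \<Rightarrow> 'a"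
  where "ten_et \<rho>1 \<sigma>1 \<rho>2 \<sigma>2 k A \<psi> l T \<phi> =
    (\<Sum>m \<in> {m \<in> irr_classes S. 0 < mult P k l m}. \<Sum>\<alpha> < mult P k l m.
      etens m
        (cmp C (\<gamma> m \<odot> \<rho>1 \<odot> \<rho>2) (\<gamma> k \<odot> \<rho>1 \<odot> \<gamma> l \<odot> \<rho>2) (\<sigma>1 \<odot> \<sigma>2)
          (ten C (\<gamma> k \<odot> \<rho>1) \<sigma>1 (\<gamma> l \<odot> \<rho>2) \<sigma>2 A T)
          (cmp C (\<gamma> m \<odot> \<rho>1 \<odot> \<rho>2) (\<gamma> k \<odot> \<gamma> l \<odot> \<rho>1 \<odot> \<rho>2) (\<gamma> k \<odot> \<rho>1 \<odot> \<gamma> l \<odot> \<rho>2)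
            (ten C (\<gamma> k) (\<gamma> k) (\<gamma> l \<odot> \<rho>1 \<odot> \<rho>2) (\<rho>1 \<odot> \<gamma> l \<odot> \<rho>2) (ide C (\<gamma> k))
              (ten C (\<gamma> l \<odot> \<rho>1) (\<rho>1 \<odot> \<gamma> l) \<rho>2 \<rho>2 (\<epsilon> (\<gamma> l) \<rho>1) (ide C \<rho>2)))
            (ten C (\<gamma> m) (\<gamma> k \<odot> \<gamma> l) (\<rho>1 \<odot> \<rho>2) (\<rho>1 \<odot> \<rho>2) (bas P k l m \<alpha>) (ide C (\<rho>1 \<odot> \<rho>2)))))
        (coef k l m \<alpha> \<psi> \<phi>))"

definition ten0 ::
    "'o \<Rightarrow> 'o \<Rightarrow> 'o \<Rightarrow> 'o \<Rightarrow> ('o set \<Rightarrow> 'v \<Rightarrow> 'a) \<Rightarrow> ('o set \<Rightarrow> 'v \<Rightarrow> 'a) \<Rightarrow> 'o set \<Rightarrow> 'v \<Rightarrow> 'a"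
  where "ten0 \<rho>1 \<sigma>1 \<rho>2 \<sigma>2 X Y =
    (\<Sum>k \<in> {k. X k \<noteq> 0}. \<Sum>e \<in> onb k. \<Sum>l \<in> {l. Y l \<noteq> 0}. \<Sum>f \<in> onb l.
      ten_et \<rho>1 \<sigma>1 \<rho>2 \<sigma>2 k (X k e) e l (Y l f) f)"

definition vbar :: "'o set \<Rightarrow> 'v \<Rightarrow> 'v"
  where "vbar k \<psi> = (THE \<phi>. \<phi> \<in> carr (fib (cbar P k)) \<and>
    (\<forall>a\<in>carr (fib (cbar P k)). ip (fib (cbar P k)) a \<phi> =
      ip (fobj F (\<gamma> k \<odot> \<gamma> (cbar P k))) (vten U (fib k) (fib (cbar P k)) \<psi> a)
        (farr F \<iota> (\<gamma> k \<odot> \<gamma> (cbar P k)) (Rbar P k) (vac U))))"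

text \<open>\<open>(A \<otimes> \<psi>)\<^sup>*\<close> for \<open>A \<in> Hom(\<gamma>\<^sub>k \<rho>, \<sigma>)\<close>.\<close>

definition str_et :: "'o \<Rightarrow> 'o \<Rightarrow> 'o set \<Rightarrow> 'a \<Rightarrow> 'v \<Rightarrow> 'o set \<Rightarrow> 'v \<Rightarrow> 'a"
  where "str_et \<rho> \<sigma> k A \<psi> =
    etens (cbar P k)
      (cmp C (\<gamma> (cbar P k) \<odot> \<sigma>) (\<gamma> (cbar P k) \<odot> \<gamma> k \<odot> \<rho>) \<rho>
        (ten C (\<gamma> (cbar P k) \<odot> \<gamma> k) \<iota> \<rho> \<rho> (str C \<iota> (\<gamma> (cbar P k) \<odot> \<gamma> k) (Rsol P k)) (ide C \<rho>))
        (ten C (\<gamma> (cbar P k)) (\<gamma> (cbar P k)) \<sigma> (\<gamma> k \<odot> \<rho>) (ide C (\<gamma> (cbar P k))) (str C (\<gamma> k \<odot> \<rho>) \<sigma> A)))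
      (vbar k \<psi>)"

definition str0 :: "'o \<Rightarrow> 'o \<Rightarrow> ('o set \<Rightarrow> 'v \<Rightarrow> 'a) \<Rightarrow> 'o set \<Rightarrow> 'v \<Rightarrow> 'a"
  where "str0 \<rho> \<sigma> X = (\<Sum>k \<in> {k. X k \<noteq> 0}. \<Sum>e \<in> onb k. str_et \<rho> \<sigma> k (X k e) e)"

text \<open>\<open>id\<^sub>\<rho> \<otimes> \<Omega>\<close> in the component of the class of \<open>\<iota>\<close>, where \<open>\<gamma>\<^sub>0 \<rho> = \<rho>\<close>.\<close>

definition ide0 :: "'o \<Rightarrow> 'o set \<Rightarrow> 'v \<Rightarrow> 'a"
  where "ide0 \<rho> = etens (irr_class S \<iota>) (ide C \<rho>) (vac U)"

definition crossed_product0 :: "('o, 'o set \<Rightarrow> 'v \<Rightarrow> 'a) tcat"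
  where "crossed_product0 = \<lparr>obj = obj C, Hom = hom0, ide = ide0, cmp = cmp0,
    unt = \<iota>, otn = (\<odot>), ten = ten0, str = str0\<rparr>"

end

definition subobject_closure :: "('o, 'a, 'm) tcat_scheme \<Rightarrow> ('o \<times> 'a, 'a) tcat"
  where "subobject_closure A = \<lparr>
    obj = {(\<rho>, E). \<rho> \<in> obj A \<and> E \<in> Hom A \<rho> \<rho> \<and> cmp A \<rho> \<rho> \<rho> E E = E \<and> str A \<rho> \<rho> E = E},
    Hom = (\<lambda>(\<rho>, E) (\<sigma>, E'). (\<lambda>X. cmp A \<rho> \<sigma> \<sigma> E' (cmp A \<rho> \<rho> \<sigma> X E)) ` Hom A \<rho> \<sigma>),
    ide = (\<lambda>(\<rho>, E). E),
    cmp = (\<lambda>(\<rho>, _) (\<sigma>, _) (\<tau>, _). cmp A \<rho> \<sigma> \<tau>),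
    unt = (\<iota>\<^bsub>A\<^esub>, ide A \<iota>\<^bsub>A\<^esub>),
    otn = (\<lambda>(\<rho>, E) (\<sigma>, E'). (\<rho> \<odot>\<^bsub>A\<^esub> \<sigma>, ten A \<rho> \<rho> \<sigma> \<sigma> E E')),
    ten = (\<lambda>(\<rho>1, _) (\<sigma>1, _) (\<rho>2, _) (\<sigma>2, _). ten A \<rho>1 \<sigma>1 \<rho>2 \<sigma>2),
    str = (\<lambda>(\<rho>, _) (\<sigma>, _). str A \<rho> \<sigma>)\<rparr>"

definition modular_closure ::
    "('o, 'a::complex_vector, 'm) btcat_scheme \<Rightarrow> ('g, 'v::complex_vector) repcat \<Rightarrow>
     ('o, 'a, 'g, 'v) rep_functor \<Rightarrow> ('o, 'a) cp_data \<Rightarrow>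
     ('o \<times> ('o set \<Rightarrow> 'v \<Rightarrow> 'a), 'o set \<Rightarrow> 'v \<Rightarrow> 'a) tcat"
  where "modular_closure C U F P = subobject_closure (crossed_product.crossed_product0 C (\<D> C) U F P)"

end

theory Submission
  imports Defs "HOL-Computational_Algebra.Fundamental_Theorem_Algebra"
begin

text \<open>
  The crossed product has the objects of \<open>C\<close> but more arrows: for a degenerate \<open>\<gamma>\<close> the space
  \<open>Hom(\<iota>, \<gamma>)\<close> becomes the Hilbert space \<open>F(\<gamma>)\<close>, so that \<open>\<gamma>\<close> splits into \<open>dim F(\<gamma>)\<close> copies of
  the unit. An irreducible object that is not degenerate receives no arrow from the unit. The
  theorem says that this difference survives the passage to subobjects.

  If every object is degenerate, each \<open>\<psi> \<in> F(\<rho>)\<close> gives an arrow \<open>Y\<^sub>\<psi> : \<iota> \<rightarrow> \<rho>\<close> of the crossed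
  product, and \<open>\<Sum>\<^sub>e Y\<^sub>e Y\<^sub>e\<^sup>* = id\<^sub>\<rho>\<close> for an orthonormal basis (\<open>fib_arrow_complete\<close>). Hence \<open>E Y\<^sub>e \<noteq> 0\<close>
  for some \<open>e\<close> whenever \<open>E \<noteq> 0\<close>; as \<open>E Y\<^sub>e\<close> is again some \<open>Y\<^sub>\<xi>\<close>, and \<open>Y\<^sub>\<xi>\<^sup>* Y\<^sub>\<xi>\<close> is the scalar \<open>\<parallel>\<xi>\<parallel>\<^sup>2\<close>, an
  irreducible \<open>(\<rho>, E)\<close> is equivalent to the unit (\<open>trivial_if_all_degenerate\<close>).

  If some object is not degenerate, then by semisimplicity some irreducible \<open>\<rho>\<close> is not degenerate.
  It has no arrows to the unit, since \<open>Hom(\<gamma>\<^sub>k \<rho>, \<iota>)\<close> is isomorphic to \<open>Hom(\<rho>, \<gamma>')\<close> for a conjugate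
  \<open>\<gamma>'\<close> of \<open>\<gamma>\<^sub>k\<close> and this vanishes (\<open>no_arrows_to_unit\<close>). No irreducible subobject of \<open>\<rho>\<close> in the
  closure can then be equivalent to the unit, and what remains is to find one at all, that is, a
  minimal projection in the endomorphisms of \<open>\<rho>\<close> in the crossed product. They form a
  finite-dimensional algebra with a positive involution, and every such algebra has minimal
  projections (\<open>minimal_projection_exists\<close>).

  Most of the work is to show that the crossed product really is a category with a positive
  involution, because its operations are defined through bases and through chosen solutions of the
  conjugate equations. The remedy is to describe its arrows as a coend. For an arbitrary
  degenerate \<open>g\<close>, an arrow \<open>A : g r \<rightarrow> s\<close> and \<open>\<psi> \<in> F(g)\<close> define an arrow \<open>coend g r A \<psi>\<close> of the
  crossed product, subject to the relation that \<open>(A \<circ> (f \<times> 1), \<psi>)\<close> and \<open>(A, F(f) \<psi>)\<close> define the same one.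
  In these terms the composite of \<open>(A, \<psi>)\<close> and \<open>(B, \<phi>)\<close> is \<open>(A \<circ> (1 \<times> B), \<psi> \<boxtimes> \<phi>)\<close> (\<open>cmp0_coend\<close>), and the
  adjoint may be computed from any solution of the conjugate equations for \<open>g\<close> (\<open>str0_coend\<close>).
  Associativity and the rules for the adjoint then follow from strictness of the tensor product.
  Positivity holds because the component of \<open>X\<^sup>* X\<close> at the unit is a sum of squares in \<open>C\<close>
  (\<open>str0_pos\<close>).
\<close>

section \<open>Minimal projections in finite-dimensional star algebras\<close>

lemma finite_dim_subspace: "finite_dim V \<Longrightarrow> cvec.subspace V"
  unfolding finite_dim_def using cvec.subspace_span by blast

lemma finite_dim_subset:
  assumes "finite_dim V" "cvec.subspace U" "U \<subseteq> V"
  shows "finite_dim U"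
proof -
  obtain B where B: "finite B" "cvec.span B = V"
    using assms(1) unfolding finite_dim_def by blast
  obtain B' where B': "B' \<subseteq> U" "cvec.independent B'" "U \<subseteq> cvec.span B'"
    using cvec.maximal_independent_subset[of U] by blast
  have "finite B'"
    using cvec.independent_span_bound[OF B(1) B'(2)] B'(1) B(2) assms(3) by blast
  moreover have "cvec.span B' = U"
    using B' assms(2) by (meson cvec.span_minimal subset_antisym)
  ultimately show ?thesis unfolding finite_dim_def by blast
qed

lemma dim_strict_mono_subspace:
  assumes "finite_dim V" "cvec.subspace U" "U \<subset> V"
  shows "cvec.dim U < cvec.dim V"
proof -
  have fU: "finite_dim U" using finite_dim_subset assms by blast
  obtain B where B: "finite B" "cvec.span B = V"
    using assms(1) unfolding finite_dim_def by blast
  obtain B' where B': "B' \<subseteq> U" "cvec.independent B'" "U \<subseteq> cvec.span B'" "card B' = cvec.dim U"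
    using cvec.basis_exists[of U] by blast
  have spU: "cvec.span B' = U"
    using B' assms(2) by (meson cvec.span_minimal subset_antisym)
  obtain v where v: "v \<in> V" "v \<notin> U" using assms(3) by blast
  have ind: "cvec.independent (insert v B')"
    using cvec.independent_insertI v(2) spU B'(2) by blast
  have sub: "insert v B' \<subseteq> cvec.span B" using v B'(1) assms(3) B(2) by blast
  have bd: "finite (insert v B')" by (rule cvec.independent_span_bound[OF B(1) ind sub, THEN conjunct1])
  obtain D where D: "D \<subseteq> V" "cvec.independent D" "V \<subseteq> cvec.span D" "card D = cvec.dim V"
    using cvec.basis_exists[of V] by blast
  have fD: "finite D" using cvec.independent_span_bound[OF B(1) D(2)] D(1) B(2) by blast
  have "card (insert v B') \<le> card D"
    using cvec.independent_span_bound[OF fD ind] sub B(2) D(3) by blast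
  moreover have "v \<notin> B'" using v B'(1) by blast
  ultimately show ?thesis using bd B'(4) D(4) by simp
qed

text \<open>
  The vectors \<open>f\<^sup>i v\<close> are linearly dependent, so some nonzero polynomial in \<open>f\<close> kills \<open>v\<close>. In one
  of least degree, splitting off a linear factor \<open>t - \<mu>\<close> leaves a polynomial that does not kill \<open>v\<close>
  and hence yields an eigenvector.
\<close>

lemma eigenvector_exists:
  fixes V :: "'x::complex_vector set"
  assumes fd: "finite_dim V" and v: "v \<in> V" "v \<noteq> 0"
    and fV: "\<And>x. x \<in> V \<Longrightarrow> f x \<in> V"
    and fadd: "\<And>x y. x \<in> V \<Longrightarrow> y \<in> V \<Longrightarrow> f (x + y) = f x + f y"
    and fscale: "\<And>c x. x \<in> V \<Longrightarrow> f (c *\<^sub>C x) = c *\<^sub>C f x"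
  shows "\<exists>w\<in>V. w \<noteq> 0 \<and> (\<exists>\<mu>. f w = \<mu> *\<^sub>C w)"
proof -
  have sV: "cvec.subspace V" using fd by (rule finite_dim_subspace)
  define u where "u i = (f ^^ i) v" for i
  have u0: "u 0 = v" and uS: "u (Suc i) = f (u i)" for i by (simp_all add: u_def)
  have uV: "u i \<in> V" for i by (induction i) (simp_all add: u0 uS v fV)
  define ev where "ev q = (\<Sum>i\<le>degree q. coeff q i *\<^sub>C u i)" for q :: "complex poly"
  have ev_ge: "ev q = (\<Sum>i\<le>n. coeff q i *\<^sub>C u i)" if "degree q \<le> n" for q n
    unfolding ev_def using that
    by (intro sum.mono_neutral_left) (auto simp: coeff_eq_0)
  have evV: "ev q \<in> V" for q
    unfolding ev_def by (intro cvec.subspace_sum cvec.subspace_scale sV uV)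
  have fsum: "f (\<Sum>i\<in>I. c i *\<^sub>C u i) = (\<Sum>i\<in>I. c i *\<^sub>C f (u i))" if "finite I" for I :: "nat set" and c
    using that
  proof (induction I)
    case empty
    have "f 0 = 0" using fscale[of v 0] v by simp
    then show ?case by simp
  next
    case (insert j I)
    have "(\<Sum>i\<in>I. c i *\<^sub>C u i) \<in> V" by (intro cvec.subspace_sum cvec.subspace_scale sV uV)
    then show ?case using insert by (simp add: fadd fscale uV cvec.subspace_scale[OF sV])
  qed
  have "\<exists>q. q \<noteq> 0 \<and> ev q = 0"
  proof (cases "inj u")
    case False
    then obtain i j where ij: "i \<noteq> j" "u i = u j" unfolding inj_def by blast
    \<comment> \<open>If two of the vectors coincide, \<open>t\<^sup>i - t\<^sup>j\<close> kills \<open>v\<close>.\<close>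
    define q where "q = monom (1::complex) i - monom 1 j"
    have c: "coeff q i = 1" using ij by (simp add: q_def)
    then have "q \<noteq> 0" by auto
    define n where "n = max i j"
    have "degree q \<le> n" unfolding q_def n_def
      by (intro degree_diff_le order_trans[OF degree_monom_le]) auto
    then have "ev q = (\<Sum>k\<le>n. coeff q k *\<^sub>C u k)" by (rule ev_ge)
    also have "\<dots> = (\<Sum>k\<in>{i,j}. coeff q k *\<^sub>C u k)"
      by (intro sum.mono_neutral_right) (auto simp: n_def q_def)
    also have "\<dots> = 0" using ij by (simp add: q_def cvec.scale_minus_left scaleC_one)
    finally show ?thesis using \<open>q \<noteq> 0\<close> by blast
  next
    case True
    obtain B where B: "finite B" "cvec.span B = V"
      using fd unfolding finite_dim_def by blast
    define N where "N = {..card B}"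
    have "card (u ` N) = Suc (card B)"
      using True by (simp add: card_image inj_on_subset N_def)
    moreover have "u ` N \<subseteq> cvec.span B" using uV B(2) by auto
    ultimately have "\<not> cvec.independent (u ` N)"
      using cvec.independent_span_bound[OF B(1)] by fastforce
    then obtain T g where T: "finite T" "T \<subseteq> u ` N" "(\<Sum>x\<in>T. g x *\<^sub>C x) = 0" "\<exists>x\<in>T. g x \<noteq> 0"
      unfolding cvec.dependent_explicit by blast
    define M where "M = {i\<in>N. u i \<in> T}"
    have M: "finite M" "u ` M = T" "inj_on u M" using T True by (auto simp: M_def N_def inj_on_def inj_def)
    define q where "q = (\<Sum>i\<in>M. monom (g (u i)) i)"
    have cq: "coeff q k = (if k \<in> M then g (u k) else 0)" for k
      unfolding q_def using M(1) by (simp add: coeff_sum)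
    have "q \<noteq> 0"
    proof -
      obtain i where "i \<in> M" "g (u i) \<noteq> 0" using T(4) M(2) by blast
      then have "coeff q i \<noteq> 0" by (simp add: cq)
      then show ?thesis by auto
    qed
    define n where "n = max (degree q) (card B)"
    have "ev q = (\<Sum>k\<le>n. coeff q k *\<^sub>C u k)" by (rule ev_ge) (simp add: n_def)
    also have "\<dots> = (\<Sum>k\<in>M. g (u k) *\<^sub>C u k)"
      by (intro sum.mono_neutral_cong_right) (auto simp: n_def M_def N_def cq)
    also have "\<dots> = (\<Sum>x\<in>T. g x *\<^sub>C x)"
      using sum.reindex[OF M(3), of "\<lambda>x. g x *\<^sub>C x"] M(2) by simp
    finally show ?thesis using \<open>q \<noteq> 0\<close> T(3) by auto
  qed
  then obtain q where q: "q \<noteq> 0" "ev q = 0"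
    and least: "\<And>q'. q' \<noteq> 0 \<Longrightarrow> ev q' = 0 \<Longrightarrow> degree q \<le> degree q'"
    using ex_has_least_nat[of "\<lambda>q. q \<noteq> 0 \<and> ev q = 0" _ degree] by blast
  have "degree q \<noteq> 0"
  proof
    assume "degree q = 0"
    then obtain a where "q = [:a:]" using degree_eq_zeroE by blast
    then have "a *\<^sub>C v = 0" "a \<noteq> 0" using q by (auto simp: ev_def u0)
    then show False using v by simp
  qed
  then obtain \<mu> where "poly q \<mu> = 0"
    using fundamental_theorem_of_algebra[of q] by (auto simp: constant_degree)
  then obtain p where p: "q = [:-\<mu>, 1:] * p" by (auto simp: poly_eq_0_iff_dvd)
  have p0: "p \<noteq> 0" using q(1) p by auto
  have "degree q = Suc (degree p)" unfolding p using p0 by (subst degree_mult_eq) auto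
  then have "ev p \<noteq> 0" using least[OF p0] by fastforce
  have "f (ev p) = (\<Sum>i\<le>degree p. coeff p i *\<^sub>C u (Suc i))"
    unfolding ev_def by (simp add: fsum uS)
  also have "\<dots> = (\<Sum>i\<in>Suc ` {..degree p}. coeff (pCons 0 p) i *\<^sub>C u i)"
    by (simp add: sum.reindex)
  also have "\<dots> = (\<Sum>i\<le>Suc (degree p). coeff (pCons 0 p) i *\<^sub>C u i)"
    by (intro sum.mono_neutral_left) (auto simp: image_iff coeff_pCons gr0_conv_Suc split: nat.splits)
  finally have 1: "f (ev p) = (\<Sum>i\<le>Suc (degree p). coeff (pCons 0 p) i *\<^sub>C u i)" .
  have 2: "\<mu> *\<^sub>C ev p = (\<Sum>i\<le>Suc (degree p). (\<mu> * coeff p i) *\<^sub>C u i)"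
    using ev_ge[of p "Suc (degree p)"] by (simp add: cvec.scale_sum_right scaleC_scaleC del: sum.atMost_Suc)
  have cq: "coeff q i = coeff (pCons 0 p) i - \<mu> * coeff p i" for i
    unfolding p by (simp add: coeff_pCons split: nat.splits)
  have "f (ev p) - \<mu> *\<^sub>C ev p = (\<Sum>i\<le>Suc (degree p). coeff q i *\<^sub>C u i)"
    unfolding 1 2 sum_subtractf[symmetric] cq cvec.scale_left_diff_distrib ..
  also have "\<dots> = 0" using ev_ge[of q "Suc (degree p)"] q(2) \<open>degree q = Suc (degree p)\<close> by simp
  finally have "f (ev p) = \<mu> *\<^sub>C ev p" by simp
  then show ?thesis using \<open>ev p \<noteq> 0\<close> evV by blast
qed

text \<open>
  Take a nonzero right ideal \<open>J\<close> of least dimension. Left multiplication by an element of \<open>J\<close> is an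
  endomorphism of the simple right module \<open>J\<close>, so having an eigenvector it is a scalar. For
  \<open>0 \<noteq> y \<in> J\<close> the element \<open>y y\<^sup>*\<close> of \<open>J\<close> is selfadjoint with nonzero square, hence a nonzero
  real multiple of the projection that is wanted.
\<close>

lemma minimal_projection_exists:
  fixes A :: "'x::complex_vector set"
  assumes fd: "finite_dim A" and a: "a \<in> A" "a \<noteq> 0"
    and mul_in: "\<And>x y. x \<in> A \<Longrightarrow> y \<in> A \<Longrightarrow> mul x y \<in> A"
    and mul_assoc: "\<And>x y z. x \<in> A \<Longrightarrow> y \<in> A \<Longrightarrow> z \<in> A \<Longrightarrow> mul (mul x y) z = mul x (mul y z)"
    and add_left: "\<And>x y z. x \<in> A \<Longrightarrow> y \<in> A \<Longrightarrow> z \<in> A \<Longrightarrow> mul (x + y) z = mul x z + mul y z"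
    and add_right: "\<And>x y z. x \<in> A \<Longrightarrow> y \<in> A \<Longrightarrow> z \<in> A \<Longrightarrow> mul x (y + z) = mul x y + mul x z"
    and scale_left: "\<And>c x y. x \<in> A \<Longrightarrow> y \<in> A \<Longrightarrow> mul (c *\<^sub>C x) y = c *\<^sub>C mul x y"
    and scale_right: "\<And>c x y. x \<in> A \<Longrightarrow> y \<in> A \<Longrightarrow> mul x (c *\<^sub>C y) = c *\<^sub>C mul x y"
    and st_in: "\<And>x. x \<in> A \<Longrightarrow> st x \<in> A"
    and st_scale: "\<And>c x. x \<in> A \<Longrightarrow> st (c *\<^sub>C x) = cnj c *\<^sub>C st x"
    and st_mul: "\<And>x y. x \<in> A \<Longrightarrow> y \<in> A \<Longrightarrow> st (mul x y) = mul (st y) (st x)"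
    and st_st: "\<And>x. x \<in> A \<Longrightarrow> st (st x) = x"
    and pos: "\<And>x. x \<in> A \<Longrightarrow> mul (st x) x = 0 \<Longrightarrow> x = 0"
  shows "\<exists>e\<in>A. e \<noteq> 0 \<and> mul e e = e \<and> st e = e \<and> (\<forall>x\<in>A. \<exists>c. mul e (mul x e) = c *\<^sub>C e)"
proof -
  have sA: "cvec.subspace A" using fd by (rule finite_dim_subspace)
  define ideal where "ideal J \<longleftrightarrow> cvec.subspace J \<and> J \<subseteq> A \<and> J \<noteq> {0} \<and> (\<forall>x\<in>J. \<forall>y\<in>A. mul x y \<in> J)" for J
  have "ideal A" using sA a mul_in by (auto simp: ideal_def)
  then obtain J where J: "ideal J" and least: "\<And>I. ideal I \<Longrightarrow> cvec.dim J \<le> cvec.dim I"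
    using ex_has_least_nat[of ideal A cvec.dim] by blast
  have sJ: "cvec.subspace J" and JA: "J \<subseteq> A" and J0: "J \<noteq> {0}"
    and Jr: "\<And>x y. x \<in> J \<Longrightarrow> y \<in> A \<Longrightarrow> mul x y \<in> J"
    using J by (auto simp: ideal_def)
  have fJ: "finite_dim J" using finite_dim_subset[OF fd sJ JA] .
  obtain y where y: "y \<in> J" "y \<noteq> 0" using J0 cvec.subspace_0[OF sJ] by blast
  have scalar: "\<exists>\<mu>. \<forall>z\<in>J. mul b z = \<mu> *\<^sub>C z" if b: "b \<in> J" for b
  proof -
    have "\<exists>w\<in>J. w \<noteq> 0 \<and> (\<exists>\<mu>. mul b w = \<mu> *\<^sub>C w)"
      using b JA by (intro eigenvector_exists[OF fJ y]) (auto simp: Jr add_right scale_right subset_iff)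
    then obtain w \<mu> where w: "w \<in> J" "w \<noteq> 0" "mul b w = \<mu> *\<^sub>C w" by blast
    \<comment> \<open>The eigenspace is a right ideal, hence all of \<open>J\<close>.\<close>
    define I where "I = {z\<in>J. mul b z = \<mu> *\<^sub>C z}"
    have "mul b 0 = 0" using scale_right[of b b 0] b JA by auto
    then have "cvec.subspace I" unfolding I_def using b JA
      by (intro cvec.subspaceI)
        (auto simp: add_right scale_right subset_iff cvec.subspace_0[OF sJ] cvec.subspace_add[OF sJ]
          cvec.subspace_scale[OF sJ] scaleC_add_right scaleC_scaleC mult.commute)
    moreover have "mul x y \<in> I" if "x \<in> I" "y \<in> A" for x y
      using that b JA by (auto simp: I_def Jr mul_assoc[symmetric] scale_left subset_iff)
    ultimately have "ideal I" using w JA by (auto simp: ideal_def I_def)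
    then have "\<not> I \<subset> J" using least dim_strict_mono_subspace[OF fJ] \<open>cvec.subspace I\<close> by fastforce
    then have "I = J" by (auto simp: I_def)
    then show ?thesis by (auto simp: I_def)
  qed
  define p where "p = mul y (st y)"
  have yA: "y \<in> A" using y JA by blast
  have pJ: "p \<in> J" unfolding p_def using Jr[OF y(1) st_in[OF yA]] .
  have pA: "p \<in> A" using pJ JA by blast
  have st_p: "st p = p" unfolding p_def by (simp add: st_mul st_st st_in yA)
  have "p \<noteq> 0"
  proof
    assume "p = 0"
    then have "st y = 0" using pos[OF st_in[OF yA]] by (simp add: p_def st_st yA)
    moreover have "st 0 = 0" using st_scale[OF yA, of 0] by simp
    ultimately show False using st_st[OF yA] y(2) by simp
  qed
  obtain \<mu> where \<mu>: "\<And>z. z \<in> J \<Longrightarrow> mul p z = \<mu> *\<^sub>C z" using scalar[OF pJ] by blast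
  have pp: "mul p p = \<mu> *\<^sub>C p" using \<mu> pJ by blast
  have "\<mu> \<noteq> 0"
  proof
    assume "\<mu> = 0"
    then have "mul (st p) p = 0" using pp st_p by simp
    then show False using pos[OF pA] \<open>p \<noteq> 0\<close> by blast
  qed
  have "st (mul p p) = mul p p" by (simp only: st_mul[OF pA pA] st_p)
  then have "cnj \<mu> *\<^sub>C p = \<mu> *\<^sub>C p" unfolding pp by (simp only: st_scale[OF pA] st_p)
  then have real: "cnj \<mu> = \<mu>" using \<open>p \<noteq> 0\<close> cvec.scale_right_imp_eq by blast
  define e where "e = (1 / \<mu>) *\<^sub>C p"
  have eJ: "e \<in> J" unfolding e_def using cvec.subspace_scale[OF sJ pJ] .
  have eA: "e \<in> A" using eJ JA by blast
  have "e \<noteq> 0" unfolding e_def using \<open>p \<noteq> 0\<close> \<open>\<mu> \<noteq> 0\<close> by simp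
  moreover have "mul e e = e"
    unfolding e_def using pA \<open>\<mu> \<noteq> 0\<close>
    by (simp add: scale_left scale_right pp cvec.subspace_scale[OF sA] scaleC_scaleC)
  moreover have "st e = e" unfolding e_def by (simp add: st_scale pA st_p real)
  moreover have "\<exists>c. mul e (mul x e) = c *\<^sub>C e" if "x \<in> A" for x
  proof -
    have "mul e x \<in> J" using Jr eJ that by blast
    then show ?thesis using scalar[of "mul e x"] eJ mul_assoc[OF eA that eA] by metis
  qed
  ultimately show ?thesis using eA by blast
qed

section \<open>A calculus of typed arrows\<close>

text \<open>
  An arrow together with its source and target. Composition and tensor product then need no
  further arguments and their laws become rewrite rules whose side conditions compare sources
  and targets.
\<close>

datatype ('o, 'a) arrow = Arr (src: 'o) (tgt: 'o) (und: 'a)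

context tensor_star_category
begin

definition arr :: "('o, 'a) arrow \<Rightarrow> bool"
  where "arr f \<longleftrightarrow> src f \<in> obj C \<and> tgt f \<in> obj C \<and> und f \<in> Hom C (src f) (tgt f)"

definition idt :: "'o \<Rightarrow> ('o, 'a) arrow"
  where "idt \<rho> = Arr \<rho> \<rho> (ide C \<rho>)"

definition compose :: "('o, 'a) arrow \<Rightarrow> ('o, 'a) arrow \<Rightarrow> ('o, 'a) arrow"  (infixr \<open>\<cdot>\<close> 70)
  where "f \<cdot> g = Arr (src g) (tgt f) (cmp C (src g) (src f) (tgt f) (und f) (und g))"

definition tensor :: "('o, 'a) arrow \<Rightarrow> ('o, 'a) arrow \<Rightarrow> ('o, 'a) arrow"  (infixr \<open>\<boxtimes>\<close> 75)
  where "f \<boxtimes> g = Arr (src f \<odot> src g) (tgt f \<odot> tgt g) (ten C (src f) (tgt f) (src g) (tgt g) (und f) (und g))"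

definition adj :: "('o, 'a) arrow \<Rightarrow> ('o, 'a) arrow"  (\<open>_\<^sup>\<dagger>\<close> [1000] 1000)
  where "f\<^sup>\<dagger> = Arr (tgt f) (src f) (str C (src f) (tgt f) (und f))"

lemma src_tgt [simp]:
  "src (idt \<rho>) = \<rho>" "tgt (idt \<rho>) = \<rho>"
  "src (f \<cdot> g) = src g" "tgt (f \<cdot> g) = tgt f"
  "src (f \<boxtimes> g) = src f \<odot> src g" "tgt (f \<boxtimes> g) = tgt f \<odot> tgt g"
  "src (f\<^sup>\<dagger>) = tgt f" "tgt (f\<^sup>\<dagger>) = src f"
  by (simp_all add: idt_def compose_def tensor_def adj_def)

lemma und_simps:
  "und (idt \<rho>) = ide C \<rho>"
  "und (f \<cdot> g) = cmp C (src g) (src f) (tgt f) (und f) (und g)"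
  "und (f \<boxtimes> g) = ten C (src f) (tgt f) (src g) (tgt g) (und f) (und g)"
  "und (f\<^sup>\<dagger>) = str C (src f) (tgt f) (und f)"
  by (simp_all add: idt_def compose_def tensor_def adj_def)

declare unt_obj [simp] otn_obj [simp] otn_assoc [simp] unt_otn [simp] otn_unt [simp]

lemma arr_Arr [simp]: "arr (Arr \<rho> \<sigma> T) \<longleftrightarrow> \<rho> \<in> obj C \<and> \<sigma> \<in> obj C \<and> T \<in> Hom C \<rho> \<sigma>"
  by (simp add: arr_def)

lemma arr_obj [simp]: "arr f \<Longrightarrow> src f \<in> obj C" "arr f \<Longrightarrow> tgt f \<in> obj C"
  by (simp_all add: arr_def)

lemma arr_und: "arr f \<Longrightarrow> src f = \<rho> \<Longrightarrow> tgt f = \<sigma> \<Longrightarrow> und f \<in> Hom C \<rho> \<sigma>"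
  by (auto simp: arr_def)

lemma arr_idt [simp]: "\<rho> \<in> obj C \<Longrightarrow> arr (idt \<rho>)"
  by (simp add: idt_def ide_in)

lemma arr_compose [simp]: "arr f \<Longrightarrow> arr g \<Longrightarrow> src f = tgt g \<Longrightarrow> arr (f \<cdot> g)"
  by (cases f; cases g) (simp add: compose_def cmp_in)

lemma arr_tensor [simp]: "arr f \<Longrightarrow> arr g \<Longrightarrow> arr (f \<boxtimes> g)"
  by (cases f; cases g) (simp add: tensor_def ten_in)

lemma arr_adj [simp]: "arr f \<Longrightarrow> arr (f\<^sup>\<dagger>)"
  by (cases f) (simp add: adj_def str_in)

lemma compose_assoc:
  "arr f \<Longrightarrow> arr g \<Longrightarrow> arr h \<Longrightarrow> src f = tgt g \<Longrightarrow> src g = tgt h \<Longrightarrow> (f \<cdot> g) \<cdot> h = f \<cdot> (g \<cdot> h)"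
  by (cases f; cases g; cases h) (simp add: compose_def cmp_assoc)

lemma idt_compose [simp]: "arr f \<Longrightarrow> tgt f = \<rho> \<Longrightarrow> idt \<rho> \<cdot> f = f"
  by (cases f) (auto simp: compose_def idt_def ide_cmp)

lemma compose_idt [simp]: "arr f \<Longrightarrow> src f = \<rho> \<Longrightarrow> f \<cdot> idt \<rho> = f"
  by (cases f) (auto simp: compose_def idt_def cmp_ide)

lemma tensor_assoc [simp]: "arr f \<Longrightarrow> arr g \<Longrightarrow> arr h \<Longrightarrow> (f \<boxtimes> g) \<boxtimes> h = f \<boxtimes> (g \<boxtimes> h)"
  by (cases f; cases g; cases h) (simp add: tensor_def ten_assoc)

lemma unit_tensor [simp]: "arr f \<Longrightarrow> idt \<iota> \<boxtimes> f = f"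
  by (cases f) (auto simp: tensor_def idt_def unt_ten)

lemma tensor_unit [simp]: "arr f \<Longrightarrow> f \<boxtimes> idt \<iota> = f"
  by (cases f) (auto simp: tensor_def idt_def ten_unt)

lemma idt_tensor: "\<rho> \<in> obj C \<Longrightarrow> \<sigma> \<in> obj C \<Longrightarrow> idt \<rho> \<boxtimes> idt \<sigma> = idt (\<rho> \<odot> \<sigma>)"
  by (simp add: tensor_def idt_def ten_ide)

lemma tensor_compose:
  "arr f \<Longrightarrow> arr g \<Longrightarrow> arr f' \<Longrightarrow> arr g' \<Longrightarrow> src f = tgt f' \<Longrightarrow> src g = tgt g'
    \<Longrightarrow> (f \<boxtimes> g) \<cdot> (f' \<boxtimes> g') = (f \<cdot> f') \<boxtimes> (g \<cdot> g')"
  by (cases f; cases g; cases f'; cases g') (simp add: tensor_def compose_def interchange)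

lemma adj_compose: "arr f \<Longrightarrow> arr g \<Longrightarrow> src f = tgt g \<Longrightarrow> (f \<cdot> g)\<^sup>\<dagger> = g\<^sup>\<dagger> \<cdot> f\<^sup>\<dagger>"
  by (cases f; cases g) (simp add: adj_def compose_def str_cmp)

lemma adj_tensor: "arr f \<Longrightarrow> arr g \<Longrightarrow> (f \<boxtimes> g)\<^sup>\<dagger> = f\<^sup>\<dagger> \<boxtimes> g\<^sup>\<dagger>"
  by (cases f; cases g) (simp add: adj_def tensor_def str_ten)

lemma adj_adj [simp]: "arr f \<Longrightarrow> f\<^sup>\<dagger>\<^sup>\<dagger> = f"
  by (cases f) (auto simp: adj_def str_str)

lemma str_ide: "\<rho> \<in> obj C \<Longrightarrow> str C \<rho> \<rho> (ide C \<rho>) = ide C \<rho>"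
proof -
  assume \<rho>: "\<rho> \<in> obj C"
  have s: "str C \<rho> \<rho> (ide C \<rho>) \<in> Hom C \<rho> \<rho>" using \<rho> by (simp add: ide_in str_in)
  then have "str C \<rho> \<rho> (ide C \<rho>) = cmp C \<rho> \<rho> \<rho> (str C \<rho> \<rho> (ide C \<rho>)) (ide C \<rho>)"
    using \<rho> by (simp add: cmp_ide)
  also have "\<dots> = str C \<rho> \<rho> (cmp C \<rho> \<rho> \<rho> (str C \<rho> \<rho> (ide C \<rho>)) (ide C \<rho>))"
    using \<rho> s by (simp add: str_cmp ide_in str_str)
  also have "\<dots> = ide C \<rho>" using \<rho> s by (simp add: cmp_ide str_str ide_in)
  finally show ?thesis .
qed

lemma adj_idt [simp]: "\<rho> \<in> obj C \<Longrightarrow> (idt \<rho>)\<^sup>\<dagger> = idt \<rho>"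
  by (simp add: adj_def idt_def str_ide)

text \<open>The forms in which the interchange law is used: arrows acting on different factors can be moved past each other.\<close>

lemma slide_left: "arr f \<Longrightarrow> arr g \<Longrightarrow> tgt g = \<tau> \<Longrightarrow> src f = \<rho> \<Longrightarrow> (f \<boxtimes> idt \<tau>) \<cdot> (idt \<rho> \<boxtimes> g) = f \<boxtimes> g"
  by (auto simp: tensor_compose)

lemma slide_right: "arr f \<Longrightarrow> arr g \<Longrightarrow> src g = \<tau> \<Longrightarrow> tgt f = \<rho> \<Longrightarrow> (idt \<rho> \<boxtimes> g) \<cdot> (f \<boxtimes> idt \<tau>) = f \<boxtimes> g"
  by (auto simp: tensor_compose)

lemma whisker_left:
  "arr f \<Longrightarrow> arr g \<Longrightarrow> src f = tgt g \<Longrightarrow> \<rho> \<in> obj C \<Longrightarrow> idt \<rho> \<boxtimes> (f \<cdot> g) = (idt \<rho> \<boxtimes> f) \<cdot> (idt \<rho> \<boxtimes> g)"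
  by (simp add: tensor_compose)

lemma whisker_right:
  "arr f \<Longrightarrow> arr g \<Longrightarrow> src f = tgt g \<Longrightarrow> \<rho> \<in> obj C \<Longrightarrow> (f \<cdot> g) \<boxtimes> idt \<rho> = (f \<boxtimes> idt \<rho>) \<cdot> (g \<boxtimes> idt \<rho>)"
  by (simp add: tensor_compose)


section \<open>Conjugates\<close>

text \<open>
  The predicate \<open>conjugate_solution\<close> in the calculus of typed arrows.
\<close>

definition conj_pair :: "'o \<Rightarrow> 'o \<Rightarrow> ('o, 'a) arrow \<Rightarrow> ('o, 'a) arrow \<Rightarrow> bool"
  where "conj_pair \<rho> \<rho>' R R' \<longleftrightarrow> \<rho> \<in> obj C \<and> \<rho>' \<in> obj C \<and>
    arr R \<and> src R = \<iota> \<and> tgt R = \<rho>' \<odot> \<rho> \<and> arr R' \<and> src R' = \<iota> \<and> tgt R' = \<rho> \<odot> \<rho>' \<and>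
    (R'\<^sup>\<dagger> \<boxtimes> idt \<rho>) \<cdot> (idt \<rho> \<boxtimes> R) = idt \<rho> \<and> (R\<^sup>\<dagger> \<boxtimes> idt \<rho>') \<cdot> (idt \<rho>' \<boxtimes> R') = idt \<rho>'"

lemma conj_pairD:
  assumes "conj_pair \<rho> \<rho>' R R'"
  shows "\<rho> \<in> obj C" "\<rho>' \<in> obj C" "arr R" "src R = \<iota>" "tgt R = \<rho>' \<odot> \<rho>" "arr R'" "src R' = \<iota>" "tgt R' = \<rho> \<odot> \<rho>'"
    and "(R'\<^sup>\<dagger> \<boxtimes> idt \<rho>) \<cdot> (idt \<rho> \<boxtimes> R) = idt \<rho>" "(R\<^sup>\<dagger> \<boxtimes> idt \<rho>') \<cdot> (idt \<rho>' \<boxtimes> R') = idt \<rho>'"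
  using assms by (simp_all add: conj_pair_def)

lemma conj_pair_adj:
  assumes "conj_pair \<rho> \<rho>' R R'"
  shows "(idt \<rho> \<boxtimes> R\<^sup>\<dagger>) \<cdot> (R' \<boxtimes> idt \<rho>) = idt \<rho>" "(idt \<rho>' \<boxtimes> R'\<^sup>\<dagger>) \<cdot> (R \<boxtimes> idt \<rho>') = idt \<rho>'"
proof -
  note R = conj_pairD[OF assms]
  show "(idt \<rho> \<boxtimes> R\<^sup>\<dagger>) \<cdot> (R' \<boxtimes> idt \<rho>) = idt \<rho>"
    using arg_cong[OF R(9), of adj] R(1-8) by (simp add: adj_compose adj_tensor)
  show "(idt \<rho>' \<boxtimes> R'\<^sup>\<dagger>) \<cdot> (R \<boxtimes> idt \<rho>') = idt \<rho>'"
    using arg_cong[OF R(10), of adj] R(1-8) by (simp add: adj_compose adj_tensor)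
qed

lemma conj_pair_swap: "conj_pair \<rho> \<rho>' R R' \<Longrightarrow> conj_pair \<rho>' \<rho> R' R"
  by (auto simp: conj_pair_def)

lemma conjugate_solution_conj_pair:
  assumes "conjugate_solution C \<rho> \<rho>' R R'" "\<rho> \<in> obj C" "\<rho>' \<in> obj C"
  shows "conj_pair \<rho> \<rho>' (Arr \<iota> (\<rho>' \<odot> \<rho>) R) (Arr \<iota> (\<rho> \<odot> \<rho>') R')"
  using assms unfolding conjugate_solution_def conj_pair_def
  by (simp add: adj_def tensor_def compose_def idt_def)

text \<open>
  Frobenius reciprocity: bending a factor over to the other side and back changes nothing. In
  particular an arrow vanishes as soon as its bent form does.
\<close>

lemma bend_left:
  assumes "conj_pair \<gamma> \<gamma>' R R'" and A: "arr A" "src A = \<gamma> \<odot> \<rho>" "tgt A = \<sigma>" and \<rho>: "\<rho> \<in> obj C"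
  shows "(R'\<^sup>\<dagger> \<boxtimes> idt \<sigma>) \<cdot> (idt \<gamma> \<boxtimes> ((idt \<gamma>' \<boxtimes> A) \<cdot> (R \<boxtimes> idt \<rho>))) = A"
proof -
  note R = conj_pairD[OF assms(1)]
  note [simp] = R(1-8) A \<rho> arr_obj(2)[OF A(1), unfolded A(3)]
  have "(R'\<^sup>\<dagger> \<boxtimes> idt \<sigma>) \<cdot> (idt \<gamma> \<boxtimes> ((idt \<gamma>' \<boxtimes> A) \<cdot> (R \<boxtimes> idt \<rho>)))
      = (R'\<^sup>\<dagger> \<boxtimes> idt \<sigma>) \<cdot> (idt \<gamma> \<boxtimes> idt \<gamma>' \<boxtimes> A) \<cdot> (idt \<gamma> \<boxtimes> R \<boxtimes> idt \<rho>)"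
    by (simp add: whisker_left)
  also have "\<dots> = ((R'\<^sup>\<dagger> \<boxtimes> idt \<sigma>) \<cdot> (idt (\<gamma> \<odot> \<gamma>') \<boxtimes> A)) \<cdot> (idt \<gamma> \<boxtimes> R \<boxtimes> idt \<rho>)"
    by (simp add: compose_assoc flip: idt_tensor)
  also have "(R'\<^sup>\<dagger> \<boxtimes> idt \<sigma>) \<cdot> (idt (\<gamma> \<odot> \<gamma>') \<boxtimes> A) = A \<cdot> (R'\<^sup>\<dagger> \<boxtimes> idt \<gamma> \<boxtimes> idt \<rho>)"
    using slide_right[of "R'\<^sup>\<dagger>" A "\<gamma> \<odot> \<rho>" \<iota>] slide_left[of "R'\<^sup>\<dagger>" A \<sigma> "\<gamma> \<odot> \<gamma>'"]
    by (simp flip: idt_tensor)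
  also have "(A \<cdot> (R'\<^sup>\<dagger> \<boxtimes> idt \<gamma> \<boxtimes> idt \<rho>)) \<cdot> (idt \<gamma> \<boxtimes> R \<boxtimes> idt \<rho>)
      = A \<cdot> (((R'\<^sup>\<dagger> \<boxtimes> idt \<gamma>) \<cdot> (idt \<gamma> \<boxtimes> R)) \<boxtimes> idt \<rho>)"
    by (simp add: compose_assoc whisker_right)
  finally show ?thesis by (simp add: R(9) idt_tensor)
qed

lemma bend_right:
  assumes "conj_pair \<gamma> \<gamma>' R R'" and B: "arr B" "src B = \<rho>" "tgt B = \<gamma>' \<odot> \<sigma>" and \<sigma>: "\<sigma> \<in> obj C"
  shows "(idt \<gamma>' \<boxtimes> ((R'\<^sup>\<dagger> \<boxtimes> idt \<sigma>) \<cdot> (idt \<gamma> \<boxtimes> B))) \<cdot> (R \<boxtimes> idt \<rho>) = B"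
proof -
  note R = conj_pairD[OF assms(1)]
  note [simp] = R(1-8) B \<sigma> arr_obj(1)[OF B(1), unfolded B(2)]
  have "(idt \<gamma>' \<boxtimes> ((R'\<^sup>\<dagger> \<boxtimes> idt \<sigma>) \<cdot> (idt \<gamma> \<boxtimes> B))) \<cdot> (R \<boxtimes> idt \<rho>)
      = (idt \<gamma>' \<boxtimes> R'\<^sup>\<dagger> \<boxtimes> idt \<sigma>) \<cdot> ((idt (\<gamma>' \<odot> \<gamma>) \<boxtimes> B) \<cdot> (R \<boxtimes> idt \<rho>))"
    by (simp add: whisker_left compose_assoc flip: idt_tensor)
  also have "(idt (\<gamma>' \<odot> \<gamma>) \<boxtimes> B) \<cdot> (R \<boxtimes> idt \<rho>) = (R \<boxtimes> idt (\<gamma>' \<odot> \<sigma>)) \<cdot> B"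
    using slide_left[of R B "\<gamma>' \<odot> \<sigma>" \<iota>] by (simp add: slide_right)
  also have "(idt \<gamma>' \<boxtimes> R'\<^sup>\<dagger> \<boxtimes> idt \<sigma>) \<cdot> (R \<boxtimes> idt (\<gamma>' \<odot> \<sigma>)) \<cdot> B
      = (((idt \<gamma>' \<boxtimes> R'\<^sup>\<dagger>) \<cdot> (R \<boxtimes> idt \<gamma>')) \<boxtimes> idt \<sigma>) \<cdot> B"
    by (simp add: whisker_right compose_assoc flip: idt_tensor)
  finally show ?thesis by (simp add: conj_pair_adj[OF assms(1)] idt_tensor)
qed

lemma bend_source:
  assumes "conj_pair \<rho> \<rho>' R R'" and A: "arr A" "src A = \<gamma> \<odot> \<rho>" "tgt A = \<sigma>" and \<gamma>: "\<gamma> \<in> obj C"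
  shows "(idt \<sigma> \<boxtimes> R\<^sup>\<dagger>) \<cdot> (((A \<boxtimes> idt \<rho>') \<cdot> (idt \<gamma> \<boxtimes> R')) \<boxtimes> idt \<rho>) = A"
proof -
  note R = conj_pairD[OF assms(1)]
  note [simp] = R(1-8) A \<gamma> arr_obj(2)[OF A(1), unfolded A(3)]
  have "(idt \<sigma> \<boxtimes> R\<^sup>\<dagger>) \<cdot> (((A \<boxtimes> idt \<rho>') \<cdot> (idt \<gamma> \<boxtimes> R')) \<boxtimes> idt \<rho>)
      = ((idt \<sigma> \<boxtimes> R\<^sup>\<dagger>) \<cdot> (A \<boxtimes> idt (\<rho>' \<odot> \<rho>))) \<cdot> (idt \<gamma> \<boxtimes> R' \<boxtimes> idt \<rho>)"
    by (simp add: whisker_right compose_assoc flip: idt_tensor)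
  also have "(idt \<sigma> \<boxtimes> R\<^sup>\<dagger>) \<cdot> (A \<boxtimes> idt (\<rho>' \<odot> \<rho>)) = A \<cdot> (idt \<gamma> \<boxtimes> idt \<rho> \<boxtimes> R\<^sup>\<dagger>)"
    using slide_left[of A "R\<^sup>\<dagger>" \<iota> "\<gamma> \<odot> \<rho>"] slide_right[of A "R\<^sup>\<dagger>" "\<rho>' \<odot> \<rho>" \<sigma>]
    by (simp flip: idt_tensor)
  also have "(A \<cdot> (idt \<gamma> \<boxtimes> idt \<rho> \<boxtimes> R\<^sup>\<dagger>)) \<cdot> (idt \<gamma> \<boxtimes> R' \<boxtimes> idt \<rho>)
      = A \<cdot> (idt \<gamma> \<boxtimes> ((idt \<rho> \<boxtimes> R\<^sup>\<dagger>) \<cdot> (R' \<boxtimes> idt \<rho>)))"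
    by (simp add: whisker_left compose_assoc)
  finally show ?thesis by (simp add: conj_pair_adj[OF assms(1)] idt_tensor)
qed

text \<open>
  The solution for \<open>\<rho>\<close> is nested inside the one for \<open>\<sigma>\<close>, and the other way round for the second
  members; this reverses the order of the conjugates.
\<close>

lemma conj_pair_product:
  assumes 1: "conj_pair \<rho> \<rho>' R R'" and 2: "conj_pair \<sigma> \<sigma>' Q Q'"
  shows "conj_pair (\<rho> \<odot> \<sigma>) (\<sigma>' \<odot> \<rho>') ((idt \<sigma>' \<boxtimes> R \<boxtimes> idt \<sigma>) \<cdot> Q) ((idt \<rho> \<boxtimes> Q' \<boxtimes> idt \<rho>') \<cdot> R')"
proof -
  have key: "(((idt \<rho> \<boxtimes> Q' \<boxtimes> idt \<rho>') \<cdot> R')\<^sup>\<dagger> \<boxtimes> idt (\<rho> \<odot> \<sigma>)) \<cdot> (idt (\<rho> \<odot> \<sigma>) \<boxtimes> ((idt \<sigma>' \<boxtimes> R \<boxtimes> idt \<sigma>) \<cdot> Q))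
      = idt (\<rho> \<odot> \<sigma>)" if 1: "conj_pair \<rho> \<rho>' R R'" and 2: "conj_pair \<sigma> \<sigma>' Q Q'" for \<rho> \<rho>' R R' \<sigma> \<sigma>' Q Q'
  proof -
    note R = conj_pairD[OF 1] and Q = conj_pairD[OF 2]
    note [simp] = R(1-8) Q(1-8)
    have "(((idt \<rho> \<boxtimes> Q' \<boxtimes> idt \<rho>') \<cdot> R')\<^sup>\<dagger> \<boxtimes> idt (\<rho> \<odot> \<sigma>)) \<cdot> (idt (\<rho> \<odot> \<sigma>) \<boxtimes> ((idt \<sigma>' \<boxtimes> R \<boxtimes> idt \<sigma>) \<cdot> Q))
      = (R'\<^sup>\<dagger> \<boxtimes> idt \<rho> \<boxtimes> idt \<sigma>) \<cdot> (idt \<rho> \<boxtimes> Q'\<^sup>\<dagger> \<boxtimes> idt \<rho>' \<boxtimes> idt \<rho> \<boxtimes> idt \<sigma>)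
        \<cdot> (idt \<rho> \<boxtimes> idt \<sigma> \<boxtimes> idt \<sigma>' \<boxtimes> R \<boxtimes> idt \<sigma>) \<cdot> (idt \<rho> \<boxtimes> idt \<sigma> \<boxtimes> Q)"
      by (simp add: adj_compose adj_tensor whisker_left whisker_right compose_assoc) (simp flip: idt_tensor)
    also have "\<dots> = (R'\<^sup>\<dagger> \<boxtimes> idt \<rho> \<boxtimes> idt \<sigma>) \<cdot>
        ((idt \<rho> \<boxtimes> ((Q'\<^sup>\<dagger> \<boxtimes> idt (\<rho>' \<odot> \<rho>)) \<cdot> (idt (\<sigma> \<odot> \<sigma>') \<boxtimes> R)) \<boxtimes> idt \<sigma>)
        \<cdot> (idt \<rho> \<boxtimes> idt \<sigma> \<boxtimes> Q))"
      by (simp add: whisker_left whisker_right compose_assoc flip: idt_tensor)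
    \<comment> \<open>The cap for \<open>\<sigma>\<close> and the cup for \<open>\<rho>\<close> act on different factors; exchanging them separates the two conjugate equations.\<close>
    also have "(Q'\<^sup>\<dagger> \<boxtimes> idt (\<rho>' \<odot> \<rho>)) \<cdot> (idt (\<sigma> \<odot> \<sigma>') \<boxtimes> R) = R \<cdot> Q'\<^sup>\<dagger>"
      using slide_right[of "Q'\<^sup>\<dagger>" R \<iota> \<iota>] by (simp add: slide_left)
    also have "(R'\<^sup>\<dagger> \<boxtimes> idt \<rho> \<boxtimes> idt \<sigma>) \<cdot> ((idt \<rho> \<boxtimes> (R \<cdot> Q'\<^sup>\<dagger>) \<boxtimes> idt \<sigma>) \<cdot> (idt \<rho> \<boxtimes> idt \<sigma> \<boxtimes> Q))
      = (((R'\<^sup>\<dagger> \<boxtimes> idt \<rho>) \<cdot> (idt \<rho> \<boxtimes> R)) \<boxtimes> idt \<sigma>) \<cdot> (idt \<rho> \<boxtimes> ((Q'\<^sup>\<dagger> \<boxtimes> idt \<sigma>) \<cdot> (idt \<sigma> \<boxtimes> Q)))"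
      by (simp add: whisker_left whisker_right compose_assoc)
    finally show ?thesis by (simp add: R(9) Q(9) idt_tensor)
  qed
  note R = conj_pairD[OF 1] and Q = conj_pairD[OF 2]
  show ?thesis
    unfolding conj_pair_def
    using key[OF 1 2] key[OF conj_pair_swap[OF 2] conj_pair_swap[OF 1]] R(1-8) Q(1-8) by simp
qed

text \<open>
  The transpose \<open>\<tau> : \<gamma>' \<rightarrow> \<kappa>'\<close> of \<open>\<theta> : \<kappa> \<rightarrow> \<gamma>\<close> with respect to chosen conjugates. Its two
  properties say that either solution of the conjugate equations may be moved across \<open>\<theta>\<close>, which is
  what makes the adjoint in the crossed product independent of choices.
\<close>

lemma transpose_exists:
  assumes 1: "conj_pair \<gamma> \<gamma>' R R'" and 2: "conj_pair \<kappa> \<kappa>' Q Q'"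
    and \<theta>: "arr \<theta>" "src \<theta> = \<kappa>" "tgt \<theta> = \<gamma>"
  obtains \<tau> where "arr \<tau>" "src \<tau> = \<gamma>'" "tgt \<tau> = \<kappa>'"
    and "(idt \<kappa>' \<boxtimes> \<theta>) \<cdot> Q = (\<tau> \<boxtimes> idt \<gamma>) \<cdot> R"
    and "(idt \<kappa> \<boxtimes> \<tau>\<^sup>\<dagger>) \<cdot> Q' = (\<theta>\<^sup>\<dagger> \<boxtimes> idt \<gamma>') \<cdot> R'"
proof -
  note R = conj_pairD[OF 1] and Q = conj_pairD[OF 2]
  note [simp] = R(1-8) Q(1-8) \<theta>
  define Z where "Z = (idt \<kappa>' \<boxtimes> \<theta>) \<cdot> Q"
  have Z [simp]: "arr Z" "src Z = \<iota>" "tgt Z = \<kappa>' \<odot> \<gamma>" by (simp_all add: Z_def)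
  define \<tau> where "\<tau> = (idt \<kappa>' \<boxtimes> R'\<^sup>\<dagger>) \<cdot> (Z \<boxtimes> idt \<gamma>')"
  have \<tau> [simp]: "arr \<tau>" "src \<tau> = \<gamma>'" "tgt \<tau> = \<kappa>'" by (simp_all add: \<tau>_def)
  have "(\<tau> \<boxtimes> idt \<gamma>) \<cdot> R = (idt \<kappa>' \<boxtimes> R'\<^sup>\<dagger> \<boxtimes> idt \<gamma>) \<cdot> ((Z \<boxtimes> idt (\<gamma>' \<odot> \<gamma>)) \<cdot> R)"
    by (simp add: \<tau>_def whisker_right compose_assoc flip: idt_tensor)
  also have "(Z \<boxtimes> idt (\<gamma>' \<odot> \<gamma>)) \<cdot> R = (idt \<kappa>' \<boxtimes> idt \<gamma> \<boxtimes> R) \<cdot> Z"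
    using slide_left[of Z R "\<gamma>' \<odot> \<gamma>" \<iota>] slide_right[of Z R \<iota> "\<kappa>' \<odot> \<gamma>"] by (simp flip: idt_tensor)
  also have "(idt \<kappa>' \<boxtimes> R'\<^sup>\<dagger> \<boxtimes> idt \<gamma>) \<cdot> ((idt \<kappa>' \<boxtimes> idt \<gamma> \<boxtimes> R) \<cdot> Z)
      = (idt \<kappa>' \<boxtimes> ((R'\<^sup>\<dagger> \<boxtimes> idt \<gamma>) \<cdot> (idt \<gamma> \<boxtimes> R))) \<cdot> Z"
    by (simp add: whisker_left compose_assoc)
  also have "\<dots> = Z" by (simp add: R(9) idt_tensor)
  finally have a: "(\<tau> \<boxtimes> idt \<gamma>) \<cdot> R = Z" .
  have "(idt \<kappa> \<boxtimes> \<tau>\<^sup>\<dagger>) \<cdot> Q' = (idt \<kappa> \<boxtimes> Z\<^sup>\<dagger> \<boxtimes> idt \<gamma>') \<cdot> ((idt (\<kappa> \<odot> \<kappa>') \<boxtimes> R') \<cdot> Q')"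
    by (simp add: \<tau>_def adj_compose adj_tensor whisker_left compose_assoc flip: idt_tensor)
  also have "(idt (\<kappa> \<odot> \<kappa>') \<boxtimes> R') \<cdot> Q' = (Q' \<boxtimes> idt \<gamma> \<boxtimes> idt \<gamma>') \<cdot> R'"
    using slide_left[of Q' R' "\<gamma> \<odot> \<gamma>'" \<iota>] slide_right[of Q' R' \<iota> "\<kappa> \<odot> \<kappa>'"] by (simp flip: idt_tensor)
  also have "(idt \<kappa> \<boxtimes> Z\<^sup>\<dagger> \<boxtimes> idt \<gamma>') \<cdot> ((Q' \<boxtimes> idt \<gamma> \<boxtimes> idt \<gamma>') \<cdot> R')
      = (((idt \<kappa> \<boxtimes> Q\<^sup>\<dagger>) \<cdot> ((idt (\<kappa> \<odot> \<kappa>') \<boxtimes> \<theta>\<^sup>\<dagger>) \<cdot> (Q' \<boxtimes> idt \<gamma>))) \<boxtimes> idt \<gamma>') \<cdot> R'"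
    by (simp add: Z_def adj_compose adj_tensor whisker_left whisker_right compose_assoc flip: idt_tensor)
  also have "(idt (\<kappa> \<odot> \<kappa>') \<boxtimes> \<theta>\<^sup>\<dagger>) \<cdot> (Q' \<boxtimes> idt \<gamma>) = (Q' \<boxtimes> idt \<kappa>) \<cdot> \<theta>\<^sup>\<dagger>"
    using slide_left[of Q' "\<theta>\<^sup>\<dagger>" \<kappa> \<iota>] by (simp add: slide_right)
  also have "(idt \<kappa> \<boxtimes> Q\<^sup>\<dagger>) \<cdot> ((Q' \<boxtimes> idt \<kappa>) \<cdot> \<theta>\<^sup>\<dagger>) = ((idt \<kappa> \<boxtimes> Q\<^sup>\<dagger>) \<cdot> (Q' \<boxtimes> idt \<kappa>)) \<cdot> \<theta>\<^sup>\<dagger>"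
    by (simp add: compose_assoc)
  also have "\<dots> = \<theta>\<^sup>\<dagger>" by (simp add: conj_pair_adj[OF 2])
  finally show ?thesis using that[of \<tau>] a by (simp add: Z_def)
qed

end

section \<open>Semisimplicity\<close>

context tensor_star_category
begin

declare ide_in [simp] cmp_in [simp] str_in [simp] str_str [simp] ide_cmp [simp] cmp_ide [simp] str_ide [simp]

lemma Hom_zero [simp]: "\<rho> \<in> obj C \<Longrightarrow> \<sigma> \<in> obj C \<Longrightarrow> 0 \<in> Hom C \<rho> \<sigma>"
  and Hom_add [simp]: "\<rho> \<in> obj C \<Longrightarrow> \<sigma> \<in> obj C \<Longrightarrow> S \<in> Hom C \<rho> \<sigma> \<Longrightarrow> T \<in> Hom C \<rho> \<sigma> \<Longrightarrow> S + T \<in> Hom C \<rho> \<sigma>"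
  and Hom_diff [simp]: "\<rho> \<in> obj C \<Longrightarrow> \<sigma> \<in> obj C \<Longrightarrow> S \<in> Hom C \<rho> \<sigma> \<Longrightarrow> T \<in> Hom C \<rho> \<sigma> \<Longrightarrow> S - T \<in> Hom C \<rho> \<sigma>"
  and Hom_scale [simp]: "\<rho> \<in> obj C \<Longrightarrow> \<sigma> \<in> obj C \<Longrightarrow> S \<in> Hom C \<rho> \<sigma> \<Longrightarrow> c *\<^sub>C S \<in> Hom C \<rho> \<sigma>"
  and Hom_sum: "\<rho> \<in> obj C \<Longrightarrow> \<sigma> \<in> obj C \<Longrightarrow> (\<And>i. i \<in> I \<Longrightarrow> t i \<in> Hom C \<rho> \<sigma>) \<Longrightarrow> sum t I \<in> Hom C \<rho> \<sigma>"
  using Hom_subspace[of \<rho> \<sigma>]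
  by (auto intro: cvec.subspace_0 cvec.subspace_add cvec.subspace_diff cvec.subspace_scale cvec.subspace_sum)

lemma cmp_zero_left [simp]: "\<rho> \<in> obj C \<Longrightarrow> \<sigma> \<in> obj C \<Longrightarrow> \<tau> \<in> obj C \<Longrightarrow> T \<in> Hom C \<rho> \<sigma> \<Longrightarrow> cmp C \<rho> \<sigma> \<tau> 0 T = 0"
  using cmp_scale_left[of \<rho> \<sigma> \<tau> 0 T 0] by simp

lemma cmp_zero_right [simp]: "\<rho> \<in> obj C \<Longrightarrow> \<sigma> \<in> obj C \<Longrightarrow> \<tau> \<in> obj C \<Longrightarrow> S \<in> Hom C \<sigma> \<tau> \<Longrightarrow> cmp C \<rho> \<sigma> \<tau> S 0 = 0"
  using cmp_scale_right[of \<rho> \<sigma> \<tau> S 0 0] by simp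

lemma str_zero [simp]: "\<rho> \<in> obj C \<Longrightarrow> \<sigma> \<in> obj C \<Longrightarrow> str C \<rho> \<sigma> 0 = 0"
  using str_scale[of \<rho> \<sigma> 0 0] by simp

lemma cmp_diff_left:
  "\<lbrakk>\<rho> \<in> obj C; \<sigma> \<in> obj C; \<tau> \<in> obj C; S \<in> Hom C \<sigma> \<tau>; S' \<in> Hom C \<sigma> \<tau>; T \<in> Hom C \<rho> \<sigma>\<rbrakk>
    \<Longrightarrow> cmp C \<rho> \<sigma> \<tau> (S - S') T = cmp C \<rho> \<sigma> \<tau> S T - cmp C \<rho> \<sigma> \<tau> S' T"
  using cmp_add_left[of \<rho> \<sigma> \<tau> "S - S'" S' T] by (simp add: eq_diff_eq)

lemma cmp_diff_right:
  "\<lbrakk>\<rho> \<in> obj C; \<sigma> \<in> obj C; \<tau> \<in> obj C; S \<in> Hom C \<sigma> \<tau>; T \<in> Hom C \<rho> \<sigma>; T' \<in> Hom C \<rho> \<sigma>\<rbrakk>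
    \<Longrightarrow> cmp C \<rho> \<sigma> \<tau> S (T - T') = cmp C \<rho> \<sigma> \<tau> S T - cmp C \<rho> \<sigma> \<tau> S T'"
  using cmp_add_right[of \<rho> \<sigma> \<tau> S "T - T'" T'] by (simp add: eq_diff_eq)

lemma str_diff:
  "\<lbrakk>\<rho> \<in> obj C; \<sigma> \<in> obj C; S \<in> Hom C \<rho> \<sigma>; T \<in> Hom C \<rho> \<sigma>\<rbrakk> \<Longrightarrow> str C \<rho> \<sigma> (S - T) = str C \<rho> \<sigma> S - str C \<rho> \<sigma> T"
  using str_add[of \<rho> \<sigma> "S - T" T] by (simp add: eq_diff_eq)

lemma cmp_sum_left:
  assumes "\<rho> \<in> obj C" "\<sigma> \<in> obj C" "\<tau> \<in> obj C" "T \<in> Hom C \<rho> \<sigma>" "\<And>i. i \<in> I \<Longrightarrow> s i \<in> Hom C \<sigma> \<tau>"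
  shows "cmp C \<rho> \<sigma> \<tau> (sum s I) T = (\<Sum>i\<in>I. cmp C \<rho> \<sigma> \<tau> (s i) T)"
  using assms(5) by (induction I rule: infinite_finite_induct) (simp_all add: assms(1-4) cmp_add_left Hom_sum)

lemma cmp_sum_right:
  assumes "\<rho> \<in> obj C" "\<sigma> \<in> obj C" "\<tau> \<in> obj C" "S \<in> Hom C \<sigma> \<tau>" "\<And>i. i \<in> I \<Longrightarrow> t i \<in> Hom C \<rho> \<sigma>"
  shows "cmp C \<rho> \<sigma> \<tau> S (sum t I) = (\<Sum>i\<in>I. cmp C \<rho> \<sigma> \<tau> S (t i))"
  using assms(5) by (induction I rule: infinite_finite_induct) (simp_all add: assms(1-4) cmp_add_right Hom_sum)

lemma range_proj_in [simp]:
  "isometry C \<rho> \<sigma> V \<Longrightarrow> \<rho> \<in> obj C \<Longrightarrow> \<sigma> \<in> obj C \<Longrightarrow> range_proj C \<rho> \<sigma> V \<in> Hom C \<sigma> \<sigma>"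
  by (simp add: range_proj_def isometry_def)

lemma isometryD: "isometry C \<rho> \<sigma> V \<Longrightarrow> V \<in> Hom C \<rho> \<sigma>" "isometry C \<rho> \<sigma> V \<Longrightarrow> cmp C \<rho> \<sigma> \<rho> (str C \<rho> \<sigma> V) V = ide C \<rho>"
  by (simp_all add: isometry_def)

lemma equivalent_obj_sym:
  assumes "equivalent_obj C \<rho> \<sigma>" "\<rho> \<in> obj C" "\<sigma> \<in> obj C"
  shows "equivalent_obj C \<sigma> \<rho>"
proof -
  obtain V where "isometry C \<rho> \<sigma> V" "range_proj C \<rho> \<sigma> V = ide C \<sigma>"
    using assms(1) by (auto simp: equivalent_obj_def)
  then have "isometry C \<sigma> \<rho> (str C \<rho> \<sigma> V) \<and> range_proj C \<sigma> \<rho> (str C \<rho> \<sigma> V) = ide C \<rho>"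
    using assms by (simp add: isometry_def range_proj_def)
  then show ?thesis unfolding equivalent_obj_def by blast
qed

lemma equivalent_obj_trans:
  assumes "equivalent_obj C \<rho> \<sigma>" "equivalent_obj C \<sigma> \<tau>" "\<rho> \<in> obj C" "\<sigma> \<in> obj C" "\<tau> \<in> obj C"
  shows "equivalent_obj C \<rho> \<tau>"
proof -
  obtain V where V: "V \<in> Hom C \<rho> \<sigma>" "cmp C \<rho> \<sigma> \<rho> (str C \<rho> \<sigma> V) V = ide C \<rho>" "cmp C \<sigma> \<rho> \<sigma> V (str C \<rho> \<sigma> V) = ide C \<sigma>"
    using assms(1) by (auto simp: equivalent_obj_def isometry_def range_proj_def)
  obtain W where W: "W \<in> Hom C \<sigma> \<tau>" "cmp C \<sigma> \<tau> \<sigma> (str C \<sigma> \<tau> W) W = ide C \<sigma>" "cmp C \<tau> \<sigma> \<tau> W (str C \<sigma> \<tau> W) = ide C \<tau>"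
    using assms(2) by (auto simp: equivalent_obj_def isometry_def range_proj_def)
  let ?V = "Arr \<rho> \<sigma> V" and ?W = "Arr \<sigma> \<tau> W"
  have aV: "arr ?V" "?V\<^sup>\<dagger> \<cdot> ?V = idt \<rho>" "?V \<cdot> ?V\<^sup>\<dagger> = idt \<sigma>" using V assms by (simp_all add: compose_def adj_def idt_def)
  have aW: "arr ?W" "?W\<^sup>\<dagger> \<cdot> ?W = idt \<sigma>" "?W \<cdot> ?W\<^sup>\<dagger> = idt \<tau>" using W assms by (simp_all add: compose_def adj_def idt_def)
  have "(?W \<cdot> ?V)\<^sup>\<dagger> \<cdot> (?W \<cdot> ?V) = ?V\<^sup>\<dagger> \<cdot> ((?W\<^sup>\<dagger> \<cdot> ?W) \<cdot> ?V)"
    using aV(1) aW(1) by (simp add: adj_compose compose_assoc)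
  also have "\<dots> = idt \<rho>" using aV aW by simp
  finally have 1: "(?W \<cdot> ?V)\<^sup>\<dagger> \<cdot> (?W \<cdot> ?V) = idt \<rho>" .
  have "(?W \<cdot> ?V) \<cdot> (?W \<cdot> ?V)\<^sup>\<dagger> = ?W \<cdot> ((?V \<cdot> ?V\<^sup>\<dagger>) \<cdot> ?W\<^sup>\<dagger>)"
    using aV(1) aW(1) by (simp add: adj_compose compose_assoc)
  also have "\<dots> = idt \<tau>" using aV aW by simp
  finally have 2: "(?W \<cdot> ?V) \<cdot> (?W \<cdot> ?V)\<^sup>\<dagger> = idt \<tau>" .
  have "isometry C \<rho> \<tau> (cmp C \<rho> \<sigma> \<tau> W V) \<and> range_proj C \<rho> \<tau> (cmp C \<rho> \<sigma> \<tau> W V) = ide C \<tau>"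
    using arg_cong[OF 1, of und] arg_cong[OF 2, of und] V(1) W(1) assms
    by (simp add: isometry_def range_proj_def und_simps)
  then show ?thesis unfolding equivalent_obj_def by blast
qed

lemma irreducible_objD: "irreducible_obj C \<rho> \<Longrightarrow> \<rho> \<in> obj C" "irreducible_obj C \<rho> \<Longrightarrow> ide C \<rho> \<noteq> 0"
  "irreducible_obj C \<rho> \<Longrightarrow> T \<in> Hom C \<rho> \<rho> \<Longrightarrow> \<exists>c. T = c *\<^sub>C ide C \<rho>"
  by (auto simp: irreducible_obj_def)

end

context TC_star
begin

text \<open>
  The positivity axiom speaks of a single \<open>T\<^sup>*T\<close>. Direct sums extend it to sums of such terms:
  \<open>Y\<^sup>*Y + Z\<^sup>*Z\<close> is again of the form \<open>T\<^sup>*T\<close>.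
\<close>

lemma add_squares:
  assumes \<rho>: "\<rho> \<in> obj C" and 1: "\<sigma>1 \<in> obj C" "Y \<in> Hom C \<rho> \<sigma>1" and 2: "\<sigma>2 \<in> obj C" "Z \<in> Hom C \<rho> \<sigma>2"
  shows "\<exists>\<tau>\<in>obj C. \<exists>T\<in>Hom C \<rho> \<tau>. cmp C \<rho> \<tau> \<rho> (str C \<rho> \<tau> T) T
      = cmp C \<rho> \<sigma>1 \<rho> (str C \<rho> \<sigma>1 Y) Y + cmp C \<rho> \<sigma>2 \<rho> (str C \<rho> \<sigma>2 Z) Z
    \<and> (T = 0 \<longrightarrow> Y = 0 \<and> Z = 0)"
proof -
  obtain \<tau> V W where \<tau>: "\<tau> \<in> obj C" and V: "isometry C \<sigma>1 \<tau> V" and W: "isometry C \<sigma>2 \<tau> W"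
    and sum: "range_proj C \<sigma>1 \<tau> V + range_proj C \<sigma>2 \<tau> W = ide C \<tau>"
    using direct_sums[OF 1(1) 2(1)] by blast
  note [simp] = \<rho> 1 2 \<tau> isometryD[OF V] isometryD[OF W]
  define X where "X = cmp C \<sigma>2 \<tau> \<sigma>1 (str C \<sigma>1 \<tau> V) W"
  have X [simp]: "X \<in> Hom C \<sigma>2 \<sigma>1" by (simp add: X_def)
  have "W = cmp C \<sigma>2 \<tau> \<tau> (range_proj C \<sigma>1 \<tau> V + range_proj C \<sigma>2 \<tau> W) W" unfolding sum by simp
  also have "\<dots> = cmp C \<sigma>2 \<sigma>1 \<tau> V X + W"
    by (simp add: range_proj_def X_def cmp_add_left cmp_assoc)
  finally have "cmp C \<sigma>2 \<sigma>1 \<tau> V X = 0" by simp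
  then have "cmp C \<sigma>2 \<tau> \<sigma>1 (str C \<sigma>1 \<tau> V) (cmp C \<sigma>2 \<sigma>1 \<tau> V X) = 0" by simp
  then have X0: "X = 0" by (simp flip: cmp_assoc)
  have VW: "cmp C \<sigma>2 \<tau> \<sigma>1 (str C \<sigma>1 \<tau> V) W = 0" using X0 by (simp add: X_def)
  have WV: "cmp C \<sigma>1 \<tau> \<sigma>2 (str C \<sigma>2 \<tau> W) V = 0"
    using arg_cong[OF VW, of "str C \<sigma>2 \<sigma>1"] by (simp add: str_cmp)
  define T where "T = cmp C \<rho> \<sigma>1 \<tau> V Y + cmp C \<rho> \<sigma>2 \<tau> W Z"
  have T [simp]: "T \<in> Hom C \<rho> \<tau>" by (simp add: T_def)
  have VT: "cmp C \<rho> \<tau> \<sigma>1 (str C \<sigma>1 \<tau> V) T = Y"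
    by (simp add: T_def cmp_add_right VW flip: cmp_assoc)
  have WT: "cmp C \<rho> \<tau> \<sigma>2 (str C \<sigma>2 \<tau> W) T = Z"
    by (simp add: T_def cmp_add_right WV flip: cmp_assoc)
  have "str C \<rho> \<tau> T = cmp C \<tau> \<sigma>1 \<rho> (str C \<rho> \<sigma>1 Y) (str C \<sigma>1 \<tau> V) + cmp C \<tau> \<sigma>2 \<rho> (str C \<rho> \<sigma>2 Z) (str C \<sigma>2 \<tau> W)"
    by (simp add: T_def str_add str_cmp)
  then have "cmp C \<rho> \<tau> \<rho> (str C \<rho> \<tau> T) T
      = cmp C \<rho> \<sigma>1 \<rho> (str C \<rho> \<sigma>1 Y) Y + cmp C \<rho> \<sigma>2 \<rho> (str C \<rho> \<sigma>2 Z) Z"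
    by (simp add: cmp_add_left cmp_assoc VT WT)
  moreover have "T = 0 \<longrightarrow> Y = 0 \<and> Z = 0" using VT WT by auto
  ultimately show ?thesis using \<tau> T by blast
qed

lemma sum_of_squares:
  assumes "finite I" "\<rho> \<in> obj C" "\<And>i. i \<in> I \<Longrightarrow> s i \<in> obj C" "\<And>i. i \<in> I \<Longrightarrow> Y i \<in> Hom C \<rho> (s i)"
  shows "\<exists>\<tau>\<in>obj C. \<exists>T\<in>Hom C \<rho> \<tau>. cmp C \<rho> \<tau> \<rho> (str C \<rho> \<tau> T) T = (\<Sum>i\<in>I. cmp C \<rho> (s i) \<rho> (str C \<rho> (s i) (Y i)) (Y i))
    \<and> (T = 0 \<longrightarrow> (\<forall>i\<in>I. Y i = 0))"
  using assms
proof (induction I rule: finite_induct)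
  case empty
  then show ?case by (intro bexI[of _ \<rho>] bexI[of _ 0]) auto
next
  case (insert j I)
  obtain \<tau> T where T: "\<tau> \<in> obj C" "T \<in> Hom C \<rho> \<tau>"
    "cmp C \<rho> \<tau> \<rho> (str C \<rho> \<tau> T) T = (\<Sum>i\<in>I. cmp C \<rho> (s i) \<rho> (str C \<rho> (s i) (Y i)) (Y i))" "T = 0 \<longrightarrow> (\<forall>i\<in>I. Y i = 0)"
    using insert.IH insert.prems by auto
  obtain \<tau>' T' where T': "\<tau>' \<in> obj C" "T' \<in> Hom C \<rho> \<tau>'"
    "cmp C \<rho> \<tau>' \<rho> (str C \<rho> \<tau>' T') T' = cmp C \<rho> (s j) \<rho> (str C \<rho> (s j) (Y j)) (Y j) + cmp C \<rho> \<tau> \<rho> (str C \<rho> \<tau> T) T"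
    "T' = 0 \<longrightarrow> Y j = 0 \<and> T = 0"
    using add_squares[of \<rho> "s j" "Y j" \<tau> T] insert.prems T(1,2) by auto
  show ?case
    using T T' insert.hyps by (intro bexI[OF _ T'(1)] bexI[OF _ T'(2)]) auto
qed

lemma sum_of_squares_zero:
  assumes "finite I" "\<rho> \<in> obj C" "\<And>i. i \<in> I \<Longrightarrow> s i \<in> obj C" "\<And>i. i \<in> I \<Longrightarrow> Y i \<in> Hom C \<rho> (s i)"
    and "(\<Sum>i\<in>I. cmp C \<rho> (s i) \<rho> (str C \<rho> (s i) (Y i)) (Y i)) = 0" and "i \<in> I"
  shows "Y i = 0"
proof -
  obtain \<tau> T where T: "\<tau> \<in> obj C" "T \<in> Hom C \<rho> \<tau>" "cmp C \<rho> \<tau> \<rho> (str C \<rho> \<tau> T) T = 0" "T = 0 \<longrightarrow> (\<forall>i\<in>I. Y i = 0)"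
    using sum_of_squares[OF assms(1,2), of s Y] assms(3-5) by auto
  have "T = 0" by (rule str_pos[OF assms(2) T(1-3)])
  then show ?thesis using T(4) assms(6) by blast
qed

text \<open>
  The scalar is real because \<open>T\<^sup>*T\<close> is selfadjoint. Were it not positive, a direct sum of \<open>T\<close> with a
  multiple of the identity would contradict positivity.
\<close>

lemma scalar_square_pos:
  assumes \<rho>: "\<rho> \<in> obj C" "ide C \<rho> \<noteq> 0" and T: "\<sigma> \<in> obj C" "T \<in> Hom C \<rho> \<sigma>" "T \<noteq> 0"
    and c: "cmp C \<rho> \<sigma> \<rho> (str C \<rho> \<sigma> T) T = c *\<^sub>C ide C \<rho>"
  shows "\<exists>r>0. c = complex_of_real r"
proof -
  note [simp] = \<rho>(1) T(1,2)
  have "c *\<^sub>C ide C \<rho> = cnj c *\<^sub>C ide C \<rho>"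
  proof -
    have "str C \<rho> \<rho> (cmp C \<rho> \<sigma> \<rho> (str C \<rho> \<sigma> T) T) = cmp C \<rho> \<sigma> \<rho> (str C \<rho> \<sigma> T) T" by (simp add: str_cmp)
    then show ?thesis unfolding c by (simp only: str_scale[OF \<rho>(1) \<rho>(1) ide_in[OF \<rho>(1)]] str_ide[OF \<rho>(1)])
  qed
  then have "cnj c = c" using \<rho>(2) cvec.scale_right_imp_eq by metis
  then obtain r where r: "c = complex_of_real r"
    by (metis Reals_cases Reals_cnj_iff)
  have "r > 0"
  proof (rule ccontr)
    assume "\<not> r > 0"
    define Z where "Z = complex_of_real (sqrt (- r)) *\<^sub>C ide C \<rho>"
    have Z [simp]: "Z \<in> Hom C \<rho> \<rho>" by (simp add: Z_def)
    have "cmp C \<rho> \<rho> \<rho> (str C \<rho> \<rho> Z) Z = complex_of_real (- r) *\<^sub>C ide C \<rho>"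
      using \<open>\<not> r > 0\<close>
      by (simp add: Z_def str_scale cmp_scale_left cmp_scale_right scaleC_scaleC flip: of_real_mult)
    then have "cmp C \<rho> \<sigma> \<rho> (str C \<rho> \<sigma> T) T + cmp C \<rho> \<rho> \<rho> (str C \<rho> \<rho> Z) Z = 0"
      by (simp add: c r)
    then show False using add_squares[of \<rho> \<sigma> T \<rho> Z] T(3) str_pos by (metis T(1,2) Z \<rho>(1))
  qed
  then show ?thesis using r by blast
qed

text \<open>
  Schur's lemma: \<open>T\<^sup>*T\<close> and \<open>TT\<^sup>*\<close> are scalars, and by positivity of the first a nonzero \<open>T\<close> can be
  normalized to a unitary.
\<close>

lemma schur_equivalent:
  assumes \<rho>: "irreducible_obj C \<rho>" and \<sigma>: "irreducible_obj C \<sigma>" and T: "T \<in> Hom C \<rho> \<sigma>" "T \<noteq> 0"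
  shows "equivalent_obj C \<rho> \<sigma>"
proof -
  note [simp] = irreducible_objD(1)[OF \<rho>] irreducible_objD(1)[OF \<sigma>] T(1)
  obtain c where c: "cmp C \<rho> \<sigma> \<rho> (str C \<rho> \<sigma> T) T = c *\<^sub>C ide C \<rho>"
    using irreducible_objD(3)[OF \<rho>, of "cmp C \<rho> \<sigma> \<rho> (str C \<rho> \<sigma> T) T"] by auto
  obtain r where r: "r > 0" "c = complex_of_real r"
    using scalar_square_pos[OF _ irreducible_objD(2)[OF \<rho>] _ T c] by auto
  define V where "V = complex_of_real (1 / sqrt r) *\<^sub>C T"
  have V [simp]: "V \<in> Hom C \<rho> \<sigma>" by (simp add: V_def)
  have iso: "cmp C \<rho> \<sigma> \<rho> (str C \<rho> \<sigma> V) V = ide C \<rho>"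
    using r by (simp add: V_def str_scale cmp_scale_left cmp_scale_right scaleC_scaleC c scaleC_one
        flip: of_real_mult of_real_divide)
  obtain d where d: "cmp C \<sigma> \<rho> \<sigma> V (str C \<rho> \<sigma> V) = d *\<^sub>C ide C \<sigma>"
    using irreducible_objD(3)[OF \<sigma>, of "cmp C \<sigma> \<rho> \<sigma> V (str C \<rho> \<sigma> V)"] by auto
  have "V = cmp C \<rho> \<sigma> \<sigma> (cmp C \<sigma> \<rho> \<sigma> V (str C \<rho> \<sigma> V)) V" by (simp add: cmp_assoc iso)
  also have "\<dots> = d *\<^sub>C V" by (simp add: d cmp_scale_left)
  finally have "1 *\<^sub>C V = d *\<^sub>C V" by (simp add: scaleC_one)
  moreover have "V \<noteq> 0" using r T by (simp add: V_def)
  ultimately have "d = 1" by (metis cvec.scale_right_imp_eq)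
  then show ?thesis
    using V iso d unfolding equivalent_obj_def isometry_def range_proj_def by (intro exI[of _ V]) (simp add: scaleC_one)
qed

text \<open>
  Every projection is an orthogonal sum of projections onto irreducible subobjects: split off a
  minimal projection of the corner \<open>E Hom(\<rho>,\<rho>) E\<close> and continue in the smaller corner of the rest.
\<close>

lemma projection_decomposition:
  assumes "\<rho> \<in> obj C" "E \<in> Hom C \<rho> \<rho>" "cmp C \<rho> \<rho> \<rho> E E = E" "str C \<rho> \<rho> E = E"
  shows "\<exists>(n::nat) r W. (\<forall>i<n. irreducible_obj C (r i) \<and> isometry C (r i) \<rho> (W i)) \<and>
    (\<Sum>i<n. range_proj C (r i) \<rho> (W i)) = E"
  using assms(2-)
proof (induction "cvec.dim {X \<in> Hom C \<rho> \<rho>. cmp C \<rho> \<rho> \<rho> E X = X \<and> cmp C \<rho> \<rho> \<rho> X E = X}" arbitrary: E rule: less_induct)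
  case (less E)
  note [simp] = assms(1) less.prems
  \<comment> \<open>The corner \<open>E Hom(\<rho>,\<rho>) E\<close>, whose dimension decreases in the induction.\<close>
  define K where "K E = {X \<in> Hom C \<rho> \<rho>. cmp C \<rho> \<rho> \<rho> E X = X \<and> cmp C \<rho> \<rho> \<rho> X E = X}" for E
  have sK: "cvec.subspace (K E)" if "E \<in> Hom C \<rho> \<rho>" for E
    using that by (intro cvec.subspaceI)
      (auto simp: K_def cmp_add_left cmp_add_right cmp_scale_left cmp_scale_right)
  have fK: "finite_dim (K E)"
    by (rule finite_dim_subset[OF finite_dim_Hom[of \<rho> \<rho>] sK]) (auto simp: K_def)
  show ?case
  proof (cases "E = 0")
    case True
    then show ?thesis by (intro exI[of _ 0]) auto
  next
    case False
    have str_K: "str C \<rho> \<rho> X \<in> K E" if "X \<in> K E" for X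
    proof -
      have X: "X \<in> Hom C \<rho> \<rho>" "cmp C \<rho> \<rho> \<rho> E X = X" "cmp C \<rho> \<rho> \<rho> X E = X" using that by (auto simp: K_def)
      show ?thesis
        using X(1) arg_cong[OF X(2), of "str C \<rho> \<rho>"] arg_cong[OF X(3), of "str C \<rho> \<rho>"]
        by (simp add: K_def str_cmp)
    qed
    have "\<exists>e\<in>K E. e \<noteq> 0 \<and> cmp C \<rho> \<rho> \<rho> e e = e \<and> str C \<rho> \<rho> e = e \<and> (\<forall>x\<in>K E. \<exists>c. cmp C \<rho> \<rho> \<rho> e (cmp C \<rho> \<rho> \<rho> x e) = c *\<^sub>C e)"
    proof (rule minimal_projection_exists[OF fK, where a = E and mul = "cmp C \<rho> \<rho> \<rho>"])
      show "cmp C \<rho> \<rho> \<rho> x y \<in> K E" if "x \<in> K E" "y \<in> K E" for x y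
      proof -
        have x: "x \<in> Hom C \<rho> \<rho>" "cmp C \<rho> \<rho> \<rho> E x = x" and y: "y \<in> Hom C \<rho> \<rho>" "cmp C \<rho> \<rho> \<rho> y E = y"
          using that by (auto simp: K_def)
        have "cmp C \<rho> \<rho> \<rho> E (cmp C \<rho> \<rho> \<rho> x y) = cmp C \<rho> \<rho> \<rho> x y"
          using x y by (simp flip: cmp_assoc)
        then show ?thesis using x y by (simp add: K_def cmp_assoc)
      qed
      show "\<And>x. x \<in> K E \<Longrightarrow> cmp C \<rho> \<rho> \<rho> (str C \<rho> \<rho> x) x = 0 \<Longrightarrow> x = 0"
        by (rule str_pos[of \<rho> \<rho>]) (auto simp: K_def)
      show "\<And>x. x \<in> K E \<Longrightarrow> str C \<rho> \<rho> x \<in> K E" by (rule str_K)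
    qed (use False in \<open>auto simp: K_def cmp_assoc cmp_add_left cmp_add_right cmp_scale_left
        cmp_scale_right str_scale str_cmp\<close>)
    then obtain e where eK: "e \<in> K E" and e0: "e \<noteq> 0" and ee: "cmp C \<rho> \<rho> \<rho> e e = e" and es: "str C \<rho> \<rho> e = e"
      and min: "\<And>x. x \<in> K E \<Longrightarrow> \<exists>c. cmp C \<rho> \<rho> \<rho> e (cmp C \<rho> \<rho> \<rho> x e) = c *\<^sub>C e" by blast
    have e [simp]: "e \<in> Hom C \<rho> \<rho>" "cmp C \<rho> \<rho> \<rho> E e = e" "cmp C \<rho> \<rho> \<rho> e E = e" using eK by (auto simp: K_def)
    note [simp] = ee es
    obtain \<sigma> V where \<sigma> [simp]: "\<sigma> \<in> obj C" and V: "isometry C \<sigma> \<rho> V" "range_proj C \<sigma> \<rho> V = e"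
      using subobjects[of \<rho> e] by auto
    note V' [simp] = isometryD[OF V(1)]
    have VV: "cmp C \<rho> \<sigma> \<rho> V (str C \<sigma> \<rho> V) = e" using V(2) by (simp add: range_proj_def)
    have eV: "cmp C \<sigma> \<rho> \<rho> e V = V" by (simp add: cmp_assoc flip: VV)
    have Ve: "cmp C \<rho> \<rho> \<sigma> (str C \<sigma> \<rho> V) e = str C \<sigma> \<rho> V" by (simp flip: VV cmp_assoc)
    have irr: "irreducible_obj C \<sigma>"
    proof -
      have "ide C \<sigma> \<noteq> 0"
      proof
        assume 0: "ide C \<sigma> = 0"
        have "V = cmp C \<sigma> \<sigma> \<rho> V (ide C \<sigma>)" by simp
        then have "V = 0" unfolding 0 by simp
        then show False using VV e0 by simp
      qed
      moreover have "\<exists>c. X = c *\<^sub>C ide C \<sigma>" if X [simp]: "X \<in> Hom C \<sigma> \<sigma>" for X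
      proof -
        define Y where "Y = cmp C \<rho> \<sigma> \<rho> V (cmp C \<rho> \<sigma> \<sigma> X (str C \<sigma> \<rho> V))"
        have Y [simp]: "Y \<in> Hom C \<rho> \<rho>" by (simp add: Y_def)
        have "cmp C \<rho> \<rho> \<rho> e Y = Y"
          unfolding Y_def by (subst cmp_assoc[symmetric]) (simp_all add: eV)
        moreover have "cmp C \<rho> \<rho> \<rho> Y e = Y"
          unfolding Y_def by (simp add: cmp_assoc Ve)
        ultimately have eYe: "cmp C \<rho> \<rho> \<rho> e (cmp C \<rho> \<rho> \<rho> Y e) = Y" by simp
        have "cmp C \<rho> \<rho> \<rho> E Y = Y"
          using \<open>cmp C \<rho> \<rho> \<rho> e Y = Y\<close> cmp_assoc[of \<rho> \<rho> \<rho> \<rho> E e Y] by simp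
        moreover have "cmp C \<rho> \<rho> \<rho> Y E = Y"
          using \<open>cmp C \<rho> \<rho> \<rho> Y e = Y\<close> cmp_assoc[of \<rho> \<rho> \<rho> \<rho> Y e E] by simp
        ultimately have "Y \<in> K E" by (simp add: K_def)
        then obtain c where c: "Y = c *\<^sub>C e" using min eYe by metis
        have "X = cmp C \<sigma> \<rho> \<sigma> (str C \<sigma> \<rho> V) (cmp C \<sigma> \<rho> \<rho> Y V)"
        proof -
          have "cmp C \<sigma> \<rho> \<rho> Y V = cmp C \<sigma> \<sigma> \<rho> V X" by (simp add: Y_def cmp_assoc)
          then show ?thesis by (simp flip: cmp_assoc)
        qed
        also have "\<dots> = c *\<^sub>C ide C \<sigma>"
          by (simp add: c cmp_scale_left cmp_scale_right eV)
        finally show ?thesis by blast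
      qed
      ultimately show ?thesis by (auto simp: irreducible_obj_def)
    qed
    define E' where "E' = E - e"
    have E' [simp]: "E' \<in> Hom C \<rho> \<rho>" "cmp C \<rho> \<rho> \<rho> E' E' = E'" "str C \<rho> \<rho> E' = E'"
      by (simp_all add: E'_def cmp_diff_left cmp_diff_right str_diff)
    have "K E' \<subseteq> K E"
    proof
      fix X assume "X \<in> K E'"
      then have X: "X \<in> Hom C \<rho> \<rho>" "cmp C \<rho> \<rho> \<rho> E' X = X" "cmp C \<rho> \<rho> \<rho> X E' = X" by (auto simp: K_def)
      have EE': "cmp C \<rho> \<rho> \<rho> E E' = E'" "cmp C \<rho> \<rho> \<rho> E' E = E'"
        by (simp_all add: E'_def cmp_diff_left cmp_diff_right)
      have "cmp C \<rho> \<rho> \<rho> E X = X" using cmp_assoc[of \<rho> \<rho> \<rho> \<rho> E E' X] X EE' by simp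
      moreover have "cmp C \<rho> \<rho> \<rho> X E = X" using cmp_assoc[of \<rho> \<rho> \<rho> \<rho> X E' E] X EE' by simp
      ultimately show "X \<in> K E" using X by (simp add: K_def)
    qed
    moreover have "e \<notin> K E'"
      using e0 by (simp add: K_def E'_def cmp_diff_left)
    ultimately have "K E' \<subset> K E" using eK by blast
    then have "cvec.dim (K E') < cvec.dim (K E)"
      by (intro dim_strict_mono_subspace[OF fK sK]) auto
    then obtain n :: nat and r W where IH: "\<And>i. i < n \<Longrightarrow> irreducible_obj C (r i) \<and> isometry C (r i) \<rho> (W i)"
      "(\<Sum>i<n. range_proj C (r i) \<rho> (W i)) = E'"
      using less.hyps[of E'] by (auto simp: K_def)
    define r' where "r' = r(n := \<sigma>)"
    define W' where "W' = W(n := V)"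
    have "(\<Sum>i<Suc n. range_proj C (r' i) \<rho> (W' i)) = (\<Sum>i<n. range_proj C (r i) \<rho> (W i)) + e"
      by (simp add: r'_def W'_def V(2))
    then have "(\<Sum>i<Suc n. range_proj C (r' i) \<rho> (W' i)) = E" by (simp add: IH(2) E'_def)
    moreover have "\<forall>i<Suc n. irreducible_obj C (r' i) \<and> isometry C (r' i) \<rho> (W' i)"
      using IH(1) irr V(1) by (auto simp: r'_def W'_def less_Suc_eq)
    ultimately show ?thesis by blast
  qed
qed

lemma decomposition:
  assumes "\<rho> \<in> obj C"
  obtains n :: nat and r W where "\<And>i. i < n \<Longrightarrow> irreducible_obj C (r i)" "\<And>i. i < n \<Longrightarrow> isometry C (r i) \<rho> (W i)"
    "(\<Sum>i<n. range_proj C (r i) \<rho> (W i)) = ide C \<rho>"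
  using projection_decomposition[OF assms, of "ide C \<rho>"] assms by auto

end

section \<open>Degenerate objects\<close>

context BTC_star
begin

definition brd :: "'o \<Rightarrow> 'o \<Rightarrow> ('o, 'a) arrow"
  where "brd \<rho> \<sigma> = Arr (\<rho> \<odot> \<sigma>) (\<sigma> \<odot> \<rho>) (\<epsilon> \<rho> \<sigma>)"

lemma brd_simps [simp]:
  "src (brd \<rho> \<sigma>) = \<rho> \<odot> \<sigma>" "tgt (brd \<rho> \<sigma>) = \<sigma> \<odot> \<rho>" "\<rho> \<in> obj C \<Longrightarrow> \<sigma> \<in> obj C \<Longrightarrow> arr (brd \<rho> \<sigma>)"
  by (simp_all add: brd_def braid_in)

lemma brd_natural:
  "arr f \<Longrightarrow> arr g \<Longrightarrow> src f = \<rho>1 \<Longrightarrow> tgt f = \<sigma>1 \<Longrightarrow> src g = \<rho>2 \<Longrightarrow> tgt g = \<sigma>2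
    \<Longrightarrow> brd \<sigma>1 \<sigma>2 \<cdot> (f \<boxtimes> g) = (g \<boxtimes> f) \<cdot> brd \<rho>1 \<rho>2"
  by (cases f; cases g) (simp add: compose_def tensor_def brd_def braid_natural)

lemma brd_hexagon1:
  "\<rho> \<in> obj C \<Longrightarrow> \<sigma> \<in> obj C \<Longrightarrow> \<tau> \<in> obj C \<Longrightarrow> brd (\<rho> \<odot> \<sigma>) \<tau> = (brd \<rho> \<tau> \<boxtimes> idt \<sigma>) \<cdot> (idt \<rho> \<boxtimes> brd \<sigma> \<tau>)"
  by (simp add: compose_def tensor_def brd_def idt_def hexagon1)

lemma brd_hexagon2:
  "\<rho> \<in> obj C \<Longrightarrow> \<sigma> \<in> obj C \<Longrightarrow> \<tau> \<in> obj C \<Longrightarrow> brd \<rho> (\<sigma> \<odot> \<tau>) = (idt \<sigma> \<boxtimes> brd \<rho> \<tau>) \<cdot> (brd \<rho> \<sigma> \<boxtimes> idt \<tau>)"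
  by (simp add: compose_def tensor_def brd_def idt_def hexagon2)

lemma brd_unitary:
  "\<rho> \<in> obj C \<Longrightarrow> \<sigma> \<in> obj C \<Longrightarrow> (brd \<rho> \<sigma>)\<^sup>\<dagger> \<cdot> brd \<rho> \<sigma> = idt (\<rho> \<odot> \<sigma>)"
  by (simp add: compose_def adj_def brd_def idt_def braid_unitary1)

text \<open>
  The hexagons for \<open>\<iota> = \<iota>\<iota>\<close> make the braiding with the unit idempotent, and a unitary idempotent is
  an identity.
\<close>

lemma brd_unit:
  assumes [simp]: "\<eta> \<in> obj C"
  shows "brd \<iota> \<eta> = idt \<eta>" "brd \<eta> \<iota> = idt \<eta>"
proof -
  have *: "f = idt \<eta>" if f: "arr f" "src f = \<eta>" "tgt f = \<eta>" "f\<^sup>\<dagger> \<cdot> f = idt \<eta>" "f = f \<cdot> f" for f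
  proof -
    have "idt \<eta> = f\<^sup>\<dagger> \<cdot> (f \<cdot> f)" using f by metis
    also have "\<dots> = (f\<^sup>\<dagger> \<cdot> f) \<cdot> f" using f(1-3) by (simp add: compose_assoc)
    finally show ?thesis using f by simp
  qed
  show "brd \<iota> \<eta> = idt \<eta>"
    by (rule *) (use brd_hexagon1[of \<iota> \<iota> \<eta>] brd_unitary[of \<iota> \<eta>] in simp_all)
  show "brd \<eta> \<iota> = idt \<eta>"
    by (rule *) (use brd_hexagon2[of \<eta> \<iota> \<iota>] brd_unitary[of \<eta> \<iota>] in simp_all)
qed

lemma degenerate_brd:
  "\<rho> \<in> obj C \<Longrightarrow> degenerate C \<rho> \<longleftrightarrow> (\<forall>\<eta>\<in>obj C. brd \<eta> \<rho> \<cdot> brd \<rho> \<eta> = idt (\<rho> \<odot> \<eta>))"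
  by (simp add: degenerate_def compose_def brd_def idt_def)

lemma degenerate_unit: "degenerate C \<iota>"
  by (simp add: degenerate_brd brd_unit)

text \<open>
  By the hexagons the monodromy of \<open>\<rho>\<sigma>\<close> with \<open>\<eta>\<close> is that of \<open>\<rho>\<close> enclosed in that of \<open>\<sigma>\<close>.
\<close>

lemma degenerate_product:
  assumes "\<rho> \<in> obj C" "\<sigma> \<in> obj C" "degenerate C \<rho>" "degenerate C \<sigma>"
  shows "degenerate C (\<rho> \<odot> \<sigma>)"
proof -
  have "brd \<eta> (\<rho> \<odot> \<sigma>) \<cdot> brd (\<rho> \<odot> \<sigma>) \<eta> = idt ((\<rho> \<odot> \<sigma>) \<odot> \<eta>)" if "\<eta> \<in> obj C" for \<eta>
  proof -
    note [simp] = assms(1,2) that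
    have \<rho>: "brd \<eta> \<rho> \<cdot> brd \<rho> \<eta> = idt (\<rho> \<odot> \<eta>)" and \<sigma>: "brd \<eta> \<sigma> \<cdot> brd \<sigma> \<eta> = idt (\<sigma> \<odot> \<eta>)"
      using assms by (simp_all add: degenerate_brd)
    have "brd \<eta> (\<rho> \<odot> \<sigma>) \<cdot> brd (\<rho> \<odot> \<sigma>) \<eta>
      = (idt \<rho> \<boxtimes> brd \<eta> \<sigma>) \<cdot> (((brd \<eta> \<rho> \<cdot> brd \<rho> \<eta>) \<boxtimes> idt \<sigma>) \<cdot> (idt \<rho> \<boxtimes> brd \<sigma> \<eta>))"
      by (simp add: brd_hexagon1 brd_hexagon2 whisker_right compose_assoc)
    also have "\<dots> = idt \<rho> \<boxtimes> (brd \<eta> \<sigma> \<cdot> brd \<sigma> \<eta>)" by (simp add: \<rho> whisker_left idt_tensor)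
    finally show ?thesis by (simp add: \<sigma> idt_tensor)
  qed
  then show ?thesis using assms(1,2) by (simp add: degenerate_brd)
qed

text \<open>
  Since the monodromy \<open>\<epsilon>(\<eta>,\<rho>) \<circ> \<epsilon>(\<rho>,\<eta>)\<close> is natural in \<open>\<rho>\<close>, its triviality passes to subobjects and
  to direct sums.
\<close>

lemma monodromy_natural:
  assumes f: "arr f" "src f = \<rho>" "tgt f = \<sigma>" and "\<eta> \<in> obj C"
  shows "(brd \<eta> \<sigma> \<cdot> brd \<sigma> \<eta>) \<cdot> (f \<boxtimes> idt \<eta>) = (f \<boxtimes> idt \<eta>) \<cdot> (brd \<eta> \<rho> \<cdot> brd \<rho> \<eta>)"
proof -
  note [simp] = f assms(4) arr_obj(1)[OF f(1), unfolded f(2)] arr_obj(2)[OF f(1), unfolded f(3)]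
  have "(brd \<eta> \<sigma> \<cdot> brd \<sigma> \<eta>) \<cdot> (f \<boxtimes> idt \<eta>) = brd \<eta> \<sigma> \<cdot> (brd \<sigma> \<eta> \<cdot> (f \<boxtimes> idt \<eta>))"
    by (simp add: compose_assoc)
  also have "\<dots> = (brd \<eta> \<sigma> \<cdot> (idt \<eta> \<boxtimes> f)) \<cdot> brd \<rho> \<eta>"
    by (simp add: brd_natural[of f _ \<rho> \<sigma> \<eta> \<eta>] compose_assoc)
  also have "\<dots> = (f \<boxtimes> idt \<eta>) \<cdot> (brd \<eta> \<rho> \<cdot> brd \<rho> \<eta>)"
    by (simp add: brd_natural[of _ f \<eta> \<eta> \<rho> \<sigma>] compose_assoc)
  finally show ?thesis .
qed

lemma degenerate_subobject:
  assumes "\<rho> \<in> obj C" "\<sigma> \<in> obj C" "degenerate C \<rho>" "isometry C \<sigma> \<rho> V"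
  shows "degenerate C \<sigma>"
proof -
  define v where "v = Arr \<sigma> \<rho> V"
  have v: "arr v" "src v = \<sigma>" "tgt v = \<rho>" "v\<^sup>\<dagger> \<cdot> v = idt \<sigma>"
    using assms by (simp_all add: v_def isometry_def compose_def adj_def idt_def)
  have "brd \<eta> \<sigma> \<cdot> brd \<sigma> \<eta> = idt (\<sigma> \<odot> \<eta>)" if "\<eta> \<in> obj C" for \<eta>
  proof -
    note [simp] = assms(1,2) that v(1-3)
    have "brd \<eta> \<sigma> \<cdot> brd \<sigma> \<eta> = ((v\<^sup>\<dagger> \<cdot> v) \<boxtimes> idt \<eta>) \<cdot> (brd \<eta> \<sigma> \<cdot> brd \<sigma> \<eta>)"
      unfolding v(4) by (simp add: idt_tensor)
    also have "\<dots> = (v\<^sup>\<dagger> \<boxtimes> idt \<eta>) \<cdot> ((v \<boxtimes> idt \<eta>) \<cdot> (brd \<eta> \<sigma> \<cdot> brd \<sigma> \<eta>))"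
      by (simp add: whisker_right compose_assoc)
    also have "(v \<boxtimes> idt \<eta>) \<cdot> (brd \<eta> \<sigma> \<cdot> brd \<sigma> \<eta>) = (brd \<eta> \<rho> \<cdot> brd \<rho> \<eta>) \<cdot> (v \<boxtimes> idt \<eta>)"
      by (rule monodromy_natural[symmetric]) simp_all
    also have "brd \<eta> \<rho> \<cdot> brd \<rho> \<eta> = idt (\<rho> \<odot> \<eta>)" using assms by (simp add: degenerate_brd)
    also have "(v\<^sup>\<dagger> \<boxtimes> idt \<eta>) \<cdot> (idt (\<rho> \<odot> \<eta>) \<cdot> (v \<boxtimes> idt \<eta>)) = idt (\<sigma> \<odot> \<eta>)"
      by (simp add: v(4) idt_tensor flip: whisker_right)
    finally show ?thesis .
  qed
  then show ?thesis using assms(2) by (simp add: degenerate_brd)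
qed

lemma degenerate_if_irreducibles:
  assumes "\<rho> \<in> obj C" "\<And>r. irreducible_obj C r \<Longrightarrow> degenerate C r"
  shows "degenerate C \<rho>"
proof -
  obtain n :: nat and r W where r: "\<And>i. i < n \<Longrightarrow> irreducible_obj C (r i)"
    and W: "\<And>i. i < n \<Longrightarrow> isometry C (r i) \<rho> (W i)"
    and sum: "(\<Sum>i<n. range_proj C (r i) \<rho> (W i)) = ide C \<rho>"
    using decomposition[OF assms(1)] by blast
  have "brd \<eta> \<rho> \<cdot> brd \<rho> \<eta> = idt (\<rho> \<odot> \<eta>)" if \<eta>: "\<eta> \<in> obj C" for \<eta>
  proof -
    note [simp] = assms(1) \<eta>
    define M where "M = brd \<eta> \<rho> \<cdot> brd \<rho> \<eta>"
    have M [simp]: "arr M" "src M = \<rho> \<odot> \<eta>" "tgt M = \<rho> \<odot> \<eta>" by (simp_all add: M_def)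
    have summand: "M \<cdot> (Arr \<rho> \<rho> (range_proj C (r i) \<rho> (W i)) \<boxtimes> idt \<eta>) = Arr \<rho> \<rho> (range_proj C (r i) \<rho> (W i)) \<boxtimes> idt \<eta>"
      if i: "i < n" for i
    proof -
      define w where "w = Arr (r i) \<rho> (W i)"
      have ri [simp]: "r i \<in> obj C" using r i irreducible_objD(1) by blast
      have w [simp]: "arr w" "src w = r i" "tgt w = \<rho>" using isometryD(1)[OF W[OF i]] by (simp_all add: w_def)
      have p: "Arr \<rho> \<rho> (range_proj C (r i) \<rho> (W i)) = w \<cdot> w\<^sup>\<dagger>"
        by (simp add: w_def range_proj_def compose_def adj_def)
      have "M \<cdot> ((w \<cdot> w\<^sup>\<dagger>) \<boxtimes> idt \<eta>) = (M \<cdot> (w \<boxtimes> idt \<eta>)) \<cdot> (w\<^sup>\<dagger> \<boxtimes> idt \<eta>)"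
        by (simp add: whisker_right compose_assoc)
      also have "M \<cdot> (w \<boxtimes> idt \<eta>) = (w \<boxtimes> idt \<eta>) \<cdot> (brd \<eta> (r i) \<cdot> brd (r i) \<eta>)"
        unfolding M_def by (rule monodromy_natural) simp_all
      also have "brd \<eta> (r i) \<cdot> brd (r i) \<eta> = idt (r i \<odot> \<eta>)"
        using assms(2)[OF r[OF i]] \<eta> degenerate_brd[OF ri] by blast
      finally show ?thesis unfolding p by (simp add: whisker_right)
    qed
    have inH: "range_proj C (r i) \<rho> (W i) \<in> Hom C \<rho> \<rho>" if "i < n" for i
      using W[OF that] r[OF that] irreducible_objD(1) by simp
    have inT: "und (Arr \<rho> \<rho> (range_proj C (r i) \<rho> (W i)) \<boxtimes> idt \<eta>) \<in> Hom C (\<rho> \<odot> \<eta>) (\<rho> \<odot> \<eta>)" if "i < n" for i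
      using inH[OF that] by (intro arr_und) simp_all
    have ten_sum: "ten C \<rho> \<rho> \<eta> \<eta> (sum t I) (ide C \<eta>) = (\<Sum>i\<in>I. ten C \<rho> \<rho> \<eta> \<eta> (t i) (ide C \<eta>))"
      if "\<And>i. i \<in> I \<Longrightarrow> t i \<in> Hom C \<rho> \<rho>" for t :: "nat \<Rightarrow> 'a" and I
      using that
    proof (induction I rule: infinite_finite_induct)
      case (insert j I)
      then show ?case by (simp add: ten_add_left Hom_sum)
    qed (use ten_scale_left[of \<rho> \<rho> \<eta> \<eta> 0 "ide C \<eta>" 0] in simp_all)
    have idsum: "ide C (\<rho> \<odot> \<eta>) = (\<Sum>i<n. und (Arr \<rho> \<rho> (range_proj C (r i) \<rho> (W i)) \<boxtimes> idt \<eta>))"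
    proof -
      have "ide C (\<rho> \<odot> \<eta>) = ten C \<rho> \<rho> \<eta> \<eta> (\<Sum>i<n. range_proj C (r i) \<rho> (W i)) (ide C \<eta>)"
        unfolding sum by (simp add: ten_ide)
      also have "\<dots> = (\<Sum>i<n. ten C \<rho> \<rho> \<eta> \<eta> (range_proj C (r i) \<rho> (W i)) (ide C \<eta>))"
        by (intro ten_sum inH) simp
      finally show ?thesis by (simp add: und_simps)
    qed
    have "und M = cmp C (\<rho> \<odot> \<eta>) (\<rho> \<odot> \<eta>) (\<rho> \<odot> \<eta>) (und M) (ide C (\<rho> \<odot> \<eta>))"
      using arr_und[of M "\<rho> \<odot> \<eta>" "\<rho> \<odot> \<eta>"] by simp
    also have "\<dots> = (\<Sum>i<n. cmp C (\<rho> \<odot> \<eta>) (\<rho> \<odot> \<eta>) (\<rho> \<odot> \<eta>) (und M) (und (Arr \<rho> \<rho> (range_proj C (r i) \<rho> (W i)) \<boxtimes> idt \<eta>)))"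
      unfolding idsum using inT arr_und[of M "\<rho> \<odot> \<eta>" "\<rho> \<odot> \<eta>"] by (intro cmp_sum_right) simp_all
    also have "\<dots> = (\<Sum>i<n. und (Arr \<rho> \<rho> (range_proj C (r i) \<rho> (W i)) \<boxtimes> idt \<eta>))"
    proof (intro sum.cong refl)
      fix i assume "i \<in> {..<n}"
      then have "i < n" by simp
      from arg_cong[OF summand[OF this], of und]
      show "cmp C (\<rho> \<odot> \<eta>) (\<rho> \<odot> \<eta>) (\<rho> \<odot> \<eta>) (und M) (und (Arr \<rho> \<rho> (range_proj C (r i) \<rho> (W i)) \<boxtimes> idt \<eta>))
          = und (Arr \<rho> \<rho> (range_proj C (r i) \<rho> (W i)) \<boxtimes> idt \<eta>)"
        by (simp add: und_simps(2))
    qed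
    finally have "und M = ide C (\<rho> \<odot> \<eta>)" using idsum by simp
    then show ?thesis unfolding M_def[symmetric] by (cases M) (use M in \<open>simp add: idt_def\<close>)
  qed
  then show ?thesis using assms(1) by (simp add: degenerate_brd)
qed

end

section \<open>Finite-dimensional Hilbert spaces\<close>

context unitary_rep
begin

lemma carr_zero [simp]: "0 \<in> carr H"
  and carr_add [simp]: "x \<in> carr H \<Longrightarrow> y \<in> carr H \<Longrightarrow> x + y \<in> carr H"
  and carr_diff [simp]: "x \<in> carr H \<Longrightarrow> y \<in> carr H \<Longrightarrow> x - y \<in> carr H"
  and carr_scale [simp]: "x \<in> carr H \<Longrightarrow> c *\<^sub>C x \<in> carr H"
  and carr_sum: "(\<And>i. i \<in> I \<Longrightarrow> f i \<in> carr H) \<Longrightarrow> sum f I \<in> carr H"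
  using carr_subspace
  by (auto intro: cvec.subspace_0 cvec.subspace_add cvec.subspace_diff cvec.subspace_scale cvec.subspace_sum)

lemma ip_zero_right [simp]: "x \<in> carr H \<Longrightarrow> ip H x 0 = 0"
  using ip_scale[of x 0 0] by simp

lemma ip_zero_left [simp]: "x \<in> carr H \<Longrightarrow> ip H 0 x = 0"
  using ip_cnj[of x 0] by simp

lemma ip_add_left: "x \<in> carr H \<Longrightarrow> y \<in> carr H \<Longrightarrow> z \<in> carr H \<Longrightarrow> ip H (x + y) z = ip H x z + ip H y z"
  using ip_cnj[of z "x + y"] ip_cnj[of z x] ip_cnj[of z y] by (simp add: ip_add)

lemma ip_scale_left: "x \<in> carr H \<Longrightarrow> y \<in> carr H \<Longrightarrow> ip H (c *\<^sub>C x) y = cnj c * ip H x y"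
  using ip_cnj[of y "c *\<^sub>C x"] ip_cnj[of y x] by (simp add: ip_scale)

lemma ip_diff_right: "x \<in> carr H \<Longrightarrow> y \<in> carr H \<Longrightarrow> z \<in> carr H \<Longrightarrow> ip H x (y - z) = ip H x y - ip H x z"
  using ip_add[of x "y - z" z] by simp

lemma ip_sum_right: "x \<in> carr H \<Longrightarrow> (\<And>i. i \<in> I \<Longrightarrow> f i \<in> carr H) \<Longrightarrow> ip H x (sum f I) = (\<Sum>i\<in>I. ip H x (f i))"
  by (induction I rule: infinite_finite_induct) (simp_all add: ip_add carr_sum)

lemma ip_sum_left: "x \<in> carr H \<Longrightarrow> (\<And>i. i \<in> I \<Longrightarrow> f i \<in> carr H) \<Longrightarrow> ip H (sum f I) x = (\<Sum>i\<in>I. ip H (f i) x)"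
  by (induction I rule: infinite_finite_induct) (simp_all add: ip_add_left carr_sum)

lemma ip_self_real:
  assumes "x \<in> carr H" "x \<noteq> 0"
  shows "\<exists>r>0. ip H x x = complex_of_real r"
proof -
  have "Im (ip H x x) = 0" using arg_cong[OF ip_cnj[OF assms(1,1)], of Im] by simp
  then have "ip H x x = complex_of_real (Re (ip H x x))" by (simp add: complex_eq_iff)
  then show ?thesis using ip_pos[OF assms] by blast
qed

lemma ip_eqI:
  assumes "x \<in> carr H" "y \<in> carr H" "\<And>a. a \<in> carr H \<Longrightarrow> ip H a x = ip H a y"
  shows "x = y"
proof (rule ccontr)
  assume "x \<noteq> y"
  then have "Re (ip H (x - y) (x - y)) > 0" using assms by (intro ip_pos) simp_all
  moreover have "ip H (x - y) (x - y) = 0" using assms by (simp add: ip_diff_right)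
  ultimately show False by simp
qed

text \<open>Gram-Schmidt orthogonalization\<close>

lemma orthonormal_basis_exists: "\<exists>B. orthonormal_basis H B"
proof -
  have "\<exists>B. finite B \<and> B \<subseteq> carr H \<and> cvec.span B = cvec.span A \<and> (\<forall>x\<in>B. \<forall>y\<in>B. ip H x y = (if x = y then 1 else 0))"
    if "finite A" "A \<subseteq> carr H" for A
    using that
  proof (induction A rule: finite_induct)
    case empty
    then show ?case by (intro exI[of _ "{}"]) simp
  next
    case (insert a A)
    then obtain B where B: "finite B" "B \<subseteq> carr H" "cvec.span B = cvec.span A"
      and on: "\<And>x y. x \<in> B \<Longrightarrow> y \<in> B \<Longrightarrow> ip H x y = (if x = y then 1 else 0)" by auto
    have a: "a \<in> carr H" using insert.prems by simp
    have span_aA: "cvec.span (insert a B) = cvec.span (insert a A)" using B(3) by (simp add: cvec.span_insert)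
    define s where "s = (\<Sum>e\<in>B. ip H e a *\<^sub>C e)"
    have sB: "s \<in> cvec.span B" unfolding s_def
      by (intro cvec.span_sum cvec.span_scale cvec.span_base)
    have s: "s \<in> carr H" unfolding s_def using B(2) by (intro carr_sum carr_scale) auto
    have orth: "ip H e (a - s) = 0" if "e \<in> B" for e
    proof -
      have e: "e \<in> carr H" using that B(2) by blast
      have "ip H e s = (\<Sum>e'\<in>B. ip H e (ip H e' a *\<^sub>C e'))"
        unfolding s_def using B(2) e by (intro ip_sum_right) auto
      also have "\<dots> = (\<Sum>e'\<in>B. if e' = e then ip H e a else 0)"
        using B(2) e that by (intro sum.cong) (auto simp: ip_scale on subset_iff)
      also have "\<dots> = ip H e a" using B(1) that by simp
      finally show ?thesis using e a s by (simp add: ip_diff_right)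
    qed
    show ?case
    proof (cases "a - s = 0")
      case True
      then have "cvec.span (insert a B) = cvec.span B" using sB by (simp add: cvec.span_redundant)
      then have "cvec.span B = cvec.span (insert a A)" using span_aA by simp
      then show ?thesis using B on by (intro exI[of _ B]) simp
    next
      case False
      then obtain r where r: "r > 0" "ip H (a - s) (a - s) = complex_of_real r"
        using ip_self_real[of "a - s"] a s by auto
      define w where "w = complex_of_real (1 / sqrt r) *\<^sub>C (a - s)"
      have w: "w \<in> carr H" using a s by (simp add: w_def)
      have "ip H w w = 1"
        unfolding w_def using a s r by (simp add: ip_scale ip_scale_left flip: of_real_mult of_real_divide)
      moreover have ew: "ip H e w = 0" if "e \<in> B" for e
        unfolding w_def using orth[OF that] that B(2) a s by (simp add: ip_scale subset_iff)
      moreover have "ip H w e = 0" if "e \<in> B" for e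
        using ip_cnj[of e w] ew[OF that] that B(2) w by auto
      moreover have "w \<notin> B" using \<open>ip H w w = 1\<close> ew by force
      ultimately have "\<forall>x\<in>insert w B. \<forall>y\<in>insert w B. ip H x y = (if x = y then 1 else 0)"
        using on by auto
      moreover have "cvec.span (insert w B) = cvec.span (insert a B)"
      proof -
        have 1: "s \<in> cvec.span (insert x B)" for x using sB cvec.span_mono[of B "insert x B"] by blast
        have "w \<in> cvec.span (insert a B)" unfolding w_def
          by (intro cvec.span_scale cvec.span_diff 1 cvec.span_base) simp
        moreover have "a \<in> cvec.span (insert w B)"
        proof -
          have "a = complex_of_real (sqrt r) *\<^sub>C w + s"
            unfolding w_def using r by (simp add: scaleC_scaleC scaleC_one flip: of_real_mult)
          moreover have "complex_of_real (sqrt r) *\<^sub>C w + s \<in> cvec.span (insert w B)"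
            by (intro cvec.span_add cvec.span_scale 1 cvec.span_base) simp
          ultimately show ?thesis by simp
        qed
        ultimately show ?thesis
          unfolding cvec.span_eq using cvec.span_superset[of "insert a B"] cvec.span_superset[of "insert w B"] by simp
      qed
      then have "cvec.span (insert w B) = cvec.span (insert a A)" using span_aA by simp
      ultimately show ?thesis using B w by (intro exI[of _ "insert w B"]) auto
    qed
  qed
  moreover obtain A where A: "finite A" "cvec.span A = carr H"
    using carr_finite_dim unfolding finite_dim_def by blast
  moreover have "A \<subseteq> carr H" using A(2) cvec.span_superset by blast
  ultimately show ?thesis unfolding orthonormal_basis_def by metis
qed

lemma orthonormal_basis_expand:
  assumes "orthonormal_basis H B" "x \<in> carr H"
  shows "(\<Sum>e\<in>B. ip H e x *\<^sub>C e) = x"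
proof -
  have B: "finite B" "B \<subseteq> carr H" "cvec.span B = carr H"
    and on: "\<And>x y. x \<in> B \<Longrightarrow> y \<in> B \<Longrightarrow> ip H x y = (if x = y then 1 else 0)"
    using assms(1) by (auto simp: orthonormal_basis_def)
  have "x \<in> cvec.span B" using assms(2) B(3) by simp
  then obtain u where u: "x = (\<Sum>e\<in>B. u e *\<^sub>C e)"
    unfolding cvec.span_finite[OF B(1)] by auto
  have "ip H e x = u e" if "e \<in> B" for e
  proof -
    have "ip H e x = (\<Sum>e'\<in>B. ip H e (u e' *\<^sub>C e'))"
      unfolding u using B(2) that by (intro ip_sum_right) auto
    also have "\<dots> = (\<Sum>e'\<in>B. if e' = e then u e else 0)"
      using B(2) that by (intro sum.cong) (auto simp: ip_scale on subset_iff)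
    finally show ?thesis using B(1) that by simp
  qed
  then show ?thesis using u by simp
qed

text \<open>
  The Riesz representation theorem, for antilinear functionals because the inner product is antilinear in
  its first variable.
\<close>

lemma antilinear_functional:
  assumes add: "\<And>a b. a \<in> carr H \<Longrightarrow> b \<in> carr H \<Longrightarrow> h (a + b) = h a + h b"
    and scale: "\<And>c a. a \<in> carr H \<Longrightarrow> h (c *\<^sub>C a) = cnj c * h a"
  shows "\<exists>!x. x \<in> carr H \<and> (\<forall>a\<in>carr H. ip H a x = h a)"
proof -
  obtain B where B: "orthonormal_basis H B" using orthonormal_basis_exists by blast
  have BH: "B \<subseteq> carr H" using B by (simp add: orthonormal_basis_def)
  have hsum: "h (\<Sum>e\<in>I. u e *\<^sub>C e) = (\<Sum>e\<in>I. cnj (u e) * h e)" if "finite I" "I \<subseteq> carr H" for I u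
    using that
  proof (induction I rule: finite_induct)
    case empty
    then show ?case using scale[of 0 0] by simp
  next
    case (insert e I)
    then show ?case by (simp add: add scale carr_sum subset_iff)
  qed
  define x where "x = (\<Sum>e\<in>B. h e *\<^sub>C e)"
  have x: "x \<in> carr H" unfolding x_def using BH by (intro carr_sum carr_scale) auto
  have "ip H a x = h a" if a: "a \<in> carr H" for a
  proof -
    have "ip H a x = (\<Sum>e\<in>B. ip H a (h e *\<^sub>C e))"
      unfolding x_def using BH a by (intro ip_sum_right) auto
    also have "\<dots> = (\<Sum>e\<in>B. cnj (ip H e a) * h e)"
      using BH a ip_cnj[OF _ a] by (intro sum.cong) (auto simp: ip_scale subset_iff)
    also have "\<dots> = h (\<Sum>e\<in>B. ip H e a *\<^sub>C e)"
      using B BH by (intro hsum[symmetric]) (auto simp: orthonormal_basis_def)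
    finally show ?thesis by (simp add: orthonormal_basis_expand[OF B a])
  qed
  then show ?thesis using x ip_eqI by metis
qed

end


section \<open>The fibre functor on degenerate objects\<close>

lemma degenerate_part_simps [simp]:
  "Hom (\<D> C) = Hom C" "ide (\<D> C) = ide C" "cmp (\<D> C) = cmp C" "\<iota>\<^bsub>\<D> C\<^esub> = \<iota>\<^bsub>C\<^esub>" "otn (\<D> C) = otn C"
  "ten (\<D> C) = ten C" "str (\<D> C) = str C" "braid (\<D> C) = braid C"
  by (simp_all add: degenerate_part_def)

lemma irreducible_degenerate_part:
  "irreducible_obj (\<D> C) \<rho> \<longleftrightarrow> irreducible_obj C \<rho> \<and> degenerate C \<rho>"
  by (auto simp: irreducible_obj_def degenerate_part_def)

lemma equivalent_degenerate_part [simp]: "equivalent_obj (\<D> C) = equivalent_obj C"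
  by (simp add: fun_eq_iff equivalent_obj_def isometry_def range_proj_def)

locale modular_closure_setting = BTC_star C + reps: rep_category G \<T> U +
    fibre: symmetric_tensor_iso "\<D> C" G U F + choices: crossed_product_data "\<D> C" P +
    crossed_product C "\<D> C" U F P
  for C :: "('o, 'a::complex_vector, 'm) btcat_scheme" (structure)
    and G :: "('g, 'n) monoid_scheme" and \<T> :: "'g topology"
    and U :: "('g, 'v::complex_vector) repcat"
    and F :: "('o, 'a, 'g, 'v) rep_functor"
    and P :: "('o, 'a) cp_data"
begin

definition deg :: "'o set"
  where "deg = {\<rho> \<in> obj C. degenerate C \<rho>}"

lemma obj_degenerate_part [simp]: "obj (\<D> C) = deg"
  by (simp add: deg_def degenerate_part_def)

abbreviation Irr :: "'o set set"
  where "Irr \<equiv> irr_classes (\<D> C)"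

abbreviation V :: "'o \<Rightarrow> 'v set"
  where "V \<rho> \<equiv> carr (fobj F \<rho>)"

abbreviation ipr :: "'o \<Rightarrow> 'v \<Rightarrow> 'v \<Rightarrow> complex"
  where "ipr \<rho> \<equiv> ip (fobj F \<rho>)"

abbreviation vt :: "'o \<Rightarrow> 'o \<Rightarrow> 'v \<Rightarrow> 'v \<Rightarrow> 'v"
  where "vt \<rho> \<sigma> \<equiv> vten U (fobj F \<rho>) (fobj F \<sigma>)"

lemma deg_obj [simp]: "\<rho> \<in> deg \<Longrightarrow> \<rho> \<in> obj C"
  by (simp add: deg_def)

lemma deg_product [simp]: "\<rho> \<in> deg \<Longrightarrow> \<sigma> \<in> deg \<Longrightarrow> \<rho> \<odot> \<sigma> \<in> deg"
  unfolding deg_def by (simp add: degenerate_product)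

lemma deg_unit [simp]: "\<iota> \<in> deg"
  unfolding deg_def by (simp add: degenerate_unit)

lemma fobj_robj: "\<rho> \<in> deg \<Longrightarrow> fobj F \<rho> \<in> robj U"
  using fibre.fobj_bij by (auto simp: bij_betw_def)

lemma fibre_rep: "\<rho> \<in> deg \<Longrightarrow> unitary_rep G \<T> (fobj F \<rho>)"
  using fobj_robj reps.robj_rep by blast

lemma V_zero: "\<rho> \<in> deg \<Longrightarrow> 0 \<in> V \<rho>"
  and V_add: "\<rho> \<in> deg \<Longrightarrow> x \<in> V \<rho> \<Longrightarrow> y \<in> V \<rho> \<Longrightarrow> x + y \<in> V \<rho>"
  and V_scale: "\<rho> \<in> deg \<Longrightarrow> x \<in> V \<rho> \<Longrightarrow> c *\<^sub>C x \<in> V \<rho>"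
  and V_sum: "\<rho> \<in> deg \<Longrightarrow> (\<And>i. i \<in> I \<Longrightarrow> f i \<in> V \<rho>) \<Longrightarrow> sum f I \<in> V \<rho>"
     apply (rule unitary_rep.carr_zero[OF fibre_rep], assumption)
    apply (rule unitary_rep.carr_add[OF fibre_rep], assumption+)
   apply (rule unitary_rep.carr_scale[OF fibre_rep], assumption+)
  apply (rule unitary_rep.carr_sum[OF fibre_rep], assumption, blast)
  done

lemmas ipr_add_right = unitary_rep.ip_add[OF fibre_rep]
  and ipr_scale_right = unitary_rep.ip_scale[OF fibre_rep]
  and ipr_add_left = unitary_rep.ip_add_left[OF fibre_rep]
  and ipr_scale_left = unitary_rep.ip_scale_left[OF fibre_rep]
  and ipr_sum_right = unitary_rep.ip_sum_right[OF fibre_rep]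
  and ipr_sum_left = unitary_rep.ip_sum_left[OF fibre_rep]
  and ipr_cnj = unitary_rep.ip_cnj[OF fibre_rep]
  and ipr_eqI = unitary_rep.ip_eqI[OF fibre_rep]

lemma farr_inter:
  assumes "\<rho> \<in> deg" "\<sigma> \<in> deg" "X \<in> Hom C \<rho> \<sigma>"
  shows "farr F \<rho> \<sigma> X \<in> intertwiners G (fobj F \<rho>) (fobj F \<sigma>)"
  using fibre.farr_bij[of \<rho> \<sigma>] assms by (auto simp: bij_betw_def)

lemma farr_in:
  assumes "\<rho> \<in> deg" "\<sigma> \<in> deg" "X \<in> Hom C \<rho> \<sigma>" "x \<in> V \<rho>"
  shows "farr F \<rho> \<sigma> X x \<in> V \<sigma>"
  using farr_inter[OF assms(1-3)] assms(4) by (auto simp: intertwiners_def linear_between_def)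

lemma farr_add:
  assumes "\<rho> \<in> deg" "\<sigma> \<in> deg" "X \<in> Hom C \<rho> \<sigma>" "x \<in> V \<rho>" "y \<in> V \<rho>"
  shows "farr F \<rho> \<sigma> X (x + y) = farr F \<rho> \<sigma> X x + farr F \<rho> \<sigma> X y"
  using farr_inter[OF assms(1-3)] assms(4-) by (auto simp: intertwiners_def linear_between_def)

lemma farr_scale:
  assumes "\<rho> \<in> deg" "\<sigma> \<in> deg" "X \<in> Hom C \<rho> \<sigma>" "x \<in> V \<rho>"
  shows "farr F \<rho> \<sigma> X (c *\<^sub>C x) = c *\<^sub>C farr F \<rho> \<sigma> X x"
  using farr_inter[OF assms(1-3)] assms(4-) by (auto simp: intertwiners_def linear_between_def)

lemma farr_sum:
  assumes "\<rho> \<in> deg" "\<sigma> \<in> deg" "X \<in> Hom C \<rho> \<sigma>" "\<And>i. i \<in> I \<Longrightarrow> f i \<in> V \<rho>"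
  shows "farr F \<rho> \<sigma> X (sum f I) = (\<Sum>i\<in>I. farr F \<rho> \<sigma> X (f i))"
  using assms(4)
proof (induction I rule: infinite_finite_induct)
  case (insert j I)
  then show ?case using assms(1-3) by (simp add: farr_add V_sum)
qed (use farr_scale[OF assms(1-3), of 0 0] V_zero[OF assms(1)] in simp_all)

lemma farr_add_arrow:
  assumes "\<rho> \<in> deg" "\<sigma> \<in> deg" "X \<in> Hom C \<rho> \<sigma>" "Y \<in> Hom C \<rho> \<sigma>"
  shows "farr F \<rho> \<sigma> (X + Y) x = farr F \<rho> \<sigma> X x + farr F \<rho> \<sigma> Y x"
  using fibre.farr_linear[of \<rho> \<sigma>] assms by (auto simp: linear_between_def)

lemma farr_scale_arrow:
  assumes "\<rho> \<in> deg" "\<sigma> \<in> deg" "X \<in> Hom C \<rho> \<sigma>"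
  shows "farr F \<rho> \<sigma> (c *\<^sub>C X) x = c *\<^sub>C farr F \<rho> \<sigma> X x"
  using fibre.farr_linear[of \<rho> \<sigma>] assms by (auto simp: linear_between_def scaleC_fun_def)

lemma farr_sum_arrow:
  assumes "\<rho> \<in> deg" "\<sigma> \<in> deg" "\<And>i. i \<in> I \<Longrightarrow> X i \<in> Hom C \<rho> \<sigma>"
  shows "farr F \<rho> \<sigma> (sum X I) x = (\<Sum>i\<in>I. farr F \<rho> \<sigma> (X i) x)"
  using assms(3)
proof (induction I rule: infinite_finite_induct)
  case (insert j I)
  then show ?case using assms(1,2) by (simp add: farr_add_arrow Hom_sum)
qed (use farr_scale_arrow[OF assms(1,2), of 0 0 x] assms(1,2) in simp_all)

lemma farr_ide: "\<rho> \<in> deg \<Longrightarrow> x \<in> V \<rho> \<Longrightarrow> farr F \<rho> \<rho> (ide C \<rho>) x = x"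
  using fibre.farr_ide[of \<rho> x] by simp

lemma farr_cmp:
  "\<lbrakk>\<rho> \<in> deg; \<sigma> \<in> deg; \<tau> \<in> deg; X \<in> Hom C \<sigma> \<tau>; Y \<in> Hom C \<rho> \<sigma>; x \<in> V \<rho>\<rbrakk>
    \<Longrightarrow> farr F \<rho> \<tau> (cmp C \<rho> \<sigma> \<tau> X Y) x = farr F \<sigma> \<tau> X (farr F \<rho> \<sigma> Y x)"
  using fibre.farr_cmp[of \<rho> \<sigma> \<tau> X Y x] by simp

lemma farr_str:
  "\<lbrakk>\<rho> \<in> deg; \<sigma> \<in> deg; X \<in> Hom C \<rho> \<sigma>; x \<in> V \<rho>; y \<in> V \<sigma>\<rbrakk>
    \<Longrightarrow> ipr \<rho> (farr F \<sigma> \<rho> (str C \<rho> \<sigma> X) y) x = ipr \<sigma> y (farr F \<rho> \<sigma> X x)"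
  using fibre.farr_str[of \<rho> \<sigma> X x y] by simp

lemma farr_str_right:
  assumes "\<rho> \<in> deg" "\<sigma> \<in> deg" "X \<in> Hom C \<rho> \<sigma>" "x \<in> V \<rho>" "y \<in> V \<sigma>"
  shows "ipr \<rho> x (farr F \<sigma> \<rho> (str C \<rho> \<sigma> X) y) = ipr \<sigma> (farr F \<rho> \<sigma> X x) y"
  using farr_str[of \<sigma> \<rho> "str C \<rho> \<sigma> X" y x] assms by simp

lemma farr_ten:
  "\<lbrakk>\<rho>1 \<in> deg; \<sigma>1 \<in> deg; \<rho>2 \<in> deg; \<sigma>2 \<in> deg; X \<in> Hom C \<rho>1 \<sigma>1; Y \<in> Hom C \<rho>2 \<sigma>2; x \<in> V \<rho>1; y \<in> V \<rho>2\<rbrakk>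
    \<Longrightarrow> farr F (\<rho>1 \<odot> \<rho>2) (\<sigma>1 \<odot> \<sigma>2) (ten C \<rho>1 \<sigma>1 \<rho>2 \<sigma>2 X Y) (vt \<rho>1 \<rho>2 x y)
      = vt \<sigma>1 \<sigma>2 (farr F \<rho>1 \<sigma>1 X x) (farr F \<rho>2 \<sigma>2 Y y)"
  using fibre.farr_ten[of \<rho>1 \<sigma>1 \<rho>2 \<sigma>2 X Y x y] by simp

lemma fobj_product: "\<rho> \<in> deg \<Longrightarrow> \<sigma> \<in> deg \<Longrightarrow> fobj F (\<rho> \<odot> \<sigma>) = rten U (fobj F \<rho>) (fobj F \<sigma>)"
  using fibre.fobj_otn[of \<rho> \<sigma>] by simp

lemma fobj_unit: "fobj F \<iota> = runit U"
  using fibre.fobj_unt by simp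

lemma vt_in: "\<lbrakk>\<rho> \<in> deg; \<sigma> \<in> deg; x \<in> V \<rho>; y \<in> V \<sigma>\<rbrakk> \<Longrightarrow> vt \<rho> \<sigma> x y \<in> V (\<rho> \<odot> \<sigma>)"
  using reps.vten_linear_left[OF fobj_robj fobj_robj, of \<rho> \<sigma> y] fobj_product[of \<rho> \<sigma>]
  by (auto simp: linear_between_def)

lemma vt_add_left: "\<lbrakk>\<rho> \<in> deg; \<sigma> \<in> deg; x \<in> V \<rho>; x' \<in> V \<rho>; y \<in> V \<sigma>\<rbrakk> \<Longrightarrow> vt \<rho> \<sigma> (x + x') y = vt \<rho> \<sigma> x y + vt \<rho> \<sigma> x' y"
  and vt_scale_left: "\<lbrakk>\<rho> \<in> deg; \<sigma> \<in> deg; x \<in> V \<rho>; y \<in> V \<sigma>\<rbrakk> \<Longrightarrow> vt \<rho> \<sigma> (c *\<^sub>C x) y = c *\<^sub>C vt \<rho> \<sigma> x y"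
  using reps.vten_linear_left[OF fobj_robj fobj_robj, of \<rho> \<sigma> y] by (auto simp: linear_between_def)

lemma vt_add_right: "\<lbrakk>\<rho> \<in> deg; \<sigma> \<in> deg; x \<in> V \<rho>; y \<in> V \<sigma>; y' \<in> V \<sigma>\<rbrakk> \<Longrightarrow> vt \<rho> \<sigma> x (y + y') = vt \<rho> \<sigma> x y + vt \<rho> \<sigma> x y'"
  and vt_scale_right: "\<lbrakk>\<rho> \<in> deg; \<sigma> \<in> deg; x \<in> V \<rho>; y \<in> V \<sigma>\<rbrakk> \<Longrightarrow> vt \<rho> \<sigma> x (c *\<^sub>C y) = c *\<^sub>C vt \<rho> \<sigma> x y"
  using reps.vten_linear_right[OF fobj_robj fobj_robj, of \<rho> \<sigma> x] by (auto simp: linear_between_def)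

lemma vt_sum_left:
  "\<lbrakk>\<rho> \<in> deg; \<sigma> \<in> deg; \<And>i. i \<in> I \<Longrightarrow> f i \<in> V \<rho>; y \<in> V \<sigma>\<rbrakk> \<Longrightarrow> vt \<rho> \<sigma> (sum f I) y = (\<Sum>i\<in>I. vt \<rho> \<sigma> (f i) y)"
proof (induction I rule: infinite_finite_induct)
  case (insert j I)
  then show ?case by (simp add: vt_add_left V_sum)
qed (use vt_scale_left[of \<rho> \<sigma> 0 y 0] V_zero in auto)

lemma vt_sum_right:
  "\<lbrakk>\<rho> \<in> deg; \<sigma> \<in> deg; x \<in> V \<rho>; \<And>i. i \<in> I \<Longrightarrow> f i \<in> V \<sigma>\<rbrakk> \<Longrightarrow> vt \<rho> \<sigma> x (sum f I) = (\<Sum>i\<in>I. vt \<rho> \<sigma> x (f i))"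
proof (induction I rule: infinite_finite_induct)
  case (insert j I)
  then show ?case by (simp add: vt_add_right V_sum)
qed (use vt_scale_right[of \<rho> \<sigma> x 0 0] V_zero in auto)

lemma vt_ip: "\<lbrakk>\<rho> \<in> deg; \<sigma> \<in> deg; x \<in> V \<rho>; x' \<in> V \<rho>; y \<in> V \<sigma>; y' \<in> V \<sigma>\<rbrakk>
    \<Longrightarrow> ipr (\<rho> \<odot> \<sigma>) (vt \<rho> \<sigma> x y) (vt \<rho> \<sigma> x' y') = ipr \<rho> x x' * ipr \<sigma> y y'"
  using reps.vten_ip[OF fobj_robj fobj_robj, of \<rho> \<sigma> x x' y y'] fobj_product[of \<rho> \<sigma>] by simp

lemma vt_assoc: "\<lbrakk>\<rho> \<in> deg; \<sigma> \<in> deg; \<tau> \<in> deg; x \<in> V \<rho>; y \<in> V \<sigma>; z \<in> V \<tau>\<rbrakk>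
    \<Longrightarrow> vt (\<rho> \<odot> \<sigma>) \<tau> (vt \<rho> \<sigma> x y) z = vt \<rho> (\<sigma> \<odot> \<tau>) x (vt \<sigma> \<tau> y z)"
  using reps.vten_assoc[OF fobj_robj fobj_robj fobj_robj, of \<rho> \<sigma> \<tau> x y z] fobj_product[of \<rho> \<sigma>] fobj_product[of \<sigma> \<tau>]
  by simp

lemma V_product_span: "\<lbrakk>\<rho> \<in> deg; \<sigma> \<in> deg\<rbrakk> \<Longrightarrow> V (\<rho> \<odot> \<sigma>) = cvec.span {vt \<rho> \<sigma> x y |x y. x \<in> V \<rho> \<and> y \<in> V \<sigma>}"
  using reps.vten_span[OF fobj_robj fobj_robj, of \<rho> \<sigma>] fobj_product[of \<rho> \<sigma>] by simp

lemma vac_in: "vac U \<in> V \<iota>"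
  by (metis fobj_unit reps.runit_carr rangeI scaleC_one)

lemma V_unit: "x \<in> V \<iota> \<Longrightarrow> \<exists>c. x = c *\<^sub>C vac U"
  by (auto simp: fobj_unit reps.runit_carr)

lemma vac_ip: "ipr \<iota> (vac U) (vac U) = 1"
  by (simp add: fobj_unit reps.runit_ip)

lemma vt_vac_left: "\<rho> \<in> deg \<Longrightarrow> x \<in> V \<rho> \<Longrightarrow> vt \<iota> \<rho> (vac U) x = x"
  and vt_vac_right: "\<rho> \<in> deg \<Longrightarrow> x \<in> V \<rho> \<Longrightarrow> vt \<rho> \<iota> x (vac U) = x"
  using reps.vac_vten[OF fobj_robj] reps.vten_vac[OF fobj_robj] by (simp_all add: fobj_unit)

text \<open>
  Simple tensors span the tensor product, so inner products with them determine a vector.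
\<close>

lemma ipr_product_eqI:
  assumes "\<rho> \<in> deg" "\<sigma> \<in> deg" "x \<in> V (\<rho> \<odot> \<sigma>)" "y \<in> V (\<rho> \<odot> \<sigma>)"
    and eq: "\<And>a b. a \<in> V \<rho> \<Longrightarrow> b \<in> V \<sigma> \<Longrightarrow> ipr (\<rho> \<odot> \<sigma>) (vt \<rho> \<sigma> a b) x = ipr (\<rho> \<odot> \<sigma>) (vt \<rho> \<sigma> a b) y"
  shows "x = y"
proof (rule ipr_eqI[OF deg_product[OF assms(1,2)] assms(3,4)])
  let ?T = "{vt \<rho> \<sigma> x y |x y. x \<in> V \<rho> \<and> y \<in> V \<sigma>}"
  have T: "V (\<rho> \<odot> \<sigma>) = cvec.span ?T" by (rule V_product_span[OF assms(1,2)])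
  fix a assume "a \<in> V (\<rho> \<odot> \<sigma>)"
  then have "a \<in> cvec.span ?T" using T by simp
  then have "a \<in> V (\<rho> \<odot> \<sigma>) \<and> ipr (\<rho> \<odot> \<sigma>) a x = ipr (\<rho> \<odot> \<sigma>) a y"
  proof (induction rule: cvec.span_induct_alt)
    case base
    show ?case
      using unitary_rep.ip_zero_left[OF fibre_rep[OF deg_product[OF assms(1,2)]]] assms V_zero[of "\<rho> \<odot> \<sigma>"] by simp
  next
    case (step c u v)
    then obtain p q where u: "u = vt \<rho> \<sigma> p q" "p \<in> V \<rho>" "q \<in> V \<sigma>" by blast
    then have "u \<in> V (\<rho> \<odot> \<sigma>)" using vt_in assms by blast
    with step u show ?case
      using eq[of p q] assms(1-4) by (simp add: ipr_add_left ipr_scale_left V_scale V_add)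
  qed
  then show "ipr (\<rho> \<odot> \<sigma>) a x = ipr (\<rho> \<odot> \<sigma>) a y" ..
qed


section \<open>Classes of irreducible degenerate objects\<close>

lemma unit_class [simp]: "irr_class (\<D> C) \<iota> \<in> Irr" "\<gamma> (irr_class (\<D> C) \<iota>) = \<iota>"
  using choices.gam_zero unt_irreducible degenerate_unit
  by (auto simp: irr_classes_def irreducible_degenerate_part)

lemma gam_irreducible:
  assumes "k \<in> Irr"
  shows "irreducible_obj C (\<gamma> k)" "degenerate C (\<gamma> k)"
  using choices.gam_class[OF assms] assms
  by (auto simp: irr_classes_def irr_class_def irreducible_degenerate_part)

lemma gam_deg [simp]: "k \<in> Irr \<Longrightarrow> \<gamma> k \<in> deg"
  unfolding deg_def using gam_irreducible irreducible_objD(1) by blast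

lemma gam_obj: "k \<in> Irr \<Longrightarrow> \<gamma> k \<in> obj C"
  by simp

lemma class_exists:
  assumes "irreducible_obj C r" "degenerate C r"
  shows "\<exists>k\<in>Irr. equivalent_obj C r (\<gamma> k)"
proof -
  have "irr_class (\<D> C) r \<in> Irr" using assms by (auto simp: irr_classes_def irreducible_degenerate_part)
  moreover from choices.gam_class[OF this] have "equivalent_obj C r (\<gamma> (irr_class (\<D> C) r))"
    by (simp add: irr_class_def)
  ultimately show ?thesis by blast
qed

lemma class_eq:
  assumes "k \<in> Irr" "l \<in> Irr" "equivalent_obj C (\<gamma> k) (\<gamma> l)"
  shows "k = l"
proof -
  have *: "k = {\<sigma>. irreducible_obj C \<sigma> \<and> degenerate C \<sigma> \<and> equivalent_obj C (\<gamma> k) \<sigma>}" if k: "k \<in> Irr" for k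
  proof -
    obtain a where a: "irreducible_obj C a" "k = irr_class (\<D> C) a"
      using k by (auto simp: irr_classes_def irreducible_degenerate_part)
    have ak: "equivalent_obj C a (\<gamma> k)" using choices.gam_class[OF k] a by (auto simp: irr_class_def)
    note obj = irreducible_objD(1)[OF a(1)] gam_obj[OF k] irreducible_objD(1)
    have "equivalent_obj C a \<sigma> \<longleftrightarrow> equivalent_obj C (\<gamma> k) \<sigma>" if "irreducible_obj C \<sigma>" for \<sigma>
      using equivalent_obj_trans[of a "\<gamma> k" \<sigma>] equivalent_obj_trans[of "\<gamma> k" a \<sigma>] equivalent_obj_sym[OF ak] ak
        obj that by blast
    then show ?thesis unfolding a(2) irr_class_def
      by (auto simp: irreducible_degenerate_part a(2)[unfolded irr_class_def, symmetric])
  qed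
  have "equivalent_obj C (\<gamma> k) \<sigma> \<longleftrightarrow> equivalent_obj C (\<gamma> l) \<sigma>" if "irreducible_obj C \<sigma>" for \<sigma>
    using equivalent_obj_trans[of "\<gamma> k" "\<gamma> l" \<sigma>] equivalent_obj_trans[of "\<gamma> l" "\<gamma> k" \<sigma>]
      equivalent_obj_sym[OF assms(3)] assms gam_obj irreducible_objD(1)[OF that] by blast
  then show ?thesis using *[OF assms(1)] *[OF assms(2)] by auto
qed

lemma Hom_gam_distinct:
  assumes "k \<in> Irr" "l \<in> Irr" "k \<noteq> l" "T \<in> Hom C (\<gamma> k) (\<gamma> l)"
  shows "T = 0"
  using schur_equivalent[OF gam_irreducible(1) gam_irreducible(1) assms(4)] class_eq assms by blast

lemma Hom_gam_scalar: "k \<in> Irr \<Longrightarrow> T \<in> Hom C (\<gamma> k) (\<gamma> k) \<Longrightarrow> \<exists>c. T = c *\<^sub>C ide C (\<gamma> k)"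
  using irreducible_objD(3)[OF gam_irreducible(1)] by blast

lemma gam_ide_nonzero: "k \<in> Irr \<Longrightarrow> ide C (\<gamma> k) \<noteq> 0"
  using irreducible_objD(2)[OF gam_irreducible(1)] by blast

text \<open>
  Every irreducible object with a nonzero arrow to \<open>\<tau>\<close> is equivalent to a summand in a fixed finite
  decomposition of \<open>\<tau>\<close>.
\<close>

lemma finite_classes:
  assumes \<tau>: "\<tau> \<in> obj C"
  shows "finite {k \<in> Irr. \<exists>T\<in>Hom C (\<gamma> k) \<tau>. T \<noteq> 0}"
proof -
  obtain n :: nat and r W where r: "\<And>i. i < n \<Longrightarrow> irreducible_obj C (r i)"
    and W: "\<And>i. i < n \<Longrightarrow> isometry C (r i) \<tau> (W i)"
    and sum: "(\<Sum>i<n. range_proj C (r i) \<tau> (W i)) = ide C \<tau>"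
    using decomposition[OF \<tau>] by blast
  have ro: "r i \<in> obj C" if "i < n" for i using r[OF that] irreducible_objD(1) by blast
  have "\<exists>i<n. equivalent_obj C (\<gamma> k) (r i)" if k: "k \<in> Irr" and T: "T \<in> Hom C (\<gamma> k) \<tau>" "T \<noteq> 0" for k T
  proof (rule ccontr)
    assume no: "\<not> (\<exists>i<n. equivalent_obj C (\<gamma> k) (r i))"
    have zero: "cmp C (\<gamma> k) \<tau> (r i) (str C (r i) \<tau> (W i)) T = 0" if "i < n" for i
      using schur_equivalent[OF gam_irreducible(1)[OF k] r[OF that]] no that
        k T \<tau> ro[OF that] isometryD(1)[OF W[OF that]]
      by (metis cmp_in gam_obj str_in)
    have "T = cmp C (\<gamma> k) \<tau> \<tau> (\<Sum>i<n. range_proj C (r i) \<tau> (W i)) T"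
      unfolding sum using k T \<tau> by simp
    also have "\<dots> = (\<Sum>i<n. cmp C (\<gamma> k) \<tau> \<tau> (range_proj C (r i) \<tau> (W i)) T)"
      using k T \<tau> W ro by (intro cmp_sum_left) simp_all
    also have "\<dots> = 0"
      using k T \<tau> ro isometryD(1)[OF W] by (intro sum.neutral) (simp add: range_proj_def cmp_assoc zero)
    finally show False using T by simp
  qed
  then have "\<forall>k\<in>{k \<in> Irr. \<exists>T\<in>Hom C (\<gamma> k) \<tau>. T \<noteq> 0}. \<exists>i. i < n \<and> equivalent_obj C (\<gamma> k) (r i)" by blast
  from bchoice[OF this] obtain j where j: "\<And>k. k \<in> {k \<in> Irr. \<exists>T\<in>Hom C (\<gamma> k) \<tau>. T \<noteq> 0} \<Longrightarrow> j k < n \<and> equivalent_obj C (\<gamma> k) (r (j k))"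
    by blast
  have "inj_on j {k \<in> Irr. \<exists>T\<in>Hom C (\<gamma> k) \<tau>. T \<noteq> 0}"
  proof (rule inj_onI)
    fix k l assume kl: "k \<in> {k \<in> Irr. \<exists>T\<in>Hom C (\<gamma> k) \<tau>. T \<noteq> 0}" "l \<in> {k \<in> Irr. \<exists>T\<in>Hom C (\<gamma> k) \<tau>. T \<noteq> 0}" "j k = j l"
    then have "equivalent_obj C (\<gamma> k) (r (j k))" "equivalent_obj C (\<gamma> l) (r (j k))" "r (j k) \<in> obj C"
      using j[OF kl(1)] j[OF kl(2)] ro by auto
    then have "equivalent_obj C (\<gamma> k) (\<gamma> l)"
      using kl equivalent_obj_trans[of "\<gamma> k" "r (j k)" "\<gamma> l"] equivalent_obj_sym[of "\<gamma> l" "r (j k)"] by simp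
    then show "k = l" using class_eq kl by blast
  qed
  moreover have "j ` {k \<in> Irr. \<exists>T\<in>Hom C (\<gamma> k) \<tau>. T \<noteq> 0} \<subseteq> {..<n}" using j by auto
  ultimately show ?thesis by (meson finite_imageD finite_lessThan finite_subset)
qed

text \<open>
  The irreducible summands of a degenerate object are degenerate and can be replaced by the chosen
  representatives of their classes.
\<close>

lemma deg_decomposition:
  assumes g: "g \<in> deg"
  obtains n :: nat and \<kappa> W where "\<And>i. i < n \<Longrightarrow> \<kappa> i \<in> Irr" "\<And>i. i < n \<Longrightarrow> isometry C (\<gamma> (\<kappa> i)) g (W i)"
    "(\<Sum>i<n. range_proj C (\<gamma> (\<kappa> i)) g (W i)) = ide C g"
proof -
  have go [simp]: "g \<in> obj C" using g by simp
  obtain n :: nat and r W where r: "\<And>i. i < n \<Longrightarrow> irreducible_obj C (r i)"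
    and W: "\<And>i. i < n \<Longrightarrow> isometry C (r i) g (W i)"
    and sum: "(\<Sum>i<n. range_proj C (r i) g (W i)) = ide C g"
    using decomposition[OF go] by blast
  have "\<exists>k\<in>Irr. \<exists>W'. isometry C (\<gamma> k) g W' \<and> range_proj C (\<gamma> k) g W' = range_proj C (r i) g (W i)" if i: "i < n" for i
  proof -
    have ri [simp]: "r i \<in> obj C" using r[OF i] irreducible_objD(1) by blast
    have "degenerate C (r i)" using degenerate_subobject[of g "r i" "W i"] g W[OF i] unfolding deg_def by simp
    then obtain k where k: "k \<in> Irr" "equivalent_obj C (r i) (\<gamma> k)" using class_exists r[OF i] by blast
    then obtain X where X: "X \<in> Hom C (\<gamma> k) (r i)" "cmp C (\<gamma> k) (r i) (\<gamma> k) (str C (\<gamma> k) (r i) X) X = ide C (\<gamma> k)"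
      "cmp C (r i) (\<gamma> k) (r i) X (str C (\<gamma> k) (r i) X) = ide C (r i)"
      using equivalent_obj_sym[OF k(2)] by (auto simp: equivalent_obj_def isometry_def range_proj_def)
    let ?x = "Arr (\<gamma> k) (r i) X" and ?w = "Arr (r i) g (W i)"
    have x: "arr ?x" "?x\<^sup>\<dagger> \<cdot> ?x = idt (\<gamma> k)" "?x \<cdot> ?x\<^sup>\<dagger> = idt (r i)" using X k by (simp_all add: compose_def adj_def idt_def)
    have w: "arr ?w" "?w\<^sup>\<dagger> \<cdot> ?w = idt (r i)" using isometryD[OF W[OF i]] by (simp_all add: compose_def adj_def idt_def)
    have "(?w \<cdot> ?x)\<^sup>\<dagger> \<cdot> (?w \<cdot> ?x) = ?x\<^sup>\<dagger> \<cdot> ((?w\<^sup>\<dagger> \<cdot> ?w) \<cdot> ?x)"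
      using x(1) w(1) by (simp add: adj_compose compose_assoc)
    then have 1: "(?w \<cdot> ?x)\<^sup>\<dagger> \<cdot> (?w \<cdot> ?x) = idt (\<gamma> k)" using x w by simp
    have "(?w \<cdot> ?x) \<cdot> (?w \<cdot> ?x)\<^sup>\<dagger> = ?w \<cdot> ((?x \<cdot> ?x\<^sup>\<dagger>) \<cdot> ?w\<^sup>\<dagger>)"
      using x(1) w(1) by (simp add: adj_compose compose_assoc)
    then have 2: "(?w \<cdot> ?x) \<cdot> (?w \<cdot> ?x)\<^sup>\<dagger> = ?w \<cdot> ?w\<^sup>\<dagger>" using x w by simp
    have "isometry C (\<gamma> k) g (cmp C (\<gamma> k) (r i) g (W i) X) \<and>
        range_proj C (\<gamma> k) g (cmp C (\<gamma> k) (r i) g (W i) X) = range_proj C (r i) g (W i)"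
      using arg_cong[OF 1, of und] arg_cong[OF 2, of und] isometryD(1)[OF W[OF i]] X k(1)
      by (simp add: isometry_def range_proj_def und_simps)
    then show ?thesis using k(1) by blast
  qed
  then obtain \<kappa> W' where "\<And>i. i < n \<Longrightarrow> \<kappa> i \<in> Irr \<and> isometry C (\<gamma> (\<kappa> i)) g (W' i) \<and>
      range_proj C (\<gamma> (\<kappa> i)) g (W' i) = range_proj C (r i) g (W i)"
    by metis
  then show ?thesis using that[of n \<kappa> W'] sum by simp
qed

end

section \<open>Linear combinations of arrows\<close>

lemma sum_fun_apply: "(sum f I) x = (\<Sum>i\<in>I. f i x)"
  by (induction I rule: infinite_finite_induct) simp_all

lemma scaleC_fun_apply: "(c *\<^sub>C f) x = c *\<^sub>C f x"
  by (simp add: scaleC_fun_def)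

lemma Arr_eta: "src f = \<rho> \<Longrightarrow> tgt f = \<sigma> \<Longrightarrow> Arr \<rho> \<sigma> (und f) = f"
  by (cases f) simp

context tensor_star_category
begin

lemma ten_zero_left [simp]:
  "\<lbrakk>\<rho>1 \<in> obj C; \<sigma>1 \<in> obj C; \<rho>2 \<in> obj C; \<sigma>2 \<in> obj C; T \<in> Hom C \<rho>2 \<sigma>2\<rbrakk> \<Longrightarrow> ten C \<rho>1 \<sigma>1 \<rho>2 \<sigma>2 0 T = 0"
  using ten_scale_left[of \<rho>1 \<sigma>1 \<rho>2 \<sigma>2 0 T 0] by simp

lemma ten_zero_right [simp]:
  "\<lbrakk>\<rho>1 \<in> obj C; \<sigma>1 \<in> obj C; \<rho>2 \<in> obj C; \<sigma>2 \<in> obj C; S \<in> Hom C \<rho>1 \<sigma>1\<rbrakk> \<Longrightarrow> ten C \<rho>1 \<sigma>1 \<rho>2 \<sigma>2 S 0 = 0"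
  using ten_scale_right[of \<rho>1 \<sigma>1 \<rho>2 \<sigma>2 S 0 0] by simp

lemma ten_arr_in:
  assumes "a \<in> obj C" "b \<in> obj C" "S \<in> Hom C a b" "r \<in> obj C"
  shows "ten C a b r r S (ide C r) \<in> Hom C (a \<odot> r) (b \<odot> r)"
  using assms by (intro ten_in) simp_all

lemma und_whisker_add:
  assumes "arr A" "src A = b \<odot> r" "a \<in> obj C" "b \<in> obj C" "r \<in> obj C" "S \<in> Hom C a b" "T \<in> Hom C a b"
  shows "und (A \<cdot> (Arr a b (S + T) \<boxtimes> idt r)) = und (A \<cdot> (Arr a b S \<boxtimes> idt r)) + und (A \<cdot> (Arr a b T \<boxtimes> idt r))"
  using assms arr_und[OF assms(1,2) refl]
  by (simp add: und_simps ten_add_left cmp_add_right ten_arr_in)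

lemma und_whisker_scale:
  assumes "arr A" "src A = b \<odot> r" "a \<in> obj C" "b \<in> obj C" "r \<in> obj C" "S \<in> Hom C a b"
  shows "und (A \<cdot> (Arr a b (c *\<^sub>C S) \<boxtimes> idt r)) = c *\<^sub>C und (A \<cdot> (Arr a b S \<boxtimes> idt r))"
  using assms arr_und[OF assms(1,2) refl]
  by (simp add: und_simps ten_scale_left cmp_scale_right ten_arr_in)

lemma und_whisker_sum:
  assumes "arr A" "src A = b \<odot> r" "a \<in> obj C" "b \<in> obj C" "r \<in> obj C" "\<And>i. i \<in> I \<Longrightarrow> S i \<in> Hom C a b"
  shows "und (A \<cdot> (Arr a b (sum S I) \<boxtimes> idt r)) = (\<Sum>i\<in>I. und (A \<cdot> (Arr a b (S i) \<boxtimes> idt r)))"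
  using assms(6)
proof (induction I rule: infinite_finite_induct)
  case (insert j I)
  then show ?case using assms(1-5) by (simp add: und_whisker_add Hom_sum)
qed (use und_whisker_scale[OF assms(1-5), of 0 0] assms(3,4) in simp_all)

lemma cmp_lincomb_right:
  assumes "\<rho> \<in> obj C" "\<sigma> \<in> obj C" "\<tau> \<in> obj C" "S \<in> Hom C \<sigma> \<tau>" "\<And>i. i \<in> I \<Longrightarrow> t i \<in> Hom C \<rho> \<sigma>"
  shows "cmp C \<rho> \<sigma> \<tau> S (\<Sum>i\<in>I. c i *\<^sub>C t i) = (\<Sum>i\<in>I. c i *\<^sub>C cmp C \<rho> \<sigma> \<tau> S (t i))"
proof -
  have "cmp C \<rho> \<sigma> \<tau> S (\<Sum>i\<in>I. c i *\<^sub>C t i) = (\<Sum>i\<in>I. cmp C \<rho> \<sigma> \<tau> S (c i *\<^sub>C t i))"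
    by (rule cmp_sum_right) (simp_all add: assms)
  also have "\<dots> = (\<Sum>i\<in>I. c i *\<^sub>C cmp C \<rho> \<sigma> \<tau> S (t i))"
    by (rule sum.cong) (simp_all add: assms cmp_scale_right)
  finally show ?thesis .
qed

end

section \<open>Coordinates of a vector in a class of irreducibles\<close>

context modular_closure_setting
begin

lemma onb_basis: "k \<in> Irr \<Longrightarrow> orthonormal_basis (fib k) (onb k)"
  unfolding onb_def using unitary_rep.orthonormal_basis_exists[OF fibre_rep[OF gam_deg]] by (rule someI_ex)

lemma onb_finite [simp]: "k \<in> Irr \<Longrightarrow> finite (onb k)"
  and onb_in: "k \<in> Irr \<Longrightarrow> e \<in> onb k \<Longrightarrow> e \<in> V (\<gamma> k)"
  using onb_basis[of k] by (auto simp: orthonormal_basis_def)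

lemma onb_expand: "k \<in> Irr \<Longrightarrow> x \<in> V (\<gamma> k) \<Longrightarrow> (\<Sum>e\<in>onb k. ipr (\<gamma> k) e x *\<^sub>C e) = x"
  using unitary_rep.orthonormal_basis_expand[OF fibre_rep[OF gam_deg] onb_basis] by blast

lemma farr_lincomb_arrow:
  assumes "\<rho> \<in> deg" "\<sigma> \<in> deg" "\<And>i. i \<in> I \<Longrightarrow> X i \<in> Hom C \<rho> \<sigma>"
  shows "farr F \<rho> \<sigma> (\<Sum>i\<in>I. c i *\<^sub>C X i) x = (\<Sum>i\<in>I. c i *\<^sub>C farr F \<rho> \<sigma> (X i) x)"
proof -
  have "farr F \<rho> \<sigma> (\<Sum>i\<in>I. c i *\<^sub>C X i) x = (\<Sum>i\<in>I. farr F \<rho> \<sigma> (c i *\<^sub>C X i) x)"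
    by (rule farr_sum_arrow) (simp_all add: assms)
  also have "\<dots> = (\<Sum>i\<in>I. c i *\<^sub>C farr F \<rho> \<sigma> (X i) x)"
    by (rule sum.cong) (simp_all add: assms farr_scale_arrow)
  finally show ?thesis .
qed

lemma farr_lincomb:
  assumes "\<rho> \<in> deg" "\<sigma> \<in> deg" "X \<in> Hom C \<rho> \<sigma>" "\<And>i. i \<in> I \<Longrightarrow> f i \<in> V \<rho>"
  shows "farr F \<rho> \<sigma> X (\<Sum>i\<in>I. c i *\<^sub>C f i) = (\<Sum>i\<in>I. c i *\<^sub>C farr F \<rho> \<sigma> X (f i))"
proof -
  have "farr F \<rho> \<sigma> X (\<Sum>i\<in>I. c i *\<^sub>C f i) = (\<Sum>i\<in>I. farr F \<rho> \<sigma> X (c i *\<^sub>C f i))"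
    by (rule farr_sum) (simp_all add: assms V_scale)
  also have "\<dots> = (\<Sum>i\<in>I. c i *\<^sub>C farr F \<rho> \<sigma> X (f i))"
    by (rule sum.cong) (simp_all add: assms farr_scale)
  finally show ?thesis .
qed

lemma ipr_lincomb_left:
  assumes "\<rho> \<in> deg" "x \<in> V \<rho>" "\<And>i. i \<in> I \<Longrightarrow> f i \<in> V \<rho>"
  shows "ipr \<rho> (\<Sum>i\<in>I. c i *\<^sub>C f i) x = (\<Sum>i\<in>I. cnj (c i) * ipr \<rho> (f i) x)"
proof -
  have "ipr \<rho> (\<Sum>i\<in>I. c i *\<^sub>C f i) x = (\<Sum>i\<in>I. ipr \<rho> (c i *\<^sub>C f i) x)"
    by (rule ipr_sum_left) (simp_all add: assms V_scale)
  also have "\<dots> = (\<Sum>i\<in>I. cnj (c i) * ipr \<rho> (f i) x)"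
    by (rule sum.cong) (simp_all add: assms ipr_scale_left)
  finally show ?thesis .
qed

text \<open>
  For \<open>x \<in> H\<^sub>k\<close> and \<open>\<psi> \<in> F(g)\<close> let \<open>coordinate k g x \<psi> : \<gamma>\<^sub>k \<rightarrow> g\<close> represent the functional
  \<open>W \<mapsto> \<langle>F(W) x, \<psi>\<rangle>\<close> on \<open>Hom(\<gamma>\<^sub>k, g)\<close>. In terms of an orthonormal basis \<open>V\<^sub>\<alpha>\<close> of that space it is
  \<open>\<Sum>\<^sub>\<alpha> \<langle>F(V\<^sub>\<alpha>) x, \<psi>\<rangle> V\<^sub>\<alpha>\<close>; the characterization without a basis makes naturality in \<open>g\<close> evident.
\<close>

definition is_coordinate :: "'o set \<Rightarrow> 'o \<Rightarrow> 'v \<Rightarrow> 'v \<Rightarrow> 'a \<Rightarrow> bool"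
  where "is_coordinate k g x \<psi> \<theta> \<longleftrightarrow> \<theta> \<in> Hom C (\<gamma> k) g \<and> (\<forall>W\<in>Hom C (\<gamma> k) g.
    cmp C (\<gamma> k) g (\<gamma> k) (str C (\<gamma> k) g W) \<theta> = ipr g (farr F (\<gamma> k) g W x) \<psi> *\<^sub>C ide C (\<gamma> k))"

definition coordinate :: "'o set \<Rightarrow> 'o \<Rightarrow> 'v \<Rightarrow> 'v \<Rightarrow> 'a"
  where "coordinate k g x \<psi> = (THE \<theta>. is_coordinate k g x \<psi> \<theta>)"

lemma is_coordinate_unique:
  assumes "k \<in> Irr" "g \<in> deg" "is_coordinate k g x \<psi> \<theta>" "is_coordinate k g x \<psi> \<theta>'"
  shows "\<theta> = \<theta>'"
proof -
  have t: "\<theta> \<in> Hom C (\<gamma> k) g" "\<theta>' \<in> Hom C (\<gamma> k) g" "\<theta> - \<theta>' \<in> Hom C (\<gamma> k) g"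
    using assms by (simp_all add: is_coordinate_def)
  have "cmp C (\<gamma> k) g (\<gamma> k) (str C (\<gamma> k) g (\<theta> - \<theta>')) (\<theta> - \<theta>') = 0"
    using assms t by (simp add: cmp_diff_right is_coordinate_def)
  then show ?thesis using str_pos[of "\<gamma> k" g "\<theta> - \<theta>'"] assms(1,2) t by simp
qed

lemma coordinate_eqI: "k \<in> Irr \<Longrightarrow> g \<in> deg \<Longrightarrow> is_coordinate k g x \<psi> \<theta> \<Longrightarrow> coordinate k g x \<psi> = \<theta>"
  unfolding coordinate_def using is_coordinate_unique by blast

lemma is_coordinate_decomposition:
  fixes n :: nat
  assumes k: "k \<in> Irr" and g: "g \<in> deg" and x: "x \<in> V (\<gamma> k)" and \<psi>: "\<psi> \<in> V g"
    and \<kappa>: "\<And>i. i < n \<Longrightarrow> \<kappa> i \<in> Irr" and W: "\<And>i. i < n \<Longrightarrow> isometry C (\<gamma> (\<kappa> i)) g (W i)"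
    and sum: "(\<Sum>i<n. range_proj C (\<gamma> (\<kappa> i)) g (W i)) = ide C g"
  shows "is_coordinate k g x \<psi> (\<Sum>i\<in>{i. i < n \<and> \<kappa> i = k}. ipr g (farr F (\<gamma> k) g (W i) x) \<psi> *\<^sub>C W i)"
proof -
  let ?I = "{i. i < n \<and> \<kappa> i = k}"
  note [simp] = k g
  have WI: "W i \<in> Hom C (\<gamma> k) g" if "i \<in> ?I" for i using isometryD(1)[OF W] that by auto
  have "cmp C (\<gamma> k) g (\<gamma> k) (str C (\<gamma> k) g X) (\<Sum>i\<in>?I. ipr g (farr F (\<gamma> k) g (W i) x) \<psi> *\<^sub>C W i)
      = ipr g (farr F (\<gamma> k) g X x) \<psi> *\<^sub>C ide C (\<gamma> k)" if X: "X \<in> Hom C (\<gamma> k) g" for X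
  proof -
    have "\<forall>i\<in>?I. \<exists>c. cmp C (\<gamma> k) g (\<gamma> k) (str C (\<gamma> k) g (W i)) X = c *\<^sub>C ide C (\<gamma> k)"
      using WI X by (intro ballI Hom_gam_scalar) simp_all
    from bchoice[OF this] obtain c
      where c: "\<And>i. i \<in> ?I \<Longrightarrow> cmp C (\<gamma> k) g (\<gamma> k) (str C (\<gamma> k) g (W i)) X = c i *\<^sub>C ide C (\<gamma> k)" by blast
    have "X = cmp C (\<gamma> k) g g (\<Sum>i<n. range_proj C (\<gamma> (\<kappa> i)) g (W i)) X"
      unfolding sum using X by simp
    also have "\<dots> = (\<Sum>i<n. cmp C (\<gamma> k) g g (range_proj C (\<gamma> (\<kappa> i)) g (W i)) X)"
      using X W \<kappa> by (intro cmp_sum_left) simp_all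
    also have "\<dots> = (\<Sum>i<n. if i \<in> ?I then c i *\<^sub>C W i else 0)"
    proof (rule sum.cong[OF refl])
      fix i assume i: "i \<in> {..<n}"
      have Wi: "W i \<in> Hom C (\<gamma> (\<kappa> i)) g" using isometryD(1)[OF W] i by simp
      have ki: "\<kappa> i \<in> Irr" using \<kappa> i by simp
      have Z: "cmp C (\<gamma> k) g (\<gamma> (\<kappa> i)) (str C (\<gamma> (\<kappa> i)) g (W i)) X \<in> Hom C (\<gamma> k) (\<gamma> (\<kappa> i))"
        using Wi ki X by simp
      have "cmp C (\<gamma> k) g g (range_proj C (\<gamma> (\<kappa> i)) g (W i)) X
          = cmp C (\<gamma> k) (\<gamma> (\<kappa> i)) g (W i) (cmp C (\<gamma> k) g (\<gamma> (\<kappa> i)) (str C (\<gamma> (\<kappa> i)) g (W i)) X)"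
        using Wi ki X by (simp add: range_proj_def cmp_assoc)
      also have "\<dots> = (if i \<in> ?I then c i *\<^sub>C W i else 0)"
      proof (cases "i \<in> ?I")
        case True
        then show ?thesis using c[OF True] Wi by (simp add: cmp_scale_right)
      next
        case False
        then have "k \<noteq> \<kappa> i" using i by auto
        then show ?thesis using Hom_gam_distinct[OF k ki _ Z] False Wi ki by simp
      qed
      finally show "cmp C (\<gamma> k) g g (range_proj C (\<gamma> (\<kappa> i)) g (W i)) X = (if i \<in> ?I then c i *\<^sub>C W i else 0)" .
    qed
    also have "\<dots> = (\<Sum>i\<in>?I. c i *\<^sub>C W i)"
      by (intro sum.mono_neutral_cong_right) auto
    finally have Xsum: "X = (\<Sum>i\<in>?I. c i *\<^sub>C W i)" .
    have "cmp C (\<gamma> k) g (\<gamma> k) (str C (\<gamma> k) g X) (\<Sum>i\<in>?I. ipr g (farr F (\<gamma> k) g (W i) x) \<psi> *\<^sub>C W i)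
        = (\<Sum>i\<in>?I. ipr g (farr F (\<gamma> k) g (W i) x) \<psi> *\<^sub>C cmp C (\<gamma> k) g (\<gamma> k) (str C (\<gamma> k) g X) (W i))"
      using X WI by (intro cmp_lincomb_right) simp_all
    also have "\<dots> = (\<Sum>i\<in>?I. (cnj (c i) * ipr g (farr F (\<gamma> k) g (W i) x) \<psi>) *\<^sub>C ide C (\<gamma> k))"
    proof (rule sum.cong[OF refl])
      fix i assume i: "i \<in> ?I"
      have "cmp C (\<gamma> k) g (\<gamma> k) (str C (\<gamma> k) g X) (W i)
          = str C (\<gamma> k) (\<gamma> k) (cmp C (\<gamma> k) g (\<gamma> k) (str C (\<gamma> k) g (W i)) X)"
        using X WI[OF i] by (simp add: str_cmp)
      also have "\<dots> = cnj (c i) *\<^sub>C ide C (\<gamma> k)" by (simp add: c[OF i] str_scale)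
      finally show "ipr g (farr F (\<gamma> k) g (W i) x) \<psi> *\<^sub>C cmp C (\<gamma> k) g (\<gamma> k) (str C (\<gamma> k) g X) (W i)
          = (cnj (c i) * ipr g (farr F (\<gamma> k) g (W i) x) \<psi>) *\<^sub>C ide C (\<gamma> k)"
        by (simp add: scaleC_scaleC mult.commute)
    qed
    also have "\<dots> = (\<Sum>i\<in>?I. cnj (c i) * ipr g (farr F (\<gamma> k) g (W i) x) \<psi>) *\<^sub>C ide C (\<gamma> k)"
      by (simp add: cvec.scale_sum_left)
    also have "(\<Sum>i\<in>?I. cnj (c i) * ipr g (farr F (\<gamma> k) g (W i) x) \<psi>) = ipr g (farr F (\<gamma> k) g X x) \<psi>"
    proof -
      have "farr F (\<gamma> k) g X x = (\<Sum>i\<in>?I. c i *\<^sub>C farr F (\<gamma> k) g (W i) x)"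
        unfolding Xsum using WI by (intro farr_lincomb_arrow) simp_all
      moreover have "ipr g (\<Sum>i\<in>?I. c i *\<^sub>C farr F (\<gamma> k) g (W i) x) \<psi>
          = (\<Sum>i\<in>?I. cnj (c i) * ipr g (farr F (\<gamma> k) g (W i) x) \<psi>)"
        by (rule ipr_lincomb_left[OF g \<psi>]) (use WI x in \<open>simp_all add: farr_in\<close>)
      ultimately show ?thesis by simp
    qed
    finally show ?thesis .
  qed
  moreover have "(\<Sum>i\<in>?I. ipr g (farr F (\<gamma> k) g (W i) x) \<psi> *\<^sub>C W i) \<in> Hom C (\<gamma> k) g"
    using WI by (intro Hom_sum) simp_all
  ultimately show ?thesis by (simp add: is_coordinate_def)
qed

lemma is_coordinate_coordinate:
  assumes "k \<in> Irr" "g \<in> deg" "x \<in> V (\<gamma> k)" "\<psi> \<in> V g"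
  shows "is_coordinate k g x \<psi> (coordinate k g x \<psi>)"
proof -
  obtain n :: nat and \<kappa> W where d: "\<And>i. i < n \<Longrightarrow> \<kappa> i \<in> Irr" "\<And>i. i < n \<Longrightarrow> isometry C (\<gamma> (\<kappa> i)) g (W i)"
    "(\<Sum>i<n. range_proj C (\<gamma> (\<kappa> i)) g (W i)) = ide C g"
    using deg_decomposition[OF assms(2)] by blast
  have dec: "is_coordinate k g x \<psi> (\<Sum>i\<in>{i. i < n \<and> \<kappa> i = k}. ipr g (farr F (\<gamma> k) g (W i) x) \<psi> *\<^sub>C W i)"
    by (rule is_coordinate_decomposition[OF assms]) (use d in auto)
  show ?thesis unfolding coordinate_eqI[OF assms(1,2) dec] by (rule dec)
qed

lemma coordinate_in [simp]:
  assumes "k \<in> Irr" "g \<in> deg" "x \<in> V (\<gamma> k)" "\<psi> \<in> V g"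
  shows "coordinate k g x \<psi> \<in> Hom C (\<gamma> k) g"
  using is_coordinate_coordinate[OF assms] by (simp add: is_coordinate_def)

lemma coordinate_pairing:
  assumes "k \<in> Irr" "g \<in> deg" "x \<in> V (\<gamma> k)" "\<psi> \<in> V g" "W \<in> Hom C (\<gamma> k) g"
  shows "cmp C (\<gamma> k) g (\<gamma> k) (str C (\<gamma> k) g W) (coordinate k g x \<psi>) = ipr g (farr F (\<gamma> k) g W x) \<psi> *\<^sub>C ide C (\<gamma> k)"
  using is_coordinate_coordinate[OF assms(1-4)] assms(5) by (simp add: is_coordinate_def)

lemma coordinate_natural:
  assumes k: "k \<in> Irr" and g: "g \<in> deg" and g': "g' \<in> deg" and x: "x \<in> V (\<gamma> k)" and \<psi>: "\<psi> \<in> V g" and f: "f \<in> Hom C g g'"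
  shows "cmp C (\<gamma> k) g g' f (coordinate k g x \<psi>) = coordinate k g' x (farr F g g' f \<psi>)"
proof (rule sym, rule coordinate_eqI[OF k g'])
  note [simp] = k g g' x \<psi> f
  have "cmp C (\<gamma> k) g' (\<gamma> k) (str C (\<gamma> k) g' W) (cmp C (\<gamma> k) g g' f (coordinate k g x \<psi>))
      = ipr g' (farr F (\<gamma> k) g' W x) (farr F g g' f \<psi>) *\<^sub>C ide C (\<gamma> k)" if W [simp]: "W \<in> Hom C (\<gamma> k) g'" for W
  proof -
    have "cmp C (\<gamma> k) g' (\<gamma> k) (str C (\<gamma> k) g' W) (cmp C (\<gamma> k) g g' f (coordinate k g x \<psi>))
        = cmp C (\<gamma> k) g (\<gamma> k) (str C (\<gamma> k) g (cmp C (\<gamma> k) g' g (str C g g' f) W)) (coordinate k g x \<psi>)"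
      by (simp add: str_cmp cmp_assoc)
    also have "\<dots> = ipr g (farr F (\<gamma> k) g (cmp C (\<gamma> k) g' g (str C g g' f) W) x) \<psi> *\<^sub>C ide C (\<gamma> k)"
      by (simp add: coordinate_pairing)
    also have "ipr g (farr F (\<gamma> k) g (cmp C (\<gamma> k) g' g (str C g g' f) W) x) \<psi>
        = ipr g' (farr F (\<gamma> k) g' W x) (farr F g g' f \<psi>)"
      by (simp add: farr_cmp farr_str farr_in)
    finally show ?thesis .
  qed
  then show "is_coordinate k g' x (farr F g g' f \<psi>) (cmp C (\<gamma> k) g g' f (coordinate k g x \<psi>))"
    by (simp add: is_coordinate_def)
qed

lemma coordinate_add:
  assumes "k \<in> Irr" "g \<in> deg" "x \<in> V (\<gamma> k)" "\<psi> \<in> V g" "\<phi> \<in> V g"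
  shows "coordinate k g x (\<psi> + \<phi>) = coordinate k g x \<psi> + coordinate k g x \<phi>"
  using assms
  by (intro coordinate_eqI) (simp_all add: is_coordinate_def cmp_add_right coordinate_pairing ipr_add_right farr_in scaleC_add_left)

lemma coordinate_scale:
  assumes "k \<in> Irr" "g \<in> deg" "x \<in> V (\<gamma> k)" "\<psi> \<in> V g"
  shows "coordinate k g x (c *\<^sub>C \<psi>) = c *\<^sub>C coordinate k g x \<psi>"
  using assms
  by (intro coordinate_eqI) (simp_all add: is_coordinate_def cmp_scale_right coordinate_pairing ipr_scale_right farr_in scaleC_scaleC)

lemma coordinate_add_left:
  assumes "k \<in> Irr" "g \<in> deg" "x \<in> V (\<gamma> k)" "y \<in> V (\<gamma> k)" "\<psi> \<in> V g"
  shows "coordinate k g (x + y) \<psi> = coordinate k g x \<psi> + coordinate k g y \<psi>"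
  using assms
  by (intro coordinate_eqI) (simp_all add: is_coordinate_def cmp_add_right coordinate_pairing farr_add ipr_add_left farr_in scaleC_add_left)

lemma coordinate_scale_left:
  assumes "k \<in> Irr" "g \<in> deg" "x \<in> V (\<gamma> k)" "\<psi> \<in> V g"
  shows "coordinate k g (c *\<^sub>C x) \<psi> = cnj c *\<^sub>C coordinate k g x \<psi>"
  using assms
  by (intro coordinate_eqI) (simp_all add: is_coordinate_def cmp_scale_right coordinate_pairing farr_scale ipr_scale_left farr_in scaleC_scaleC)

lemma coordinate_gam:
  assumes k: "k \<in> Irr" and l: "l \<in> Irr" and x: "x \<in> V (\<gamma> k)" and \<psi>: "\<psi> \<in> V (\<gamma> l)"
  shows "coordinate k (\<gamma> l) x \<psi> = (if k = l then ipr (\<gamma> k) x \<psi> *\<^sub>C ide C (\<gamma> k) else 0)"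
proof (rule coordinate_eqI[OF k gam_deg[OF l]])
  note [simp] = k l x \<psi>
  show "is_coordinate k (\<gamma> l) x \<psi> (if k = l then ipr (\<gamma> k) x \<psi> *\<^sub>C ide C (\<gamma> k) else 0)"
  proof (cases "k = l")
    case True
    have "cmp C (\<gamma> l) (\<gamma> l) (\<gamma> l) (str C (\<gamma> l) (\<gamma> l) W) (ipr (\<gamma> l) x \<psi> *\<^sub>C ide C (\<gamma> l))
        = ipr (\<gamma> l) (farr F (\<gamma> l) (\<gamma> l) W x) \<psi> *\<^sub>C ide C (\<gamma> l)" if W: "W \<in> Hom C (\<gamma> l) (\<gamma> l)" for W
    proof -
      obtain c where c: "W = c *\<^sub>C ide C (\<gamma> l)" using Hom_gam_scalar[OF l W] by blast
      have "x \<in> V (\<gamma> l)" using x True by simp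
      then show ?thesis unfolding c
        by (simp add: str_scale cmp_scale_left cmp_scale_right scaleC_scaleC farr_scale_arrow farr_ide ipr_scale_left mult.commute)
    qed
    then show ?thesis using True by (simp add: is_coordinate_def)
  next
    case False
    have "farr F (\<gamma> k) (\<gamma> l) 0 x = 0" using farr_scale_arrow[of "\<gamma> k" "\<gamma> l" 0 0 x] by simp
    moreover have "ipr (\<gamma> l) 0 \<psi> = 0" using ipr_scale_left[of "\<gamma> l" \<psi> \<psi> 0] by simp
    ultimately show ?thesis
      by (auto simp: is_coordinate_def False dest!: Hom_gam_distinct[OF k l False])
  qed
qed

lemma coordinate_basis:
  fixes N :: nat
  assumes k: "k \<in> Irr" and g: "g \<in> deg" and x: "x \<in> V (\<gamma> k)" and \<psi>: "\<psi> \<in> V g"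
    and span: "cvec.span (B ` {..<N}) = Hom C (\<gamma> k) g"
    and on: "\<And>\<alpha> \<beta>. \<alpha> < N \<Longrightarrow> \<beta> < N \<Longrightarrow> cmp C (\<gamma> k) g (\<gamma> k) (str C (\<gamma> k) g (B \<alpha>)) (B \<beta>) = (if \<alpha> = \<beta> then ide C (\<gamma> k) else 0)"
  shows "coordinate k g x \<psi> = (\<Sum>\<alpha><N. ipr g (farr F (\<gamma> k) g (B \<alpha>) x) \<psi> *\<^sub>C B \<alpha>)"
proof (rule coordinate_eqI[OF k g])
  note [simp] = k g x \<psi>
  have B: "B \<alpha> \<in> Hom C (\<gamma> k) g" if "\<alpha> < N" for \<alpha>
    using cvec.span_base[of "B \<alpha>" "B ` {..<N}"] that span by auto
  define \<theta> where "\<theta> = (\<Sum>\<alpha><N. ipr g (farr F (\<gamma> k) g (B \<alpha>) x) \<psi> *\<^sub>C B \<alpha>)"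
  have \<theta> [simp]: "\<theta> \<in> Hom C (\<gamma> k) g" unfolding \<theta>_def using B by (intro Hom_sum) simp_all
  have "cmp C (\<gamma> k) g (\<gamma> k) (str C (\<gamma> k) g W) \<theta> = ipr g (farr F (\<gamma> k) g W x) \<psi> *\<^sub>C ide C (\<gamma> k)"
    if W: "W \<in> Hom C (\<gamma> k) g" for W
  proof -
    have "W \<in> cvec.span (B ` {..<N})" using W span by simp
    then have "W \<in> Hom C (\<gamma> k) g \<and> cmp C (\<gamma> k) g (\<gamma> k) (str C (\<gamma> k) g W) \<theta> = ipr g (farr F (\<gamma> k) g W x) \<psi> *\<^sub>C ide C (\<gamma> k)"
    proof (induction rule: cvec.span_induct_alt)
      case base
      have "farr F (\<gamma> k) g 0 x = 0" using farr_scale_arrow[of "\<gamma> k" g 0 0 x] by simp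
      moreover have "ipr g 0 \<psi> = 0" using ipr_scale_left[of g \<psi> \<psi> 0] by simp
      ultimately show ?case by simp
    next
      case (step c Y Z)
      then obtain \<beta> where \<beta>: "\<beta> < N" "Y = B \<beta>" by blast
      have Y: "Y \<in> Hom C (\<gamma> k) g" using B \<beta> by simp
      have "cmp C (\<gamma> k) g (\<gamma> k) (str C (\<gamma> k) g Y) \<theta>
          = (\<Sum>\<alpha><N. ipr g (farr F (\<gamma> k) g (B \<alpha>) x) \<psi> *\<^sub>C cmp C (\<gamma> k) g (\<gamma> k) (str C (\<gamma> k) g Y) (B \<alpha>))"
        unfolding \<theta>_def using Y B by (intro cmp_lincomb_right) simp_all
      also have "\<dots> = (\<Sum>\<alpha><N. if \<alpha> = \<beta> then ipr g (farr F (\<gamma> k) g (B \<beta>) x) \<psi> *\<^sub>C ide C (\<gamma> k) else 0)"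
        using \<beta> by (intro sum.cong) (auto simp: on)
      also have "\<dots> = ipr g (farr F (\<gamma> k) g Y x) \<psi> *\<^sub>C ide C (\<gamma> k)" using \<beta> by simp
      finally have "cmp C (\<gamma> k) g (\<gamma> k) (str C (\<gamma> k) g Y) \<theta> = ipr g (farr F (\<gamma> k) g Y x) \<psi> *\<^sub>C ide C (\<gamma> k)" .
      then show ?case
        using Y step by (simp add: str_add str_scale cmp_add_left cmp_scale_left farr_add_arrow farr_scale_arrow
            ipr_add_left ipr_scale_left V_scale farr_in scaleC_add_left scaleC_scaleC)
    qed
    then show ?thesis ..
  qed
  then show "is_coordinate k g x \<psi> (\<Sum>\<alpha><N. ipr g (farr F (\<gamma> k) g (B \<alpha>) x) \<psi> *\<^sub>C B \<alpha>)"
    using \<theta> by (simp add: is_coordinate_def \<theta>_def)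
qed

text \<open>
  Only these classes occur in \<open>g\<close>; they index all sums over coordinates.
\<close>

definition constituents :: "'o \<Rightarrow> 'o set set"
  where "constituents g = {k \<in> Irr. \<exists>T\<in>Hom C (\<gamma> k) g. T \<noteq> 0}"

lemma constituents_finite [simp]: "g \<in> obj C \<Longrightarrow> finite (constituents g)"
  unfolding constituents_def by (rule finite_classes)

lemma constituents_Irr: "k \<in> constituents g \<Longrightarrow> k \<in> Irr"
  by (simp add: constituents_def)

text \<open>
  Decompose \<open>id\<^sub>g\<close> into copies of the \<open>\<gamma>\<^sub>k\<close> and expand the components of \<open>\<psi>\<close> in orthonormal bases of the
  \<open>H\<^sub>k\<close>: the result is an expansion of \<open>\<psi>\<close> in terms of its coordinates.
\<close>

lemma coordinate_complete:
  assumes g: "g \<in> deg" and \<psi>: "\<psi> \<in> V g"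
  shows "(\<Sum>k\<in>constituents g. \<Sum>e\<in>onb k. farr F (\<gamma> k) g (coordinate k g e \<psi>) e) = \<psi>"
proof -
  note [simp] = g \<psi>
  obtain n :: nat and \<kappa> W where \<kappa>: "\<And>i. i < n \<Longrightarrow> \<kappa> i \<in> Irr" and W: "\<And>i. i < n \<Longrightarrow> isometry C (\<gamma> (\<kappa> i)) g (W i)"
    and sum: "(\<Sum>i<n. range_proj C (\<gamma> (\<kappa> i)) g (W i)) = ide C g"
    using deg_decomposition[OF g] by blast
  have WI: "W i \<in> Hom C (\<gamma> (\<kappa> i)) g" if "i < n" for i using isometryD(1)[OF W] that by auto
  define t where "t i k = (\<Sum>e\<in>onb k. ipr g (farr F (\<gamma> k) g (W i) e) \<psi> *\<^sub>C farr F (\<gamma> k) g (W i) e)" for i k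
  have t: "t i (\<kappa> i) = farr F g g (range_proj C (\<gamma> (\<kappa> i)) g (W i)) \<psi>" if i: "i < n" for i
  proof -
    note [simp] = \<kappa>[OF i] WI[OF i]
    define \<phi> where "\<phi> = farr F g (\<gamma> (\<kappa> i)) (str C (\<gamma> (\<kappa> i)) g (W i)) \<psi>"
    have \<phi>: "\<phi> \<in> V (\<gamma> (\<kappa> i))" unfolding \<phi>_def by (rule farr_in) simp_all
    have "farr F g g (range_proj C (\<gamma> (\<kappa> i)) g (W i)) \<psi> = farr F (\<gamma> (\<kappa> i)) g (W i) \<phi>"
      unfolding range_proj_def \<phi>_def by (rule farr_cmp) simp_all
    also have "\<dots> = farr F (\<gamma> (\<kappa> i)) g (W i) (\<Sum>e\<in>onb (\<kappa> i). ipr (\<gamma> (\<kappa> i)) e \<phi> *\<^sub>C e)"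
      using \<phi> by (simp add: onb_expand)
    also have "\<dots> = (\<Sum>e\<in>onb (\<kappa> i). ipr (\<gamma> (\<kappa> i)) e \<phi> *\<^sub>C farr F (\<gamma> (\<kappa> i)) g (W i) e)"
      by (rule farr_lincomb) (simp_all add: onb_in)
    also have "\<dots> = t i (\<kappa> i)"
      unfolding t_def \<phi>_def by (simp add: farr_str_right onb_in)
    finally show ?thesis by simp
  qed
  have constituents: "\<kappa> i \<in> constituents g" if i: "i < n" for i
  proof -
    have "W i \<noteq> 0"
    proof
      assume "W i = 0"
      then have "ide C (\<gamma> (\<kappa> i)) = 0" using isometryD[OF W[OF i]] \<kappa>[OF i] by simp
      then show False using gam_ide_nonzero[OF \<kappa>[OF i]] by simp
    qed
    then show ?thesis using \<kappa>[OF i] WI[OF i] by (auto simp: constituents_def)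
  qed
  have "(\<Sum>e\<in>onb k. farr F (\<gamma> k) g (coordinate k g e \<psi>) e) = (\<Sum>i\<in>{i. i < n \<and> \<kappa> i = k}. t i k)" if k [simp]: "k \<in> Irr" for k
  proof -
    have "(\<Sum>e\<in>onb k. farr F (\<gamma> k) g (coordinate k g e \<psi>) e)
        = (\<Sum>e\<in>onb k. \<Sum>i\<in>{i. i < n \<and> \<kappa> i = k}. ipr g (farr F (\<gamma> k) g (W i) e) \<psi> *\<^sub>C farr F (\<gamma> k) g (W i) e)"
    proof (rule sum.cong[OF refl])
      fix e assume e: "e \<in> onb k"
      have "coordinate k g e \<psi> = (\<Sum>i\<in>{i. i < n \<and> \<kappa> i = k}. ipr g (farr F (\<gamma> k) g (W i) e) \<psi> *\<^sub>C W i)"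
        by (rule coordinate_eqI[OF k g], rule is_coordinate_decomposition[OF k g onb_in[OF k e] \<psi>]) (use \<kappa> W sum in auto)
      show "farr F (\<gamma> k) g (coordinate k g e \<psi>) e
          = (\<Sum>i\<in>{i. i < n \<and> \<kappa> i = k}. ipr g (farr F (\<gamma> k) g (W i) e) \<psi> *\<^sub>C farr F (\<gamma> k) g (W i) e)"
        unfolding \<open>coordinate k g e \<psi> = _\<close> using WI by (intro farr_lincomb_arrow) auto
    qed
    then show ?thesis by (simp add: t_def) (rule sum.swap)
  qed
  then have "(\<Sum>k\<in>constituents g. \<Sum>e\<in>onb k. farr F (\<gamma> k) g (coordinate k g e \<psi>) e)
      = (\<Sum>k\<in>constituents g. \<Sum>i\<in>{i\<in>{..<n}. \<kappa> i = k}. t i (\<kappa> i))"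
    by (intro sum.cong refl) (auto simp: constituents_Irr intro!: sum.cong)
  also have "\<dots> = (\<Sum>i<n. t i (\<kappa> i))"
    using constituents by (intro sum.group) auto
  also have "\<dots> = (\<Sum>i<n. farr F g g (range_proj C (\<gamma> (\<kappa> i)) g (W i)) \<psi>)"
    by (intro sum.cong refl) (simp add: t)
  also have "\<dots> = farr F g g (\<Sum>i<n. range_proj C (\<gamma> (\<kappa> i)) g (W i)) \<psi>"
    using W \<kappa> by (intro farr_sum_arrow[symmetric]) simp_all
  finally show ?thesis by (simp add: sum farr_ide)
qed

section \<open>Elements of the crossed product as coends\<close>


abbreviation coordinate_arrow :: "'o set \<Rightarrow> 'o \<Rightarrow> 'v \<Rightarrow> 'v \<Rightarrow> ('o, 'a) arrow"
  where "coordinate_arrow k g x \<psi> \<equiv> Arr (\<gamma> k) g (coordinate k g x \<psi>)"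

text \<open>
  \<open>coend g r A \<psi>\<close> is the arrow of the crossed product determined by \<open>A : g r \<rightarrow> s\<close> and
  \<open>\<psi> \<in> F(g)\<close> for an arbitrary degenerate \<open>g\<close>, not only for one of the chosen representatives
  \<open>\<gamma>\<^sub>k\<close>. It exhibits the Hom-spaces of the crossed product as the coend of
  \<open>Hom(g r, s) \<otimes> F(g)\<close> over \<open>g\<close>: the defining relation is naturality.
\<close>

definition coend :: "'o \<Rightarrow> 'o \<Rightarrow> ('o, 'a) arrow \<Rightarrow> 'v \<Rightarrow> 'o set \<Rightarrow> 'v \<Rightarrow> 'a"
  where "coend g r A \<psi> = (\<lambda>k x. if k \<in> Irr \<and> x \<in> V (\<gamma> k) then und (A \<cdot> (coordinate_arrow k g x \<psi> \<boxtimes> idt r)) else 0)"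

lemma coend_natural:
  assumes A: "arr A" "src A = g' \<odot> r" and f: "arr f" "src f = g" "tgt f = g'"
    and g: "g \<in> deg" "g' \<in> deg" and r: "r \<in> obj C" and \<psi>: "\<psi> \<in> V g"
  shows "coend g r (A \<cdot> (f \<boxtimes> idt r)) \<psi> = coend g' r A (farr F g g' (und f) \<psi>)"
proof (intro ext)
  fix k x
  note [simp] = A f g r \<psi>
  have "(A \<cdot> (f \<boxtimes> idt r)) \<cdot> (coordinate_arrow k g x \<psi> \<boxtimes> idt r) = A \<cdot> (coordinate_arrow k g' x (farr F g g' (und f) \<psi>) \<boxtimes> idt r)"
    if [simp]: "k \<in> Irr" "x \<in> V (\<gamma> k)"
  proof -
    have fH: "und f \<in> Hom C g g'" using f arr_und by blast
    have "f \<cdot> coordinate_arrow k g x \<psi> = coordinate_arrow k g' x (farr F g g' (und f) \<psi>)"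
      using fH coordinate_natural[of k g g' x \<psi> "und f"] by (simp add: compose_def)
    then show ?thesis by (simp add: compose_assoc flip: whisker_right)
  qed
  then show "coend g r (A \<cdot> (f \<boxtimes> idt r)) \<psi> k x = coend g' r A (farr F g g' (und f) \<psi>) k x"
    by (simp add: coend_def)
qed

lemma coend_add:
  assumes "arr A" "src A = g \<odot> r" "g \<in> deg" "r \<in> obj C" "\<psi> \<in> V g" "\<phi> \<in> V g"
  shows "coend g r A (\<psi> + \<phi>) = coend g r A \<psi> + coend g r A \<phi>"
  using assms by (intro ext) (simp add: coend_def coordinate_add und_whisker_add)

lemma coend_scale:
  assumes "arr A" "src A = g \<odot> r" "g \<in> deg" "r \<in> obj C" "\<psi> \<in> V g"
  shows "coend g r A (c *\<^sub>C \<psi>) = c *\<^sub>C coend g r A \<psi>"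
  using assms by (intro ext) (simp add: coend_def coordinate_scale und_whisker_scale scaleC_fun_apply)

lemma coend_zero:
  assumes "arr A" "src A = g \<odot> r" "g \<in> deg" "r \<in> obj C"
  shows "coend g r A 0 = 0"
  using coend_scale[OF assms V_zero[OF assms(3)], of 0] by simp

lemma coend_sum:
  assumes "arr A" "src A = g \<odot> r" "g \<in> deg" "r \<in> obj C" "\<And>i. i \<in> I \<Longrightarrow> \<psi> i \<in> V g"
  shows "coend g r A (sum \<psi> I) = (\<Sum>i\<in>I. coend g r A (\<psi> i))"
  using assms(5)
proof (induction I rule: infinite_finite_induct)
  case (insert j I)
  then show ?case using coend_add[OF assms(1-4), of "\<psi> j" "sum \<psi> I"] V_sum[OF assms(3), of I \<psi>] by simp
qed (simp_all add: coend_zero[OF assms(1-4)])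

lemma coend_und_add:
  assumes D: "arr D" "arr D1" "arr D2" "src D = g \<odot> r" "src D1 = g \<odot> r" "src D2 = g \<odot> r" "tgt D1 = tgt D" "tgt D2 = tgt D"
    and und: "und D = und D1 + und D2" and g: "g \<in> deg" "r \<in> obj C" "\<psi> \<in> V g"
  shows "coend g r D \<psi> = coend g r D1 \<psi> + coend g r D2 \<psi>"
proof (intro ext)
  fix k x
  have H: "und D1 \<in> Hom C (g \<odot> r) (tgt D)" "und D2 \<in> Hom C (g \<odot> r) (tgt D)"
    using D by (auto intro!: arr_und)
  have "und (D \<cdot> E) = und (D1 \<cdot> E) + und (D2 \<cdot> E)" if E: "arr E" "tgt E = g \<odot> r" for E
    using D E H g arr_und[OF E(1) refl E(2)] by (simp add: und_simps(2) und cmp_add_left)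
  then show "coend g r D \<psi> k x = (coend g r D1 \<psi> + coend g r D2 \<psi>) k x"
    using g by (simp add: coend_def)
qed

lemma coend_und_scale:
  assumes D: "arr D" "arr D1" "src D = g \<odot> r" "src D1 = g \<odot> r" "tgt D1 = tgt D"
    and und: "und D = c *\<^sub>C und D1" and g: "g \<in> deg" "r \<in> obj C" "\<psi> \<in> V g"
  shows "coend g r D \<psi> = c *\<^sub>C coend g r D1 \<psi>"
proof (intro ext)
  fix k x
  have H: "und D1 \<in> Hom C (g \<odot> r) (tgt D)"
    using D by (auto intro!: arr_und)
  have "und (D \<cdot> E) = c *\<^sub>C und (D1 \<cdot> E)" if E: "arr E" "tgt E = g \<odot> r" for E
    using D E H g arr_und[OF E(1) refl E(2)] by (simp add: und_simps(2) und cmp_scale_left)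
  then show "coend g r D \<psi> k x = (c *\<^sub>C coend g r D1 \<psi>) k x"
    using g by (simp add: coend_def scaleC_fun_apply)
qed

lemma coend_arrow_add:
  assumes "S \<in> Hom C a b" "T \<in> Hom C a b" "a \<in> obj C" "b \<in> obj C" "arr B" "tgt B = a" "src B = g \<odot> r"
    and "g \<in> deg" "r \<in> obj C" "\<psi> \<in> V g"
  shows "coend g r (Arr a b (S + T) \<cdot> B) \<psi> = coend g r (Arr a b S \<cdot> B) \<psi> + coend g r (Arr a b T \<cdot> B) \<psi>"
  using assms arr_und[of B "g \<odot> r" a] by (intro coend_und_add) (simp_all add: und_simps(2) cmp_add_left)

lemma coend_arrow_scale:
  assumes "S \<in> Hom C a b" "a \<in> obj C" "b \<in> obj C" "arr B" "tgt B = a" "src B = g \<odot> r"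
    and "g \<in> deg" "r \<in> obj C" "\<psi> \<in> V g"
  shows "coend g r (Arr a b (c *\<^sub>C S) \<cdot> B) \<psi> = c *\<^sub>C coend g r (Arr a b S \<cdot> B) \<psi>"
  using assms arr_und[of B "g \<odot> r" a] by (intro coend_und_scale) (simp_all add: und_simps(2) cmp_scale_left)

lemma coend_arrow_add_right:
  assumes "S \<in> Hom C a b" "T \<in> Hom C a b" "a \<in> obj C" "b \<in> obj C" "h \<in> obj C" "arr A" "src A = h \<odot> b"
    and "h \<odot> a = g \<odot> r" "g \<in> deg" "r \<in> obj C" "\<psi> \<in> V g"
  shows "coend g r (A \<cdot> (idt h \<boxtimes> Arr a b (S + T))) \<psi>
    = coend g r (A \<cdot> (idt h \<boxtimes> Arr a b S)) \<psi> + coend g r (A \<cdot> (idt h \<boxtimes> Arr a b T)) \<psi>"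
proof -
  have "ten C h h a b (ide C h) X \<in> Hom C (g \<odot> r) (h \<odot> b)" if "X \<in> Hom C a b" for X
    using ten_in[of h h a b "ide C h" X] assms that by simp
  then show ?thesis using assms arr_und[OF assms(6,7) refl]
    by (intro coend_und_add) (simp_all add: und_simps ten_add_right cmp_add_right)
qed

lemma coend_arrow_scale_right:
  assumes "S \<in> Hom C a b" "a \<in> obj C" "b \<in> obj C" "h \<in> obj C" "arr A" "src A = h \<odot> b"
    and "h \<odot> a = g \<odot> r" "g \<in> deg" "r \<in> obj C" "\<psi> \<in> V g"
  shows "coend g r (A \<cdot> (idt h \<boxtimes> Arr a b (c *\<^sub>C S))) \<psi> = c *\<^sub>C coend g r (A \<cdot> (idt h \<boxtimes> Arr a b S)) \<psi>"
proof -
  have "ten C h h a b (ide C h) X \<in> Hom C (g \<odot> r) (h \<odot> b)" if "X \<in> Hom C a b" for X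
    using ten_in[of h h a b "ide C h" X] assms that by simp
  then show ?thesis using assms arr_und[OF assms(5,6) refl]
    by (intro coend_und_scale) (simp_all add: und_simps ten_scale_right cmp_scale_right)
qed

text \<open>
  For a representative \<open>\<gamma>\<^sub>l\<close> Schur's lemma leaves only the component \<open>l\<close>; there \<open>coend\<close> is the
  elementary tensor of the definition of the crossed product.
\<close>

lemma coend_gam_apply:
  assumes "k \<in> Irr" "l \<in> Irr" "arr A" "src A = \<gamma> l \<odot> r" "r \<in> obj C" "\<psi> \<in> V (\<gamma> l)" "x \<in> V (\<gamma> k)"
  shows "coend (\<gamma> l) r A \<psi> k x = (if k = l then ipr (\<gamma> l) x \<psi> *\<^sub>C und A else 0)"
proof -
  have 1: "und (A \<cdot> (Arr (\<gamma> k) (\<gamma> l) (c *\<^sub>C S) \<boxtimes> idt r)) = c *\<^sub>C und (A \<cdot> (Arr (\<gamma> k) (\<gamma> l) S \<boxtimes> idt r))"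
    if "S \<in> Hom C (\<gamma> k) (\<gamma> l)" for c S
    using assms that by (intro und_whisker_scale) simp_all
  show ?thesis
  proof (cases "k = l")
    case True
    have "A \<cdot> (Arr (\<gamma> l) (\<gamma> l) (ide C (\<gamma> l)) \<boxtimes> idt r) = A"
      using assms by (simp add: idt_tensor flip: idt_def)
    then show ?thesis using 1[of "ide C (\<gamma> k)" "ipr (\<gamma> k) x \<psi>"] assms True by (simp add: coend_def coordinate_gam)
  next
    case False
    then show ?thesis using 1[of 0 0] assms by (simp add: coend_def coordinate_gam)
  qed
qed

lemma etens_coend:
  assumes "l \<in> Irr" "T \<in> Hom C (\<gamma> l \<odot> r) s" "r \<in> obj C" "s \<in> obj C" "\<psi> \<in> V (\<gamma> l)"
  shows "etens l T \<psi> = coend (\<gamma> l) r (Arr (\<gamma> l \<odot> r) s T) \<psi>"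
proof (intro ext)
  fix k x
  show "etens l T \<psi> k x = coend (\<gamma> l) r (Arr (\<gamma> l \<odot> r) s T) \<psi> k x"
  proof (cases "k \<in> Irr \<and> x \<in> V (\<gamma> k)")
    case True
    then show ?thesis using assms by (cases "k = l") (simp_all add: coend_gam_apply etens_def)
  next
    case False
    then show ?thesis using assms by (auto simp: coend_def etens_def)
  qed
qed

lemma hom0D:
  assumes "X \<in> hom0 r s"
  shows "finite {k. X k \<noteq> 0}" "{k. X k \<noteq> 0} \<subseteq> Irr"
    and "k \<in> Irr \<Longrightarrow> x \<in> V (\<gamma> k) \<Longrightarrow> X k x \<in> Hom C (\<gamma> k \<odot> r) s"
    and "k \<in> Irr \<Longrightarrow> x \<notin> V (\<gamma> k) \<Longrightarrow> X k x = 0"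
    and "k \<notin> Irr \<Longrightarrow> X k = 0"
    and "k \<in> Irr \<Longrightarrow> x \<in> V (\<gamma> k) \<Longrightarrow> y \<in> V (\<gamma> k) \<Longrightarrow> X k (x + y) = X k x + X k y"
    and "k \<in> Irr \<Longrightarrow> x \<in> V (\<gamma> k) \<Longrightarrow> X k (c *\<^sub>C x) = cnj c *\<^sub>C X k x"
  using assms unfolding hom0_def by auto

lemma hom0_subspace:
  assumes "r \<in> obj C" "s \<in> obj C"
  shows "cvec.subspace (hom0 r s)"
proof (intro cvec.subspaceI)
  show "0 \<in> hom0 r s" using assms by (simp add: hom0_def)
  show "X + Y \<in> hom0 r s" if X: "X \<in> hom0 r s" and Y: "Y \<in> hom0 r s" for X Y
  proof -
    have "{k. (X + Y) k \<noteq> 0} \<subseteq> {k. X k \<noteq> 0} \<union> {k. Y k \<noteq> 0}" by auto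
    then have "finite {k. (X + Y) k \<noteq> 0}" "{k. (X + Y) k \<noteq> 0} \<subseteq> Irr"
      using hom0D(1,2)[OF X] hom0D(1,2)[OF Y] by (meson finite_UnI finite_subset, blast)
    then show ?thesis
      using hom0D(3-7)[OF X] hom0D(3-7)[OF Y] assms by (simp add: hom0_def scaleC_add_right)
  qed
  show "c *\<^sub>C X \<in> hom0 r s" if X: "X \<in> hom0 r s" for c X
  proof -
    have "{k. (c *\<^sub>C X) k \<noteq> 0} \<subseteq> {k. X k \<noteq> 0}" by (auto simp: scaleC_fun_apply)
    then have "finite {k. (c *\<^sub>C X) k \<noteq> 0}" "{k. (c *\<^sub>C X) k \<noteq> 0} \<subseteq> Irr"
      using hom0D(1,2)[OF X] by (meson finite_subset, blast)
    then show ?thesis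
      using hom0D(3-7)[OF X] assms by (simp add: hom0_def scaleC_add_right scaleC_fun_apply scaleC_scaleC mult.commute)
  qed
qed

lemmas hom0_zero = cvec.subspace_0[OF hom0_subspace]
  and hom0_add = cvec.subspace_add[OF hom0_subspace]
  and hom0_scale = cvec.subspace_scale[OF hom0_subspace]
  and hom0_sum = cvec.subspace_sum[OF hom0_subspace]

lemma coend_constituents:
  assumes "arr A" "src A = g \<odot> r" "g \<in> deg" "r \<in> obj C" "\<psi> \<in> V g"
  shows "{k. coend g r A \<psi> k \<noteq> 0} \<subseteq> constituents g"
proof
  fix k assume "k \<in> {k. coend g r A \<psi> k \<noteq> 0}"
  then obtain x where x: "coend g r A \<psi> k x \<noteq> 0" by (auto simp: fun_eq_iff)
  then have k: "k \<in> Irr" "x \<in> V (\<gamma> k)" by (auto simp: coend_def split: if_splits)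
  have "coordinate k g x \<psi> \<noteq> 0"
  proof
    assume "coordinate k g x \<psi> = 0"
    moreover have "und (A \<cdot> (Arr (\<gamma> k) g (0 *\<^sub>C 0) \<boxtimes> idt r)) = 0 *\<^sub>C und (A \<cdot> (Arr (\<gamma> k) g 0 \<boxtimes> idt r))"
      using assms k by (intro und_whisker_scale) simp_all
    ultimately show False using x k by (simp add: coend_def)
  qed
  then show "k \<in> constituents g" using k assms coordinate_in[of k g x \<psi>] by (auto simp: constituents_def)
qed

lemma coend_in:
  assumes A: "arr A" "src A = g \<odot> r" "tgt A = s" and "g \<in> deg" "r \<in> obj C" "\<psi> \<in> V g"
  shows "coend g r A \<psi> \<in> hom0 r s"
proof -
  note [simp] = assms
  have "finite {k. coend g r A \<psi> k \<noteq> 0}" "{k. coend g r A \<psi> k \<noteq> 0} \<subseteq> Irr"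
    using coend_constituents[of A g r \<psi>] by (auto intro: finite_subset simp: constituents_Irr)
  moreover have "und (A \<cdot> (coordinate_arrow k g x \<psi> \<boxtimes> idt r)) \<in> Hom C (\<gamma> k \<odot> r) s" if "k \<in> Irr" "x \<in> V (\<gamma> k)" for k x
    using that by (intro arr_und) simp_all
  ultimately show ?thesis
    by (simp add: hom0_def coend_def V_add V_scale coordinate_add_left coordinate_scale_left und_whisker_add und_whisker_scale)
qed

lemma hom0_lincomb:
  assumes "X \<in> hom0 r s" "k \<in> Irr" "\<And>i. i \<in> I \<Longrightarrow> f i \<in> V (\<gamma> k)"
  shows "X k (\<Sum>i\<in>I. c i *\<^sub>C f i) = (\<Sum>i\<in>I. cnj (c i) *\<^sub>C X k (f i))"
  using assms(3)
proof (induction I rule: infinite_finite_induct)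
  case (insert j I)
  have "(\<Sum>i\<in>I. c i *\<^sub>C f i) \<in> V (\<gamma> k)" using insert.prems assms(2) by (intro V_sum) (simp_all add: V_scale)
  then show ?case using insert assms(2) hom0D(6,7)[OF assms(1,2)] by (simp add: V_scale)
qed (use hom0D(7)[OF assms(1,2), of 0 0] V_zero[of "\<gamma> k"] assms(2) in simp_all)

text \<open>
  Expansion over orthonormal bases of the \<open>H\<^sub>k\<close>. It reduces every linear identity between arrows of
  the crossed product to arrows \<open>coend (\<gamma> k) r A \<psi>\<close>.
\<close>

lemma hom0_expand:
  assumes X: "X \<in> hom0 r s" and L: "finite L" "{k. X k \<noteq> 0} \<subseteq> L" "L \<subseteq> Irr" and rs: "r \<in> obj C" "s \<in> obj C"
  shows "X = (\<Sum>k\<in>L. \<Sum>e\<in>onb k. coend (\<gamma> k) r (Arr (\<gamma> k \<odot> r) s (X k e)) e)"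
proof (intro ext)
  fix k x
  show "X k x = (\<Sum>k\<in>L. \<Sum>e\<in>onb k. coend (\<gamma> k) r (Arr (\<gamma> k \<odot> r) s (X k e)) e) k x"
  proof (cases "k \<in> Irr \<and> x \<in> V (\<gamma> k)")
    case False
    then have "X k x = 0" using hom0D(4,5)[OF X, of k] by (cases "k \<in> Irr") auto
    then show ?thesis using False by (auto simp: sum_fun_apply coend_def)
  next
    case True
    then have k: "k \<in> Irr" "x \<in> V (\<gamma> k)" by auto
    have "(\<Sum>l\<in>L. \<Sum>e\<in>onb l. coend (\<gamma> l) r (Arr (\<gamma> l \<odot> r) s (X l e)) e k x)
        = (\<Sum>l\<in>L. if l = k then (\<Sum>e\<in>onb k. ipr (\<gamma> k) x e *\<^sub>C X k e) else 0)"
      using L(3) k rs hom0D(3)[OF X] by (intro sum.cong refl) (auto simp: coend_gam_apply onb_in subset_iff intro!: sum.cong sum.neutral)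
    also have "\<dots> = (if k \<in> L then (\<Sum>e\<in>onb k. ipr (\<gamma> k) x e *\<^sub>C X k e) else 0)"
      using L(1) by simp
    also have "\<dots> = (if k \<in> L then X k (\<Sum>e\<in>onb k. ipr (\<gamma> k) e x *\<^sub>C e) else 0)"
      using k ipr_cnj[of "\<gamma> k" _ x] by (simp add: hom0_lincomb[OF X] onb_in)
    also have "\<dots> = X k x"
    proof (cases "k \<in> L")
      case False
      then have "X k = 0" using L(2) by blast
      then show ?thesis using False by simp
    qed (use k in \<open>simp add: onb_expand\<close>)
    finally show ?thesis by (simp add: sum_fun_apply)
  qed
qed

lemma hom0_induct [consumes 3, case_names zero add coend]:
  assumes X: "X \<in> hom0 r s" and rs: "r \<in> obj C" "s \<in> obj C"
    and zero: "Q 0" and add: "\<And>X Y. X \<in> hom0 r s \<Longrightarrow> Y \<in> hom0 r s \<Longrightarrow> Q X \<Longrightarrow> Q Y \<Longrightarrow> Q (X + Y)"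
    and coend: "\<And>k A \<psi>. k \<in> Irr \<Longrightarrow> arr A \<Longrightarrow> src A = \<gamma> k \<odot> r \<Longrightarrow> tgt A = s \<Longrightarrow> \<psi> \<in> V (\<gamma> k) \<Longrightarrow> Q (coend (\<gamma> k) r A \<psi>)"
  shows "Q X"
proof -
  have sumQ': "Q (sum f I) \<and> sum f I \<in> hom0 r s" if "\<And>i. i \<in> I \<Longrightarrow> Q (f i) \<and> f i \<in> hom0 r s" for f and I :: "'o set set"
    using that
    by (induction I rule: infinite_finite_induct) (simp_all add: zero add hom0_zero[OF rs] hom0_add[OF rs])
  have sumQ'': "Q (sum f I) \<and> sum f I \<in> hom0 r s" if "\<And>i. i \<in> I \<Longrightarrow> Q (f i) \<and> f i \<in> hom0 r s" for f and I :: "'v set"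
    using that
    by (induction I rule: infinite_finite_induct) (simp_all add: zero add hom0_zero[OF rs] hom0_add[OF rs])
  have "Q (\<Sum>k\<in>{k. X k \<noteq> 0}. \<Sum>e\<in>onb k. coend (\<gamma> k) r (Arr (\<gamma> k \<odot> r) s (X k e)) e)"
  proof (rule conjunct1, rule sumQ', rule sumQ'', rule conjI)
    fix k e assume "k \<in> {k. X k \<noteq> 0}" and e: "e \<in> onb k"
    then have k: "k \<in> Irr" using hom0D(2)[OF X] by blast
    have ev: "e \<in> V (\<gamma> k)" using k e onb_in by blast
    show "Q (coend (\<gamma> k) r (Arr (\<gamma> k \<odot> r) s (X k e)) e)"
      using k ev rs hom0D(3)[OF X] by (intro coend) simp_all
    show "coend (\<gamma> k) r (Arr (\<gamma> k \<odot> r) s (X k e)) e \<in> hom0 r s"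
      using k ev rs hom0D(3)[OF X] by (intro coend_in) simp_all
  qed
  then show ?thesis unfolding hom0_expand[OF X hom0D(1)[OF X] subset_refl hom0D(2)[OF X] rs, symmetric] .
qed


section \<open>Composition in the crossed product\<close>

text \<open>
  The double sum defining the composite of elementary tensors is the expansion of the coordinates of
  \<open>\<psi> \<boxtimes> \<phi>\<close> in the chosen basis of \<open>Hom(\<gamma>\<^sub>m, \<gamma>\<^sub>k \<gamma>\<^sub>l)\<close>, so it does not depend on that basis.
\<close>

lemma cmp_et_coend:
  assumes k: "k \<in> Irr" and l: "l \<in> Irr" and rst: "r \<in> obj C" "s \<in> obj C" "t \<in> obj C"
    and A: "A \<in> Hom C (\<gamma> k \<odot> s) t" and T: "T \<in> Hom C (\<gamma> l \<odot> r) s"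
    and \<psi>: "\<psi> \<in> V (\<gamma> k)" and \<phi>: "\<phi> \<in> V (\<gamma> l)"
  shows "cmp_et r s t k A \<psi> l T \<phi> = coend (\<gamma> k \<odot> \<gamma> l) r
    (Arr (\<gamma> k \<odot> s) t A \<cdot> (idt (\<gamma> k) \<boxtimes> Arr (\<gamma> l \<odot> r) s T)) (vt (\<gamma> k) (\<gamma> l) \<psi> \<phi>)"
proof (intro ext)
  fix m x
  note [simp] = k l rst A T \<psi> \<phi>
  let ?A = "Arr (\<gamma> k \<odot> s) t A" and ?T = "Arr (\<gamma> l \<odot> r) s T"
  let ?g = "\<gamma> k \<odot> \<gamma> l"
  define v where "v = vt (\<gamma> k) (\<gamma> l) \<psi> \<phi>"
  have v [simp]: "v \<in> V ?g" by (simp add: v_def vt_in)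
  have g [simp]: "?g \<in> deg" by simp
  have B: "bas P k l m \<alpha> \<in> Hom C (\<gamma> m) ?g" if "m \<in> Irr" "\<alpha> < mult P k l m" for m \<alpha>
    using choices.bas_span[OF k l that(1)] cvec.span_base[of "bas P k l m \<alpha>" "bas P k l m ` {..<mult P k l m}"] that
    by auto
  have on: "cmp C (\<gamma> m) ?g (\<gamma> m) (str C (\<gamma> m) ?g (bas P k l m \<alpha>)) (bas P k l m \<beta>) = (if \<alpha> = \<beta> then ide C (\<gamma> m) else 0)"
    if "m \<in> Irr" "\<alpha> < mult P k l m" "\<beta> < mult P k l m" for m \<alpha> \<beta>
    using choices.bas_orthonormal[OF k l that] by simp
  define M where "M = {m \<in> Irr. 0 < mult P k l m}"
  have "M \<subseteq> constituents ?g"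
  proof
    fix m assume "m \<in> M"
    then have m: "m \<in> Irr" "0 < mult P k l m" by (auto simp: M_def)
    have "bas P k l m 0 \<noteq> 0"
    proof
      assume 0: "bas P k l m 0 = 0"
      have "ide C (\<gamma> m) = 0" using on[OF m(1) m(2) m(2)] m(1) unfolding 0 by simp
      then show False using gam_ide_nonzero m(1) by blast
    qed
    then show "m \<in> constituents ?g" using B[OF m] m(1) by (auto simp: constituents_def)
  qed
  then have fM: "finite M" by (rule finite_subset) simp
  define b where "b m \<alpha> = ?A \<cdot> ((idt (\<gamma> k) \<boxtimes> ?T) \<cdot> (Arr (\<gamma> m) ?g (bas P k l m \<alpha>) \<boxtimes> idt r))" for m \<alpha>
  have "cmp_et r s t k A \<psi> l T \<phi> = (\<Sum>m\<in>M. \<Sum>\<alpha><mult P k l m. etens m (und (b m \<alpha>)) (coef k l m \<alpha> \<psi> \<phi>))"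
    unfolding cmp_et_def b_def M_def by (simp add: und_simps)
  then have "cmp_et r s t k A \<psi> l T \<phi> m x
      = (\<Sum>m'\<in>M. if m' = m then (\<Sum>\<alpha><mult P k l m. etens m (und (b m \<alpha>)) (coef k l m \<alpha> \<psi> \<phi>) m x) else 0)"
    by (simp add: sum_fun_apply) (intro sum.cong refl, auto simp: etens_def)
  also have "\<dots> = (if m \<in> M then (\<Sum>\<alpha><mult P k l m. etens m (und (b m \<alpha>)) (coef k l m \<alpha> \<psi> \<phi>) m x) else 0)"
    using fM by simp
  also have "\<dots> = coend ?g r (?A \<cdot> (idt (\<gamma> k) \<boxtimes> ?T)) v m x"
  proof (cases "m \<in> Irr \<and> x \<in> V (\<gamma> m)")
    case False
    then show ?thesis by (auto simp: M_def etens_def coend_def)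
  next
    case True
    then have m [simp]: "m \<in> Irr" "x \<in> V (\<gamma> m)" by auto
    have "(if m \<in> M then (\<Sum>\<alpha><mult P k l m. etens m (und (b m \<alpha>)) (coef k l m \<alpha> \<psi> \<phi>) m x) else 0)
        = (\<Sum>\<alpha><mult P k l m. ipr (\<gamma> m) x (coef k l m \<alpha> \<psi> \<phi>) *\<^sub>C und (b m \<alpha>))"
      by (auto simp: M_def etens_def)
    also have "\<dots> = (\<Sum>\<alpha><mult P k l m. ipr ?g (farr F (\<gamma> m) ?g (bas P k l m \<alpha>) x) v *\<^sub>C und (b m \<alpha>))"
      using B by (intro sum.cong refl) (simp add: coef_def farr_str_right flip: v_def)
    also have "\<dots> = (\<Sum>\<alpha><mult P k l m. und ((?A \<cdot> (idt (\<gamma> k) \<boxtimes> ?T)) \<cdot>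
        (Arr (\<gamma> m) ?g (ipr ?g (farr F (\<gamma> m) ?g (bas P k l m \<alpha>) x) v *\<^sub>C bas P k l m \<alpha>) \<boxtimes> idt r)))"
    proof (intro sum.cong refl)
      fix \<alpha> assume "\<alpha> \<in> {..<mult P k l m}"
      then have "bas P k l m \<alpha> \<in> Hom C (\<gamma> m) ?g" using B by simp
      then show "ipr ?g (farr F (\<gamma> m) ?g (bas P k l m \<alpha>) x) v *\<^sub>C und (b m \<alpha>) = und ((?A \<cdot> (idt (\<gamma> k) \<boxtimes> ?T)) \<cdot>
        (Arr (\<gamma> m) ?g (ipr ?g (farr F (\<gamma> m) ?g (bas P k l m \<alpha>) x) v *\<^sub>C bas P k l m \<alpha>) \<boxtimes> idt r))"
        by (subst und_whisker_scale) (simp_all add: b_def compose_assoc)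
    qed
    also have "\<dots> = und ((?A \<cdot> (idt (\<gamma> k) \<boxtimes> ?T)) \<cdot>
        (Arr (\<gamma> m) ?g (\<Sum>\<alpha><mult P k l m. ipr ?g (farr F (\<gamma> m) ?g (bas P k l m \<alpha>) x) v *\<^sub>C bas P k l m \<alpha>) \<boxtimes> idt r))"
      using B by (intro und_whisker_sum[symmetric]) simp_all
    also have "(\<Sum>\<alpha><mult P k l m. ipr ?g (farr F (\<gamma> m) ?g (bas P k l m \<alpha>) x) v *\<^sub>C bas P k l m \<alpha>) = coordinate m ?g x v"
      using choices.bas_span[OF k l m(1)] on by (intro coordinate_basis[symmetric]) simp_all
    finally show ?thesis by (simp add: coend_def)
  qed
  finally show "cmp_et r s t k A \<psi> l T \<phi> m x = coend ?g r (?A \<cdot> (idt (\<gamma> k) \<boxtimes> ?T)) (vt (\<gamma> k) (\<gamma> l) \<psi> \<phi>) m x"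
    by (simp add: v_def)
qed

text \<open>
  The composite of two elementary tensors in the form in which its bilinearity is visible. It agrees with
  \<open>cmp_et\<close> on arrows of the right types.
\<close>

definition cmp_coend :: "'o \<Rightarrow> 'o \<Rightarrow> 'o \<Rightarrow> 'o set \<Rightarrow> 'a \<Rightarrow> 'v \<Rightarrow> 'o set \<Rightarrow> 'a \<Rightarrow> 'v \<Rightarrow> 'o set \<Rightarrow> 'v \<Rightarrow> 'a"
  where "cmp_coend r s t k A \<psi> l T \<phi> = coend (\<gamma> k \<odot> \<gamma> l) r
    (Arr (\<gamma> k \<odot> s) t A \<cdot> (idt (\<gamma> k) \<boxtimes> Arr (\<gamma> l \<odot> r) s T)) (vt (\<gamma> k) (\<gamma> l) \<psi> \<phi>)"

lemma cmp_coend_linear: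
  assumes "k \<in> Irr" "l \<in> Irr" "r \<in> obj C" "s \<in> obj C" "t \<in> obj C" "\<psi> \<in> V (\<gamma> k)" "\<phi> \<in> V (\<gamma> l)"
    and A: "A \<in> Hom C (\<gamma> k \<odot> s) t" and T: "T \<in> Hom C (\<gamma> l \<odot> r) s"
  shows "A' \<in> Hom C (\<gamma> k \<odot> s) t \<Longrightarrow> cmp_coend r s t k (A + A') \<psi> l T \<phi> = cmp_coend r s t k A \<psi> l T \<phi> + cmp_coend r s t k A' \<psi> l T \<phi>"
    and "cmp_coend r s t k (c *\<^sub>C A) \<psi> l T \<phi> = c *\<^sub>C cmp_coend r s t k A \<psi> l T \<phi>"
    and "T' \<in> Hom C (\<gamma> l \<odot> r) s \<Longrightarrow> cmp_coend r s t k A \<psi> l (T + T') \<phi> = cmp_coend r s t k A \<psi> l T \<phi> + cmp_coend r s t k A \<psi> l T' \<phi>"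
    and "cmp_coend r s t k A \<psi> l (c *\<^sub>C T) \<phi> = c *\<^sub>C cmp_coend r s t k A \<psi> l T \<phi>"
  unfolding cmp_coend_def using assms
  by (simp_all add: coend_arrow_add coend_arrow_scale coend_arrow_add_right coend_arrow_scale_right vt_in)

lemma cmp_coend_zero:
  assumes "k \<in> Irr" "l \<in> Irr" "r \<in> obj C" "s \<in> obj C" "t \<in> obj C" "\<psi> \<in> V (\<gamma> k)" "\<phi> \<in> V (\<gamma> l)"
  shows "T \<in> Hom C (\<gamma> l \<odot> r) s \<Longrightarrow> cmp_coend r s t k 0 \<psi> l T \<phi> = 0"
    and "A \<in> Hom C (\<gamma> k \<odot> s) t \<Longrightarrow> cmp_coend r s t k A \<psi> l 0 \<phi> = 0"
  using cmp_coend_linear(2)[OF assms, of 0 T 0] cmp_coend_linear(4)[OF assms, of A 0 0] assms by simp_all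

lemma cmp0_sum:
  assumes X: "X \<in> hom0 s t" and Y: "Y \<in> hom0 r s" and rst: "r \<in> obj C" "s \<in> obj C" "t \<in> obj C"
    and L: "finite L" "{k. X k \<noteq> 0} \<subseteq> L" "L \<subseteq> Irr" and M: "finite M" "{k. Y k \<noteq> 0} \<subseteq> M" "M \<subseteq> Irr"
  shows "cmp0 r s t X Y = (\<Sum>k\<in>L. \<Sum>e\<in>onb k. \<Sum>l\<in>M. \<Sum>f\<in>onb l. cmp_coend r s t k (X k e) e l (Y l f) f)"
proof -
  have "cmp0 r s t X Y = (\<Sum>k\<in>{k. X k \<noteq> 0}. \<Sum>e\<in>onb k. \<Sum>l\<in>{k. Y k \<noteq> 0}. \<Sum>f\<in>onb l. cmp_coend r s t k (X k e) e l (Y l f) f)"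
    unfolding cmp0_def cmp_coend_def
  proof (intro sum.cong refl)
    fix k e l f
    assume "k \<in> {k. X k \<noteq> 0}" "e \<in> onb k" "l \<in> {k. Y k \<noteq> 0}" "f \<in> onb l"
    moreover from this have "k \<in> Irr" "l \<in> Irr" using L M by blast+
    ultimately show "cmp_et r s t k (X k e) e l (Y l f) f = coend (\<gamma> k \<odot> \<gamma> l) r
        (Arr (\<gamma> k \<odot> s) t (X k e) \<cdot> (idt (\<gamma> k) \<boxtimes> Arr (\<gamma> l \<odot> r) s (Y l f))) (vt (\<gamma> k) (\<gamma> l) e f)"
      using rst by (intro cmp_et_coend) (simp_all add: onb_in hom0D(3)[OF X] hom0D(3)[OF Y])
  qed
  also have "\<dots> = (\<Sum>k\<in>{k. X k \<noteq> 0}. \<Sum>e\<in>onb k. \<Sum>l\<in>M. \<Sum>f\<in>onb l. cmp_coend r s t k (X k e) e l (Y l f) f)"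
  proof (rule sum.cong[OF refl], rule sum.cong[OF refl], rule sum.mono_neutral_left[OF M(1,2)],
      rule ballI, rule sum.neutral, rule ballI)
    fix k e l f
    assume k: "k \<in> {k. X k \<noteq> 0}" and e: "e \<in> onb k" and l: "l \<in> M - {k. Y k \<noteq> 0}" and f: "f \<in> onb l"
    have kl: "k \<in> Irr" "l \<in> Irr" using k l L M by blast+
    have "Y l = 0" using l by simp
    then show "cmp_coend r s t k (X k e) e l (Y l f) f = 0"
      using cmp_coend_zero(2)[OF kl rst] kl e f by (simp add: onb_in hom0D(3)[OF X])
  qed
  also have "\<dots> = (\<Sum>k\<in>L. \<Sum>e\<in>onb k. \<Sum>l\<in>M. \<Sum>f\<in>onb l. cmp_coend r s t k (X k e) e l (Y l f) f)"
  proof (rule sum.mono_neutral_left[OF L(1,2)], rule ballI, rule sum.neutral, rule ballI, rule sum.neutral,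
      rule ballI, rule sum.neutral, rule ballI)
    fix k e l f
    assume k: "k \<in> L - {k. X k \<noteq> 0}" and e: "e \<in> onb k" and l: "l \<in> M" and f: "f \<in> onb l"
    have kl: "k \<in> Irr" "l \<in> Irr" using k l L M by blast+
    have "X k = 0" using k by simp
    then show "cmp_coend r s t k (X k e) e l (Y l f) f = 0"
      using cmp_coend_zero(1)[OF kl rst] kl e f by (simp add: onb_in hom0D(3)[OF Y])
  qed
  finally show ?thesis .
qed

lemma cmp0_linear_left:
  assumes X: "X \<in> hom0 s t" and X': "X' \<in> hom0 s t" and Y: "Y \<in> hom0 r s" and rst: "r \<in> obj C" "s \<in> obj C" "t \<in> obj C"
  shows "cmp0 r s t (c *\<^sub>C X + X') Y = c *\<^sub>C cmp0 r s t X Y + cmp0 r s t X' Y"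
proof -
  define L where "L = {k. X k \<noteq> 0} \<union> {k. X' k \<noteq> 0}"
  define M where "M = {k. Y k \<noteq> 0}"
  have L: "finite L" "{k. X k \<noteq> 0} \<subseteq> L" "{k. X' k \<noteq> 0} \<subseteq> L" "{k. (c *\<^sub>C X + X') k \<noteq> 0} \<subseteq> L" "L \<subseteq> Irr"
    using hom0D(1,2)[OF X] hom0D(1,2)[OF X'] by (auto simp: L_def scaleC_fun_apply)
  have M: "finite M" "{k. Y k \<noteq> 0} \<subseteq> M" "M \<subseteq> Irr"
    using hom0D(1,2)[OF Y] by (auto simp: M_def)
  show ?thesis
    unfolding cmp0_sum[OF X Y rst L(1,2,5) M] cmp0_sum[OF X' Y rst L(1,3,5) M]
      cmp0_sum[OF hom0_add[OF rst(2,3) hom0_scale[OF rst(2,3) X] X'] Y rst L(1,4,5) M]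
      cvec.scale_sum_right sum.distrib[symmetric]
  proof (intro sum.cong refl)
    fix k e l f assume "k \<in> L" "e \<in> onb k" "l \<in> M" "f \<in> onb l"
    moreover from this have "k \<in> Irr" "l \<in> Irr" using L M by blast+
    ultimately show "cmp_coend r s t k ((c *\<^sub>C X + X') k e) e l (Y l f) f
        = c *\<^sub>C cmp_coend r s t k (X k e) e l (Y l f) f + cmp_coend r s t k (X' k e) e l (Y l f) f"
      using rst by (simp add: scaleC_fun_apply cmp_coend_linear(1,2) onb_in hom0D(3)[OF X] hom0D(3)[OF X'] hom0D(3)[OF Y])
  qed
qed

lemma cmp0_linear_right:
  assumes X: "X \<in> hom0 s t" and Y: "Y \<in> hom0 r s" and Y': "Y' \<in> hom0 r s" and rst: "r \<in> obj C" "s \<in> obj C" "t \<in> obj C"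
  shows "cmp0 r s t X (c *\<^sub>C Y + Y') = c *\<^sub>C cmp0 r s t X Y + cmp0 r s t X Y'"
proof -
  define L where "L = {k. Y k \<noteq> 0} \<union> {k. Y' k \<noteq> 0}"
  define M where "M = {k. X k \<noteq> 0}"
  have L: "finite L" "{k. Y k \<noteq> 0} \<subseteq> L" "{k. Y' k \<noteq> 0} \<subseteq> L" "{k. (c *\<^sub>C Y + Y') k \<noteq> 0} \<subseteq> L" "L \<subseteq> Irr"
    using hom0D(1,2)[OF Y] hom0D(1,2)[OF Y'] by (auto simp: L_def scaleC_fun_apply)
  have M: "finite M" "{k. X k \<noteq> 0} \<subseteq> M" "M \<subseteq> Irr"
    using hom0D(1,2)[OF X] by (auto simp: M_def)
  show ?thesis
    unfolding cmp0_sum[OF X Y rst M L(1,2,5)] cmp0_sum[OF X Y' rst M L(1,3,5)]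
      cmp0_sum[OF X hom0_add[OF rst(1,2) hom0_scale[OF rst(1,2) Y] Y'] rst M L(1,4,5)]
      cvec.scale_sum_right sum.distrib[symmetric]
  proof (intro sum.cong refl)
    fix k e l f assume "k \<in> M" "e \<in> onb k" "l \<in> L" "f \<in> onb l"
    moreover from this have "k \<in> Irr" "l \<in> Irr" using L M by blast+
    ultimately show "cmp_coend r s t k (X k e) e l ((c *\<^sub>C Y + Y') l f) f
        = c *\<^sub>C cmp_coend r s t k (X k e) e l (Y l f) f + cmp_coend r s t k (X k e) e l (Y' l f) f"
      using rst by (simp add: scaleC_fun_apply cmp_coend_linear(3,4) onb_in hom0D(3)[OF X] hom0D(3)[OF Y] hom0D(3)[OF Y'])
  qed
qed

lemma cmp0_zero [simp]: "cmp0 r s t 0 Y = 0" "cmp0 r s t X 0 = 0"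
  by (simp_all add: cmp0_def)

lemma cmp0_bilinear:
  assumes "X \<in> hom0 s t" "Y \<in> hom0 r s" "r \<in> obj C" "s \<in> obj C" "t \<in> obj C"
  shows cmp0_add_left: "X' \<in> hom0 s t \<Longrightarrow> cmp0 r s t (X + X') Y = cmp0 r s t X Y + cmp0 r s t X' Y"
    and cmp0_add_right: "Y' \<in> hom0 r s \<Longrightarrow> cmp0 r s t X (Y + Y') = cmp0 r s t X Y + cmp0 r s t X Y'"
    and cmp0_scale_left: "cmp0 r s t (c *\<^sub>C X) Y = c *\<^sub>C cmp0 r s t X Y"
    and cmp0_scale_right: "cmp0 r s t X (c *\<^sub>C Y) = c *\<^sub>C cmp0 r s t X Y"
  using cmp0_linear_left[OF assms(1) _ assms(2-), of X' 1] cmp0_linear_right[OF assms(1,2) _ assms(3-), of Y' 1]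
    cmp0_linear_left[OF assms(1) hom0_zero assms(2-), of c] cmp0_linear_right[OF assms(1,2) hom0_zero assms(3-), of c]
    assms(3-)
  by (simp_all del: plus_fun_apply zero_fun_apply)

text \<open>
  In terms of \<open>coend\<close> composition involves no choice of bases, and its associativity becomes that of
  the tensor product.
\<close>

lemma cmp0_coend:
  assumes A: "arr A" "src A = g \<odot> s" "tgt A = t" and B: "arr B" "src B = h \<odot> r" "tgt B = s"
    and gh: "g \<in> deg" "h \<in> deg" and rst: "r \<in> obj C" "s \<in> obj C" "t \<in> obj C" and \<psi>: "\<psi> \<in> V g" and \<phi>: "\<phi> \<in> V h"
  shows "cmp0 r s t (coend g s A \<psi>) (coend h r B \<phi>) = coend (g \<odot> h) r (A \<cdot> (idt g \<boxtimes> B)) (vt g h \<psi> \<phi>)"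
proof -
  note [simp] = A B gh rst \<psi> \<phi>
  let ?X = "coend g s A \<psi>" and ?Y = "coend h r B \<phi>"
  let ?AB = "A \<cdot> (idt g \<boxtimes> B)"
  have X: "?X \<in> hom0 s t" by (rule coend_in) simp_all
  have Y: "?Y \<in> hom0 r s" by (rule coend_in) simp_all
  have sX: "{k. ?X k \<noteq> 0} \<subseteq> constituents g" by (rule coend_constituents) simp_all
  have sY: "{k. ?Y k \<noteq> 0} \<subseteq> constituents h" by (rule coend_constituents) simp_all
  have sI: "constituents g \<subseteq> Irr" "constituents h \<subseteq> Irr" using constituents_Irr by auto
  have step: "cmp_coend r s t k (?X k e) e l (?Y l f) f
      = coend (g \<odot> h) r ?AB (vt g h (farr F (\<gamma> k) g (coordinate k g e \<psi>) e) (farr F (\<gamma> l) h (coordinate l h f \<phi>) f))"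
    if "k \<in> constituents g" "e \<in> onb k" "l \<in> constituents h" "f \<in> onb l" for k e l f
  proof -
    have k [simp]: "k \<in> Irr" "l \<in> Irr" using that sI by auto
    have e [simp]: "e \<in> V (\<gamma> k)" "f \<in> V (\<gamma> l)" using that onb_in by auto
    let ?a = "coordinate_arrow k g e \<psi>" and ?b = "coordinate_arrow l h f \<phi>"
    have "Arr (\<gamma> k \<odot> s) t (?X k e) = A \<cdot> (?a \<boxtimes> idt s)" by (simp add: coend_def Arr_eta)
    moreover have "Arr (\<gamma> l \<odot> r) s (?Y l f) = B \<cdot> (?b \<boxtimes> idt r)" by (simp add: coend_def Arr_eta)
    moreover have "(A \<cdot> (?a \<boxtimes> idt s)) \<cdot> (idt (\<gamma> k) \<boxtimes> (B \<cdot> (?b \<boxtimes> idt r))) = ?AB \<cdot> ((?a \<boxtimes> ?b) \<boxtimes> idt r)"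
    proof -
      have "(A \<cdot> (?a \<boxtimes> idt s)) \<cdot> (idt (\<gamma> k) \<boxtimes> (B \<cdot> (?b \<boxtimes> idt r))) = A \<cdot> (?a \<boxtimes> (B \<cdot> (?b \<boxtimes> idt r)))"
        by (simp add: compose_assoc slide_left)
      also have "?a \<boxtimes> (B \<cdot> (?b \<boxtimes> idt r)) = (idt g \<boxtimes> B) \<cdot> (?a \<boxtimes> (?b \<boxtimes> idt r))"
        by (simp add: tensor_compose)
      finally show ?thesis by (simp add: compose_assoc)
    qed
    ultimately have "cmp_coend r s t k (?X k e) e l (?Y l f) f
        = coend (\<gamma> k \<odot> \<gamma> l) r (?AB \<cdot> ((?a \<boxtimes> ?b) \<boxtimes> idt r)) (vt (\<gamma> k) (\<gamma> l) e f)"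
      unfolding cmp_coend_def by presburger
    also have "\<dots> = coend (g \<odot> h) r ?AB (farr F (\<gamma> k \<odot> \<gamma> l) (g \<odot> h) (und (?a \<boxtimes> ?b)) (vt (\<gamma> k) (\<gamma> l) e f))"
      by (rule coend_natural) (simp_all add: vt_in)
    also have "farr F (\<gamma> k \<odot> \<gamma> l) (g \<odot> h) (und (?a \<boxtimes> ?b)) (vt (\<gamma> k) (\<gamma> l) e f)
        = vt g h (farr F (\<gamma> k) g (coordinate k g e \<psi>) e) (farr F (\<gamma> l) h (coordinate l h f \<phi>) f)"
      by (simp add: und_simps farr_ten)
    finally show ?thesis .
  qed
  define p where "p k e = farr F (\<gamma> k) g (coordinate k g e \<psi>) e" for k e
  define q where "q l f = farr F (\<gamma> l) h (coordinate l h f \<phi>) f" for l f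
  have p: "p k e \<in> V g" if "k \<in> constituents g" "e \<in> onb k" for k e
    unfolding p_def using that constituents_Irr onb_in by (intro farr_in) auto
  have q: "q l f \<in> V h" if "l \<in> constituents h" "f \<in> onb l" for l f
    unfolding q_def using that constituents_Irr onb_in by (intro farr_in) auto
  have AB: "arr ?AB" "src ?AB = (g \<odot> h) \<odot> r" "g \<odot> h \<in> deg" by simp_all
  have qV: "(\<Sum>l\<in>constituents h. \<Sum>f\<in>onb l. q l f) \<in> V h" using q by (intro V_sum) auto
  have "cmp0 r s t ?X ?Y = (\<Sum>k\<in>constituents g. \<Sum>e\<in>onb k. \<Sum>l\<in>constituents h. \<Sum>f\<in>onb l. cmp_coend r s t k (?X k e) e l (?Y l f) f)"
    by (rule cmp0_sum[OF X Y rst _ sX sI(1) _ sY sI(2)]) simp_all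
  also have "\<dots> = (\<Sum>k\<in>constituents g. \<Sum>e\<in>onb k. \<Sum>l\<in>constituents h. \<Sum>f\<in>onb l. coend (g \<odot> h) r ?AB (vt g h (p k e) (q l f)))"
    by (intro sum.cong refl) (simp add: step p_def q_def)
  also have "\<dots> = (\<Sum>k\<in>constituents g. \<Sum>e\<in>onb k. coend (g \<odot> h) r ?AB (vt g h (p k e) (\<Sum>l\<in>constituents h. \<Sum>f\<in>onb l. q l f)))"
  proof (intro sum.cong refl)
    fix k e assume ke: "k \<in> constituents g" "e \<in> onb k"
    have "vt g h (p k e) (\<Sum>l\<in>constituents h. \<Sum>f\<in>onb l. q l f) = (\<Sum>l\<in>constituents h. vt g h (p k e) (\<Sum>f\<in>onb l. q l f))"
      using p[OF ke] q by (intro vt_sum_right V_sum) auto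
    also have "\<dots> = (\<Sum>l\<in>constituents h. \<Sum>f\<in>onb l. vt g h (p k e) (q l f))"
      using p[OF ke] q by (intro sum.cong refl vt_sum_right) auto
    finally have "coend (g \<odot> h) r ?AB (vt g h (p k e) (\<Sum>l\<in>constituents h. \<Sum>f\<in>onb l. q l f))
        = coend (g \<odot> h) r ?AB (\<Sum>l\<in>constituents h. \<Sum>f\<in>onb l. vt g h (p k e) (q l f))" by simp
    also have "\<dots> = (\<Sum>l\<in>constituents h. coend (g \<odot> h) r ?AB (\<Sum>f\<in>onb l. vt g h (p k e) (q l f)))"
      using p[OF ke] q by (intro coend_sum AB rst V_sum vt_in gh) auto
    also have "\<dots> = (\<Sum>l\<in>constituents h. \<Sum>f\<in>onb l. coend (g \<odot> h) r ?AB (vt g h (p k e) (q l f)))"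
      using p[OF ke] q by (intro sum.cong refl coend_sum AB rst vt_in gh) auto
    finally show "(\<Sum>l\<in>constituents h. \<Sum>f\<in>onb l. coend (g \<odot> h) r ?AB (vt g h (p k e) (q l f)))
        = coend (g \<odot> h) r ?AB (vt g h (p k e) (\<Sum>l\<in>constituents h. \<Sum>f\<in>onb l. q l f))" by simp
  qed
  also have "(\<Sum>l\<in>constituents h. \<Sum>f\<in>onb l. q l f) = \<phi>" unfolding q_def by (rule coordinate_complete) simp_all
  also have "(\<Sum>k\<in>constituents g. \<Sum>e\<in>onb k. coend (g \<odot> h) r ?AB (vt g h (p k e) \<phi>))
      = (\<Sum>k\<in>constituents g. coend (g \<odot> h) r ?AB (\<Sum>e\<in>onb k. vt g h (p k e) \<phi>))"
    using p by (intro sum.cong refl coend_sum[symmetric] AB rst vt_in gh \<phi>) auto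
  also have "\<dots> = coend (g \<odot> h) r ?AB (\<Sum>k\<in>constituents g. \<Sum>e\<in>onb k. vt g h (p k e) \<phi>)"
    using p by (intro coend_sum[symmetric] AB rst V_sum vt_in gh \<phi>) auto
  also have "(\<Sum>k\<in>constituents g. \<Sum>e\<in>onb k. vt g h (p k e) \<phi>) = (\<Sum>k\<in>constituents g. vt g h (\<Sum>e\<in>onb k. p k e) \<phi>)"
    using p by (intro sum.cong refl vt_sum_left[symmetric]) auto
  also have "\<dots> = vt g h (\<Sum>k\<in>constituents g. \<Sum>e\<in>onb k. p k e) \<phi>"
    using p by (intro vt_sum_left[symmetric] V_sum) auto
  also have "(\<Sum>k\<in>constituents g. \<Sum>e\<in>onb k. p k e) = \<psi>" unfolding p_def by (rule coordinate_complete) simp_all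
  finally show ?thesis .
qed

lemma cmp0_in:
  assumes X: "X \<in> hom0 s t" and Y: "Y \<in> hom0 r s" and rst: "r \<in> obj C" "s \<in> obj C" "t \<in> obj C"
  shows "cmp0 r s t X Y \<in> hom0 r t"
  using X rst(2,3)
proof (induction rule: hom0_induct)
  case zero
  then show ?case by (simp add: hom0_zero rst del: plus_fun_apply zero_fun_apply)
next
  case (add X X')
  then show ?case using Y rst by (simp add: cmp0_add_left hom0_add del: plus_fun_apply zero_fun_apply)
next
  case (coend k A \<psi>)
  note k = coend
  show ?case using Y rst(1,2)
  proof (induction rule: hom0_induct)
    case zero
    then show ?case by (simp add: hom0_zero rst del: plus_fun_apply zero_fun_apply)
  next
    case (add Y Y')
    have "coend (\<gamma> k) s A \<psi> \<in> hom0 s t" using k rst by (intro coend_in) simp_all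
    then show ?case using add rst by (simp add: cmp0_add_right hom0_add del: plus_fun_apply zero_fun_apply)
  next
    case (coend l B \<phi>)
    then show ?case using k rst
      by (subst cmp0_coend) (simp_all add: coend_in vt_in)
  qed
qed

lemma cmp0_assoc:
  assumes X: "X \<in> hom0 t u" and Y: "Y \<in> hom0 s t" and Z: "Z \<in> hom0 r s"
    and rstu: "r \<in> obj C" "s \<in> obj C" "t \<in> obj C" "u \<in> obj C"
  shows "cmp0 r s u (cmp0 s t u X Y) Z = cmp0 r t u X (cmp0 r s t Y Z)"
  using X rstu(3,4)
proof (induction rule: hom0_induct)
  case zero
  then show ?case by (simp del: zero_fun_apply)
next
  case (add X X')
  then show ?case using Y Z rstu by (simp add: cmp0_add_left cmp0_in del: plus_fun_apply zero_fun_apply)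
next
  case (coend k A \<psi>)
  note k = coend
  have kX: "coend (\<gamma> k) t A \<psi> \<in> hom0 t u" using k rstu by (intro coend_in) simp_all
  show ?case using Y rstu(2,3)
  proof (induction rule: hom0_induct)
    case zero
    then show ?case by (simp del: zero_fun_apply)
  next
    case (add Y Y')
    then show ?case using kX Z rstu by (simp add: cmp0_add_left cmp0_add_right cmp0_in del: plus_fun_apply zero_fun_apply)
  next
    case (coend l B \<phi>)
    note l = coend
    have lY: "coend (\<gamma> l) s B \<phi> \<in> hom0 s t" using l rstu by (intro coend_in) simp_all
    show ?case using Z rstu(1,2)
    proof (induction rule: hom0_induct)
      case zero
      then show ?case by (simp del: zero_fun_apply)
    next
      case (add Z Z')
      then show ?case using kX lY rstu by (simp add: cmp0_add_right cmp0_in del: plus_fun_apply zero_fun_apply)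
    next
      case (coend m D \<xi>)
      note [simp] = k l coend rstu
      have "cmp0 r s u (cmp0 s t u (coend (\<gamma> k) t A \<psi>) (coend (\<gamma> l) s B \<phi>)) (coend (\<gamma> m) r D \<xi>)
          = coend ((\<gamma> k \<odot> \<gamma> l) \<odot> \<gamma> m) r ((A \<cdot> (idt (\<gamma> k) \<boxtimes> B)) \<cdot> (idt (\<gamma> k \<odot> \<gamma> l) \<boxtimes> D))
            (vt (\<gamma> k \<odot> \<gamma> l) (\<gamma> m) (vt (\<gamma> k) (\<gamma> l) \<psi> \<phi>) \<xi>)"
        by (subst cmp0_coend, simp_all, subst cmp0_coend, simp_all add: vt_in)
      also have "(A \<cdot> (idt (\<gamma> k) \<boxtimes> B)) \<cdot> (idt (\<gamma> k \<odot> \<gamma> l) \<boxtimes> D) = A \<cdot> (idt (\<gamma> k) \<boxtimes> (B \<cdot> (idt (\<gamma> l) \<boxtimes> D)))"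
        by (simp add: whisker_left compose_assoc flip: idt_tensor)
      also have "vt (\<gamma> k \<odot> \<gamma> l) (\<gamma> m) (vt (\<gamma> k) (\<gamma> l) \<psi> \<phi>) \<xi> = vt (\<gamma> k) (\<gamma> l \<odot> \<gamma> m) \<psi> (vt (\<gamma> l) (\<gamma> m) \<phi> \<xi>)"
        by (rule vt_assoc) simp_all
      also have "coend ((\<gamma> k \<odot> \<gamma> l) \<odot> \<gamma> m) r (A \<cdot> (idt (\<gamma> k) \<boxtimes> (B \<cdot> (idt (\<gamma> l) \<boxtimes> D)))) \<dots>
          = cmp0 r t u (coend (\<gamma> k) t A \<psi>) (cmp0 r s t (coend (\<gamma> l) s B \<phi>) (coend (\<gamma> m) r D \<xi>))"
        by (subst cmp0_coend, simp_all, subst cmp0_coend, simp_all add: vt_in)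
      finally show ?case .
    qed
  qed
qed

lemma ide0_coend: "r \<in> obj C \<Longrightarrow> ide0 r = coend \<iota> r (idt r) (vac U)"
  unfolding ide0_def using etens_coend[of "irr_class (\<D> C) \<iota>" "ide C r" r r "vac U"] vac_in
  by (simp add: idt_def)

lemma ide0_in: "r \<in> obj C \<Longrightarrow> ide0 r \<in> hom0 r r"
  unfolding ide0_coend by (rule coend_in) (simp_all add: vac_in)

lemma cmp0_ide0:
  assumes X: "X \<in> hom0 r s" and rs: "r \<in> obj C" "s \<in> obj C"
  shows "cmp0 r r s X (ide0 r) = X"
  using X rs
proof (induction rule: hom0_induct)
  case (add X Y)
  then show ?case using rs by (simp add: cmp0_add_left ide0_in del: plus_fun_apply zero_fun_apply)
next
  case (coend k A \<psi>)
  then show ?case using rs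
    by (simp add: ide0_coend cmp0_coend vac_in vt_vac_right idt_tensor)
qed (simp del: zero_fun_apply)

lemma ide0_cmp0:
  assumes X: "X \<in> hom0 r s" and rs: "r \<in> obj C" "s \<in> obj C"
  shows "cmp0 r s s (ide0 s) X = X"
  using X rs
proof (induction rule: hom0_induct)
  case (add X Y)
  then show ?case using rs by (simp add: cmp0_add_right ide0_in del: plus_fun_apply zero_fun_apply)
next
  case (coend k A \<psi>)
  then show ?case using rs
    by (simp add: ide0_coend cmp0_coend vac_in vt_vac_left)
qed (simp del: zero_fun_apply)

section \<open>Adjoints in the crossed product\<close>

definition fib_map :: "('o, 'a) arrow \<Rightarrow> 'v \<Rightarrow> 'v"
  where "fib_map f = farr F (src f) (tgt f) (und f)"

lemma fib_map_in: "arr f \<Longrightarrow> src f \<in> deg \<Longrightarrow> tgt f \<in> deg \<Longrightarrow> x \<in> V (src f) \<Longrightarrow> fib_map f x \<in> V (tgt f)"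
  unfolding fib_map_def by (rule farr_in) (auto intro: arr_und)

lemma fib_map_compose:
  "\<lbrakk>arr f; arr g; src f = tgt g; src g \<in> deg; tgt g \<in> deg; tgt f \<in> deg; x \<in> V (src g)\<rbrakk> \<Longrightarrow> fib_map (f \<cdot> g) x = fib_map f (fib_map g x)"
  unfolding fib_map_def by (simp add: und_simps(2) farr_cmp arr_und)

lemma fib_map_tensor:
  "\<lbrakk>arr f; arr g; src f = a; src g = b; src f \<in> deg; tgt f \<in> deg; src g \<in> deg; tgt g \<in> deg; x \<in> V a; y \<in> V b\<rbrakk>
    \<Longrightarrow> fib_map (f \<boxtimes> g) (vt a b x y) = vt (tgt f) (tgt g) (fib_map f x) (fib_map g y)"
  unfolding fib_map_def by (auto simp: und_simps(3) farr_ten arr_und)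

lemma fib_map_idt: "\<rho> \<in> deg \<Longrightarrow> x \<in> V \<rho> \<Longrightarrow> fib_map (idt \<rho>) x = x"
  unfolding fib_map_def by (simp add: und_simps farr_ide)

lemma fib_map_adj:
  "\<lbrakk>arr f; src f = a; tgt f = b; a \<in> deg; b \<in> deg; x \<in> V a; y \<in> V b\<rbrakk>
    \<Longrightarrow> ipr a x (fib_map (f\<^sup>\<dagger>) y) = ipr b (fib_map f x) y"
  unfolding fib_map_def by (auto simp: und_simps(4) farr_str_right arr_und)

lemma V_unit_vac: "x \<in> V \<iota> \<Longrightarrow> x = ipr \<iota> (vac U) x *\<^sub>C vac U"
  using V_unit[of x] by (auto simp: ipr_scale_right vac_in vac_ip)

text \<open>
  The antilinear map \<open>\<psi> \<mapsto> \<psi>\<close>-bar from \<open>F(g)\<close> to \<open>F(b)\<close> attached to a solution of the conjugate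
  equations. For \<open>g = \<gamma> k\<close> and the chosen solution it is \<open>vbar k\<close>.
\<close>

definition conj_vec :: "'o \<Rightarrow> 'o \<Rightarrow> ('o, 'a) arrow \<Rightarrow> 'v \<Rightarrow> 'v"
  where "conj_vec g b R' \<psi> = (THE \<phi>. \<phi> \<in> V b \<and>
    (\<forall>a\<in>V b. ipr b a \<phi> = ipr (g \<odot> b) (vt g b \<psi> a) (farr F \<iota> (g \<odot> b) (und R') (vac U))))"

lemma fib_map_solution:
  assumes "arr R'" "src R' = \<iota>" "tgt R' = g \<odot> b" "g \<in> deg" "b \<in> deg"
  shows "farr F \<iota> (g \<odot> b) (und R') (vac U) = fib_map R' (vac U)" "fib_map R' (vac U) \<in> V (g \<odot> b)"
  using assms fib_map_in[of R' "vac U"] by (simp_all add: fib_map_def vac_in)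

lemma conj_vec_ex1:
  assumes R: "arr R'" "src R' = \<iota>" "tgt R' = g \<odot> b" and gb: "g \<in> deg" "b \<in> deg" and \<psi>: "\<psi> \<in> V g"
  shows "\<exists>!\<phi>. \<phi> \<in> V b \<and> (\<forall>a\<in>V b. ipr b a \<phi> = ipr (g \<odot> b) (vt g b \<psi> a) (fib_map R' (vac U)))"
proof (rule unitary_rep.antilinear_functional[OF fibre_rep[OF gb(2)]])
  note w = fib_map_solution(2)[OF R gb]
  show "ipr (g \<odot> b) (vt g b \<psi> (a + a')) (fib_map R' (vac U))
      = ipr (g \<odot> b) (vt g b \<psi> a) (fib_map R' (vac U)) + ipr (g \<odot> b) (vt g b \<psi> a') (fib_map R' (vac U))"
    if "a \<in> V b" "a' \<in> V b" for a a'
    using that w gb \<psi> by (simp add: vt_add_right ipr_add_left vt_in)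
  show "ipr (g \<odot> b) (vt g b \<psi> (c *\<^sub>C a)) (fib_map R' (vac U)) = cnj c * ipr (g \<odot> b) (vt g b \<psi> a) (fib_map R' (vac U))"
    if "a \<in> V b" for a c
    using that w gb \<psi> by (simp add: vt_scale_right ipr_scale_left vt_in)
qed

lemma conj_vec_props:
  assumes R: "arr R'" "src R' = \<iota>" "tgt R' = g \<odot> b" and gb: "g \<in> deg" "b \<in> deg" and \<psi>: "\<psi> \<in> V g"
  shows conj_vec_in: "conj_vec g b R' \<psi> \<in> V b"
    and conj_vec_ip: "a \<in> V b \<Longrightarrow> ipr b a (conj_vec g b R' \<psi>) = ipr (g \<odot> b) (vt g b \<psi> a) (fib_map R' (vac U))"
  using theI'[OF conj_vec_ex1[OF assms]] unfolding conj_vec_def fib_map_solution(1)[OF R gb] by blast+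

lemma conj_vec_eqI:
  assumes R: "arr R'" "src R' = \<iota>" "tgt R' = g \<odot> b" and gb: "g \<in> deg" "b \<in> deg" and \<psi>: "\<psi> \<in> V g"
    and \<phi>: "\<phi> \<in> V b" "\<And>a. a \<in> V b \<Longrightarrow> ipr b a \<phi> = ipr (g \<odot> b) (vt g b \<psi> a) (fib_map R' (vac U))"
  shows "conj_vec g b R' \<psi> = \<phi>"
  by (rule ipr_eqI[OF gb(2) conj_vec_in[OF R gb \<psi>] \<phi>(1)]) (simp add: conj_vec_ip[OF R gb \<psi>] \<phi>(2))

lemma conj_vec_add:
  assumes R: "arr R'" "src R' = \<iota>" "tgt R' = g \<odot> b" and gb: "g \<in> deg" "b \<in> deg" and \<psi>: "\<psi> \<in> V g" "\<phi> \<in> V g"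
  shows "conj_vec g b R' (\<psi> + \<phi>) = conj_vec g b R' \<psi> + conj_vec g b R' \<phi>"
  using assms fib_map_solution(2)[OF R gb]
  by (intro conj_vec_eqI) (simp_all add: V_add conj_vec_in ipr_add_right conj_vec_ip vt_add_left ipr_add_left vt_in)

lemma conj_vec_scale:
  assumes R: "arr R'" "src R' = \<iota>" "tgt R' = g \<odot> b" and gb: "g \<in> deg" "b \<in> deg" and \<psi>: "\<psi> \<in> V g"
  shows "conj_vec g b R' (c *\<^sub>C \<psi>) = cnj c *\<^sub>C conj_vec g b R' \<psi>"
  using assms fib_map_solution(2)[OF R gb]
  by (intro conj_vec_eqI) (simp_all add: V_scale conj_vec_in ipr_scale_right conj_vec_ip vt_scale_left ipr_scale_left vt_in)

lemma conj_vec_sum: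
  assumes R: "arr R'" "src R' = \<iota>" "tgt R' = g \<odot> b" and gb: "g \<in> deg" "b \<in> deg" and \<psi>: "\<And>i. i \<in> I \<Longrightarrow> \<psi> i \<in> V g"
  shows "conj_vec g b R' (sum \<psi> I) = (\<Sum>i\<in>I. conj_vec g b R' (\<psi> i))"
  using \<psi>
proof (induction I rule: infinite_finite_induct)
  case (insert j I)
  then show ?case using conj_vec_add[OF R gb, of "\<psi> j" "sum \<psi> I"] V_sum[OF gb(1), of I \<psi>] by simp
qed (use conj_vec_scale[OF R gb V_zero[OF gb(1)], of 0] in simp_all)

text \<open>
  The first conjugate equation maps \<open>\<psi> \<boxtimes> F(R) \<Omega>\<close> to \<open>\<psi>\<close>; pairing the result with \<open>a\<close> gives the
  defining property of the vector conjugate to \<open>conj_vec g b R' \<psi>\<close>.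
\<close>

lemma conj_vec_conj_vec:
  assumes cp: "conj_pair g b R R'" and gb: "g \<in> deg" "b \<in> deg" and \<psi>: "\<psi> \<in> V g"
  shows "conj_vec b g R (conj_vec g b R' \<psi>) = \<psi>"
proof -
  note R = conj_pairD[OF cp]
  note [simp] = R(1-8) gb \<psi>
  define w where "w = fib_map R (vac U)"
  define w' where "w' = fib_map R' (vac U)"
  have w [simp]: "w \<in> V (b \<odot> g)" and w' [simp]: "w' \<in> V (g \<odot> b)"
    unfolding w_def w'_def by (rule fib_map_solution(2); simp)+
  have c [simp]: "conj_vec g b R' \<psi> \<in> V b" by (rule conj_vec_in) simp_all
  note [simp] = vac_in
  show ?thesis
  proof (rule conj_vec_eqI)
    fix a assume a [simp]: "a \<in> V g"
    \<comment> \<open>Contracting \<open>\<psi>\<close> with the first factor of \<open>F(R') \<Omega>\<close> leaves its conjugate in the second.\<close>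
    have key: "ipr (g \<odot> b \<odot> g) (vt (g \<odot> b) g w' a) (vt g (b \<odot> g) \<psi> y) = ipr (b \<odot> g) (vt b g (conj_vec g b R' \<psi>) a) y"
      if "y \<in> V (b \<odot> g)" for y
    proof -
      have "y \<in> cvec.span {vt b g x y |x y. x \<in> V b \<and> y \<in> V g}" using that V_product_span[OF gb(2,1)] by simp
      then have "y \<in> V (b \<odot> g) \<and> ipr (g \<odot> b \<odot> g) (vt (g \<odot> b) g w' a) (vt g (b \<odot> g) \<psi> y)
          = ipr (b \<odot> g) (vt b g (conj_vec g b R' \<psi>) a) y"
      proof (induction rule: cvec.span_induct_alt)
        case base
        have "vt g (b \<odot> g) \<psi> 0 = 0" using vt_scale_right[of g "b \<odot> g" \<psi> 0 0] by (simp add: V_zero)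
        moreover have "ipr (g \<odot> b \<odot> g) (vt (g \<odot> b) g w' a) 0 = 0"
          using ipr_scale_right[of "g \<odot> b \<odot> g" "vt (g \<odot> b) g w' a" 0 0] vt_in[of "g \<odot> b" g w' a] by (simp add: V_zero)
        moreover have "ipr (b \<odot> g) (vt b g (conj_vec g b R' \<psi>) a) 0 = 0"
          using ipr_scale_right[of "b \<odot> g" "vt b g (conj_vec g b R' \<psi>) a" 0 0] by (simp add: V_zero vt_in)
        ultimately show ?case by (simp add: V_zero)
      next
        case (step c' u v)
        then obtain p q where u: "u = vt b g p q" and pq [simp]: "p \<in> V b" "q \<in> V g" by blast
        have [simp]: "vt (g \<odot> b) g w' a \<in> V (g \<odot> b \<odot> g)" using vt_in[of "g \<odot> b" g w' a] by simp
        have "ipr (g \<odot> b \<odot> g) (vt (g \<odot> b) g w' a) (vt g (b \<odot> g) \<psi> u)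
            = ipr ((g \<odot> b) \<odot> g) (vt (g \<odot> b) g w' a) (vt (g \<odot> b) g (vt g b \<psi> p) q)"
          by (simp add: u vt_assoc)
        also have "\<dots> = ipr (g \<odot> b) w' (vt g b \<psi> p) * ipr g a q"
          by (rule vt_ip) (simp_all add: vt_in)
        also have "ipr (g \<odot> b) w' (vt g b \<psi> p) = cnj (ipr b p (conj_vec g b R' \<psi>))"
          using ipr_cnj[of "g \<odot> b" "vt g b \<psi> p" w'] by (simp add: vt_in conj_vec_ip flip: w'_def)
        also have "\<dots> = ipr b (conj_vec g b R' \<psi>) p" by (rule ipr_cnj[symmetric]) simp_all
        also have "\<dots> * ipr g a q = ipr (b \<odot> g) (vt b g (conj_vec g b R' \<psi>) a) u"
          by (simp add: u vt_ip)
        finally show ?case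
          using step by (simp add: u vt_in V_add V_scale vt_add_right vt_scale_right ipr_add_right ipr_scale_right)
      qed
      then show ?thesis ..
    qed
    have "fib_map ((R'\<^sup>\<dagger> \<boxtimes> idt g) \<cdot> (idt g \<boxtimes> R)) \<psi> = fib_map (R'\<^sup>\<dagger> \<boxtimes> idt g) (fib_map (idt g \<boxtimes> R) (vt g \<iota> \<psi> (vac U)))"
      by (simp add: fib_map_compose vt_vac_right)
    also have "fib_map (idt g \<boxtimes> R) (vt g \<iota> \<psi> (vac U)) = vt g (b \<odot> g) \<psi> w"
      by (subst fib_map_tensor) (simp_all add: fib_map_idt w_def)
    finally have "\<psi> = fib_map ((R' \<boxtimes> idt g)\<^sup>\<dagger>) (vt g (b \<odot> g) \<psi> w)"
      by (simp add: R(9) fib_map_idt adj_tensor)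
    then have "ipr g a \<psi> = ipr g a (fib_map ((R' \<boxtimes> idt g)\<^sup>\<dagger>) (vt g (b \<odot> g) \<psi> w))" by simp
    also have "\<dots> = ipr (g \<odot> b \<odot> g) (fib_map (R' \<boxtimes> idt g) a) (vt g (b \<odot> g) \<psi> w)"
      by (rule fib_map_adj) (simp_all add: vt_in)
    also have "fib_map (R' \<boxtimes> idt g) a = fib_map (R' \<boxtimes> idt g) (vt \<iota> g (vac U) a)" by (simp add: vt_vac_left)
    also have "\<dots> = vt (g \<odot> b) g w' a"
      by (subst fib_map_tensor) (simp_all add: fib_map_idt w'_def)
    finally show "ipr g a \<psi> = ipr (b \<odot> g) (vt b g (conj_vec g b R' \<psi>) a) (fib_map R (vac U))"
      by (simp add: key flip: w_def)
  qed simp_all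
qed

text \<open>
  Conjugation reverses tensor products when the solution for \<open>k l\<close> is the one of \<open>conj_pair_product\<close>:
  contracting with \<open>F(Q')\<close> inside \<open>F(R')\<close> yields a scalar times the contraction with \<open>F(R')\<close>.
\<close>

lemma conj_vec_product:
  assumes 1: "conj_pair k k' R R'" and 2: "conj_pair l l' Q Q'"
    and d: "k \<in> deg" "k' \<in> deg" "l \<in> deg" "l' \<in> deg" and \<psi>: "\<psi> \<in> V k" and \<phi>: "\<phi> \<in> V l"
  shows "conj_vec (k \<odot> l) (l' \<odot> k') ((idt k \<boxtimes> Q' \<boxtimes> idt k') \<cdot> R') (vt k l \<psi> \<phi>) = vt l' k' (conj_vec l l' Q' \<phi>) (conj_vec k k' R' \<psi>)"
proof -
  note R = conj_pairD[OF 1] and Q = conj_pairD[OF 2]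
  note [simp] = R(1-8) Q(1-8) d \<psi> \<phi> vac_in
  let ?S = "(idt k \<boxtimes> Q' \<boxtimes> idt k') \<cdot> R'"
  define w where "w = fib_map R' (vac U)"
  have w [simp]: "w \<in> V (k \<odot> k')" unfolding w_def by (rule fib_map_solution(2)) simp_all
  have c1 [simp]: "conj_vec k k' R' \<psi> \<in> V k'" by (rule conj_vec_in) simp_all
  have c2 [simp]: "conj_vec l l' Q' \<phi> \<in> V l'" by (rule conj_vec_in) simp_all
  have S: "arr ?S" "src ?S = \<iota>" "tgt ?S = (k \<odot> l) \<odot> (l' \<odot> k')" by simp_all
  have kl: "k \<odot> l \<in> deg" "l' \<odot> k' \<in> deg" "vt k l \<psi> \<phi> \<in> V (k \<odot> l)" by (simp_all add: vt_in)
  note cS = conj_vec_props[OF S kl]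
  show ?thesis
  proof (rule ipr_product_eqI[OF d(4,2) cS(1)])
    show "vt l' k' (conj_vec l l' Q' \<phi>) (conj_vec k k' R' \<psi>) \<in> V (l' \<odot> k')" by (simp add: vt_in)
    fix p q assume pq [simp]: "p \<in> V l'" "q \<in> V k'"
    have "ipr (l' \<odot> k') (vt l' k' p q) (conj_vec (k \<odot> l) (l' \<odot> k') ?S (vt k l \<psi> \<phi>))
        = ipr (k \<odot> l \<odot> l' \<odot> k') (vt (k \<odot> l) (l' \<odot> k') (vt k l \<psi> \<phi>) (vt l' k' p q)) (fib_map ?S (vac U))"
      using cS(2)[of "vt l' k' p q"] by (simp add: vt_in)
    also have "vt (k \<odot> l) (l' \<odot> k') (vt k l \<psi> \<phi>) (vt l' k' p q)
        = vt k (l \<odot> (l' \<odot> k')) \<psi> (vt (l \<odot> l') k' (vt l l' \<phi> p) q)"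
      by (simp add: vt_assoc vt_in)
    also have "fib_map ?S (vac U) = fib_map ((idt k \<boxtimes> Q'\<^sup>\<dagger> \<boxtimes> idt k')\<^sup>\<dagger>) w"
      by (simp add: fib_map_compose w_def adj_tensor)
    also have "ipr (k \<odot> l \<odot> l' \<odot> k') (vt k (l \<odot> (l' \<odot> k')) \<psi> (vt (l \<odot> l') k' (vt l l' \<phi> p) q)) \<dots>
        = ipr (k \<odot> k') (fib_map (idt k \<boxtimes> Q'\<^sup>\<dagger> \<boxtimes> idt k') (vt k (l \<odot> (l' \<odot> k')) \<psi> (vt (l \<odot> l') k' (vt l l' \<phi> p) q))) w"
      using vt_in[of "l \<odot> l'" k' "vt l l' \<phi> p" q] by (intro fib_map_adj) (simp_all add: vt_in)
    also have "fib_map (idt k \<boxtimes> Q'\<^sup>\<dagger> \<boxtimes> idt k') (vt k (l \<odot> (l' \<odot> k')) \<psi> (vt (l \<odot> l') k' (vt l l' \<phi> p) q))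
        = vt k k' \<psi> (vt \<iota> k' (fib_map (Q'\<^sup>\<dagger>) (vt l l' \<phi> p)) q)"
    proof -
      have "vt (l \<odot> l') k' (vt l l' \<phi> p) q \<in> V (l \<odot> l' \<odot> k')"
        using vt_in[of "l \<odot> l'" k' "vt l l' \<phi> p" q] by (simp add: vt_in)
      then have "fib_map (idt k \<boxtimes> Q'\<^sup>\<dagger> \<boxtimes> idt k') (vt k (l \<odot> (l' \<odot> k')) \<psi> (vt (l \<odot> l') k' (vt l l' \<phi> p) q))
          = vt k k' \<psi> (fib_map (Q'\<^sup>\<dagger> \<boxtimes> idt k') (vt (l \<odot> l') k' (vt l l' \<phi> p) q))"
        using fib_map_tensor[of "idt k" "Q'\<^sup>\<dagger> \<boxtimes> idt k'" k "l \<odot> l' \<odot> k'"] by (simp add: fib_map_idt)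
      also have "fib_map (Q'\<^sup>\<dagger> \<boxtimes> idt k') (vt (l \<odot> l') k' (vt l l' \<phi> p) q) = vt \<iota> k' (fib_map (Q'\<^sup>\<dagger>) (vt l l' \<phi> p)) q"
        using fib_map_tensor[of "Q'\<^sup>\<dagger>" "idt k'" "l \<odot> l'" k'] by (simp add: fib_map_idt vt_in)
      finally show ?thesis .
    qed
    also have "fib_map (Q'\<^sup>\<dagger>) (vt l l' \<phi> p) = ipr l' (conj_vec l l' Q' \<phi>) p *\<^sub>C vac U"
    proof -
      have v: "fib_map (Q'\<^sup>\<dagger>) (vt l l' \<phi> p) \<in> V \<iota>" using fib_map_in[of "Q'\<^sup>\<dagger>" "vt l l' \<phi> p"] by (simp add: vt_in)
      have q: "fib_map Q' (vac U) \<in> V (l \<odot> l')" by (rule fib_map_solution(2)) simp_all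
      have "ipr \<iota> (vac U) (fib_map (Q'\<^sup>\<dagger>) (vt l l' \<phi> p)) = ipr (l \<odot> l') (fib_map Q' (vac U)) (vt l l' \<phi> p)"
        by (rule fib_map_adj) (simp_all add: vt_in)
      also have "\<dots> = cnj (ipr l' p (conj_vec l l' Q' \<phi>))"
        using ipr_cnj[of "l \<odot> l'" "vt l l' \<phi> p" "fib_map Q' (vac U)"] q by (simp add: vt_in conj_vec_ip)
      also have "\<dots> = ipr l' (conj_vec l l' Q' \<phi>) p" by (rule ipr_cnj[symmetric]) simp_all
      finally show ?thesis using V_unit_vac[OF v] by simp
    qed
    also have "vt \<iota> k' (ipr l' (conj_vec l l' Q' \<phi>) p *\<^sub>C vac U) q = ipr l' (conj_vec l l' Q' \<phi>) p *\<^sub>C q"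
      by (simp add: vt_scale_left vt_vac_left)
    also have "ipr (k \<odot> k') (vt k k' \<psi> (ipr l' (conj_vec l l' Q' \<phi>) p *\<^sub>C q)) w
        = cnj (ipr l' (conj_vec l l' Q' \<phi>) p) * ipr (k \<odot> k') (vt k k' \<psi> q) w"
      by (simp add: vt_scale_right ipr_scale_left vt_in)
    also have "cnj (ipr l' (conj_vec l l' Q' \<phi>) p) = ipr l' p (conj_vec l l' Q' \<phi>)"
      by (rule ipr_cnj[symmetric]) simp_all
    also have "ipr (k \<odot> k') (vt k k' \<psi> q) w = ipr k' q (conj_vec k k' R' \<psi>)"
      by (simp add: conj_vec_ip w_def)
    also have "ipr l' p (conj_vec l l' Q' \<phi>) * ipr k' q (conj_vec k k' R' \<psi>)
        = ipr (l' \<odot> k') (vt l' k' p q) (vt l' k' (conj_vec l l' Q' \<phi>) (conj_vec k k' R' \<psi>))"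
      by (simp add: vt_ip)
    finally show "ipr (l' \<odot> k') (vt l' k' p q) (conj_vec (k \<odot> l) (l' \<odot> k') ?S (vt k l \<psi> \<phi>))
        = ipr (l' \<odot> k') (vt l' k' p q) (vt l' k' (conj_vec l l' Q' \<phi>) (conj_vec k k' R' \<psi>))" .
  qed
qed

text \<open>
  The arrow part of the adjoint: \<open>A\<^sup>*\<close> with its factor \<open>g\<close> bent to the source side by \<open>R\<close>.
\<close>

definition conj_arrow :: "'o \<Rightarrow> 'o \<Rightarrow> ('o, 'a) arrow \<Rightarrow> ('o, 'a) arrow \<Rightarrow> ('o, 'a) arrow"
  where "conj_arrow r b R A = (R\<^sup>\<dagger> \<boxtimes> idt r) \<cdot> (idt b \<boxtimes> A\<^sup>\<dagger>)"

lemma conj_arrow_arr [simp]: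
  assumes "conj_pair g b R R'" "arr A" "src A = g \<odot> r" "r \<in> obj C"
  shows "arr (conj_arrow r b R A)" "src (conj_arrow r b R A) = b \<odot> tgt A" "tgt (conj_arrow r b R A) = r"
  using conj_pairD[OF assms(1)] assms(2-) by (simp_all add: conj_arrow_def)

lemma cbar_Irr [simp]: "k \<in> Irr \<Longrightarrow> cbar P k \<in> Irr"
  by (rule choices.cbar_class)

abbreviation conj_gam :: "'o set \<Rightarrow> 'o"
  where "conj_gam k \<equiv> \<gamma> (cbar P k)"

definition Rk :: "'o set \<Rightarrow> ('o, 'a) arrow"
  where "Rk k = Arr \<iota> (conj_gam k \<odot> \<gamma> k) (Rsol P k)"

definition Rk' :: "'o set \<Rightarrow> ('o, 'a) arrow"
  where "Rk' k = Arr \<iota> (\<gamma> k \<odot> conj_gam k) (Rbar P k)"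

lemma Rk_simps [simp]:
  "src (Rk k) = \<iota>" "tgt (Rk k) = conj_gam k \<odot> \<gamma> k" "und (Rk k) = Rsol P k"
  "src (Rk' k) = \<iota>" "tgt (Rk' k) = \<gamma> k \<odot> conj_gam k" "und (Rk' k) = Rbar P k"
  by (simp_all add: Rk_def Rk'_def)

lemma gam_conj_pair: "k \<in> Irr \<Longrightarrow> conj_pair (\<gamma> k) (conj_gam k) (Rk k) (Rk' k)"
  unfolding Rk_def Rk'_def using choices.R_solution[of k]
  by (intro conjugate_solution_conj_pair) (simp_all add: normalized_solution_def conjugate_solution_def)

lemma vbar_conj_vec: "vbar k \<psi> = conj_vec (\<gamma> k) (conj_gam k) (Rk' k) \<psi>"
  by (simp add: vbar_def conj_vec_def)

definition str_coend :: "'o \<Rightarrow> 'o \<Rightarrow> 'o set \<Rightarrow> 'a \<Rightarrow> 'v \<Rightarrow> 'o set \<Rightarrow> 'v \<Rightarrow> 'a"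
  where "str_coend r s k A \<psi> = coend (conj_gam k) s (conj_arrow r (conj_gam k) (Rk k) (Arr (\<gamma> k \<odot> r) s A)) (conj_vec (\<gamma> k) (conj_gam k) (Rk' k) \<psi>)"

lemma gam_conj_vec_in: "k \<in> Irr \<Longrightarrow> \<psi> \<in> V (\<gamma> k) \<Longrightarrow> conj_vec (\<gamma> k) (conj_gam k) (Rk' k) \<psi> \<in> V (conj_gam k)"
  using conj_pairD[OF gam_conj_pair] by (intro conj_vec_in) simp_all

lemma str_et_coend:
  assumes k: "k \<in> Irr" and rs: "r \<in> obj C" "s \<in> obj C" and A: "A \<in> Hom C (\<gamma> k \<odot> r) s" and \<psi>: "\<psi> \<in> V (\<gamma> k)"
  shows "str_et r s k A \<psi> = str_coend r s k A \<psi>"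
proof -
  note cp = gam_conj_pair[OF k]
  let ?A = "conj_arrow r (conj_gam k) (Rk k) (Arr (\<gamma> k \<odot> r) s A)"
  have arrA: "arr ?A" "src ?A = conj_gam k \<odot> s" "tgt ?A = r" using conj_arrow_arr[OF cp, of "Arr (\<gamma> k \<odot> r) s A" r] k rs A by simp_all
  have "str_et r s k A \<psi> = etens (cbar P k) (und ?A) (conj_vec (\<gamma> k) (conj_gam k) (Rk' k) \<psi>)"
    using conj_pairD[OF cp] rs k by (simp add: str_et_def conj_arrow_def und_simps vbar_conj_vec)
  also have "\<dots> = coend (conj_gam k) s (Arr (conj_gam k \<odot> s) r (und ?A)) (conj_vec (\<gamma> k) (conj_gam k) (Rk' k) \<psi>)"
    using k rs arrA gam_conj_vec_in[OF k \<psi>] by (intro etens_coend) (auto intro: arr_und)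
  also have "Arr (conj_gam k \<odot> s) r (und ?A) = ?A" using arrA by (simp add: Arr_eta)
  finally show ?thesis by (simp add: str_coend_def)
qed

lemma str_coend_linear:
  assumes k: "k \<in> Irr" and rs: "r \<in> obj C" "s \<in> obj C" and A: "A \<in> Hom C (\<gamma> k \<odot> r) s" and \<psi>: "\<psi> \<in> V (\<gamma> k)"
  shows "A' \<in> Hom C (\<gamma> k \<odot> r) s \<Longrightarrow> str_coend r s k (A + A') \<psi> = str_coend r s k A \<psi> + str_coend r s k A' \<psi>"
    and "str_coend r s k (c *\<^sub>C A) \<psi> = cnj c *\<^sub>C str_coend r s k A \<psi>"
  unfolding str_coend_def conj_arrow_def
  using conj_pairD[OF gam_conj_pair[OF k]] assms gam_conj_vec_in[OF k \<psi>]
  by (simp_all add: adj_def[of "Arr _ _ _"] str_add str_scale coend_arrow_add_right coend_arrow_scale_right)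

lemma str_coend_zero:
  assumes "k \<in> Irr" "r \<in> obj C" "s \<in> obj C" "\<psi> \<in> V (\<gamma> k)"
  shows "str_coend r s k 0 \<psi> = 0"
  using str_coend_linear(2)[OF assms(1-3) _ assms(4), of 0 0] assms by simp

lemma str0_sum:
  assumes X: "X \<in> hom0 r s" and rs: "r \<in> obj C" "s \<in> obj C"
    and L: "finite L" "{k. X k \<noteq> 0} \<subseteq> L" "L \<subseteq> Irr"
  shows "str0 r s X = (\<Sum>k\<in>L. \<Sum>e\<in>onb k. str_coend r s k (X k e) e)"
proof -
  have "str0 r s X = (\<Sum>k\<in>{k. X k \<noteq> 0}. \<Sum>e\<in>onb k. str_coend r s k (X k e) e)"
    unfolding str0_def
  proof (intro sum.cong refl)
    fix k e assume "k \<in> {k. X k \<noteq> 0}" and e: "e \<in> onb k"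
    then have k: "k \<in> Irr" using L by blast
    then show "str_et r s k (X k e) e = str_coend r s k (X k e) e"
      using rs e by (intro str_et_coend) (simp_all add: onb_in hom0D(3)[OF X])
  qed
  also have "\<dots> = (\<Sum>k\<in>L. \<Sum>e\<in>onb k. str_coend r s k (X k e) e)"
  proof (rule sum.mono_neutral_left[OF L(1,2)], rule ballI, rule sum.neutral, rule ballI)
    fix k e assume k: "k \<in> L - {k. X k \<noteq> 0}" and e: "e \<in> onb k"
    have kI: "k \<in> Irr" using k L by blast
    have "X k = 0" using k by simp
    then show "str_coend r s k (X k e) e = 0" using str_coend_zero[OF kI rs] kI e onb_in by simp
  qed
  finally show ?thesis .
qed

lemma str0_linear:
  assumes X: "X \<in> hom0 r s" and Y: "Y \<in> hom0 r s" and rs: "r \<in> obj C" "s \<in> obj C"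
  shows "str0 r s (c *\<^sub>C X + Y) = cnj c *\<^sub>C str0 r s X + str0 r s Y"
proof -
  define L where "L = {k. X k \<noteq> 0} \<union> {k. Y k \<noteq> 0}"
  have L: "finite L" "{k. X k \<noteq> 0} \<subseteq> L" "{k. Y k \<noteq> 0} \<subseteq> L" "{k. (c *\<^sub>C X + Y) k \<noteq> 0} \<subseteq> L" "L \<subseteq> Irr"
    using hom0D(1,2)[OF X] hom0D(1,2)[OF Y] by (auto simp: L_def scaleC_fun_apply)
  show ?thesis
    unfolding str0_sum[OF X rs L(1,2,5)] str0_sum[OF Y rs L(1,3,5)]
      str0_sum[OF hom0_add[OF rs hom0_scale[OF rs X] Y] rs L(1,4,5)] cvec.scale_sum_right sum.distrib[symmetric]
  proof (intro sum.cong refl)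
    fix k e assume "k \<in> L" "e \<in> onb k"
    moreover from this have "k \<in> Irr" using L by blast
    ultimately show "str_coend r s k ((c *\<^sub>C X + Y) k e) e = cnj c *\<^sub>C str_coend r s k (X k e) e + str_coend r s k (Y k e) e"
      using rs by (simp add: scaleC_fun_apply str_coend_linear onb_in hom0D(3)[OF X] hom0D(3)[OF Y])
  qed
qed

lemma str0_zero [simp]: "str0 r s 0 = 0"
  by (simp add: str0_def)

lemma str0_antilinear:
  assumes "X \<in> hom0 r s" "r \<in> obj C" "s \<in> obj C"
  shows str0_add: "Y \<in> hom0 r s \<Longrightarrow> str0 r s (X + Y) = str0 r s X + str0 r s Y"
    and str0_scale: "str0 r s (c *\<^sub>C X) = cnj c *\<^sub>C str0 r s X"
  using str0_linear[OF assms(1) _ assms(2,3), of Y 1] str0_linear[OF assms(1) hom0_zero assms(2,3), of c] assms(2,3)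
  by (simp_all del: plus_fun_apply zero_fun_apply)

text \<open>
  The adjoint of \<open>coend g r A \<psi>\<close> may be computed with any solution of the conjugate equations for
  \<open>g\<close>: transposing the coefficients \<open>\<gamma>\<^sub>k \<rightarrow> g\<close> carries the chosen solution for \<open>\<gamma>\<^sub>k\<close> into the
  given one.
\<close>

lemma str0_coend:
  assumes cp: "conj_pair g b R R'" and gb: "g \<in> deg" "b \<in> deg"
    and A: "arr A" "src A = g \<odot> r" "tgt A = s" and rs: "r \<in> obj C" "s \<in> obj C" and \<psi>: "\<psi> \<in> V g"
  shows "str0 r s (coend g r A \<psi>) = coend b s (conj_arrow r b R A) (conj_vec g b R' \<psi>)"
proof -
  note R = conj_pairD[OF cp]
  note [simp] = R(1-8) gb A rs \<psi> vac_in
  let ?X = "coend g r A \<psi>" and ?B = "conj_arrow r b R A"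
  have X: "?X \<in> hom0 r s" by (rule coend_in) simp_all
  have sX: "{k. ?X k \<noteq> 0} \<subseteq> constituents g" by (rule coend_constituents) simp_all
  have sI: "constituents g \<subseteq> Irr" using constituents_Irr by auto
  have B [simp]: "arr ?B" "src ?B = b \<odot> s" "tgt ?B = r" using conj_arrow_arr[OF cp, of A r] by simp_all
  have R': "arr R'" "src R' = \<iota>" "tgt R' = g \<odot> b" by simp_all
  have step: "str_coend r s k (?X k e) e = coend b s ?B (conj_vec g b R' (farr F (\<gamma> k) g (coordinate k g e \<psi>) e))"
    if "k \<in> constituents g" "e \<in> onb k" for k e
  proof -
    have k [simp]: "k \<in> Irr" using that sI by auto
    have e [simp]: "e \<in> V (\<gamma> k)" using that onb_in by auto
    note Q = conj_pairD[OF gam_conj_pair[OF k]]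
    note [simp] = Q(1-8)
    define t where "t = coordinate_arrow k g e \<psi>"
    have t [simp]: "arr t" "src t = \<gamma> k" "tgt t = g" by (simp_all add: t_def)
    obtain \<tau> where \<tau> [simp]: "arr \<tau>" "src \<tau> = b" "tgt \<tau> = conj_gam k"
      and \<tau>1: "(idt (conj_gam k) \<boxtimes> t) \<cdot> Rk k = (\<tau> \<boxtimes> idt g) \<cdot> R"
      and \<tau>2: "(idt (\<gamma> k) \<boxtimes> \<tau>\<^sup>\<dagger>) \<cdot> Rk' k = (t\<^sup>\<dagger> \<boxtimes> idt b) \<cdot> R'"
      using transpose_exists[OF cp gam_conj_pair[OF k] t] by blast
    have "Arr (\<gamma> k \<odot> r) s (?X k e) = A \<cdot> (t \<boxtimes> idt r)" by (simp add: coend_def Arr_eta t_def)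
    moreover have "conj_arrow r (conj_gam k) (Rk k) (A \<cdot> (t \<boxtimes> idt r)) = ?B \<cdot> (\<tau>\<^sup>\<dagger> \<boxtimes> idt s)"
    proof -
      have "conj_arrow r (conj_gam k) (Rk k) (A \<cdot> (t \<boxtimes> idt r))
          = (((Rk k)\<^sup>\<dagger> \<cdot> (idt (conj_gam k) \<boxtimes> t\<^sup>\<dagger>)) \<boxtimes> idt r) \<cdot> (idt (conj_gam k) \<boxtimes> A\<^sup>\<dagger>)"
        by (simp add: conj_arrow_def adj_compose adj_tensor whisker_left whisker_right compose_assoc)
      also have "(Rk k)\<^sup>\<dagger> \<cdot> (idt (conj_gam k) \<boxtimes> t\<^sup>\<dagger>) = R\<^sup>\<dagger> \<cdot> (\<tau>\<^sup>\<dagger> \<boxtimes> idt g)"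
        using arg_cong[OF \<tau>1, of adj] by (simp add: adj_compose adj_tensor)
      also have "((R\<^sup>\<dagger> \<cdot> (\<tau>\<^sup>\<dagger> \<boxtimes> idt g)) \<boxtimes> idt r) \<cdot> (idt (conj_gam k) \<boxtimes> A\<^sup>\<dagger>)
          = (R\<^sup>\<dagger> \<boxtimes> idt r) \<cdot> ((\<tau>\<^sup>\<dagger> \<boxtimes> idt (g \<odot> r)) \<cdot> (idt (conj_gam k) \<boxtimes> A\<^sup>\<dagger>))"
        by (simp add: whisker_right compose_assoc idt_tensor)
      also have "(\<tau>\<^sup>\<dagger> \<boxtimes> idt (g \<odot> r)) \<cdot> (idt (conj_gam k) \<boxtimes> A\<^sup>\<dagger>) = (idt b \<boxtimes> A\<^sup>\<dagger>) \<cdot> (\<tau>\<^sup>\<dagger> \<boxtimes> idt s)"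
        by (simp add: slide_left slide_right)
      finally show ?thesis by (simp add: conj_arrow_def compose_assoc)
    qed
    ultimately have "str_coend r s k (?X k e) e = coend (conj_gam k) s (?B \<cdot> (\<tau>\<^sup>\<dagger> \<boxtimes> idt s)) (conj_vec (\<gamma> k) (conj_gam k) (Rk' k) e)"
      unfolding str_coend_def by presburger
    also have "\<dots> = coend b s ?B (farr F (conj_gam k) b (und (\<tau>\<^sup>\<dagger>)) (conj_vec (\<gamma> k) (conj_gam k) (Rk' k) e))"
      by (rule coend_natural) (simp_all add: gam_conj_vec_in)
    also have "farr F (conj_gam k) b (und (\<tau>\<^sup>\<dagger>)) (conj_vec (\<gamma> k) (conj_gam k) (Rk' k) e) = fib_map (\<tau>\<^sup>\<dagger>) (conj_vec (\<gamma> k) (conj_gam k) (Rk' k) e)"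
      by (simp add: fib_map_def)
    also have "\<dots> = conj_vec g b R' (fib_map t e)"
    proof (rule sym, rule conj_vec_eqI[OF R' gb])
      have te [simp]: "fib_map t e \<in> V g" using fib_map_in[of t e] by simp
      show "fib_map t e \<in> V g" by simp
      show "fib_map (\<tau>\<^sup>\<dagger>) (conj_vec (\<gamma> k) (conj_gam k) (Rk' k) e) \<in> V b"
        using fib_map_in[of "\<tau>\<^sup>\<dagger>" "conj_vec (\<gamma> k) (conj_gam k) (Rk' k) e"] by (simp add: gam_conj_vec_in)
      fix a assume a [simp]: "a \<in> V b"
      have ta [simp]: "fib_map \<tau> a \<in> V (conj_gam k)" using fib_map_in[of \<tau> a] by simp
      have wk: "fib_map (Rk' k) (vac U) \<in> V (\<gamma> k \<odot> conj_gam k)" by (rule fib_map_solution(2)) simp_all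
      have w: "fib_map R' (vac U) \<in> V (g \<odot> b)" by (rule fib_map_solution(2)) simp_all
      have "ipr b a (fib_map (\<tau>\<^sup>\<dagger>) (conj_vec (\<gamma> k) (conj_gam k) (Rk' k) e)) = ipr (conj_gam k) (fib_map \<tau> a) (conj_vec (\<gamma> k) (conj_gam k) (Rk' k) e)"
        by (rule fib_map_adj) (simp_all add: gam_conj_vec_in)
      also have "\<dots> = ipr (\<gamma> k \<odot> conj_gam k) (vt (\<gamma> k) (conj_gam k) e (fib_map \<tau> a)) (fib_map (Rk' k) (vac U))"
        by (rule conj_vec_ip) simp_all
      also have "vt (\<gamma> k) (conj_gam k) e (fib_map \<tau> a) = fib_map (idt (\<gamma> k) \<boxtimes> \<tau>) (vt (\<gamma> k) b e a)"
        by (subst fib_map_tensor) (simp_all add: fib_map_idt)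
      also have "ipr (\<gamma> k \<odot> conj_gam k) \<dots> (fib_map (Rk' k) (vac U))
          = ipr (\<gamma> k \<odot> b) (vt (\<gamma> k) b e a) (fib_map ((idt (\<gamma> k) \<boxtimes> \<tau>)\<^sup>\<dagger>) (fib_map (Rk' k) (vac U)))"
        using wk by (intro fib_map_adj[symmetric]) (simp_all add: vt_in)
      also have "fib_map ((idt (\<gamma> k) \<boxtimes> \<tau>)\<^sup>\<dagger>) (fib_map (Rk' k) (vac U)) = fib_map ((idt (\<gamma> k) \<boxtimes> \<tau>\<^sup>\<dagger>) \<cdot> Rk' k) (vac U)"
        by (subst fib_map_compose) (simp_all add: adj_tensor)
      also have "\<dots> = fib_map ((t \<boxtimes> idt b)\<^sup>\<dagger>) (fib_map R' (vac U))"
        unfolding \<tau>2 by (subst fib_map_compose) (simp_all add: adj_tensor)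
      also have "ipr (\<gamma> k \<odot> b) (vt (\<gamma> k) b e a) \<dots> = ipr (g \<odot> b) (fib_map (t \<boxtimes> idt b) (vt (\<gamma> k) b e a)) (fib_map R' (vac U))"
        using w by (intro fib_map_adj) (simp_all add: vt_in)
      also have "fib_map (t \<boxtimes> idt b) (vt (\<gamma> k) b e a) = vt g b (fib_map t e) a"
        by (subst fib_map_tensor) (simp_all add: fib_map_idt)
      finally show "ipr b a (fib_map (\<tau>\<^sup>\<dagger>) (conj_vec (\<gamma> k) (conj_gam k) (Rk' k) e)) = ipr (g \<odot> b) (vt g b (fib_map t e) a) (fib_map R' (vac U))" .
    qed
    finally show ?thesis by (simp add: fib_map_def t_def)
  qed
  define p where "p k e = farr F (\<gamma> k) g (coordinate k g e \<psi>) e" for k e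
  have p: "p k e \<in> V g" if "k \<in> constituents g" "e \<in> onb k" for k e
    unfolding p_def using that constituents_Irr onb_in by (intro farr_in) auto
  have "str0 r s ?X = (\<Sum>k\<in>constituents g. \<Sum>e\<in>onb k. str_coend r s k (?X k e) e)"
    by (rule str0_sum[OF X rs _ sX sI]) simp
  also have "\<dots> = (\<Sum>k\<in>constituents g. \<Sum>e\<in>onb k. coend b s ?B (conj_vec g b R' (p k e)))"
    by (intro sum.cong refl) (simp add: step p_def)
  also have "\<dots> = (\<Sum>k\<in>constituents g. coend b s ?B (\<Sum>e\<in>onb k. conj_vec g b R' (p k e)))"
    using p by (intro sum.cong refl coend_sum[symmetric] B gb rs conj_vec_in R') auto
  also have "\<dots> = coend b s ?B (\<Sum>k\<in>constituents g. \<Sum>e\<in>onb k. conj_vec g b R' (p k e))"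
    using p by (intro coend_sum[symmetric] B gb rs V_sum conj_vec_in R') auto
  also have "(\<Sum>k\<in>constituents g. \<Sum>e\<in>onb k. conj_vec g b R' (p k e)) = (\<Sum>k\<in>constituents g. conj_vec g b R' (\<Sum>e\<in>onb k. p k e))"
    using p by (intro sum.cong refl conj_vec_sum[symmetric] R' gb) auto
  also have "\<dots> = conj_vec g b R' (\<Sum>k\<in>constituents g. \<Sum>e\<in>onb k. p k e)"
    using p by (intro conj_vec_sum[symmetric] R' gb V_sum) auto
  also have "(\<Sum>k\<in>constituents g. \<Sum>e\<in>onb k. p k e) = \<psi>" unfolding p_def by (rule coordinate_complete) simp_all
  finally show ?thesis .
qed

lemma str0_in:
  assumes X: "X \<in> hom0 r s" and rs: "r \<in> obj C" "s \<in> obj C"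
  shows "str0 r s X \<in> hom0 s r"
  using X rs
proof (induction rule: hom0_induct)
  case zero
  then show ?case using rs by (simp add: hom0_zero del: zero_fun_apply)
next
  case (add X Y)
  then show ?case using rs by (simp add: str0_add hom0_add del: plus_fun_apply)
next
  case (coend k A \<psi>)
  then show ?case
    using rs conj_arrow_arr[OF gam_conj_pair[OF coend(1)] coend(2,3) rs(1)]
    by (subst str0_coend[OF gam_conj_pair[OF coend(1)]]) (simp_all add: coend_in gam_conj_vec_in)
qed

lemma str0_str0:
  assumes X: "X \<in> hom0 r s" and rs: "r \<in> obj C" "s \<in> obj C"
  shows "str0 s r (str0 r s X) = X"
  using X rs
proof (induction rule: hom0_induct)
  case zero
  then show ?case by (simp del: zero_fun_apply)
next
  case (add X Y)
  then show ?case using rs by (simp add: str0_add str0_in del: plus_fun_apply)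
next
  case (coend k A \<psi>)
  note cp = gam_conj_pair[OF coend(1)]
  note [simp] = coend rs conj_pairD(1-8)[OF cp]
  have B [simp]: "arr (conj_arrow r (conj_gam k) (Rk k) A)" "src (conj_arrow r (conj_gam k) (Rk k) A) = conj_gam k \<odot> s" "tgt (conj_arrow r (conj_gam k) (Rk k) A) = r"
    using conj_arrow_arr[OF cp coend(2,3) rs(1)] by simp_all
  have "conj_arrow s (\<gamma> k) (Rk' k) (conj_arrow r (conj_gam k) (Rk k) A)
      = ((Rk' k)\<^sup>\<dagger> \<boxtimes> idt s) \<cdot> (idt (\<gamma> k) \<boxtimes> ((idt (conj_gam k) \<boxtimes> A) \<cdot> (Rk k \<boxtimes> idt r)))"
    by (simp add: conj_arrow_def adj_compose adj_tensor)
  also have "\<dots> = A" by (rule bend_left[OF cp]) simp_all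
  finally have "conj_arrow s (\<gamma> k) (Rk' k) (conj_arrow r (conj_gam k) (Rk k) A) = A" .
  then show ?case
    by (simp add: str0_coend[OF cp] str0_coend[OF conj_pair_swap[OF cp]] gam_conj_vec_in conj_vec_conj_vec[OF cp])
qed

text \<open>
  Computing the adjoint of a composite over \<open>\<gamma>\<^sub>k \<gamma>\<^sub>l\<close> with the product of the two conjugates makes both
  sides composites of the same arrows.
\<close>

lemma str0_cmp0:
  assumes X: "X \<in> hom0 s t" and Y: "Y \<in> hom0 r s" and rst: "r \<in> obj C" "s \<in> obj C" "t \<in> obj C"
  shows "str0 r t (cmp0 r s t X Y) = cmp0 t s r (str0 r s Y) (str0 s t X)"
  using X rst(2,3)
proof (induction rule: hom0_induct)
  case zero
  then show ?case by (simp del: zero_fun_apply)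
next
  case (add X X')
  then show ?case using Y rst
    by (simp add: str0_add str0_in cmp0_in cmp0_add_left cmp0_add_right del: plus_fun_apply)
next
  case (coend k A \<psi>)
  note k = coend
  have kX: "coend (\<gamma> k) s A \<psi> \<in> hom0 s t" using k rst by (intro coend_in) simp_all
  show ?case using Y rst(1,2)
  proof (induction rule: hom0_induct)
    case zero
    then show ?case by (simp del: zero_fun_apply)
  next
    case (add Y Y')
    then show ?case using kX rst
      by (simp add: str0_add str0_in cmp0_in cmp0_add_left cmp0_add_right del: plus_fun_apply)
  next
    case (coend l B \<phi>)
    note ck = gam_conj_pair[OF k(1)] and cl = gam_conj_pair[OF coend(1)]
    note [simp] = k coend rst conj_pairD(1-8)[OF ck] conj_pairD(1-8)[OF cl]
    note cp = conj_pair_product[OF ck cl]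
    have shA [simp]: "arr (conj_arrow s (conj_gam k) (Rk k) A)" "src (conj_arrow s (conj_gam k) (Rk k) A) = conj_gam k \<odot> t" "tgt (conj_arrow s (conj_gam k) (Rk k) A) = s"
      using conj_arrow_arr[OF ck k(2,3) rst(2)] by simp_all
    have shB [simp]: "arr (conj_arrow r (conj_gam l) (Rk l) B)" "src (conj_arrow r (conj_gam l) (Rk l) B) = conj_gam l \<odot> s" "tgt (conj_arrow r (conj_gam l) (Rk l) B) = r"
      using conj_arrow_arr[OF cl coend(2,3) rst(1)] by simp_all
    let ?Q = "(idt (conj_gam l) \<boxtimes> Rk k \<boxtimes> idt (\<gamma> l)) \<cdot> Rk l"
    have "cmp0 t s r (str0 r s (coend (\<gamma> l) r B \<phi>)) (str0 s t (coend (\<gamma> k) s A \<psi>))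
        = coend (conj_gam l \<odot> conj_gam k) t (conj_arrow r (conj_gam l) (Rk l) B \<cdot> (idt (conj_gam l) \<boxtimes> conj_arrow s (conj_gam k) (Rk k) A))
          (vt (conj_gam l) (conj_gam k) (conj_vec (\<gamma> l) (conj_gam l) (Rk' l) \<phi>) (conj_vec (\<gamma> k) (conj_gam k) (Rk' k) \<psi>))"
      by (simp add: str0_coend[OF ck] str0_coend[OF cl] cmp0_coend gam_conj_vec_in)
    also have "conj_arrow r (conj_gam l) (Rk l) B \<cdot> (idt (conj_gam l) \<boxtimes> conj_arrow s (conj_gam k) (Rk k) A)
        = conj_arrow r (conj_gam l \<odot> conj_gam k) ?Q (A \<cdot> (idt (\<gamma> k) \<boxtimes> B))"
    proof -
      have "conj_arrow r (conj_gam l) (Rk l) B \<cdot> (idt (conj_gam l) \<boxtimes> conj_arrow s (conj_gam k) (Rk k) A)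
          = ((Rk l)\<^sup>\<dagger> \<boxtimes> idt r) \<cdot> (idt (conj_gam l) \<boxtimes> (B\<^sup>\<dagger> \<cdot> ((Rk k)\<^sup>\<dagger> \<boxtimes> idt s))) \<cdot> (idt (conj_gam l) \<boxtimes> idt (conj_gam k) \<boxtimes> A\<^sup>\<dagger>)"
        by (simp add: conj_arrow_def whisker_left compose_assoc)
      also have "B\<^sup>\<dagger> \<cdot> ((Rk k)\<^sup>\<dagger> \<boxtimes> idt s) = ((Rk k)\<^sup>\<dagger> \<boxtimes> idt (\<gamma> l \<odot> r)) \<cdot> (idt (conj_gam k \<odot> \<gamma> k) \<boxtimes> B\<^sup>\<dagger>)"
        using slide_right[of "(Rk k)\<^sup>\<dagger>" "B\<^sup>\<dagger>" s \<iota>] by (simp add: slide_left)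
      also have "((Rk l)\<^sup>\<dagger> \<boxtimes> idt r) \<cdot> (idt (conj_gam l) \<boxtimes> (((Rk k)\<^sup>\<dagger> \<boxtimes> idt (\<gamma> l \<odot> r)) \<cdot> (idt (conj_gam k \<odot> \<gamma> k) \<boxtimes> B\<^sup>\<dagger>)))
            \<cdot> (idt (conj_gam l) \<boxtimes> idt (conj_gam k) \<boxtimes> A\<^sup>\<dagger>)
          = conj_arrow r (conj_gam l \<odot> conj_gam k) ?Q (A \<cdot> (idt (\<gamma> k) \<boxtimes> B))"
        by (simp add: conj_arrow_def adj_compose adj_tensor whisker_left whisker_right compose_assoc flip: idt_tensor)
      finally show ?thesis .
    qed
    also have "vt (conj_gam l) (conj_gam k) (conj_vec (\<gamma> l) (conj_gam l) (Rk' l) \<phi>) (conj_vec (\<gamma> k) (conj_gam k) (Rk' k) \<psi>)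
        = conj_vec (\<gamma> k \<odot> \<gamma> l) (conj_gam l \<odot> conj_gam k) ((idt (\<gamma> k) \<boxtimes> Rk' l \<boxtimes> idt (conj_gam k)) \<cdot> Rk' k) (vt (\<gamma> k) (\<gamma> l) \<psi> \<phi>)"
      by (rule conj_vec_product[OF ck cl, symmetric]) simp_all
    also have "coend (conj_gam l \<odot> conj_gam k) t (conj_arrow r (conj_gam l \<odot> conj_gam k) ?Q (A \<cdot> (idt (\<gamma> k) \<boxtimes> B))) \<dots>
        = str0 r t (coend (\<gamma> k \<odot> \<gamma> l) r (A \<cdot> (idt (\<gamma> k) \<boxtimes> B)) (vt (\<gamma> k) (\<gamma> l) \<psi> \<phi>))"
      by (rule str0_coend[OF cp, symmetric]) (simp_all add: vt_in)
    finally show ?case by (simp add: cmp0_coend)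
  qed
qed

section \<open>Positivity and finite dimension\<close>


lemma cmp0_sum_left:
  assumes "\<And>i. i \<in> I \<Longrightarrow> f i \<in> hom0 s t" "Y \<in> hom0 r s" "r \<in> obj C" "s \<in> obj C" "t \<in> obj C"
  shows "cmp0 r s t (sum f I) Y = (\<Sum>i\<in>I. cmp0 r s t (f i) Y)"
  using assms(1)
proof (induction I rule: infinite_finite_induct)
  case (insert j I)
  then show ?case using assms(2-) hom0_sum[OF assms(4,5), of I f] by (simp add: cmp0_add_left del: plus_fun_apply)
qed simp_all

lemma cmp0_sum_right:
  assumes "\<And>i. i \<in> I \<Longrightarrow> f i \<in> hom0 r s" "X \<in> hom0 s t" "r \<in> obj C" "s \<in> obj C" "t \<in> obj C"
  shows "cmp0 r s t X (sum f I) = (\<Sum>i\<in>I. cmp0 r s t X (f i))"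
  using assms(1)
proof (induction I rule: infinite_finite_induct)
  case (insert j I)
  then show ?case using assms(2-) hom0_sum[OF assms(3,4), of I f] by (simp add: cmp0_add_right del: plus_fun_apply)
qed simp_all

lemma str0_sum_dist:
  assumes "\<And>i. i \<in> I \<Longrightarrow> f i \<in> hom0 r s" "r \<in> obj C" "s \<in> obj C"
  shows "str0 r s (sum f I) = (\<Sum>i\<in>I. str0 r s (f i))"
  using assms(1)
proof (induction I rule: infinite_finite_induct)
  case (insert j I)
  then show ?case using assms(2-) hom0_sum[OF assms(2,3), of I f] by (simp add: str0_add del: plus_fun_apply)
qed simp_all

text \<open>
  The dimension is positive because \<open>R\<^sub>k \<noteq> 0\<close>: otherwise the conjugate equation would give \<open>id = 0\<close>.
\<close>

lemma Rsol_norm: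
  assumes k: "k \<in> Irr"
  obtains d where "d > 0"
    and "cmp C \<iota> (conj_gam k \<odot> \<gamma> k) \<iota> (str C \<iota> (conj_gam k \<odot> \<gamma> k) (Rsol P k)) (Rsol P k) = complex_of_real d *\<^sub>C ide C \<iota>"
proof -
  note cp = conj_pairD[OF gam_conj_pair[OF k]]
  have kd [simp]: "\<gamma> k \<in> obj C" "conj_gam k \<in> obj C" using k by simp_all
  have R: "Rsol P k \<in> Hom C \<iota> (conj_gam k \<odot> \<gamma> k)" using arr_und[OF cp(3) cp(4,5)] by simp
  have "Rsol P k \<noteq> 0"
  proof
    assume 0: "Rsol P k = 0"
    let ?f = "(Rk' k)\<^sup>\<dagger> \<boxtimes> idt (\<gamma> k)"
    have f: "und ?f \<in> Hom C (\<gamma> k \<odot> conj_gam k \<odot> \<gamma> k) (\<gamma> k)"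
      using cp(1-8) by (intro arr_und) simp_all
    have "ide C (\<gamma> k) = und (?f \<cdot> (idt (\<gamma> k) \<boxtimes> Rk k))" using cp(9) by (simp add: und_simps(1))
    also have "\<dots> = cmp C (\<gamma> k) (\<gamma> k \<odot> conj_gam k \<odot> \<gamma> k) (\<gamma> k) (und ?f) (und (idt (\<gamma> k) \<boxtimes> Rk k))"
      by (simp add: und_simps(2))
    also have "und (idt (\<gamma> k) \<boxtimes> Rk k) = 0" by (simp add: und_simps(1,3) 0)
    also have "cmp C (\<gamma> k) (\<gamma> k \<odot> conj_gam k \<odot> \<gamma> k) (\<gamma> k) (und ?f) 0 = 0" using f by simp
    finally show False using gam_ide_nonzero[OF k] by simp
  qed
  moreover obtain c where "cmp C \<iota> (conj_gam k \<odot> \<gamma> k) \<iota> (str C \<iota> (conj_gam k \<odot> \<gamma> k) (Rsol P k)) (Rsol P k) = c *\<^sub>C ide C \<iota>"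
    using choices.R_solution[OF k] by (auto simp: normalized_solution_def)
  ultimately show ?thesis
    using that scalar_square_pos[of \<iota> "conj_gam k \<odot> \<gamma> k" "Rsol P k" c] irreducible_objD(2)[OF unt_irreducible] R by auto
qed

text \<open>
  Frobenius reciprocity identifies \<open>Hom(\<iota>, \<gamma>' \<gamma>\<^sub>l)\<close> with \<open>Hom(\<gamma>\<^sub>k, \<gamma>\<^sub>l)\<close> for the conjugate \<open>\<gamma>'\<close> of \<open>\<gamma>\<^sub>k\<close>.
\<close>

lemma Hom_unit_conj:
  assumes k: "k \<in> Irr" and l: "l \<in> Irr" and T: "T \<in> Hom C \<iota> (conj_gam k \<odot> \<gamma> l)"
  shows "k \<noteq> l \<Longrightarrow> T = 0" and "k = l \<Longrightarrow> \<exists>c. T = c *\<^sub>C Rsol P k"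
proof -
  note cp = conj_pairD[OF gam_conj_pair[OF k]]
  note [simp] = k l T cp(1-8)
  define Z where "Z = ((Rk' k)\<^sup>\<dagger> \<boxtimes> idt (\<gamma> l)) \<cdot> (idt (\<gamma> k) \<boxtimes> Arr \<iota> (conj_gam k \<odot> \<gamma> l) T)"
  have Z [simp]: "arr Z" "src Z = \<gamma> k" "tgt Z = \<gamma> l" by (simp_all add: Z_def)
  have ZH: "und Z \<in> Hom C (\<gamma> k) (\<gamma> l)" by (rule arr_und) simp_all
  have RH: "Rsol P k \<in> Hom C \<iota> (conj_gam k \<odot> \<gamma> k)" using arr_und[OF cp(3) cp(4,5)] by simp
  have "(idt (conj_gam k) \<boxtimes> Z) \<cdot> (Rk k \<boxtimes> idt \<iota>) = Arr \<iota> (conj_gam k \<odot> \<gamma> l) T"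
    unfolding Z_def by (rule bend_right[OF gam_conj_pair[OF k]]) simp_all
  from arg_cong[OF this, of und]
  have T: "T = cmp C \<iota> (conj_gam k \<odot> \<gamma> k) (conj_gam k \<odot> \<gamma> l) (ten C (conj_gam k) (conj_gam k) (\<gamma> k) (\<gamma> l) (ide C (conj_gam k)) (und Z)) (Rsol P k)"
    by (simp add: und_simps)
  show "T = 0" if "k \<noteq> l"
    using T Hom_gam_distinct[OF k l that ZH] RH by simp
  show "\<exists>c. T = c *\<^sub>C Rsol P k" if kl: "k = l"
  proof -
    obtain c where "und Z = c *\<^sub>C ide C (\<gamma> k)" using Hom_gam_scalar[OF k] ZH kl by blast
    then have "T = c *\<^sub>C Rsol P k"
      using T RH kl by (simp add: ten_scale_right cmp_scale_left ten_ide)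
    then show ?thesis by blast
  qed
qed

text \<open>
  The component of \<open>X\<^sup>* \<circ> Y\<close> in the class of the unit. Different classes are orthogonal, and within
  a class the fibre contributes the inner product, so evaluating \<open>X\<^sup>* \<circ> X\<close> there gives a sum of
  squares in the original category.
\<close>

lemma unit_component:
  assumes k: "k \<in> Irr" and l: "l \<in> Irr" and rs: "r \<in> obj C" "s \<in> obj C"
    and A: "arr A" "src A = \<gamma> k \<odot> r" "tgt A = s" and B: "arr B" "src B = \<gamma> l \<odot> r" "tgt B = s"
    and e: "e \<in> V (\<gamma> k)" and f: "f \<in> V (\<gamma> l)"
    and d: "d > 0" "cmp C \<iota> (conj_gam k \<odot> \<gamma> k) \<iota> (str C \<iota> (conj_gam k \<odot> \<gamma> k) (Rsol P k)) (Rsol P k) = complex_of_real d *\<^sub>C ide C \<iota>"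
  shows "cmp0 r s r (str0 r s (coend (\<gamma> k) r A e)) (coend (\<gamma> l) r B f) (irr_class (\<D> C) \<iota>) (vac U)
    = (if k = l then (ipr (\<gamma> k) e f / complex_of_real d) *\<^sub>C
        und (((idt (conj_gam k) \<boxtimes> A) \<cdot> (Rk k \<boxtimes> idt r))\<^sup>\<dagger> \<cdot> ((idt (conj_gam k) \<boxtimes> B) \<cdot> (Rk k \<boxtimes> idt r))) else 0)"
proof -
  let ?k0 = "irr_class (\<D> C) \<iota>"
  note cp = conj_pairD[OF gam_conj_pair[OF k]]
  note [simp] = k l rs A B e f cp(1-8) vac_in
  define v where "v = conj_vec (\<gamma> k) (conj_gam k) (Rk' k) e"
  have v [simp]: "v \<in> V (conj_gam k)" unfolding v_def by (simp add: gam_conj_vec_in)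
  define S where "S = conj_arrow r (conj_gam k) (Rk k) A"
  have S [simp]: "arr S" "src S = conj_gam k \<odot> s" "tgt S = r"
    unfolding S_def using conj_arrow_arr[OF gam_conj_pair[OF k], of A r] by simp_all
  define D where "D = S \<cdot> (idt (conj_gam k) \<boxtimes> B)"
  have D [simp]: "arr D" "src D = (conj_gam k \<odot> \<gamma> l) \<odot> r" "tgt D = r" by (simp_all add: D_def)
  define \<theta> where "\<theta> = coordinate ?k0 (conj_gam k \<odot> \<gamma> l) (vac U) (vt (conj_gam k) (\<gamma> l) v f)"
  have \<theta>: "\<theta> \<in> Hom C \<iota> (conj_gam k \<odot> \<gamma> l)"
    unfolding \<theta>_def using coordinate_in[of ?k0 "conj_gam k \<odot> \<gamma> l" "vac U" "vt (conj_gam k) (\<gamma> l) v f"] by (simp add: vt_in)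
  have "cmp0 r s r (str0 r s (coend (\<gamma> k) r A e)) (coend (\<gamma> l) r B f) = coend (conj_gam k \<odot> \<gamma> l) r D (vt (conj_gam k) (\<gamma> l) v f)"
    by (simp add: str0_coend[OF gam_conj_pair[OF k]] cmp0_coend D_def flip: v_def S_def)
  then have val: "cmp0 r s r (str0 r s (coend (\<gamma> k) r A e)) (coend (\<gamma> l) r B f) ?k0 (vac U)
      = und (D \<cdot> (Arr \<iota> (conj_gam k \<odot> \<gamma> l) \<theta> \<boxtimes> idt r))"
    by (simp add: coend_def \<theta>_def)
  show ?thesis
  proof (cases "k = l")
    case False
    then have "\<theta> = 0 *\<^sub>C 0" using Hom_unit_conj(1)[OF k l \<theta>] by simp
    moreover have "und (D \<cdot> (Arr \<iota> (conj_gam k \<odot> \<gamma> l) (0 *\<^sub>C 0) \<boxtimes> idt r)) = 0 *\<^sub>C und (D \<cdot> (Arr \<iota> (conj_gam k \<odot> \<gamma> l) 0 \<boxtimes> idt r))"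
      by (rule und_whisker_scale) simp_all
    ultimately show ?thesis using False val by simp
  next
    case True
    note kl = True[symmetric]
    have RH: "Rsol P k \<in> Hom C \<iota> (conj_gam k \<odot> \<gamma> k)" using arr_und[OF cp(3) cp(4,5)] by simp
    obtain c where c: "\<theta> = c *\<^sub>C Rsol P k" using Hom_unit_conj(2)[OF k l \<theta> True] by blast
    have fk: "f \<in> V (\<gamma> k)" using f True by simp
    have "(c * complex_of_real d) *\<^sub>C ide C \<iota>
        = cmp C \<iota> (conj_gam k \<odot> \<gamma> k) \<iota> (str C \<iota> (conj_gam k \<odot> \<gamma> k) (Rsol P k)) \<theta>"
      using RH by (simp add: c cmp_scale_right d(2) scaleC_scaleC)
    also have "\<dots> = ipr (conj_gam k \<odot> \<gamma> k) (farr F \<iota> (conj_gam k \<odot> \<gamma> k) (Rsol P k) (vac U)) (vt (conj_gam k) (\<gamma> k) v f) *\<^sub>C ide C \<iota>"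
      using coordinate_pairing[of ?k0 "conj_gam k \<odot> \<gamma> k" "vac U" "vt (conj_gam k) (\<gamma> k) v f" "Rsol P k"] RH fk
      by (simp add: \<theta>_def kl vt_in)
    also have "farr F \<iota> (conj_gam k \<odot> \<gamma> k) (Rsol P k) (vac U) = fib_map (Rk k) (vac U)" by (simp add: fib_map_def)
    also have "ipr (conj_gam k \<odot> \<gamma> k) (fib_map (Rk k) (vac U)) (vt (conj_gam k) (\<gamma> k) v f) = ipr (\<gamma> k) e f"
    proof -
      have w: "fib_map (Rk k) (vac U) \<in> V (conj_gam k \<odot> \<gamma> k)" by (rule fib_map_solution(2)) simp_all
      have "ipr (conj_gam k \<odot> \<gamma> k) (fib_map (Rk k) (vac U)) (vt (conj_gam k) (\<gamma> k) v f)
          = cnj (ipr (conj_gam k \<odot> \<gamma> k) (vt (conj_gam k) (\<gamma> k) v f) (fib_map (Rk k) (vac U)))"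
        using w fk by (intro ipr_cnj) (simp_all add: vt_in)
      also have "ipr (conj_gam k \<odot> \<gamma> k) (vt (conj_gam k) (\<gamma> k) v f) (fib_map (Rk k) (vac U)) = ipr (\<gamma> k) f (conj_vec (conj_gam k) (\<gamma> k) (Rk k) v)"
        using fk by (intro conj_vec_ip[symmetric]) simp_all
      also have "conj_vec (conj_gam k) (\<gamma> k) (Rk k) v = e" unfolding v_def by (rule conj_vec_conj_vec[OF gam_conj_pair[OF k]]) simp_all
      also have "cnj (ipr (\<gamma> k) f e) = ipr (\<gamma> k) e f" using fk by (intro ipr_cnj[symmetric]) simp_all
      finally show ?thesis .
    qed
    finally have "c * complex_of_real d = ipr (\<gamma> k) e f"
      using irreducible_objD(2)[OF unt_irreducible] cvec.scale_right_imp_eq by blast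
    then have cd: "c = ipr (\<gamma> k) e f / complex_of_real d" using d(1) by (simp add: field_simps)
    have "und (D \<cdot> (Arr \<iota> (conj_gam k \<odot> \<gamma> l) \<theta> \<boxtimes> idt r)) = c *\<^sub>C und (D \<cdot> (Arr \<iota> (conj_gam k \<odot> \<gamma> l) (Rsol P k) \<boxtimes> idt r))"
      unfolding c using RH kl by (intro und_whisker_scale) simp_all
    also have "Arr \<iota> (conj_gam k \<odot> \<gamma> l) (Rsol P k) = Rk k" using kl by (simp add: Rk_def)
    also have "D \<cdot> (Rk k \<boxtimes> idt r)
        = ((idt (conj_gam k) \<boxtimes> A) \<cdot> (Rk k \<boxtimes> idt r))\<^sup>\<dagger> \<cdot> ((idt (conj_gam k) \<boxtimes> B) \<cdot> (Rk k \<boxtimes> idt r))"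
      using kl by (simp add: D_def S_def conj_arrow_def adj_compose adj_tensor compose_assoc)
    finally show ?thesis using val True cd by simp
  qed
qed

text \<open>
  Over orthonormal bases the unit component of \<open>X\<^sup>* \<circ> X\<close> is the sum of the \<open>Y\<^sup>*Y\<close>, divided by dimensions,
  where \<open>Y\<close> runs over the bent coefficients of \<open>X\<close>. If it vanishes, each \<open>Y\<close> vanishes, and so does
  \<open>X\<close> after bending back.
\<close>

lemma str0_pos:
  assumes X: "X \<in> hom0 r s" and rs: "r \<in> obj C" "s \<in> obj C" and zero: "cmp0 r s r (str0 r s X) X = 0"
  shows "X = 0"
proof -
  let ?k0 = "irr_class (\<D> C) \<iota>"
  define L where "L = {k. X k \<noteq> 0}"
  have L: "finite L" "L \<subseteq> Irr" using hom0D(1,2)[OF X] by (auto simp: L_def)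
  define I where "I = Sigma L onb"
  have fI: "finite I" unfolding I_def using L by (intro finite_SigmaI) auto
  have I: "fst i \<in> Irr" "snd i \<in> onb (fst i)" "snd i \<in> V (\<gamma> (fst i))" if "i \<in> I" for i
    using that L onb_in by (auto simp: I_def)
  define A where "A i = Arr (\<gamma> (fst i) \<odot> r) s (X (fst i) (snd i))" for i
  have A: "arr (A i)" "src (A i) = \<gamma> (fst i) \<odot> r" "tgt (A i) = s" if "i \<in> I" for i
    using I[OF that] rs hom0D(3)[OF X] by (simp_all add: A_def)
  define x where "x i = coend (\<gamma> (fst i)) r (A i) (snd i)" for i
  have x: "x i \<in> hom0 r s" if "i \<in> I" for i
    unfolding x_def using A[OF that] I[OF that] rs by (intro coend_in) simp_all
  have Xx: "X = sum x I"
    unfolding I_def x_def A_def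
    using hom0_expand[OF X L(1) _ L(2) rs] L onb_finite by (simp add: L_def sum.Sigma case_prod_unfold subset_iff)
  have "\<forall>k\<in>Irr. \<exists>d>0. cmp C \<iota> (conj_gam k \<odot> \<gamma> k) \<iota> (str C \<iota> (conj_gam k \<odot> \<gamma> k) (Rsol P k)) (Rsol P k) = complex_of_real d *\<^sub>C ide C \<iota>"
    using Rsol_norm by metis
  from bchoice[OF this] obtain d where d: "\<And>k. k \<in> Irr \<Longrightarrow> d k > 0"
    "\<And>k. k \<in> Irr \<Longrightarrow> cmp C \<iota> (conj_gam k \<odot> \<gamma> k) \<iota> (str C \<iota> (conj_gam k \<odot> \<gamma> k) (Rsol P k)) (Rsol P k) = complex_of_real (d k) *\<^sub>C ide C \<iota>"
    by blast
  define Y where "Y i = (idt (conj_gam (fst i)) \<boxtimes> A i) \<cdot> (Rk (fst i) \<boxtimes> idt r)" for i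
  have Y: "arr (Y i)" "src (Y i) = r" "tgt (Y i) = conj_gam (fst i) \<odot> s" if "i \<in> I" for i
    using A[OF that] conj_pairD(1-8)[OF gam_conj_pair[OF I(1)[OF that]]] rs by (simp_all add: Y_def)
  have YH: "und (Y i) \<in> Hom C r (conj_gam (fst i) \<odot> s)" if "i \<in> I" for i using arr_und[OF Y[OF that]] .
  \<comment> \<open>The factor turns the weight \<open>1 / d\<close> of each summand into part of the square.\<close>
  define Z where "Z i = complex_of_real (1 / sqrt (d (fst i))) *\<^sub>C und (Y i)" for i
  have kbo: "conj_gam (fst i) \<odot> s \<in> obj C" if "i \<in> I" for i using I[OF that] rs by simp
  have comp: "cmp0 r s r (str0 r s (x i)) (x j) ?k0 (vac U)
      = (if i = j then cmp C r (conj_gam (fst i) \<odot> s) r (str C r (conj_gam (fst i) \<odot> s) (Z i)) (Z i) else 0)"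
    if ij: "i \<in> I" "j \<in> I" for i j
  proof -
    have on: "ipr (\<gamma> (fst i)) (snd i) (snd j) = (if snd i = snd j then 1 else 0)" if "fst i = fst j"
      using onb_basis[OF I(1)[OF ij(1)]] I[OF ij(1)] I[OF ij(2)] that by (auto simp: orthonormal_basis_def)
    have ij_eq: "i = j \<longleftrightarrow> fst i = fst j \<and> snd i = snd j" by (auto simp: prod_eq_iff)
    note uc = unit_component[OF I(1)[OF ij(1)] I(1)[OF ij(2)] rs A[OF ij(1)] A[OF ij(2)] I(3)[OF ij(1)] I(3)[OF ij(2)]
        d[OF I(1)[OF ij(1)]], folded x_def]
    show ?thesis
    proof (cases "i = j")
      case False
      then show ?thesis using uc on ij_eq by (auto split: if_splits)
    next
      case True
      have d0: "d (fst i) > 0" using d(1) I(1)[OF ij(1)] by simp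
      have "cmp0 r s r (str0 r s (x i)) (x j) ?k0 (vac U) = complex_of_real (1 / d (fst i)) *\<^sub>C und ((Y i)\<^sup>\<dagger> \<cdot> Y i)"
        using uc on True by (simp add: Y_def)
      also have "und ((Y i)\<^sup>\<dagger> \<cdot> Y i) = cmp C r (conj_gam (fst i) \<odot> s) r (str C r (conj_gam (fst i) \<odot> s) (und (Y i))) (und (Y i))"
        using Y[OF ij(1)] by (simp add: und_simps)
      also have "complex_of_real (1 / d (fst i)) *\<^sub>C \<dots> = cmp C r (conj_gam (fst i) \<odot> s) r (str C r (conj_gam (fst i) \<odot> s) (Z i)) (Z i)"
        using YH[OF ij(1)] kbo[OF ij(1)] rs d0
        by (simp add: Z_def str_scale cmp_scale_left cmp_scale_right scaleC_scaleC flip: of_real_mult of_real_divide)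
      finally show ?thesis using True by simp
    qed
  qed
  have sx: "str0 r s (x i) \<in> hom0 s r" if "i \<in> I" for i using str0_in[OF x[OF that] rs] .
  have "str0 r s X = (\<Sum>i\<in>I. str0 r s (x i))" unfolding Xx by (rule str0_sum_dist[OF x rs])
  then have "cmp0 r s r (str0 r s X) X = (\<Sum>i\<in>I. cmp0 r s r (str0 r s (x i)) X)"
    using cmp0_sum_left[OF sx X rs(1,2,1)] by simp
  also have "\<dots> = (\<Sum>i\<in>I. \<Sum>j\<in>I. cmp0 r s r (str0 r s (x i)) (x j))"
    by (intro sum.cong refl) (use cmp0_sum_right[OF x sx rs(1,2,1)] Xx in simp)
  finally have "(\<Sum>i\<in>I. \<Sum>j\<in>I. cmp0 r s r (str0 r s (x i)) (x j) ?k0 (vac U)) = 0"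
    using zero by (simp add: fun_eq_iff sum_fun_apply)
  moreover have "(\<Sum>i\<in>I. \<Sum>j\<in>I. cmp0 r s r (str0 r s (x i)) (x j) ?k0 (vac U))
      = (\<Sum>i\<in>I. cmp C r (conj_gam (fst i) \<odot> s) r (str C r (conj_gam (fst i) \<odot> s) (Z i)) (Z i))"
    using fI by (intro sum.cong refl) (simp add: comp)
  ultimately have sq: "(\<Sum>i\<in>I. cmp C r (conj_gam (fst i) \<odot> s) r (str C r (conj_gam (fst i) \<odot> s) (Z i)) (Z i)) = 0" by simp
  have "x i = 0" if i: "i \<in> I" for i
  proof -
    have "Z i = 0"
    proof (rule sum_of_squares_zero[OF fI rs(1) _ _ sq i])
      show "conj_gam (fst j) \<odot> s \<in> obj C" if "j \<in> I" for j using kbo[OF that] .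
      show "Z j \<in> Hom C r (conj_gam (fst j) \<odot> s)" if "j \<in> I" for j
        using YH[OF that] kbo[OF that] rs by (simp add: Z_def)
    qed
    then have Y0: "und (Y i) = 0" using d(1)[OF I(1)[OF i]] by (simp add: Z_def)
    let ?f = "(Rk' (fst i))\<^sup>\<dagger> \<boxtimes> idt s"
    note cp = gam_conj_pair[OF I(1)[OF i]]
    note [simp] = conj_pairD(1-8)[OF cp] rs Y[OF i] A[OF i]
    have fH: "und ?f \<in> Hom C (\<gamma> (fst i) \<odot> conj_gam (fst i) \<odot> s) s" by (rule arr_und) simp_all
    have "und (A i) = und (?f \<cdot> (idt (\<gamma> (fst i)) \<boxtimes> Y i))"
      unfolding Y_def by (subst bend_left[OF cp]) simp_all
    also have "\<dots> = 0" using fH by (simp add: und_simps(2)[of ?f] und_simps(1) und_simps(3)[of _ "Y i"] Y0)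
    finally have "X (fst i) (snd i) = 0" by (simp add: A_def)
    then have a: "A i = Arr (\<gamma> (fst i) \<odot> r) s 0 \<cdot> idt (\<gamma> (fst i) \<odot> r)"
      using I[OF i] by (simp add: A_def)
    have "x i = coend (\<gamma> (fst i)) r (Arr (\<gamma> (fst i) \<odot> r) s (0 *\<^sub>C 0) \<cdot> idt (\<gamma> (fst i) \<odot> r)) (snd i)"
      unfolding x_def a by simp
    also have "\<dots> = 0 *\<^sub>C coend (\<gamma> (fst i)) r (Arr (\<gamma> (fst i) \<odot> r) s 0 \<cdot> idt (\<gamma> (fst i) \<odot> r)) (snd i)"
      using I[OF i] by (intro coend_arrow_scale) simp_all
    finally show "x i = 0" by simp
  qed
  then show ?thesis unfolding Xx by (rule sum.neutral[OF ballI])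
qed

text \<open>
  Only finitely many classes contribute, because \<open>Hom(\<gamma>\<^sub>k r, s)\<close> embeds into \<open>Hom(\<gamma>\<^sub>k, s r')\<close> for a
  conjugate \<open>r'\<close> of \<open>r\<close>.
\<close>

lemma hom0_finite_dim:
  assumes rs: "r \<in> obj C" "s \<in> obj C"
  shows "finite_dim (hom0 r s)"
proof -
  note [simp] = rs
  obtain r' R R' where r' [simp]: "r' \<in> obj C" and cs: "conjugate_solution C r r' R R'"
    using conjugates[OF rs(1)] by blast
  define Q where "Q = Arr \<iota> (r' \<odot> r) R"
  define Q' where "Q' = Arr \<iota> (r \<odot> r') R'"
  have cp: "conj_pair r r' Q Q'" using conjugate_solution_conj_pair[OF cs] by (simp add: Q_def Q'_def)
  note [simp] = conj_pairD(1-8)[OF cp]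
  define K where "K = {k \<in> Irr. \<exists>T\<in>Hom C (\<gamma> k \<odot> r) s. T \<noteq> 0}"
  have "K \<subseteq> {k \<in> Irr. \<exists>T\<in>Hom C (\<gamma> k) (s \<odot> r'). T \<noteq> 0}"
  proof
    fix k assume "k \<in> K"
    then obtain T where k [simp]: "k \<in> Irr" and T [simp]: "T \<in> Hom C (\<gamma> k \<odot> r) s" and T0: "T \<noteq> 0" by (auto simp: K_def)
    let ?A = "Arr (\<gamma> k \<odot> r) s T"
    define D where "D = (?A \<boxtimes> idt r') \<cdot> (idt (\<gamma> k) \<boxtimes> Q')"
    have D [simp]: "arr D" "src D = \<gamma> k" "tgt D = s \<odot> r'" by (simp_all add: D_def)
    have DH: "und D \<in> Hom C (\<gamma> k) (s \<odot> r')" by (rule arr_und) simp_all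
    have "und D \<noteq> 0"
    proof
      assume D0: "und D = 0"
      let ?f = "idt s \<boxtimes> Q\<^sup>\<dagger>"
      have fH: "und ?f \<in> Hom C (s \<odot> r' \<odot> r) s" by (rule arr_und) simp_all
      have "T = und (?f \<cdot> (D \<boxtimes> idt r))"
        unfolding D_def by (subst bend_source[OF cp]) simp_all
      also have "\<dots> = 0" using fH by (simp add: und_simps(2)[of ?f] und_simps(3)[of D] und_simps(1) D0)
      finally show False using T0 by simp
    qed
    then show "k \<in> {k \<in> Irr. \<exists>T\<in>Hom C (\<gamma> k) (s \<odot> r'). T \<noteq> 0}" using DH by auto
  qed
  then have fK: "finite K" using finite_classes[of "s \<odot> r'"] by (auto intro: finite_subset)
  have KI: "K \<subseteq> Irr" by (auto simp: K_def)
  have "\<forall>k\<in>K. \<exists>B. finite B \<and> cvec.span B = Hom C (\<gamma> k \<odot> r) s"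
    using finite_dim_Hom[of "\<gamma> _ \<odot> r" s] KI by (auto simp: finite_dim_def)
  from bchoice[OF this] obtain B where B: "\<And>k. k \<in> K \<Longrightarrow> finite (B k)" "\<And>k. k \<in> K \<Longrightarrow> cvec.span (B k) = Hom C (\<gamma> k \<odot> r) s"
    by blast
  define G where "G = (\<Union>k\<in>K. \<Union>e\<in>onb k. (\<lambda>T. coend (\<gamma> k) r (Arr (\<gamma> k \<odot> r) s T) e) ` B k)"
  have fG: "finite G" unfolding G_def using fK KI B(1) onb_finite by (intro finite_UN_I finite_imageI) auto
  have in_span: "coend (\<gamma> k) r (Arr (\<gamma> k \<odot> r) s T) e \<in> cvec.span G"
    if k: "k \<in> K" and e: "e \<in> onb k" and T: "T \<in> Hom C (\<gamma> k \<odot> r) s" for k e T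
  proof -
    have [simp]: "k \<in> Irr" "e \<in> V (\<gamma> k)" using k KI e onb_in by auto
    have "T \<in> cvec.span (B k)" using T B(2)[OF k] by simp
    then have "T \<in> Hom C (\<gamma> k \<odot> r) s \<and> coend (\<gamma> k) r (Arr (\<gamma> k \<odot> r) s T) e \<in> cvec.span G"
    proof (induction rule: cvec.span_induct_alt)
      case base
      have "coend (\<gamma> k) r (Arr (\<gamma> k \<odot> r) s (0 *\<^sub>C 0) \<cdot> idt (\<gamma> k \<odot> r)) e
          = 0 *\<^sub>C coend (\<gamma> k) r (Arr (\<gamma> k \<odot> r) s 0 \<cdot> idt (\<gamma> k \<odot> r)) e"
        by (rule coend_arrow_scale) simp_all
      then show ?case by (simp add: cvec.span_zero del: zero_fun_apply)
    next
      case (step c S S')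
      have S: "S \<in> Hom C (\<gamma> k \<odot> r) s" using step(1) B(2)[OF k] cvec.span_base by blast
      have SG: "coend (\<gamma> k) r (Arr (\<gamma> k \<odot> r) s S) e \<in> cvec.span G"
        using step(1) k e by (intro cvec.span_base) (auto simp: G_def)
      have "coend (\<gamma> k) r (Arr (\<gamma> k \<odot> r) s (c *\<^sub>C S + S')) e
          = c *\<^sub>C coend (\<gamma> k) r (Arr (\<gamma> k \<odot> r) s S) e + coend (\<gamma> k) r (Arr (\<gamma> k \<odot> r) s S') e"
        using coend_arrow_add[of "c *\<^sub>C S" "\<gamma> k \<odot> r" s S' "idt (\<gamma> k \<odot> r)" "\<gamma> k" r e]
          coend_arrow_scale[of S "\<gamma> k \<odot> r" s "idt (\<gamma> k \<odot> r)" "\<gamma> k" r e c] S step(2) by simp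
      then show ?case using S step(2) SG by (simp add: cvec.span_add cvec.span_scale del: plus_fun_apply)
    qed
    then show ?thesis ..
  qed
  have "hom0 r s \<subseteq> cvec.span G"
  proof
    fix X assume X: "X \<in> hom0 r s"
    have "{k. X k \<noteq> 0} \<subseteq> K"
    proof
      fix k assume k: "k \<in> {k. X k \<noteq> 0}"
      then have kI: "k \<in> Irr" using hom0D(2)[OF X] by blast
      obtain x where "X k x \<noteq> 0" using k by (auto simp: fun_eq_iff)
      then show "k \<in> K" using hom0D(3,4)[OF X kI] kI by (auto simp: K_def)
    qed
    from hom0_expand[OF X fK this KI rs]
    have eq: "X = (\<Sum>k\<in>K. \<Sum>e\<in>onb k. coend (\<gamma> k) r (Arr (\<gamma> k \<odot> r) s (X k e)) e)" .
    have "(\<Sum>k\<in>K. \<Sum>e\<in>onb k. coend (\<gamma> k) r (Arr (\<gamma> k \<odot> r) s (X k e)) e) \<in> cvec.span G"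
      using hom0D(3)[OF X] KI onb_in by (intro cvec.span_sum in_span) auto
    then show "X \<in> cvec.span G" using eq by simp
  qed
  moreover have "finite_dim (cvec.span G)" using fG unfolding finite_dim_def by blast
  ultimately show ?thesis using finite_dim_subset hom0_subspace rs by blast
qed


section \<open>The modular closure\<close>

lemma closure_simps:
  "obj (modular_closure C U F P) = {(\<rho>, E). \<rho> \<in> obj C \<and> E \<in> hom0 \<rho> \<rho> \<and> cmp0 \<rho> \<rho> \<rho> E E = E \<and> str0 \<rho> \<rho> E = E}"
  "Hom (modular_closure C U F P) (\<rho>, E) (\<sigma>, E') = (\<lambda>X. cmp0 \<rho> \<sigma> \<sigma> E' (cmp0 \<rho> \<rho> \<sigma> X E)) ` hom0 \<rho> \<sigma>"
  "ide (modular_closure C U F P) (\<rho>, E) = E"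
  "cmp (modular_closure C U F P) (\<rho>, E) (\<sigma>, E') (\<tau>, E'') = cmp0 \<rho> \<sigma> \<tau>"
  "str (modular_closure C U F P) (\<rho>, E) (\<sigma>, E') = str0 \<rho> \<sigma>"
  "\<iota>\<^bsub>modular_closure C U F P\<^esub> = (\<iota>, ide0 \<iota>)"
  by (simp_all add: modular_closure_def subobject_closure_def crossed_product0_def)

lemma ide0_nonzero:
  assumes "r \<in> obj C" "ide C r \<noteq> 0"
  shows "ide0 r \<noteq> 0"
proof
  assume "ide0 r = 0"
  then have "ide0 r (irr_class (\<D> C) \<iota>) (vac U) = 0" by simp
  then show False using assms vac_in by (simp add: ide0_def etens_def vac_ip scaleC_one)
qed

text \<open>
  An irreducible non-degenerate object shares no subobject with a degenerate one, so it has no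
  arrows to the unit in the crossed product.
\<close>

lemma no_arrows_to_unit:
  assumes \<rho>: "irreducible_obj C \<rho>" "\<not> degenerate C \<rho>" and X: "X \<in> hom0 \<rho> \<iota>"
  shows "X = 0"
proof -
  have \<rho>o [simp]: "\<rho> \<in> obj C" using \<rho>(1) irreducible_objD(1) by blast
  have "T = 0" if k [simp]: "k \<in> Irr" and T [simp]: "T \<in> Hom C (\<gamma> k \<odot> \<rho>) \<iota>" for k T
  proof -
    note cp = gam_conj_pair[OF k]
    note [simp] = conj_pairD(1-8)[OF cp]
    let ?A = "Arr (\<gamma> k \<odot> \<rho>) \<iota> T"
    define D where "D = (idt (conj_gam k) \<boxtimes> ?A) \<cdot> (Rk k \<boxtimes> idt \<rho>)"
    have D [simp]: "arr D" "src D = \<rho>" "tgt D = conj_gam k" by (simp_all add: D_def)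
    have DH: "und D \<in> Hom C \<rho> (conj_gam k)" by (rule arr_und) simp_all
    have D0: "und D = 0"
    proof (rule ccontr)
      assume "und D \<noteq> 0"
      then have "equivalent_obj C \<rho> (conj_gam k)" using schur_equivalent[OF \<rho>(1) gam_irreducible(1) DH] by simp
      then obtain W where "isometry C \<rho> (conj_gam k) W" by (auto simp: equivalent_obj_def)
      then show False using degenerate_subobject[of "conj_gam k" \<rho> W] gam_irreducible(2)[of "cbar P k"] \<rho>(2) by simp
    qed
    let ?f = "(Rk' k)\<^sup>\<dagger> \<boxtimes> idt \<iota>"
    have fH: "und ?f \<in> Hom C (\<gamma> k \<odot> conj_gam k) \<iota>" by (rule arr_und) simp_all
    have "T = und (?f \<cdot> (idt (\<gamma> k) \<boxtimes> D))"
      unfolding D_def by (subst bend_left[OF cp]) simp_all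
    also have "\<dots> = 0" using fH by (simp add: und_simps(2)[of ?f] und_simps(3)[of _ D] und_simps(1) D0 del: tensor_unit)
    finally show ?thesis .
  qed
  then have "X k x = 0" for k x
    using hom0D(3-5)[OF X, of k] by (cases "k \<in> Irr"; cases "x \<in> V (\<gamma> k)") simp_all
  then show ?thesis by (simp add: fun_eq_iff)
qed

text \<open>
  A minimal projection \<open>e\<close> of the endomorphisms of \<open>\<rho>\<close> gives an irreducible object \<open>(\<rho>, e)\<close>, which cannot
  be equivalent to the unit as there are no arrows from \<open>\<rho>\<close> to \<open>\<iota>\<close>.
\<close>

lemma nontrivial_if_nondegenerate:
  assumes "\<exists>\<rho>\<in>obj C. \<not> degenerate C \<rho>"
  shows "\<not> trivial_category (modular_closure C U F P)"
proof
  assume triv: "trivial_category (modular_closure C U F P)"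
  obtain \<rho> where \<rho>: "irreducible_obj C \<rho>" "\<not> degenerate C \<rho>" using assms degenerate_if_irreducibles by blast
  have \<rho>o [simp]: "\<rho> \<in> obj C" using \<rho>(1) irreducible_objD(1) by blast
  have "\<exists>e\<in>hom0 \<rho> \<rho>. e \<noteq> 0 \<and> cmp0 \<rho> \<rho> \<rho> e e = e \<and> str0 \<rho> \<rho> e = e \<and>
      (\<forall>x\<in>hom0 \<rho> \<rho>. \<exists>c. cmp0 \<rho> \<rho> \<rho> e (cmp0 \<rho> \<rho> \<rho> x e) = c *\<^sub>C e)"
    by (rule minimal_projection_exists[OF hom0_finite_dim, where a = "ide0 \<rho>"])
      (simp_all add: ide0_in ide0_nonzero irreducible_objD(2)[OF \<rho>(1)] cmp0_in cmp0_assoc cmp0_add_left cmp0_add_right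
        cmp0_scale_left cmp0_scale_right str0_in str0_scale str0_cmp0 str0_str0 str0_pos del: plus_fun_apply zero_fun_apply)
  then obtain e where e: "e \<in> hom0 \<rho> \<rho>" "e \<noteq> 0" "cmp0 \<rho> \<rho> \<rho> e e = e" "str0 \<rho> \<rho> e = e"
    and min: "\<And>x. x \<in> hom0 \<rho> \<rho> \<Longrightarrow> \<exists>c. cmp0 \<rho> \<rho> \<rho> e (cmp0 \<rho> \<rho> \<rho> x e) = c *\<^sub>C e" by blast
  have "(\<lambda>X. cmp0 \<rho> \<rho> \<rho> e (cmp0 \<rho> \<rho> \<rho> X e)) ` hom0 \<rho> \<rho> = range (\<lambda>c. c *\<^sub>C e)"
  proof
    show "(\<lambda>X. cmp0 \<rho> \<rho> \<rho> e (cmp0 \<rho> \<rho> \<rho> X e)) ` hom0 \<rho> \<rho> \<subseteq> range (\<lambda>c. c *\<^sub>C e)" using min by fastforce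
    show "range (\<lambda>c. c *\<^sub>C e) \<subseteq> (\<lambda>X. cmp0 \<rho> \<rho> \<rho> e (cmp0 \<rho> \<rho> \<rho> X e)) ` hom0 \<rho> \<rho>"
    proof
      fix y assume "y \<in> range (\<lambda>c. c *\<^sub>C e)"
      then obtain c where "y = c *\<^sub>C e" by blast
      then have "y = cmp0 \<rho> \<rho> \<rho> e (cmp0 \<rho> \<rho> \<rho> (c *\<^sub>C e) e)"
        using e by (simp add: cmp0_scale_left cmp0_scale_right)
      moreover have "c *\<^sub>C e \<in> hom0 \<rho> \<rho>" using e by (intro hom0_scale) simp_all
      ultimately show "y \<in> (\<lambda>X. cmp0 \<rho> \<rho> \<rho> e (cmp0 \<rho> \<rho> \<rho> X e)) ` hom0 \<rho> \<rho>" by blast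
    qed
  qed
  then have "irreducible_obj (modular_closure C U F P) (\<rho>, e)"
    using e by (simp add: irreducible_obj_def closure_simps)
  then have "equivalent_obj (modular_closure C U F P) (\<rho>, e) (\<iota>, ide0 \<iota>)"
    using triv by (simp add: trivial_category_def closure_simps)
  then obtain W where W: "W \<in> (\<lambda>X. cmp0 \<rho> \<iota> \<iota> (ide0 \<iota>) (cmp0 \<rho> \<rho> \<iota> X e)) ` hom0 \<rho> \<iota>"
    "cmp0 \<rho> \<iota> \<rho> (str0 \<rho> \<iota> W) W = e"
    unfolding equivalent_obj_def isometry_def closure_simps by blast
  from W(1) obtain X where X: "X \<in> hom0 \<rho> \<iota>" "W = cmp0 \<rho> \<iota> \<iota> (ide0 \<iota>) (cmp0 \<rho> \<rho> \<iota> X e)" by blast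
  have "W = 0" unfolding X(2) no_arrows_to_unit[OF \<rho> X(1)] by (simp del: zero_fun_apply)
  then show False using W(2) e(2) by simp
qed

text \<open>
  For degenerate \<open>\<rho>\<close> every vector \<open>\<psi> \<in> F(\<rho>)\<close> gives an arrow \<open>\<iota> \<rightarrow> \<rho>\<close> of the crossed
  product, and an orthonormal basis of \<open>F(\<rho>)\<close> makes \<open>\<rho>\<close> a direct sum of copies of the unit.
\<close>

definition fib_arrow :: "'o \<Rightarrow> 'v \<Rightarrow> 'o set \<Rightarrow> 'v \<Rightarrow> 'a"
  where "fib_arrow \<rho> \<psi> = coend \<rho> \<iota> (idt \<rho>) \<psi>"

lemma fib_arrow_in: "\<rho> \<in> deg \<Longrightarrow> \<psi> \<in> V \<rho> \<Longrightarrow> fib_arrow \<rho> \<psi> \<in> hom0 \<iota> \<rho>"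
  unfolding fib_arrow_def by (rule coend_in) simp_all

lemma str0_fib_arrow:
  assumes "conj_pair \<rho> \<rho>' R R'" "\<rho> \<in> deg" "\<rho>' \<in> deg" "\<psi> \<in> V \<rho>"
  shows "str0 \<iota> \<rho> (fib_arrow \<rho> \<psi>) = coend \<rho>' \<rho> (R\<^sup>\<dagger>) (conj_vec \<rho> \<rho>' R' \<psi>)"
proof -
  note R = conj_pairD(1-8)[OF assms(1)]
  have "conj_arrow \<iota> \<rho>' R (idt \<rho>) = R\<^sup>\<dagger>" using R by (simp add: conj_arrow_def idt_tensor)
  then show ?thesis
    using str0_coend[OF assms(1-3), of "idt \<rho>" \<iota> \<rho> \<psi>] R assms by (simp add: fib_arrow_def)
qed

text \<open>
  The sum of \<open>e \<boxtimes> conj_vec \<rho> \<rho>' R' e\<close> over an orthonormal basis is \<open>F(R') \<Omega>\<close>, and naturality turns this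
  into the second factor of a conjugate equation.
\<close>

lemma fib_arrow_complete:
  assumes cp: "conj_pair \<rho> \<rho>' R R'" and d: "\<rho> \<in> deg" "\<rho>' \<in> deg" and B: "orthonormal_basis (fobj F \<rho>) B"
  shows "(\<Sum>e\<in>B. cmp0 \<rho> \<iota> \<rho> (fib_arrow \<rho> e) (str0 \<iota> \<rho> (fib_arrow \<rho> e))) = ide0 \<rho>"
proof -
  note R = conj_pairD(1-8)[OF cp]
  note [simp] = R d vac_in
  have Be: "e \<in> V \<rho>" if "e \<in> B" for e using B that by (auto simp: orthonormal_basis_def)
  have R': "arr R'" "src R' = \<iota>" "tgt R' = \<rho> \<odot> \<rho>'" by simp_all
  have c: "conj_vec \<rho> \<rho>' R' e \<in> V \<rho>'" if "e \<in> B" for e using Be[OF that] by (intro conj_vec_in) simp_all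
  have w: "fib_map R' (vac U) \<in> V (\<rho> \<odot> \<rho>')" by (rule fib_map_solution(2)) simp_all
  have S: "(\<Sum>e\<in>B. vt \<rho> \<rho>' e (conj_vec \<rho> \<rho>' R' e)) = fib_map R' (vac U)"
  proof (rule ipr_product_eqI[OF d])
    show "(\<Sum>e\<in>B. vt \<rho> \<rho>' e (conj_vec \<rho> \<rho>' R' e)) \<in> V (\<rho> \<odot> \<rho>')"
      using Be c by (intro V_sum) (simp_all add: vt_in)
    show "fib_map R' (vac U) \<in> V (\<rho> \<odot> \<rho>')" by (rule w)
    fix a b assume a [simp]: "a \<in> V \<rho>" and b [simp]: "b \<in> V \<rho>'"
    have "ipr (\<rho> \<odot> \<rho>') (vt \<rho> \<rho>' a b) (\<Sum>e\<in>B. vt \<rho> \<rho>' e (conj_vec \<rho> \<rho>' R' e))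
        = (\<Sum>e\<in>B. ipr (\<rho> \<odot> \<rho>') (vt \<rho> \<rho>' a b) (vt \<rho> \<rho>' e (conj_vec \<rho> \<rho>' R' e)))"
      using Be c by (intro ipr_sum_right) (simp_all add: vt_in)
    also have "\<dots> = (\<Sum>e\<in>B. ipr (\<rho> \<odot> \<rho>') (vt \<rho> \<rho>' (ipr \<rho> e a *\<^sub>C e) b) (fib_map R' (vac U)))"
    proof (rule sum.cong[OF refl])
      fix e assume e: "e \<in> B"
      have "ipr (\<rho> \<odot> \<rho>') (vt \<rho> \<rho>' a b) (vt \<rho> \<rho>' e (conj_vec \<rho> \<rho>' R' e)) = ipr \<rho> a e * ipr \<rho>' b (conj_vec \<rho> \<rho>' R' e)"
        using Be[OF e] c[OF e] by (simp add: vt_ip)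
      also have "ipr \<rho>' b (conj_vec \<rho> \<rho>' R' e) = ipr (\<rho> \<odot> \<rho>') (vt \<rho> \<rho>' e b) (fib_map R' (vac U))"
        using Be[OF e] by (simp add: conj_vec_ip)
      also have "ipr \<rho> a e = cnj (ipr \<rho> e a)" using Be[OF e] by (intro ipr_cnj) simp_all
      also have "cnj (ipr \<rho> e a) * ipr (\<rho> \<odot> \<rho>') (vt \<rho> \<rho>' e b) (fib_map R' (vac U))
          = ipr (\<rho> \<odot> \<rho>') (vt \<rho> \<rho>' (ipr \<rho> e a *\<^sub>C e) b) (fib_map R' (vac U))"
        using Be[OF e] w by (simp add: vt_scale_left ipr_scale_left vt_in)
      finally show "ipr (\<rho> \<odot> \<rho>') (vt \<rho> \<rho>' a b) (vt \<rho> \<rho>' e (conj_vec \<rho> \<rho>' R' e))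
          = ipr (\<rho> \<odot> \<rho>') (vt \<rho> \<rho>' (ipr \<rho> e a *\<^sub>C e) b) (fib_map R' (vac U))" .
    qed
    also have "\<dots> = ipr (\<rho> \<odot> \<rho>') (\<Sum>e\<in>B. vt \<rho> \<rho>' (ipr \<rho> e a *\<^sub>C e) b) (fib_map R' (vac U))"
      using Be w by (intro ipr_sum_left[symmetric]) (simp_all add: vt_in V_scale)
    also have "(\<Sum>e\<in>B. vt \<rho> \<rho>' (ipr \<rho> e a *\<^sub>C e) b) = vt \<rho> \<rho>' (\<Sum>e\<in>B. ipr \<rho> e a *\<^sub>C e) b"
      using Be by (intro vt_sum_left[symmetric]) (simp_all add: V_scale)
    also have "(\<Sum>e\<in>B. ipr \<rho> e a *\<^sub>C e) = a"
      by (rule unitary_rep.orthonormal_basis_expand[OF fibre_rep[OF d(1)] B a])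
    finally show "ipr (\<rho> \<odot> \<rho>') (vt \<rho> \<rho>' a b) (\<Sum>e\<in>B. vt \<rho> \<rho>' e (conj_vec \<rho> \<rho>' R' e))
        = ipr (\<rho> \<odot> \<rho>') (vt \<rho> \<rho>' a b) (fib_map R' (vac U))" .
  qed
  have "cmp0 \<rho> \<iota> \<rho> (fib_arrow \<rho> e) (str0 \<iota> \<rho> (fib_arrow \<rho> e))
      = coend (\<rho> \<odot> \<rho>') \<rho> (idt \<rho> \<boxtimes> R\<^sup>\<dagger>) (vt \<rho> \<rho>' e (conj_vec \<rho> \<rho>' R' e))" if "e \<in> B" for e
    using Be[OF that] c[OF that]
    by (simp add: str0_fib_arrow[OF cp]) (simp add: fib_arrow_def cmp0_coend)
  then have "(\<Sum>e\<in>B. cmp0 \<rho> \<iota> \<rho> (fib_arrow \<rho> e) (str0 \<iota> \<rho> (fib_arrow \<rho> e)))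
      = (\<Sum>e\<in>B. coend (\<rho> \<odot> \<rho>') \<rho> (idt \<rho> \<boxtimes> R\<^sup>\<dagger>) (vt \<rho> \<rho>' e (conj_vec \<rho> \<rho>' R' e)))" by simp
  also have "\<dots> = coend (\<rho> \<odot> \<rho>') \<rho> (idt \<rho> \<boxtimes> R\<^sup>\<dagger>) (\<Sum>e\<in>B. vt \<rho> \<rho>' e (conj_vec \<rho> \<rho>' R' e))"
    using Be c by (intro coend_sum[symmetric]) (simp_all add: vt_in)
  also have "\<dots> = coend (\<rho> \<odot> \<rho>') \<rho> (idt \<rho> \<boxtimes> R\<^sup>\<dagger>) (farr F \<iota> (\<rho> \<odot> \<rho>') (und R') (vac U))"
    unfolding S by (simp add: fib_map_def)
  also have "\<dots> = coend \<iota> \<rho> ((idt \<rho> \<boxtimes> R\<^sup>\<dagger>) \<cdot> (R' \<boxtimes> idt \<rho>)) (vac U)"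
    by (rule coend_natural[symmetric]) simp_all
  finally show ?thesis by (simp add: conj_pair_adj[OF cp] ide0_coend)
qed

text \<open>
  Composition with an endomorphism of \<open>\<rho>\<close> preserves the arrows given by vectors: by naturality, composing
  with \<open>coend g \<rho> A \<phi>\<close> replaces \<open>\<psi>\<close> by \<open>F(A) (\<phi> \<boxtimes> \<psi>)\<close>.
\<close>

lemma cmp0_fib_arrow:
  assumes X: "X \<in> hom0 \<rho> \<rho>" and \<rho>: "\<rho> \<in> deg" and \<psi>: "\<psi> \<in> V \<rho>"
  shows "\<exists>\<xi>\<in>V \<rho>. cmp0 \<iota> \<rho> \<rho> X (fib_arrow \<rho> \<psi>) = fib_arrow \<rho> \<xi>"
  using X deg_obj[OF \<rho>] deg_obj[OF \<rho>]
proof (induction rule: hom0_induct)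
  case zero
  have "fib_arrow \<rho> 0 = 0" unfolding fib_arrow_def using \<rho> by (intro coend_zero) simp_all
  then show ?case using V_zero[OF \<rho>] by (intro bexI[of _ 0]) (simp_all del: zero_fun_apply)
next
  case (add X Y)
  then obtain \<xi> \<xi>' where x: "\<xi> \<in> V \<rho>" "cmp0 \<iota> \<rho> \<rho> X (fib_arrow \<rho> \<psi>) = fib_arrow \<rho> \<xi>"
    "\<xi>' \<in> V \<rho>" "cmp0 \<iota> \<rho> \<rho> Y (fib_arrow \<rho> \<psi>) = fib_arrow \<rho> \<xi>'" by blast
  have "cmp0 \<iota> \<rho> \<rho> (X + Y) (fib_arrow \<rho> \<psi>) = fib_arrow \<rho> (\<xi> + \<xi>')"
    using add(1,2) x \<rho> \<psi> fib_arrow_in[OF \<rho> \<psi>]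
    by (simp add: cmp0_add_left del: plus_fun_apply) (simp add: fib_arrow_def coend_add del: plus_fun_apply)
  then show ?case using V_add[OF \<rho> x(1,3)] by blast
next
  case (coend k A \<phi>)
  note [simp] = coend \<rho> \<psi>
  have "cmp0 \<iota> \<rho> \<rho> (coend (\<gamma> k) \<rho> A \<phi>) (fib_arrow \<rho> \<psi>) = coend (\<gamma> k \<odot> \<rho>) \<iota> (idt \<rho> \<cdot> (A \<boxtimes> idt \<iota>)) (vt (\<gamma> k) \<rho> \<phi> \<psi>)"
    unfolding fib_arrow_def by (subst cmp0_coend) (simp_all add: idt_tensor)
  also have "\<dots> = coend \<rho> \<iota> (idt \<rho>) (farr F (\<gamma> k \<odot> \<rho>) \<rho> (und A) (vt (\<gamma> k) \<rho> \<phi> \<psi>))"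
    by (rule coend_natural) (simp_all add: vt_in)
  finally show ?case
    using fib_map_in[of A "vt (\<gamma> k) \<rho> \<phi> \<psi>"] by (intro bexI[of _ "fib_map A (vt (\<gamma> k) \<rho> \<phi> \<psi>)"]) (simp_all add: vt_in fib_arrow_def fib_map_def)
qed

text \<open>
  The scalar is \<open>\<parallel>\<xi>\<parallel>\<^sup>2\<close>: applying \<open>F(R)\<^sup>*\<close> to the conjugate of \<open>\<xi>\<close> tensored with \<open>\<xi>\<close> gives \<open>\<langle>\<xi>, \<xi>\<rangle> \<Omega>\<close>.
\<close>

lemma fib_arrow_norm:
  assumes cp: "conj_pair \<rho> \<rho>' R R'" and d: "\<rho> \<in> deg" "\<rho>' \<in> deg" and \<xi>: "\<xi> \<in> V \<rho>" "\<xi> \<noteq> 0"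
  shows "\<exists>r>0. cmp0 \<iota> \<rho> \<iota> (str0 \<iota> \<rho> (fib_arrow \<rho> \<xi>)) (fib_arrow \<rho> \<xi>) = complex_of_real r *\<^sub>C ide0 \<iota>"
proof -
  note R = conj_pairD(1-8)[OF cp]
  note [simp] = R d \<xi>(1) vac_in
  have c [simp]: "conj_vec \<rho> \<rho>' R' \<xi> \<in> V \<rho>'" by (intro conj_vec_in) simp_all
  obtain r where r: "r > 0" "ipr \<rho> \<xi> \<xi> = complex_of_real r"
    using unitary_rep.ip_self_real[OF fibre_rep[OF d(1)] \<xi>] by blast
  have v [simp]: "vt \<rho>' \<rho> (conj_vec \<rho> \<rho>' R' \<xi>) \<xi> \<in> V (\<rho>' \<odot> \<rho>)" by (simp add: vt_in)
  have w: "fib_map R (vac U) \<in> V (\<rho>' \<odot> \<rho>)" by (rule fib_map_solution(2)) simp_all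
  have "cmp0 \<iota> \<rho> \<iota> (str0 \<iota> \<rho> (fib_arrow \<rho> \<xi>)) (fib_arrow \<rho> \<xi>)
      = coend (\<rho>' \<odot> \<rho>) \<iota> (idt \<iota> \<cdot> (R\<^sup>\<dagger> \<boxtimes> idt \<iota>)) (vt \<rho>' \<rho> (conj_vec \<rho> \<rho>' R' \<xi>) \<xi>)"
    by (simp add: str0_fib_arrow[OF cp]) (simp add: fib_arrow_def cmp0_coend idt_tensor)
  also have "\<dots> = coend \<iota> \<iota> (idt \<iota>) (fib_map (R\<^sup>\<dagger>) (vt \<rho>' \<rho> (conj_vec \<rho> \<rho>' R' \<xi>) \<xi>))"
    unfolding fib_map_def using coend_natural[of "idt \<iota>" \<iota> \<iota> "R\<^sup>\<dagger>" "\<rho>' \<odot> \<rho>" "vt \<rho>' \<rho> (conj_vec \<rho> \<rho>' R' \<xi>) \<xi>"] by simp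
  also have "fib_map (R\<^sup>\<dagger>) (vt \<rho>' \<rho> (conj_vec \<rho> \<rho>' R' \<xi>) \<xi>) = complex_of_real r *\<^sub>C vac U"
  proof -
    have u: "fib_map (R\<^sup>\<dagger>) (vt \<rho>' \<rho> (conj_vec \<rho> \<rho>' R' \<xi>) \<xi>) \<in> V \<iota>" using fib_map_in[of "R\<^sup>\<dagger>" "vt \<rho>' \<rho> (conj_vec \<rho> \<rho>' R' \<xi>) \<xi>"] by simp
    have "ipr \<iota> (vac U) (fib_map (R\<^sup>\<dagger>) (vt \<rho>' \<rho> (conj_vec \<rho> \<rho>' R' \<xi>) \<xi>))
        = ipr (\<rho>' \<odot> \<rho>) (fib_map R (vac U)) (vt \<rho>' \<rho> (conj_vec \<rho> \<rho>' R' \<xi>) \<xi>)"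
      by (rule fib_map_adj) simp_all
    also have "\<dots> = cnj (ipr (\<rho>' \<odot> \<rho>) (vt \<rho>' \<rho> (conj_vec \<rho> \<rho>' R' \<xi>) \<xi>) (fib_map R (vac U)))"
      using w by (intro ipr_cnj) simp_all
    also have "ipr (\<rho>' \<odot> \<rho>) (vt \<rho>' \<rho> (conj_vec \<rho> \<rho>' R' \<xi>) \<xi>) (fib_map R (vac U)) = ipr \<rho> \<xi> (conj_vec \<rho>' \<rho> R (conj_vec \<rho> \<rho>' R' \<xi>))"
      by (intro conj_vec_ip[symmetric]) simp_all
    also have "conj_vec \<rho>' \<rho> R (conj_vec \<rho> \<rho>' R' \<xi>) = \<xi>" by (rule conj_vec_conj_vec[OF cp]) simp_all
    finally show ?thesis using V_unit_vac[OF u] r by simp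
  qed
  also have "coend \<iota> \<iota> (idt \<iota>) (complex_of_real r *\<^sub>C vac U) = complex_of_real r *\<^sub>C ide0 \<iota>"
    by (simp add: coend_scale ide0_coend)
  finally show ?thesis using r(1) by blast
qed

text \<open>
  Some \<open>y = E Y\<^sub>e\<close> is nonzero, and \<open>y\<^sup>* y\<close> is a positive scalar. Irreducibility of \<open>(\<rho>, E)\<close> makes \<open>y y\<^sup>*\<close>
  a multiple of \<open>E\<close>, so a multiple of \<open>y\<^sup>*\<close> is a unitary from \<open>(\<rho>, E)\<close> to the unit.
\<close>

lemma trivial_if_all_degenerate:
  assumes all: "\<forall>\<rho>\<in>obj C. degenerate C \<rho>"
  shows "trivial_category (modular_closure C U F P)"
  unfolding trivial_category_def
proof (intro allI impI)
  fix \<rho>E assume "irreducible_obj (modular_closure C U F P) \<rho>E"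
  then obtain \<rho> E where \<rho>E: "\<rho>E = (\<rho>, E)" and \<rho>: "\<rho> \<in> obj C" and E: "E \<in> hom0 \<rho> \<rho>" "cmp0 \<rho> \<rho> \<rho> E E = E" "str0 \<rho> \<rho> E = E" "E \<noteq> 0"
    and irr: "(\<lambda>X. cmp0 \<rho> \<rho> \<rho> E (cmp0 \<rho> \<rho> \<rho> X E)) ` hom0 \<rho> \<rho> = range (\<lambda>c. c *\<^sub>C E)"
    by (cases \<rho>E) (auto simp: irreducible_obj_def closure_simps)
  obtain \<rho>' R\<^sub>0 R\<^sub>0' where \<rho>': "\<rho>' \<in> obj C" and cs: "conjugate_solution C \<rho> \<rho>' R\<^sub>0 R\<^sub>0'"
    using conjugates[OF \<rho>] by blast
  obtain R R' where cp: "conj_pair \<rho> \<rho>' R R'" using conjugate_solution_conj_pair[OF cs \<rho> \<rho>'] by blast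
  have d: "\<rho> \<in> deg" "\<rho>' \<in> deg" using all \<rho> \<rho>' unfolding deg_def by simp_all
  obtain B where B: "orthonormal_basis (fobj F \<rho>) B"
    using unitary_rep.orthonormal_basis_exists[OF fibre_rep[OF d(1)]] by blast
  have Be: "e \<in> V \<rho>" if "e \<in> B" for e using B that by (auto simp: orthonormal_basis_def)
  note obs = \<rho> unt_obj
  note fi = fib_arrow_in[OF d(1)]
  have "\<exists>e\<in>B. cmp0 \<iota> \<rho> \<rho> E (fib_arrow \<rho> e) \<noteq> 0"
  proof (rule ccontr)
    assume no: "\<not> (\<exists>e\<in>B. cmp0 \<iota> \<rho> \<rho> E (fib_arrow \<rho> e) \<noteq> 0)"
    have "E = cmp0 \<rho> \<rho> \<rho> E (\<Sum>e\<in>B. cmp0 \<rho> \<iota> \<rho> (fib_arrow \<rho> e) (str0 \<iota> \<rho> (fib_arrow \<rho> e)))"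
      using cmp0_ide0[OF E(1) \<rho> \<rho>] by (simp add: fib_arrow_complete[OF cp d B])
    also have "\<dots> = (\<Sum>e\<in>B. cmp0 \<rho> \<rho> \<rho> E (cmp0 \<rho> \<iota> \<rho> (fib_arrow \<rho> e) (str0 \<iota> \<rho> (fib_arrow \<rho> e))))"
      using Be fi obs E(1) by (intro cmp0_sum_right) (simp_all add: cmp0_in str0_in)
    also have "\<dots> = (\<Sum>e\<in>B. cmp0 \<rho> \<iota> \<rho> (cmp0 \<iota> \<rho> \<rho> E (fib_arrow \<rho> e)) (str0 \<iota> \<rho> (fib_arrow \<rho> e)))"
      using Be fi obs E(1) by (intro sum.cong refl cmp0_assoc[symmetric]) (simp_all add: str0_in)
    also have "\<dots> = 0" using no by (intro sum.neutral) simp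
    finally show False using E(4) by simp
  qed
  then obtain e \<xi> where e: "e \<in> B" and \<xi>: "\<xi> \<in> V \<rho>" "cmp0 \<iota> \<rho> \<rho> E (fib_arrow \<rho> e) = fib_arrow \<rho> \<xi>" "fib_arrow \<rho> \<xi> \<noteq> 0"
    using cmp0_fib_arrow[OF E(1) d(1)] Be by metis
  define y where "y = fib_arrow \<rho> \<xi>"
  have y: "y \<in> hom0 \<iota> \<rho>" "y \<noteq> 0" using fi \<xi> by (simp_all add: y_def)
  have sy: "str0 \<iota> \<rho> y \<in> hom0 \<rho> \<iota>" using y obs by (simp add: str0_in)
  have "\<xi> \<noteq> 0"
  proof
    assume "\<xi> = 0"
    then have "fib_arrow \<rho> \<xi> = 0" unfolding fib_arrow_def using d by (simp add: coend_zero)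
    then show False using \<xi>(3) by simp
  qed
  then obtain r where r: "r > 0" and yy: "cmp0 \<iota> \<rho> \<iota> (str0 \<iota> \<rho> y) y = complex_of_real r *\<^sub>C ide0 \<iota>"
    using fib_arrow_norm[OF cp d \<xi>(1)] by (auto simp: y_def)
  have Ey: "cmp0 \<iota> \<rho> \<rho> E y = y"
    using cmp0_assoc[OF E(1) E(1) fi[OF Be[OF e]]] obs E(2) \<xi>(2) by (simp add: y_def)
  have yE: "cmp0 \<rho> \<rho> \<iota> (str0 \<iota> \<rho> y) E = str0 \<iota> \<rho> y"
    using str0_cmp0[OF E(1) y(1)] obs E(3) Ey by simp
  define Z where "Z = cmp0 \<rho> \<iota> \<rho> y (str0 \<iota> \<rho> y)"
  have Z: "Z \<in> hom0 \<rho> \<rho>" using y sy obs by (simp add: Z_def cmp0_in)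
  have EZE: "cmp0 \<rho> \<rho> \<rho> E (cmp0 \<rho> \<rho> \<rho> Z E) = Z"
    using cmp0_assoc[OF y(1) sy E(1)] cmp0_assoc[OF E(1) y(1) sy] obs by (simp add: Z_def yE Ey)
  then have "Z \<in> range (\<lambda>c. c *\<^sub>C E)" using irr Z by (metis image_eqI)
  then obtain c where c: "Z = c *\<^sub>C E" by blast
  have "c *\<^sub>C y = complex_of_real r *\<^sub>C y"
  proof -
    have "c *\<^sub>C y = cmp0 \<iota> \<rho> \<rho> Z y" using y E obs by (simp add: c cmp0_scale_left Ey)
    also have "\<dots> = cmp0 \<iota> \<iota> \<rho> y (complex_of_real r *\<^sub>C ide0 \<iota>)"
      unfolding Z_def using cmp0_assoc[OF y(1) sy y(1)] obs by (simp add: yy)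
    also have "\<dots> = complex_of_real r *\<^sub>C y" using y obs by (simp add: cmp0_scale_right ide0_in cmp0_ide0)
    finally show ?thesis .
  qed
  then have cr: "c = complex_of_real r" using y(2) cvec.scale_right_imp_eq by blast
  \<comment> \<open>The constant normalizes \<open>y\<^sup>*\<close> to a unitary.\<close>
  define a where "a = complex_of_real (1 / sqrt r)"
  have ar: "a * cnj a * complex_of_real r = 1"
    using r by (simp add: a_def flip: of_real_mult of_real_divide)
  define W where "W = a *\<^sub>C str0 \<iota> \<rho> y"
  have W: "W \<in> hom0 \<rho> \<iota>" unfolding W_def using sy obs by (intro hom0_scale) simp_all
  have sW: "str0 \<rho> \<iota> W = cnj a *\<^sub>C y"
    using str0_scale[OF sy obs] str0_str0[OF y(1)] obs by (simp add: W_def)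
  have WE: "cmp0 \<rho> \<rho> \<iota> W E = W"
    using sy E obs by (simp add: W_def cmp0_scale_left yE)
  have "W = cmp0 \<rho> \<iota> \<iota> (ide0 \<iota>) (cmp0 \<rho> \<rho> \<iota> W E)"
    using ide0_cmp0[OF W] obs by (simp add: WE)
  then have "W \<in> (\<lambda>X. cmp0 \<rho> \<iota> \<iota> (ide0 \<iota>) (cmp0 \<rho> \<rho> \<iota> X E)) ` hom0 \<rho> \<iota>" using W by blast
  moreover have "cmp0 \<rho> \<iota> \<rho> (str0 \<rho> \<iota> W) W = E"
  proof -
    have "cmp0 \<rho> \<iota> \<rho> (str0 \<rho> \<iota> W) W = (cnj a * a) *\<^sub>C Z"
      unfolding sW unfolding W_def using y sy obs hom0_scale[OF obs(1,2) sy, of a]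
      by (simp add: cmp0_scale_left cmp0_scale_right scaleC_scaleC Z_def)
    then show ?thesis using ar by (simp add: c cr scaleC_scaleC scaleC_one mult.commute mult.left_commute)
  qed
  moreover have "cmp0 \<iota> \<rho> \<iota> W (str0 \<rho> \<iota> W) = ide0 \<iota>"
  proof -
    have "cmp0 \<iota> \<rho> \<iota> W (str0 \<rho> \<iota> W) = (a * cnj a) *\<^sub>C cmp0 \<iota> \<rho> \<iota> (str0 \<iota> \<rho> y) y"
      unfolding sW unfolding W_def using y sy obs hom0_scale[OF obs(2,1) y(1), of "cnj a"]
      by (simp add: cmp0_scale_left cmp0_scale_right scaleC_scaleC)
    then show ?thesis using ar by (simp add: yy scaleC_scaleC scaleC_one)
  qed
  ultimately show "equivalent_obj (modular_closure C U F P) \<rho>E \<iota>\<^bsub>modular_closure C U F P\<^esub>"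
    unfolding \<rho>E equivalent_obj_def isometry_def range_proj_def closure_simps by blast
qed

end

theorem corollary4p15:
  fixes C :: "('o, 'a::complex_vector) btcat"
    and G :: "'g monoid" and \<T> :: "'g topology"
    and U :: "('g, 'v::complex_vector) repcat"
    and F :: "('o, 'a, 'g, 'v) rep_functor"
    and P :: "('o, 'a) cp_data"
  assumes "BTC_star C"
    and "even_category (\<D> C)"
    and "rep_category G \<T> U"
    and "symmetric_tensor_iso (\<D> C) G U F"
    and "crossed_product_data (\<D> C) P"
  shows "\<not> trivial_category (modular_closure C U F P) \<longleftrightarrow> (\<exists>\<rho>\<in>obj C. \<not> degenerate C \<rho>)"
proof -
  interpret modular_closure_setting C G \<T> U F P
    using assms by (intro modular_closure_setting.intro)
  show ?thesis using nontrivial_if_nondegenerate trivial_if_all_degenerate by blast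
qed

end
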